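(* The classical limit $U_1$ of $U_q(\mathfrak g)$, $\mathfrak g=\mathfrak q(n)$, is isomorphic (as a $\mathbb C$-algebra) to the universal enveloping algebra $U(\mathfrak g)$.
   Context: Let $n$ be a positive integer, $I=\{1,\dots,n-1\}$, $J=\{1,\dots,n\}$, $P^\vee=\bigoplus_{i=1}^n\mathbb Zk_i$. $\mathfrak g=\mathfrak q(n)$ is the complex Lie superalgebra of matrices $\begin{pmatrix}A&B\\ B&A\end{pmatrix}$, $A,B\in\mathfrak{gl}_n(\mathbb C)$ ($A$ even part, $B$ odd part, super commutator bracket), and $U(\mathfrak g)$ is its universal enveloping (super)algebra. $U_q(\mathfrak g)$ is the unital associative superalgebra over $\mathbb C(q)$ generated by $L_{ij}$, for $i\le j$ with $i,j\in\{\pm1,\dots,\pm n\}$ ($L_{ij}$ of parity $p(i,j)$), with defining relations $L_{ii}L_{-i,-i}=L_{-i,-i}L_{ii}=1$ and, for all $i\le j$, $k\le l$, $$\begin{aligned}&(-1)^{p(i,j)p(k,l)}q^{\varphi(j,l)}L_{ij}L_{kl}+\{k\le j<l\}\theta(i,j,k)(q-q^{-1})L_{il}L_{kj}\\&\quad+\{i\le -l<j\le -k\}\theta(-i,-j,k)(q-q^{-1})L_{i,-l}L_{k,-j}\\&=q^{\varphi(i,k)}L_{kl}L_{ij}+\{k<i\le l\}\theta(i,j,k)(q-q^{-1})L_{il}L_{kj}\\&\quad+\{-l\le i<-k\le j\}\theta(-i,-j,k)(q-q^{-1})L_{-i,l}L_{-k,j},\end{aligned}$$ where $\varphi(i,j)=\delta_{|i|,|j|}\,\mathrm{sgn}(j)$,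 $\theta(i,j,k)=\mathrm{sgn}(\mathrm{sgn}(i)+\mathrm{sgn}(j)+\mathrm{sgn}(k))$, $p(i,j)=0$ if $ij>0$ and $1$ if $ij<0$, and $\{\cdots\}$ is $1$ if all inequalities inside hold and $0$ otherwise. Put $q^{\pm k_i}:=L_{\pm i,\pm i}$, $q^h:=\prod_i(q^{k_i})^{a_i}$ for $h=\sum a_ik_i\in P^\vee$, $e_i:=-\frac{1}{q-q^{-1}}L_{-i-1,-i}$, $f_i:=\frac{1}{q-q^{-1}}L_{i,i+1}$, $e_{\bar i}:=-\frac1{q-q^{-1}}L_{-i-1,i}$, $f_{\bar i}:=-\frac1{q-q^{-1}}L_{-i,i+1}$ ($i\in I$), $k_{\bar l}:=-\frac1{q-q^{-1}}L_{-l,l}$ ($l\in J$). Let $\mathbf A_1=\{f/g\in\mathbb C(q)\mid f,g\in\mathbb C[q],g(1)\ne0\}$ and $\mathbf J_1=(q-1)\mathbf A_1$, so $\mathbf A_1/\mathbf J_1\cong\mathbb C$ via $q\mapsto 1$. $U_{\mathbf A_1}$ is the unital $\mathbf A_1$-subalgebra of $U_q(\mathfrak g)$ generated by $e_i,e_{\bar i},f_i,f_{\bar i},q^h,k_{\bar l}$ and $(q^h;0)_q:=\frac{q^h-1}{q-1}$ ($i\in I$, $l\in J$, $h\in P^\vee$). The classical limit is $U_1=(\mathbf A_1/\mathbf J_1)\otimes_{\mathbf A_1}U_{\mathbf A_1}$. *)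

theory Defs
  imports
    "Jordan_Normal_Form.Matrix"
    "HOL-Computational_Algebra.Fraction_Field"
    "HOL-Computational_Algebra.Polynomial"
    "HOL-Algebra.QuotRing"
begin

section \<open>Algebras as module records\<close>

text \<open>
  A possibly noncommutative unital algebra over a type of scalars is a record of type
  \<open>module\<close> from \<open>HOL-Algebra\<close>: a ring together with a scalar multiplication. (The locale
  \<open>algebra\<close> of \<open>HOL-Algebra\<close> is only about commutative algebras.)
\<close>

definition as_algebra :: "('a, 'z) ring_scheme \<Rightarrow> ('k \<Rightarrow> 'a \<Rightarrow> 'a) \<Rightarrow> ('k, 'a) module" where
  "as_algebra R s =
     \<lparr>carrier = carrier R, mult = mult R, one = \<one>\<^bsub>R\<^esub>, zero = \<zero>\<^bsub>R\<^esub>, add = add R, module.smult = s\<rparr>"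

definition alg_iso :: "('k, 'a, 'z) module_scheme \<Rightarrow> ('k, 'b, 'y) module_scheme \<Rightarrow> ('a \<Rightarrow> 'b) set" where
  "alg_iso A B = {h \<in> ring_iso A B. \<forall>c. \<forall>x\<in>carrier A. h (c \<odot>\<^bsub>A\<^esub> x) = c \<odot>\<^bsub>B\<^esub> h x}"

definition algebra_isomorphic :: "('k, 'a, 'z) module_scheme \<Rightarrow> ('k, 'b, 'y) module_scheme \<Rightarrow> bool" where
  "algebra_isomorphic A B \<longleftrightarrow> alg_iso A B \<noteq> {}"

text \<open>
  The quotient by a two-sided ideal. The union below is over cosets that all coincide when \<open>I\<close>
  is closed under scalar multiplication.
\<close>

definition quot_alg :: "('k, 'a, 'z) module_scheme \<Rightarrow> 'a set \<Rightarrow> ('k, 'a set) module" where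
  "quot_alg A I = as_algebra (A Quot I) (\<lambda>c X. \<Union>x\<in>X. I +>\<^bsub>A\<^esub> (c \<odot>\<^bsub>A\<^esub> x))"

text \<open>A pair \<open>(x, y)\<close> in \<open>Rel\<close> stands for the relation \<open>x = y\<close>.\<close>

definition rel_ideal :: "('k, 'a, 'z) module_scheme \<Rightarrow> ('a \<times> 'a) set \<Rightarrow> 'a set" where
  "rel_ideal A Rel = Idl\<^bsub>A\<^esub> {x \<ominus>\<^bsub>A\<^esub> y | x y. (x, y) \<in> Rel}"

inductive_set gen_subalgebra :: "'k set \<Rightarrow> ('k, 'a, 'z) module_scheme \<Rightarrow> 'a set \<Rightarrow> 'a set"
  for R :: "'k set" and A :: "('k, 'a, 'z) module_scheme" and S :: "'a set" where
  gen: "x \<in> S \<Longrightarrow> x \<in> gen_subalgebra R A S"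
| one: "\<one>\<^bsub>A\<^esub> \<in> gen_subalgebra R A S"
| scale: "r \<in> R \<Longrightarrow> x \<in> gen_subalgebra R A S \<Longrightarrow> r \<odot>\<^bsub>A\<^esub> x \<in> gen_subalgebra R A S"
| add: "x \<in> gen_subalgebra R A S \<Longrightarrow> y \<in> gen_subalgebra R A S
    \<Longrightarrow> x \<oplus>\<^bsub>A\<^esub> y \<in> gen_subalgebra R A S"
| mult: "x \<in> gen_subalgebra R A S \<Longrightarrow> y \<in> gen_subalgebra R A S
    \<Longrightarrow> x \<otimes>\<^bsub>A\<^esub> y \<in> gen_subalgebra R A S"

section \<open>Monoid algebras, free algebras and tensor products\<close>

definition single :: "'m \<Rightarrow> 'm \<Rightarrow> 'k::comm_ring_1" where
  "single x = (\<lambda>y. if y = x then 1 else 0)"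

definition monoid_algebra :: "('m, 'z) monoid_scheme \<Rightarrow> ('k::comm_ring_1, 'm \<Rightarrow> 'k) module" where
  "monoid_algebra M =
     \<lparr>carrier = {f. finite {x. f x \<noteq> 0} \<and> {x. f x \<noteq> 0} \<subseteq> carrier M},
      mult = (\<lambda>f g w. \<Sum>(u, v)\<in>{(u, v). f u \<noteq> 0 \<and> g v \<noteq> 0 \<and> u \<otimes>\<^bsub>M\<^esub> v = w}. f u * g v),
      one = single \<one>\<^bsub>M\<^esub>,
      zero = (\<lambda>_. 0),
      add = (\<lambda>f g x. f x + g x),
      module.smult = (\<lambda>c f x. c * f x)\<rparr>"

definition word_monoid :: "'x set \<Rightarrow> 'x list monoid" where
  "word_monoid X = \<lparr>carrier = lists X, mult = (@), one = []\<rparr>"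

definition free_algebra :: "'x set \<Rightarrow> ('k::comm_ring_1, 'x list \<Rightarrow> 'k) module" where
  "free_algebra X = monoid_algebra (word_monoid X)"

text \<open>
  The tensor product of two algebras \<open>B\<close> and \<open>U\<close> over a commutative ring with underlying set
  \<open>R\<close>: the free abelian group on \<open>B \<times> U\<close>, modulo the relations making \<open>(b, u)\<close> additive in each
  argument and \<open>R\<close>-balanced. The free abelian group is given the multiplication
  \<open>(b, u) (b', u') = (b b', u u')\<close>, i.e. it is the integral monoid ring of the multiplicative
  monoid \<open>B \<times> U\<close>. Multiplying a relation by a pair \<open>(b', u')\<close> gives a relation again, so the
  subgroup generated by the relations is already a two-sided ideal. The scalar multiplication
  of the result is the base-change structure of a \<open>B\<close>-algebra, \<open>b t = (b \<otimes> 1) t\<close>.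
\<close>

definition tensor_ideal ::
  "'r set \<Rightarrow> ('r, 'b, 'z) module_scheme \<Rightarrow> ('r, 'u, 'y) module_scheme \<Rightarrow> ('b \<times> 'u \<Rightarrow> int) set" where
  "tensor_ideal R B U =
     (let F = (monoid_algebra (B \<times>\<times> U) :: (int, 'b \<times> 'u \<Rightarrow> int) module) in
      rel_ideal F
       ({(single (b \<oplus>\<^bsub>B\<^esub> b', u), single (b, u) \<oplus>\<^bsub>F\<^esub> single (b', u)) | b b' u.
           b \<in> carrier B \<and> b' \<in> carrier B \<and> u \<in> carrier U}
      \<union> {(single (b, u \<oplus>\<^bsub>U\<^esub> u'), single (b, u) \<oplus>\<^bsub>F\<^esub> single (b, u')) | b u u'.
           b \<in> carrier B \<and> u \<in> carrier U \<and> u' \<in> carrier U}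
      \<union> {(single (r \<odot>\<^bsub>B\<^esub> b, u), single (b, r \<odot>\<^bsub>U\<^esub> u)) | r b u.
           r \<in> R \<and> b \<in> carrier B \<and> u \<in> carrier U}))"

definition pure_tensor ::
  "'r set \<Rightarrow> ('r, 'b, 'z) module_scheme \<Rightarrow> ('r, 'u, 'y) module_scheme
    \<Rightarrow> 'b \<Rightarrow> 'u \<Rightarrow> ('b \<times> 'u \<Rightarrow> int) set" where
  "pure_tensor R B U b u =
     tensor_ideal R B U
       +>\<^bsub>(monoid_algebra (B \<times>\<times> U) :: (int, 'b \<times> 'u \<Rightarrow> int) module)\<^esub> single (b, u)"

definition tensor_alg ::
  "'r set \<Rightarrow> ('r, 'b, 'z) module_scheme \<Rightarrow> ('r, 'u, 'y) module_scheme
    \<Rightarrow> ('b, ('b \<times> 'u \<Rightarrow> int) set) module" where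
  "tensor_alg R B U =
     (let T = (monoid_algebra (B \<times>\<times> U) :: (int, 'b \<times> 'u \<Rightarrow> int) module) Quot tensor_ideal R B U
      in as_algebra T (\<lambda>b t. pure_tensor R B U b \<one>\<^bsub>U\<^esub> \<otimes>\<^bsub>T\<^esub> t))"

section \<open>Lie superalgebras and their universal enveloping algebras\<close>

text \<open>\<open>part g 0\<close> and \<open>part g 1\<close> are the even and the odd part.\<close>

record ('k, 'v) lie_superalgebra =
  space :: "'v set"
  part :: "nat \<Rightarrow> 'v set"
  ladd :: "'v \<Rightarrow> 'v \<Rightarrow> 'v"
  lscale :: "'k \<Rightarrow> 'v \<Rightarrow> 'v"
  bracket :: "'v \<Rightarrow> 'v \<Rightarrow> 'v"

text \<open>
  The tensor algebra of the underlying vector space, realised as the free algebra on its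
  elements modulo linearity of the inclusion, divided by the relations
  \<open>x y = (-1)\<^sup>|\<^sup>x\<^sup>|\<^sup>|\<^sup>y\<^sup>| y x + [x, y]\<close> for homogeneous \<open>x\<close> and \<open>y\<close>.
\<close>

definition enveloping_algebra ::
  "('k::field, 'v) lie_superalgebra \<Rightarrow> ('k, ('v list \<Rightarrow> 'k) set) module" where
  "enveloping_algebra g =
     (let F = (free_algebra (space g) :: ('k, 'v list \<Rightarrow> 'k) module);
          \<iota> = (\<lambda>x. single [x]) in
      quot_alg F (rel_ideal F
       ({(\<iota> (ladd g x y), \<iota> x \<oplus>\<^bsub>F\<^esub> \<iota> y) | x y. x \<in> space g \<and> y \<in> space g}
      \<union> {(\<iota> (lscale g c x), c \<odot>\<^bsub>F\<^esub> \<iota> x) | c x. x \<in> space g}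
      \<union> {(\<iota> x \<otimes>\<^bsub>F\<^esub> \<iota> y,
           ((-1) ^ (a * b) \<odot>\<^bsub>F\<^esub> (\<iota> y \<otimes>\<^bsub>F\<^esub> \<iota> x)) \<oplus>\<^bsub>F\<^esub> \<iota> (bracket g x y)) | a b x y.
           a \<in> {0, 1} \<and> b \<in> {0, 1} \<and> x \<in> part g a \<and> y \<in> part g b})))"

text \<open>
  The homogeneous component of parity \<open>p\<close> of a \<open>2n \<times> 2n\<close> matrix, and the bilinear extension of
  the super commutator \<open>X Y - (-1)\<^sup>|\<^sup>X\<^sup>|\<^sup>|\<^sup>Y\<^sup>| Y X\<close> from homogeneous matrices to all matrices.
\<close>

definition mat_component :: "nat \<Rightarrow> nat \<Rightarrow> complex mat \<Rightarrow> complex mat" where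
  "mat_component n p X =
     mat (2 * n) (2 * n) (\<lambda>(i, j). if (i < n \<longleftrightarrow> j < n) = (p = 0) then X $$ (i, j) else 0)"

definition super_commutator :: "nat \<Rightarrow> complex mat \<Rightarrow> complex mat \<Rightarrow> complex mat" where
  "super_commutator n X Y =
     (let X0 = mat_component n 0 X; X1 = mat_component n 1 X;
          Y0 = mat_component n 0 Y; Y1 = mat_component n 1 Y
      in (X0 * Y0 - Y0 * X0) + (X0 * Y1 - Y1 * X0) + (X1 * Y0 - Y0 * X1) + (X1 * Y1 + Y1 * X1))"

definition queer_lie :: "nat \<Rightarrow> (complex, complex mat) lie_superalgebra" where
  "queer_lie n =
     \<lparr>space = {four_block_mat A B B A | A B. A \<in> carrier_mat n n \<and> B \<in> carrier_mat n n},
      part = (\<lambda>p. if p = 0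
        then {four_block_mat A (0\<^sub>m n n) (0\<^sub>m n n) A | A. A \<in> carrier_mat n n}
        else {four_block_mat (0\<^sub>m n n) B B (0\<^sub>m n n) | B. B \<in> carrier_mat n n}),
      ladd = (+),
      lscale = (\<lambda>c X. c \<cdot>\<^sub>m X),
      bracket = super_commutator n\<rparr>"

section \<open>The quantum queer superalgebra\<close>

type_synonym cq = "complex poly fract"

definition qvar :: cq where
  "qvar = Fract [:0, 1:] 1"

definition nu :: cq where
  "nu = qvar - inverse qvar"

definition phi :: "int \<Rightarrow> int \<Rightarrow> int" where
  "phi i j = (if \<bar>i\<bar> = \<bar>j\<bar> then sgn j else 0)"

definition theta :: "int \<Rightarrow> int \<Rightarrow> int \<Rightarrow> int" where
  "theta i j k = sgn (sgn i + sgn j + sgn k)"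

definition par :: "int \<Rightarrow> int \<Rightarrow> nat" where
  "par i j = (if i * j > 0 then 0 else 1)"

definition Lidx :: "nat \<Rightarrow> (int \<times> int) set" where
  "Lidx n = {(i, j). i \<noteq> 0 \<and> j \<noteq> 0 \<and> \<bar>i\<bar> \<le> int n \<and> \<bar>j\<bar> \<le> int n \<and> i \<le> j}"

definition Lfree :: "nat \<Rightarrow> (cq, (int \<times> int) list \<Rightarrow> cq) module" where
  "Lfree n = free_algebra (Lidx n)"

definition Lmono :: "int \<Rightarrow> int \<Rightarrow> int \<Rightarrow> int \<Rightarrow> (int \<times> int) list \<Rightarrow> cq" where
  "Lmono i j k l = single [(i, j), (k, l)]"

text \<open>
  Whenever one of the bracketed conditions below holds, the two index pairs of the corresponding
  monomial are ordered; otherwise the coefficient is \<open>0\<close>.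
\<close>

definition Lrel_lhs :: "nat \<Rightarrow> int \<Rightarrow> int \<Rightarrow> int \<Rightarrow> int \<Rightarrow> (int \<times> int) list \<Rightarrow> cq" where
  "Lrel_lhs n i j k l =
     (((-1) ^ (par i j * par k l) * qvar powi phi j l) \<odot>\<^bsub>Lfree n\<^esub> Lmono i j k l)
     \<oplus>\<^bsub>Lfree n\<^esub>
     ((of_bool (k \<le> j \<and> j < l) * of_int (theta i j k) * nu) \<odot>\<^bsub>Lfree n\<^esub> Lmono i l k j)
     \<oplus>\<^bsub>Lfree n\<^esub>
     ((of_bool (i \<le> -l \<and> -l < j \<and> j \<le> -k) * of_int (theta (-i) (-j) k) * nu)
        \<odot>\<^bsub>Lfree n\<^esub> Lmono i (-l) k (-j))"

definition Lrel_rhs :: "nat \<Rightarrow> int \<Rightarrow> int \<Rightarrow> int \<Rightarrow> int \<Rightarrow> (int \<times> int) list \<Rightarrow> cq" where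
  "Lrel_rhs n i j k l =
     ((qvar powi phi i k) \<odot>\<^bsub>Lfree n\<^esub> Lmono k l i j)
     \<oplus>\<^bsub>Lfree n\<^esub>
     ((of_bool (k < i \<and> i \<le> l) * of_int (theta i j k) * nu) \<odot>\<^bsub>Lfree n\<^esub> Lmono i l k j)
     \<oplus>\<^bsub>Lfree n\<^esub>
     ((of_bool (-l \<le> i \<and> i < -k \<and> -k \<le> j) * of_int (theta (-i) (-j) k) * nu)
        \<odot>\<^bsub>Lfree n\<^esub> Lmono (-i) l (-k) j)"

text \<open>
  In the first family \<open>i\<close> ranges over positive and negative indices, so it contains both
  \<open>L\<^sub>i\<^sub>i L\<^sub>-\<^sub>i\<^sub>,\<^sub>-\<^sub>i = 1\<close> and \<open>L\<^sub>-\<^sub>i\<^sub>,\<^sub>-\<^sub>i L\<^sub>i\<^sub>i = 1\<close>.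
\<close>

definition Uq_ideal :: "nat \<Rightarrow> ((int \<times> int) list \<Rightarrow> cq) set" where
  "Uq_ideal n = rel_ideal (Lfree n)
     ({(Lmono i i (-i) (-i), \<one>\<^bsub>Lfree n\<^esub>) | i. (i, i) \<in> Lidx n}
    \<union> {(Lrel_lhs n i j k l, Lrel_rhs n i j k l) | i j k l. (i, j) \<in> Lidx n \<and> (k, l) \<in> Lidx n})"

definition Uq :: "nat \<Rightarrow> (cq, ((int \<times> int) list \<Rightarrow> cq) set) module" where
  "Uq n = quot_alg (Lfree n) (Uq_ideal n)"

definition Lgen :: "nat \<Rightarrow> int \<Rightarrow> int \<Rightarrow> ((int \<times> int) list \<Rightarrow> cq) set" where
  "Lgen n i j = Uq_ideal n +>\<^bsub>Lfree n\<^esub> single [(i, j)]"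

text \<open>\<open>h\<close> in \<open>Pvee n\<close> stands for the sum of the \<open>h i \<cdot> k\<^sub>i\<close> with \<open>1 \<le> i \<le> n\<close>.\<close>

definition Pvee :: "nat \<Rightarrow> (nat \<Rightarrow> int) set" where
  "Pvee n = {h. \<forall>i. i \<notin> {1..n} \<longrightarrow> h i = 0}"

definition qpow :: "nat \<Rightarrow> (nat \<Rightarrow> int) \<Rightarrow> ((int \<times> int) list \<Rightarrow> cq) set" where
  "qpow n h =
     foldr (\<lambda>i x. (Lgen n (int i) (int i) [^]\<^bsub>Uq n\<^esub> h i) \<otimes>\<^bsub>Uq n\<^esub> x) [1..<Suc n] \<one>\<^bsub>Uq n\<^esub>"

definition qpow_diff :: "nat \<Rightarrow> (nat \<Rightarrow> int) \<Rightarrow> ((int \<times> int) list \<Rightarrow> cq) set" where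
  "qpow_diff n h = (1 / (qvar - 1)) \<odot>\<^bsub>Uq n\<^esub> (qpow n h \<ominus>\<^bsub>Uq n\<^esub> \<one>\<^bsub>Uq n\<^esub>)"

definition e_gen :: "nat \<Rightarrow> int \<Rightarrow> ((int \<times> int) list \<Rightarrow> cq) set" where
  "e_gen n i = (- 1 / nu) \<odot>\<^bsub>Uq n\<^esub> Lgen n (- i - 1) (- i)"

definition f_gen :: "nat \<Rightarrow> int \<Rightarrow> ((int \<times> int) list \<Rightarrow> cq) set" where
  "f_gen n i = (1 / nu) \<odot>\<^bsub>Uq n\<^esub> Lgen n i (i + 1)"

definition ebar_gen :: "nat \<Rightarrow> int \<Rightarrow> ((int \<times> int) list \<Rightarrow> cq) set" where
  "ebar_gen n i = (- 1 / nu) \<odot>\<^bsub>Uq n\<^esub> Lgen n (- i - 1) i"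

definition fbar_gen :: "nat \<Rightarrow> int \<Rightarrow> ((int \<times> int) list \<Rightarrow> cq) set" where
  "fbar_gen n i = (- 1 / nu) \<odot>\<^bsub>Uq n\<^esub> Lgen n (- i) (i + 1)"

definition kbar_gen :: "nat \<Rightarrow> int \<Rightarrow> ((int \<times> int) list \<Rightarrow> cq) set" where
  "kbar_gen n l = (- 1 / nu) \<odot>\<^bsub>Uq n\<^esub> Lgen n (- l) l"

section \<open>The integral form and the classical limit\<close>

definition A1 :: "cq set" where
  "A1 = {Fract f g | f g. poly g 1 \<noteq> 0}"

definition J1 :: "cq set" where
  "J1 = {(qvar - 1) * a | a. a \<in> A1}"

definition A1_alg :: "(cq, cq) module" where
  "A1_alg = \<lparr>carrier = A1, mult = (*), one = 1, zero = 0, add = (+), module.smult = (*)\<rparr>"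

definition UA1 :: "nat \<Rightarrow> (cq, ((int \<times> int) list \<Rightarrow> cq) set) module" where
  "UA1 n = (Uq n)\<lparr>carrier := gen_subalgebra A1 (Uq n)
     (e_gen n ` {1..int n - 1} \<union> ebar_gen n ` {1..int n - 1}
    \<union> f_gen n ` {1..int n - 1} \<union> fbar_gen n ` {1..int n - 1}
    \<union> qpow n ` Pvee n \<union> kbar_gen n ` {1..int n} \<union> qpow_diff n ` Pvee n)\<rparr>"

text \<open>
  The residue field \<open>A1 / J1\<close> and the inverse of its identification with the complex numbers
  given by evaluation at \<open>q = 1\<close>: a complex number goes to the class of the constant function.
\<close>

definition residue_field :: "(cq, cq set) module" where
  "residue_field = quot_alg A1_alg J1"

definition residue_const :: "complex \<Rightarrow> cq set" where
  "residue_const c = J1 +>\<^bsub>A1_alg\<^esub> Fract [:c:] 1"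

definition classical_limit :: "nat \<Rightarrow> (complex, (cq set \<times> ((int \<times> int) list \<Rightarrow> cq) set \<Rightarrow> int) set) module" where
  "classical_limit n =
     (let T = tensor_alg A1 residue_field (UA1 n)
      in as_algebra T (\<lambda>c t. residue_const c \<odot>\<^bsub>T\<^esub> t))"

end

theory Submission
  imports Defs "HOL-Algebra.Subrings" "HOL-Library.Multiset"
begin

text \<open>
  The quantum superalgebra acts on functions of words in the letters \<open>\<plusminus> 1, \<dots>, \<plusminus> n\<close>: moving an
  auxiliary index through a word by a solution of the braid relation gives operators that satisfy
  the defining relations of the \<open>L\<^sub>i\<^sub>j\<close>. The integral form is generated over \<open>A1\<close> by the elements
  \<open>(L\<^sub>i\<^sub>j - \<delta>\<^sub>i\<^sub>j) / (q - q\<^sup>-\<^sup>1)\<close>. Dividing the defining relations by powers of \<open>q - q\<^sup>-\<^sup>1\<close> and putting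
  \<open>q = 1\<close> turns them into the relations of the queer Lie superalgebra, so that its enveloping
  algebra maps onto the classical limit. For injectivity, the enveloping algebra is spanned by
  ordered monomials; on words the generators of the limit act as the derivations that extend the
  matrices of \<open>q(n)\<close>, and a nontrivial combination of ordered monomials acts nontrivially on
  sufficiently long words, as the number of letters that it changes shows.
\<close>

section \<open>Algebras over a commutative ring\<close>

text \<open>No basis of \<open>Uq n\<close> or of \<open>UA1 n\<close> is ever found, so neither
  freeness of the integral form nor an ordered basis of the quantum algebra can be invoked, and a
  basis theorem for the enveloping algebra is not presupposed either. This decides the direction of
  the main map: out of the enveloping algebra, where only relations have to be checked, and then one
  explicit action proves at once that the ordered monomials are independent and that the map is
  injective. Words of all lengths are needed, because the action on words of one fixed length has
  finite-dimensional image.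

  With every generator written as \<delta> + nu X, the commutator of two of them has order nu
  squared. That is why the relations are divided twice, and why the powers of q still contribute:
  their first-order parts survive. Since nu agrees to first order with 2 (q - 1), they contribute
  halves, and the diagonal Lie generators are twice the reduced ones.

  The products of \<theta>-signs and parity signs in the defining relations never have to be
  understood as a whole. They depend only on signs and on the order of the indices, so each
  comparison is a finite case distinction.\<close>

locale unital_algebra = ring A for A :: "('k::comm_ring_1, 'a, 'z) module_scheme" (structure) +
  assumes smult_closed [simp, intro]: "x \<in> carrier A \<Longrightarrow> c \<odot> x \<in> carrier A"
    and smult_add_left: "x \<in> carrier A \<Longrightarrow> (c + d) \<odot> x = c \<odot> x \<oplus> d \<odot> x"
    and smult_add_right: "x \<in> carrier A \<Longrightarrow> y \<in> carrier A \<Longrightarrow> c \<odot> (x \<oplus> y) = c \<odot> x \<oplus> c \<odot> y"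
    and smult_smult: "x \<in> carrier A \<Longrightarrow> c \<odot> (d \<odot> x) = (c * d) \<odot> x"
    and smult_1 [simp]: "x \<in> carrier A \<Longrightarrow> 1 \<odot> x = x"
    and smult_mult_left: "x \<in> carrier A \<Longrightarrow> y \<in> carrier A \<Longrightarrow> (c \<odot> x) \<otimes> y = c \<odot> (x \<otimes> y)"
    and smult_mult_right: "x \<in> carrier A \<Longrightarrow> y \<in> carrier A \<Longrightarrow> x \<otimes> (c \<odot> y) = c \<odot> (x \<otimes> y)"
begin

lemma smult_0 [simp]: "x \<in> carrier A \<Longrightarrow> 0 \<odot> x = \<zero>"
  using smult_add_left[of x 0 0] by (metis add_cancel_right_right local.add.l_cancel_one smult_closed)

lemma smult_zero [simp]: "c \<odot> \<zero> = \<zero>"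
  using smult_add_right[of \<zero> \<zero> c] by (metis local.add.l_cancel_one smult_closed l_zero zero_closed)

lemma smult_uminus_left: "x \<in> carrier A \<Longrightarrow> (- c) \<odot> x = \<ominus> (c \<odot> x)"
  using smult_add_left[of x "- c" c] by (simp add: minus_equality)

lemma smult_uminus_right: "x \<in> carrier A \<Longrightarrow> c \<odot> (\<ominus> x) = \<ominus> (c \<odot> x)"
  using smult_add_right[of "\<ominus> x" x c] by (simp add: l_neg minus_equality)

lemma smult_minus1: "x \<in> carrier A \<Longrightarrow> \<ominus> x = (- 1) \<odot> x"
  by (simp add: smult_uminus_left)

lemma smult_minus_right: "x \<in> carrier A \<Longrightarrow> y \<in> carrier A \<Longrightarrow> c \<odot> (x \<ominus> y) = c \<odot> x \<ominus> c \<odot> y"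
  by (simp add: minus_eq smult_add_right smult_uminus_right)

lemma minus_eq_zero_iff: "x \<in> carrier A \<Longrightarrow> y \<in> carrier A \<Longrightarrow> x \<ominus> y = \<zero> \<longleftrightarrow> x = y"
  by (metis a_minus_def minus_equality minus_minus r_neg add.inv_closed)

lemma smult_finsum:
  "finite I \<Longrightarrow> f \<in> I \<rightarrow> carrier A \<Longrightarrow> c \<odot> (\<Oplus>i\<in>I. f i) = (\<Oplus>i\<in>I. c \<odot> f i)"
  by (induction I rule: finite_induct) (auto simp: smult_add_right Pi_iff)

end

definition alg_hom :: "('k, 'a, 'z) module_scheme \<Rightarrow> ('k, 'b, 'y) module_scheme \<Rightarrow> ('a \<Rightarrow> 'b) set" where
  "alg_hom A B = {h \<in> ring_hom A B. \<forall>c. \<forall>x\<in>carrier A. h (c \<odot>\<^bsub>A\<^esub> x) = c \<odot>\<^bsub>B\<^esub> h x}"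

lemma alg_homD:
  assumes "h \<in> alg_hom A B"
  shows "h \<in> ring_hom A B"
    and "x \<in> carrier A \<Longrightarrow> h x \<in> carrier B"
    and "x \<in> carrier A \<Longrightarrow> y \<in> carrier A \<Longrightarrow> h (x \<oplus>\<^bsub>A\<^esub> y) = h x \<oplus>\<^bsub>B\<^esub> h y"
    and "x \<in> carrier A \<Longrightarrow> y \<in> carrier A \<Longrightarrow> h (x \<otimes>\<^bsub>A\<^esub> y) = h x \<otimes>\<^bsub>B\<^esub> h y"
    and "h \<one>\<^bsub>A\<^esub> = \<one>\<^bsub>B\<^esub>"
    and "x \<in> carrier A \<Longrightarrow> h (c \<odot>\<^bsub>A\<^esub> x) = c \<odot>\<^bsub>B\<^esub> h x"
  using assms by (auto simp: alg_hom_def ring_hom_def Pi_iff)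

lemma ring_hom_zero_minus:
  assumes "ring A" "ring B" "h \<in> ring_hom A B"
  shows "h \<zero>\<^bsub>A\<^esub> = \<zero>\<^bsub>B\<^esub>"
    and "x \<in> carrier A \<Longrightarrow> h (\<ominus>\<^bsub>A\<^esub> x) = \<ominus>\<^bsub>B\<^esub> h x"
    and "x \<in> carrier A \<Longrightarrow> y \<in> carrier A \<Longrightarrow> h (x \<ominus>\<^bsub>A\<^esub> y) = h x \<ominus>\<^bsub>B\<^esub> h y"
proof -
  interpret ring_hom_ring A B h
    using assms by (simp add: ring_hom_ringI2)
  show "h \<zero>\<^bsub>A\<^esub> = \<zero>\<^bsub>B\<^esub>" by (rule hom_zero)
  show m: "h (\<ominus>\<^bsub>A\<^esub> x) = \<ominus>\<^bsub>B\<^esub> h x" if "x \<in> carrier A" for x using that by (rule hom_a_inv)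
  show "h (x \<ominus>\<^bsub>A\<^esub> y) = h x \<ominus>\<^bsub>B\<^esub> h y" if "x \<in> carrier A" "y \<in> carrier A"
    using that by (simp add: a_minus_def m)
qed

lemma ring_hom_finsum:
  assumes "ring A" "ring B" "h \<in> ring_hom A B" "finite I" "f \<in> I \<rightarrow> carrier A"
  shows "h (finsum A f I) = finsum B (\<lambda>i. h (f i)) I"
proof -
  interpret ring_hom_ring A B h
    using assms by (simp add: ring_hom_ringI2)
  show ?thesis using assms(4,5)
  proof (induction I rule: finite_induct)
    case (insert x F)
    then have "(\<lambda>i. h (f i)) \<in> F \<rightarrow> carrier B" "f \<in> F \<rightarrow> carrier A" "h (f x) \<in> carrier B"
      by (auto simp: Pi_iff)
    with insert show ?case by (simp)
  qed simp
qed

section \<open>Monoid algebras\<close>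

lemma monoid_algebra_simps:
  "carrier (monoid_algebra M) = {f. finite {x. f x \<noteq> 0} \<and> {x. f x \<noteq> 0} \<subseteq> carrier M}"
  "\<one>\<^bsub>monoid_algebra M\<^esub> = single \<one>\<^bsub>M\<^esub>"
  "\<zero>\<^bsub>monoid_algebra M\<^esub> = (\<lambda>_. 0)"
  "f \<oplus>\<^bsub>monoid_algebra M\<^esub> g = (\<lambda>x. f x + g x)"
  "c \<odot>\<^bsub>monoid_algebra M\<^esub> f = (\<lambda>x. c * f x)"
  by (simp_all add: monoid_algebra_def)

text \<open>The definition sums over the pairs that actually multiply to \<open>w\<close>. Summing
  over fixed finite supersets of the supports, with the condition moved into the summand, makes the
  sums for different products comparable.\<close>

lemma monoid_algebra_mult:
  fixes f g :: "'m \<Rightarrow> 'k::comm_ring_1"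
  assumes "finite S" "finite T" "{x. f x \<noteq> 0} \<subseteq> S" "{x. g x \<noteq> 0} \<subseteq> T"
  shows "(f \<otimes>\<^bsub>monoid_algebra M\<^esub> g) w
    = (\<Sum>u\<in>S. \<Sum>v\<in>T. if u \<otimes>\<^bsub>M\<^esub> v = w then f u * g v else 0)"
proof -
  have "(f \<otimes>\<^bsub>monoid_algebra M\<^esub> g) w
      = (\<Sum>(u, v)\<in>{(u, v). f u \<noteq> 0 \<and> g v \<noteq> 0 \<and> u \<otimes>\<^bsub>M\<^esub> v = w}. f u * g v)"
    by (simp add: monoid_algebra_def)
  also have "\<dots> = (\<Sum>(u, v)\<in>S \<times> T. if u \<otimes>\<^bsub>M\<^esub> v = w then f u * g v else 0)"
    using assms by (intro sum.mono_neutral_cong_left) (auto split: if_splits)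
  finally show ?thesis by (simp add: sum.cartesian_product)
qed

lemma finite_supports:
  "f \<in> carrier (monoid_algebra M) \<Longrightarrow> finite {x. f x \<noteq> 0}"
  "f \<in> carrier (monoid_algebra M) \<Longrightarrow> {x. f x \<noteq> 0} \<subseteq> carrier M"
  by (auto simp: monoid_algebra_simps)

lemma sum_swap4:
  "(\<Sum>p\<in>P. \<Sum>t\<in>U. \<Sum>u\<in>S. \<Sum>v\<in>T. G p t u v) = (\<Sum>u\<in>S. \<Sum>v\<in>T. \<Sum>t\<in>U. \<Sum>p\<in>P. G p t u v)"
proof -
  have "(\<Sum>p\<in>P. \<Sum>t\<in>U. \<Sum>u\<in>S. \<Sum>v\<in>T. G p t u v) = (\<Sum>p\<in>P. \<Sum>u\<in>S. \<Sum>t\<in>U. \<Sum>v\<in>T. G p t u v)"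
    by (rule sum.cong[OF refl], rule sum.swap)
  also have "\<dots> = (\<Sum>u\<in>S. \<Sum>p\<in>P. \<Sum>t\<in>U. \<Sum>v\<in>T. G p t u v)" by (rule sum.swap)
  also have "\<dots> = (\<Sum>u\<in>S. \<Sum>t\<in>U. \<Sum>p\<in>P. \<Sum>v\<in>T. G p t u v)"
    by (rule sum.cong[OF refl], rule sum.swap)
  also have "\<dots> = (\<Sum>u\<in>S. \<Sum>t\<in>U. \<Sum>v\<in>T. \<Sum>p\<in>P. G p t u v)"
    by (rule sum.cong[OF refl], rule sum.cong[OF refl], rule sum.swap)
  also have "\<dots> = (\<Sum>u\<in>S. \<Sum>v\<in>T. \<Sum>t\<in>U. \<Sum>p\<in>P. G p t u v)"
    by (rule sum.cong[OF refl], rule sum.swap)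
  finally show ?thesis .
qed

lemma if_sum_mult:
  fixes h :: "'k::comm_ring_1"
  shows "(if c then (\<Sum>u\<in>S. \<Sum>v\<in>T. if P u v then a u v else 0) * h else 0)
      = (\<Sum>u\<in>S. \<Sum>v\<in>T. if P u v then (if c then a u v * h else 0) else 0)"
    and "(if c then h * (\<Sum>u\<in>S. \<Sum>v\<in>T. if P u v then a u v else 0) else 0)
      = (\<Sum>u\<in>S. \<Sum>v\<in>T. if P u v then (if c then h * a u v else 0) else 0)"
proof -
  have "(if P u v then a u v else 0) * h = (if P u v then a u v * h else 0)"
    "h * (if P u v then a u v else 0) = (if P u v then h * a u v else 0)" for u v
    by auto
  then show "(if c then (\<Sum>u\<in>S. \<Sum>v\<in>T. if P u v then a u v else 0) * h else 0)
      = (\<Sum>u\<in>S. \<Sum>v\<in>T. if P u v then (if c then a u v * h else 0) else 0)"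
    "(if c then h * (\<Sum>u\<in>S. \<Sum>v\<in>T. if P u v then a u v else 0) else 0)
      = (\<Sum>u\<in>S. \<Sum>v\<in>T. if P u v then (if c then h * a u v else 0) else 0)"
    by (simp_all only: sum_distrib_right sum_distrib_left) (cases c; simp cong: if_cong)+
qed

context monoid begin

lemma monoid_algebra_mult_closed:
  fixes f g :: "'a \<Rightarrow> 'k::comm_ring_1"
  assumes "f \<in> carrier (monoid_algebra G)" "g \<in> carrier (monoid_algebra G)"
  shows "f \<otimes>\<^bsub>monoid_algebra G\<^esub> g \<in> carrier (monoid_algebra G)"
    and "{w. (f \<otimes>\<^bsub>monoid_algebra G\<^esub> g) w \<noteq> 0} \<subseteq> (\<lambda>(u, v). u \<otimes> v) ` ({x. f x \<noteq> 0} \<times> {x. g x \<noteq> 0})"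
proof -
  let ?S = "{x. f x \<noteq> 0}" and ?T = "{x. g x \<noteq> 0}"
  note fin = finite_supports[OF assms(1)] finite_supports[OF assms(2)]
  show *: "{w. (f \<otimes>\<^bsub>monoid_algebra G\<^esub> g) w \<noteq> 0} \<subseteq> (\<lambda>(u, v). u \<otimes> v) ` (?S \<times> ?T)"
  proof
    fix w assume "w \<in> {w. (f \<otimes>\<^bsub>monoid_algebra G\<^esub> g) w \<noteq> 0}"
    then have "(\<Sum>u\<in>?S. \<Sum>v\<in>?T. if u \<otimes> v = w then f u * g v else 0) \<noteq> 0"
      by (simp add: monoid_algebra_mult[OF fin(1,3) order_refl order_refl])
    then obtain u where u: "u \<in> ?S" "(\<Sum>v\<in>?T. if u \<otimes> v = w then f u * g v else 0) \<noteq> 0"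
      by (rule sum.not_neutral_contains_not_neutral)
    then obtain v where "v \<in> ?T" "(if u \<otimes> v = w then f u * g v else 0) \<noteq> 0"
      using sum.not_neutral_contains_not_neutral[OF u(2)] by blast
    then have "u \<in> ?S" "v \<in> ?T" "u \<otimes> v = w"
      using u by (auto split: if_splits)
    then show "w \<in> (\<lambda>(u, v). u \<otimes> v) ` (?S \<times> ?T)" by force
  qed
  have "finite ((\<lambda>(u, v). u \<otimes> v) ` (?S \<times> ?T))" using fin by blast
  moreover have "(\<lambda>(u, v). u \<otimes> v) ` (?S \<times> ?T) \<subseteq> carrier G" using fin by auto
  ultimately show "f \<otimes>\<^bsub>monoid_algebra G\<^esub> g \<in> carrier (monoid_algebra G)"
    using * by (auto simp: monoid_algebra_simps intro: finite_subset)
qed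

text \<open>Both bracketings expand to the same triple sum over the supports; the variable for the
  inner product takes exactly one value for each pair of factors and is removed by
  \<open>sum.delta'\<close>.\<close>

lemma monoid_algebra_assoc:
  fixes f g h :: "'a \<Rightarrow> 'k::comm_ring_1"
  assumes "f \<in> carrier (monoid_algebra G)" "g \<in> carrier (monoid_algebra G)"
    "h \<in> carrier (monoid_algebra G)"
  shows "f \<otimes>\<^bsub>monoid_algebra G\<^esub> g \<otimes>\<^bsub>monoid_algebra G\<^esub> h
    = f \<otimes>\<^bsub>monoid_algebra G\<^esub> (g \<otimes>\<^bsub>monoid_algebra G\<^esub> h)"
proof
  fix w
  let ?A = "monoid_algebra G :: ('k, 'a \<Rightarrow> 'k) module"
  let ?S = "{x. f x \<noteq> 0}" and ?T = "{x. g x \<noteq> 0}" and ?U = "{x. h x \<noteq> 0}"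
  note fin = finite_supports[OF assms(1)] finite_supports[OF assms(2)] finite_supports[OF assms(3)]
  let ?P = "(\<lambda>(u, v). u \<otimes> v) ` (?S \<times> ?T)" and ?Q = "(\<lambda>(u, v). u \<otimes> v) ` (?T \<times> ?U)"
  have P: "finite ?P" "finite ?Q" using fin by auto
  have "(f \<otimes>\<^bsub>?A\<^esub> g \<otimes>\<^bsub>?A\<^esub> h) w
      = (\<Sum>p\<in>?P. \<Sum>t\<in>?U. if p \<otimes> t = w then (f \<otimes>\<^bsub>?A\<^esub> g) p * h t else 0)"
    by (rule monoid_algebra_mult[OF P(1) fin(5) monoid_algebra_mult_closed(2)[OF assms(1,2)] order_refl])
  also have "\<dots> = (\<Sum>p\<in>?P. \<Sum>t\<in>?U. \<Sum>u\<in>?S. \<Sum>v\<in>?T.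
      if u \<otimes> v = p then (if p \<otimes> t = w then f u * g v * h t else 0) else 0)"
    unfolding monoid_algebra_mult[OF fin(1,3) order_refl order_refl] if_sum_mult ..
  also have "\<dots> = (\<Sum>u\<in>?S. \<Sum>v\<in>?T. \<Sum>t\<in>?U. \<Sum>p\<in>?P.
      if u \<otimes> v = p then (if p \<otimes> t = w then f u * g v * h t else 0) else 0)"
    by (rule sum_swap4)
  also have "\<dots> = (\<Sum>u\<in>?S. \<Sum>v\<in>?T. \<Sum>t\<in>?U. if u \<otimes> v \<otimes> t = w then f u * g v * h t else 0)"
    using P by (intro sum.cong refl) (subst sum.delta', auto)
  also have "\<dots> = (\<Sum>u\<in>?S. \<Sum>v\<in>?T. \<Sum>t\<in>?U. if u \<otimes> (v \<otimes> t) = w then f u * g v * h t else 0)"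
    using fin by (intro sum.cong refl) (subst m_assoc, auto)
  also have "\<dots> = (\<Sum>u\<in>?S. \<Sum>v\<in>?T. \<Sum>t\<in>?U. \<Sum>p\<in>?Q.
      if v \<otimes> t = p then (if u \<otimes> p = w then f u * g v * h t else 0) else 0)"
    using P by (intro sum.cong refl) (subst sum.delta', auto)
  also have "\<dots> = (\<Sum>u\<in>?S. \<Sum>p\<in>?Q. \<Sum>v\<in>?T. \<Sum>t\<in>?U.
      if v \<otimes> t = p then (if u \<otimes> p = w then f u * g v * h t else 0) else 0)"
    by (rule sum.cong[OF refl], rule trans[OF sum.cong[OF refl sum.swap] sum.swap])
  also have "\<dots> = (\<Sum>u\<in>?S. \<Sum>p\<in>?Q. if u \<otimes> p = w then f u * (g \<otimes>\<^bsub>?A\<^esub> h) p else 0)"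
    unfolding monoid_algebra_mult[OF fin(3,5) order_refl order_refl] if_sum_mult mult.assoc ..
  also have "\<dots> = (f \<otimes>\<^bsub>?A\<^esub> (g \<otimes>\<^bsub>?A\<^esub> h)) w"
    by (rule monoid_algebra_mult[symmetric, OF fin(1) P(2) order_refl monoid_algebra_mult_closed(2)[OF assms(2,3)]])
  finally show "(f \<otimes>\<^bsub>?A\<^esub> g \<otimes>\<^bsub>?A\<^esub> h) w = (f \<otimes>\<^bsub>?A\<^esub> (g \<otimes>\<^bsub>?A\<^esub> h)) w" .
qed

lemma unital_algebra_monoid_algebra:
  "unital_algebra (monoid_algebra G :: ('k::comm_ring_1, 'a \<Rightarrow> 'k) module)"
proof -
  let ?A = "monoid_algebra G :: ('k, 'a \<Rightarrow> 'k) module"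
  have add: "f \<oplus>\<^bsub>?A\<^esub> g \<in> carrier ?A" if "f \<in> carrier ?A" "g \<in> carrier ?A" for f g
  proof -
    have "{x. f x + g x \<noteq> 0} \<subseteq> {x. f x \<noteq> 0} \<union> {x. g x \<noteq> 0}" by auto
    then show ?thesis using that by (auto simp: monoid_algebra_simps intro: finite_subset)
  qed
  have sm: "c \<odot>\<^bsub>?A\<^esub> f \<in> carrier ?A" if "f \<in> carrier ?A" for c f
  proof -
    have "{x. c * f x \<noteq> 0} \<subseteq> {x. f x \<noteq> 0}" by auto
    then show ?thesis using that by (auto simp: monoid_algebra_simps intro: finite_subset)
  qed
  have one: "\<one>\<^bsub>?A\<^esub> \<in> carrier ?A"
    by (auto simp: monoid_algebra_simps single_def)
  have abel: "abelian_group ?A"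
  proof (rule abelian_groupI)
    fix f assume f: "f \<in> carrier ?A"
    show "\<exists>g\<in>carrier ?A. g \<oplus>\<^bsub>?A\<^esub> f = \<zero>\<^bsub>?A\<^esub>"
      by (rule bexI[OF _ sm[OF f, of "-1"]]) (simp add: monoid_algebra_simps)
  qed (use add in \<open>auto simp: monoid_algebra_simps add_ac\<close>)
  have one_l: "\<one>\<^bsub>?A\<^esub> \<otimes>\<^bsub>?A\<^esub> f = f" and one_r: "f \<otimes>\<^bsub>?A\<^esub> \<one>\<^bsub>?A\<^esub> = f" if f: "f \<in> carrier ?A" for f
  proof -
    note fin = finite_supports[OF f]
    have s1: "{x. single \<one> x \<noteq> (0::'k)} \<subseteq> {\<one>}" by (auto simp: single_def)
    have z: "f w = 0" if "w \<notin> carrier G" for w using that fin by auto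
    have "(single \<one> \<otimes>\<^bsub>?A\<^esub> f) w = (\<Sum>v\<in>{x. f x \<noteq> 0}. if v = w then f v else 0)" for w
      unfolding monoid_algebra_mult[OF _ fin(1) s1 order_refl, simplified]
      using fin by (intro sum.cong) (auto simp: single_def)
    then show "\<one>\<^bsub>?A\<^esub> \<otimes>\<^bsub>?A\<^esub> f = f" using fin by (auto simp: fun_eq_iff monoid_algebra_simps)
    have "(f \<otimes>\<^bsub>?A\<^esub> single \<one>) w = (\<Sum>v\<in>{x. f x \<noteq> 0}. if v = w then f v else 0)" for w
      unfolding monoid_algebra_mult[OF fin(1) _ order_refl s1, simplified]
      using fin by (intro sum.cong) (auto simp: single_def)
    then show "f \<otimes>\<^bsub>?A\<^esub> \<one>\<^bsub>?A\<^esub> = f" using fin by (auto simp: fun_eq_iff monoid_algebra_simps)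
  qed
  have mon: "monoid ?A"
    by (rule monoidI)
      (use monoid_algebra_mult_closed(1) one monoid_algebra_assoc one_l one_r in auto)
  have mult2: "(f \<otimes>\<^bsub>?A\<^esub> g) w = (\<Sum>u\<in>S. \<Sum>v\<in>T. if u \<otimes> v = w then f u * g v else 0)"
    if "finite S" "finite T" "{x. f x \<noteq> 0} \<subseteq> S" "{x. g x \<noteq> 0} \<subseteq> T" for f g :: "'a \<Rightarrow> 'k" and w S T
    using that by (rule monoid_algebra_mult)
  have l: "(f \<oplus>\<^bsub>?A\<^esub> g) \<otimes>\<^bsub>?A\<^esub> h = f \<otimes>\<^bsub>?A\<^esub> h \<oplus>\<^bsub>?A\<^esub> g \<otimes>\<^bsub>?A\<^esub> h"
    and r: "h \<otimes>\<^bsub>?A\<^esub> (f \<oplus>\<^bsub>?A\<^esub> g) = h \<otimes>\<^bsub>?A\<^esub> f \<oplus>\<^bsub>?A\<^esub> h \<otimes>\<^bsub>?A\<^esub> g"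
    if f: "f \<in> carrier ?A" and g: "g \<in> carrier ?A" and h: "h \<in> carrier ?A" for f g h
  proof -
    let ?S = "{x. f x \<noteq> 0} \<union> {x. g x \<noteq> 0}" and ?U = "{x. h x \<noteq> 0}"
    have S: "finite ?S" "{x. f x \<noteq> 0} \<subseteq> ?S" "{x. g x \<noteq> 0} \<subseteq> ?S" "{x. f x + g x \<noteq> 0} \<subseteq> ?S" "finite ?U"
      using finite_supports[OF f] finite_supports[OF g] finite_supports[OF h] by auto
    show "(f \<oplus>\<^bsub>?A\<^esub> g) \<otimes>\<^bsub>?A\<^esub> h = f \<otimes>\<^bsub>?A\<^esub> h \<oplus>\<^bsub>?A\<^esub> g \<otimes>\<^bsub>?A\<^esub> h"
      unfolding monoid_algebra_simps
      by (rule ext) (simp only: mult2[OF S(1,5) S(2) order_refl] mult2[OF S(1,5) S(3) order_refl]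
          mult2[OF S(1,5) S(4) order_refl] sum.distrib[symmetric], intro sum.cong refl, simp add: algebra_simps)
    show "h \<otimes>\<^bsub>?A\<^esub> (f \<oplus>\<^bsub>?A\<^esub> g) = h \<otimes>\<^bsub>?A\<^esub> f \<oplus>\<^bsub>?A\<^esub> h \<otimes>\<^bsub>?A\<^esub> g"
      unfolding monoid_algebra_simps
      by (rule ext) (simp only: mult2[OF S(5,1) order_refl S(2)] mult2[OF S(5,1) order_refl S(3)]
          mult2[OF S(5,1) order_refl S(4)] sum.distrib[symmetric], intro sum.cong refl, simp add: algebra_simps)
  qed
  have ring: "ring ?A" by (rule ringI[OF abel mon]) (use l r in auto)
  have sl: "(c \<odot>\<^bsub>?A\<^esub> f) \<otimes>\<^bsub>?A\<^esub> g = c \<odot>\<^bsub>?A\<^esub> (f \<otimes>\<^bsub>?A\<^esub> g)"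
    and sr: "f \<otimes>\<^bsub>?A\<^esub> (c \<odot>\<^bsub>?A\<^esub> g) = c \<odot>\<^bsub>?A\<^esub> (f \<otimes>\<^bsub>?A\<^esub> g)"
    if f: "f \<in> carrier ?A" and g: "g \<in> carrier ?A" for f g c
  proof -
    let ?S = "{x. f x \<noteq> 0}" and ?T = "{x. g x \<noteq> 0}"
    have S: "finite ?S" "finite ?T" "{x. c * f x \<noteq> 0} \<subseteq> ?S" "{x. c * g x \<noteq> 0} \<subseteq> ?T"
      using finite_supports[OF f] finite_supports[OF g] by auto
    show "(c \<odot>\<^bsub>?A\<^esub> f) \<otimes>\<^bsub>?A\<^esub> g = c \<odot>\<^bsub>?A\<^esub> (f \<otimes>\<^bsub>?A\<^esub> g)"
      unfolding monoid_algebra_simps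
      by (rule ext) (simp only: mult2[OF S(1,2) order_refl order_refl] mult2[OF S(1,2) S(3) order_refl]
          sum_distrib_left, intro sum.cong refl, simp add: algebra_simps)
    show "f \<otimes>\<^bsub>?A\<^esub> (c \<odot>\<^bsub>?A\<^esub> g) = c \<odot>\<^bsub>?A\<^esub> (f \<otimes>\<^bsub>?A\<^esub> g)"
      unfolding monoid_algebra_simps
      by (rule ext) (simp only: mult2[OF S(1,2) order_refl order_refl] mult2[OF S(1,2) order_refl S(4)]
          sum_distrib_left, intro sum.cong refl, simp add: algebra_simps)
  qed
  show ?thesis
  proof (intro unital_algebra.intro unital_algebra_axioms.intro)
    show "ring ?A" by (rule ring)
    fix c d f assume "f \<in> carrier ?A"
    show "(c + d) \<odot>\<^bsub>?A\<^esub> f = c \<odot>\<^bsub>?A\<^esub> f \<oplus>\<^bsub>?A\<^esub> d \<odot>\<^bsub>?A\<^esub> f"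
      "c \<odot>\<^bsub>?A\<^esub> (d \<odot>\<^bsub>?A\<^esub> f) = (c * d) \<odot>\<^bsub>?A\<^esub> f" "1 \<odot>\<^bsub>?A\<^esub> f = f"
      by (simp_all add: monoid_algebra_simps distrib_right mult.assoc)
  next
    fix c f g
    show "c \<odot>\<^bsub>?A\<^esub> (f \<oplus>\<^bsub>?A\<^esub> g) = c \<odot>\<^bsub>?A\<^esub> f \<oplus>\<^bsub>?A\<^esub> c \<odot>\<^bsub>?A\<^esub> g"
      by (simp add: monoid_algebra_simps distrib_left)
  qed (fact sm sl sr)+
qed

end

lemma single_carrier [simp]: "m \<in> carrier M \<Longrightarrow> single m \<in> carrier (monoid_algebra M)"
  by (auto simp: monoid_algebra_simps single_def)

lemma single_mult:
  "single a \<otimes>\<^bsub>monoid_algebra M\<^esub> single b = (single (a \<otimes>\<^bsub>M\<^esub> b) :: _ \<Rightarrow> 'k::comm_ring_1)"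
proof
  fix w
  have "(single a \<otimes>\<^bsub>monoid_algebra M\<^esub> single b) w
      = (\<Sum>u\<in>{a}. \<Sum>v\<in>{b}. if u \<otimes>\<^bsub>M\<^esub> v = w then single a u * single b v else (0::'k))"
    by (rule monoid_algebra_mult) (auto simp: single_def)
  then show "(single a \<otimes>\<^bsub>monoid_algebra M\<^esub> single b) w = (single (a \<otimes>\<^bsub>M\<^esub> b) :: _ \<Rightarrow> 'k) w"
    by (simp add: single_def)
qed

text \<open>The support grows by one point at a time, so additive statements reduce to scalar
  multiples of \<open>single m\<close>.\<close>

lemma monoid_algebra_induct [consumes 1, case_names zero add]:
  assumes "f \<in> carrier (monoid_algebra M)"
    and "P (\<lambda>_. 0)"
    and "\<And>c m f. m \<in> carrier M \<Longrightarrow> f \<in> carrier (monoid_algebra M) \<Longrightarrow> f m = 0 \<Longrightarrow> c \<noteq> 0 \<Longrightarrow>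
      P f \<Longrightarrow> P (\<lambda>x. c * single m x + f x)"
  shows "P f"
proof -
  have "P f" if "finite S" "{x. f x \<noteq> 0} = S" "S \<subseteq> carrier M" for S
    using that
  proof (induction S arbitrary: f rule: finite_induct)
    case empty
    then have "f = (\<lambda>_. 0)" by auto
    with assms(2) show ?case by simp
  next
    case (insert m S)
    let ?f = "\<lambda>x. if x = m then 0 else f x"
    have s: "{x. ?f x \<noteq> 0} = S" using insert by auto
    have "P (\<lambda>x. f m * single m x + ?f x)"
    proof (rule assms(3))
      show "?f \<in> carrier (monoid_algebra M)" using s insert by (auto simp: monoid_algebra_simps)
      show "P ?f" using insert s by auto
    qed (use insert in auto)
    moreover have "(\<lambda>x. f m * single m x + ?f x) = f" by (auto simp: single_def)
    ultimately show ?case by simp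
  qed
  then show ?thesis using finite_supports[OF assms(1)] by blast
qed

section \<open>Linear extension of maps from a monoid to its monoid algebra\<close>

definition lin_ext :: "('k::comm_ring_1, 'a, 'z) module_scheme \<Rightarrow> ('m \<Rightarrow> 'a) \<Rightarrow> ('m \<Rightarrow> 'k) \<Rightarrow> 'a" where
  "lin_ext A \<phi> f = (\<Oplus>\<^bsub>A\<^esub>m\<in>{m. f m \<noteq> 0}. f m \<odot>\<^bsub>A\<^esub> \<phi> m)"

context unital_algebra begin

lemma lin_ext_superset:
  assumes "finite S" "{m. f m \<noteq> 0} \<subseteq> S" "\<phi> \<in> S \<rightarrow> carrier A"
  shows "lin_ext A \<phi> f = (\<Oplus>m\<in>S. f m \<odot> \<phi> m)"
  unfolding lin_ext_def
  by (rule add.finprod_mono_neutral_cong_left) (use assms in \<open>auto simp: Pi_iff\<close>)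

lemma lin_ext_closed:
  "\<phi> \<in> {m. f m \<noteq> 0} \<rightarrow> carrier A \<Longrightarrow> lin_ext A \<phi> f \<in> carrier A"
  unfolding lin_ext_def by (rule finsum_closed) auto

lemma lin_ext_add:
  assumes "finite {m. f m \<noteq> 0}" "finite {m. g m \<noteq> 0}"
    "\<phi> \<in> {m. f m \<noteq> 0} \<union> {m. g m \<noteq> 0} \<rightarrow> carrier A"
  shows "lin_ext A \<phi> (\<lambda>x. f x + g x) = lin_ext A \<phi> f \<oplus> lin_ext A \<phi> g"
proof -
  let ?S = "{m. f m \<noteq> 0} \<union> {m. g m \<noteq> 0}"
  have "lin_ext A \<phi> (\<lambda>x. f x + g x) = (\<Oplus>m\<in>?S. (f m + g m) \<odot> \<phi> m)"
    using assms by (intro lin_ext_superset) auto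
  also have "\<dots> = (\<Oplus>m\<in>?S. f m \<odot> \<phi> m \<oplus> g m \<odot> \<phi> m)"
    using assms by (intro add.finprod_cong') (auto simp: smult_add_left Pi_iff)
  also have "\<dots> = (\<Oplus>m\<in>?S. f m \<odot> \<phi> m) \<oplus> (\<Oplus>m\<in>?S. g m \<odot> \<phi> m)"
    using assms by (intro finsum_addf) (auto simp: Pi_iff)
  also have "\<dots> = lin_ext A \<phi> f \<oplus> lin_ext A \<phi> g"
    using assms by (simp add: lin_ext_superset[of ?S f \<phi>] lin_ext_superset[of ?S g \<phi>])
  finally show ?thesis .
qed

lemma lin_ext_smult:
  assumes "finite {m. f m \<noteq> 0}" "\<phi> \<in> {m. f m \<noteq> 0} \<rightarrow> carrier A"
  shows "lin_ext A \<phi> (\<lambda>x. c * f x) = c \<odot> lin_ext A \<phi> f"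
proof -
  let ?S = "{m. f m \<noteq> 0}"
  have "lin_ext A \<phi> (\<lambda>x. c * f x) = (\<Oplus>m\<in>?S. (c * f m) \<odot> \<phi> m)"
    using assms by (intro lin_ext_superset) auto
  also have "\<dots> = (\<Oplus>m\<in>?S. c \<odot> (f m \<odot> \<phi> m))"
    using assms by (intro add.finprod_cong') (auto simp: smult_smult Pi_iff)
  also have "\<dots> = c \<odot> lin_ext A \<phi> f"
    unfolding lin_ext_def using assms by (intro smult_finsum[symmetric]) auto
  finally show ?thesis .
qed

lemma lin_ext_zero [simp]: "lin_ext A \<phi> (\<lambda>_. 0) = \<zero>"
  by (simp add: lin_ext_def)

lemma lin_ext_single [simp]: "\<phi> m \<in> carrier A \<Longrightarrow> lin_ext A \<phi> (single m) = \<phi> m"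
  using lin_ext_superset[of "{m}" "single m" \<phi>] by (auto simp: single_def)

text \<open>The universal property of a monoid algebra. Multiplicativity is bilinear, so it is shown
  for \<open>single m\<close> on the left of an arbitrary element and then extended in the left
  factor.\<close>

lemma lin_ext_alg_hom:
  fixes M :: "('m, 'w) monoid_scheme"
  assumes "monoid M" and \<phi>: "\<phi> \<in> carrier M \<rightarrow> carrier A"
    and one: "\<phi> \<one>\<^bsub>M\<^esub> = \<one>"
    and mult: "\<And>x y. x \<in> carrier M \<Longrightarrow> y \<in> carrier M \<Longrightarrow> \<phi> (x \<otimes>\<^bsub>M\<^esub> y) = \<phi> x \<otimes> \<phi> y"
  shows "lin_ext A \<phi> \<in> alg_hom (monoid_algebra M) A"
proof -
  let ?M = "monoid_algebra M :: ('k, 'm \<Rightarrow> 'k) module"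
  interpret M: monoid M by fact
  interpret M: unital_algebra ?M by (rule M.unital_algebra_monoid_algebra)
  have closed: "lin_ext A \<phi> f \<in> carrier A" if "f \<in> carrier ?M" for f
    using finite_supports[OF that] \<phi> by (intro lin_ext_closed) auto
  have addh: "lin_ext A \<phi> (f \<oplus>\<^bsub>?M\<^esub> g) = lin_ext A \<phi> f \<oplus> lin_ext A \<phi> g"
    if "f \<in> carrier ?M" "g \<in> carrier ?M" for f g
    unfolding monoid_algebra_simps
    using finite_supports[OF that(1)] finite_supports[OF that(2)] \<phi> by (intro lin_ext_add) auto
  have sm: "lin_ext A \<phi> (c \<odot>\<^bsub>?M\<^esub> f) = c \<odot> lin_ext A \<phi> f" if "f \<in> carrier ?M" for f c
    unfolding monoid_algebra_simps
    using finite_supports[OF that] \<phi> by (intro lin_ext_smult) auto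
  have step: "(\<lambda>x. c * single m x + f x) = c \<odot>\<^bsub>?M\<^esub> single m \<oplus>\<^bsub>?M\<^esub> f" for c m f
    by (simp add: monoid_algebra_simps)
  have sing: "lin_ext A \<phi> (single m \<otimes>\<^bsub>?M\<^esub> f) = \<phi> m \<otimes> lin_ext A \<phi> f"
    if "m \<in> carrier M" "f \<in> carrier ?M" for m f
    using that(2)
  proof (induction rule: monoid_algebra_induct)
    case zero
    have "single m \<otimes>\<^bsub>?M\<^esub> (\<lambda>_. 0) = (\<lambda>_. 0)"
      using that(1) M.r_null[of "single m"] by (simp add: monoid_algebra_simps(3))
    then show ?case using that(1) \<phi> by (simp add: Pi_iff)
  next
    case (add c k f)
    have c: "\<phi> m \<in> carrier A" "\<phi> k \<in> carrier A" "\<phi> (m \<otimes>\<^bsub>M\<^esub> k) \<in> carrier A"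
      using that(1) add \<phi> by auto
    show ?case
      unfolding step using that(1) add closed c
      by (simp add: M.r_distr M.smult_mult_right addh
          sm single_mult mult r_distr smult_mult_right)
  qed
  have m: "lin_ext A \<phi> (f \<otimes>\<^bsub>?M\<^esub> g) = lin_ext A \<phi> f \<otimes> lin_ext A \<phi> g"
    if f: "f \<in> carrier ?M" and g: "g \<in> carrier ?M" for f g
    using f
  proof (induction rule: monoid_algebra_induct)
    case zero
    have "(\<lambda>_. 0) \<otimes>\<^bsub>?M\<^esub> g = (\<lambda>_. 0)"
      using g M.l_null[of g] by (simp add: monoid_algebra_simps(3))
    then show ?case using closed[OF g] by simp
  next
    case (add c k f)
    have c: "\<phi> k \<in> carrier A" using add \<phi> by auto
    show ?case
      unfolding step using g add closed c
      by (simp add: M.l_distr M.smult_mult_left addh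
          sm sing l_distr smult_mult_left)
  qed
  have "lin_ext A \<phi> \<one>\<^bsub>?M\<^esub> = \<one>"
    using lin_ext_single[of \<phi> "\<one>\<^bsub>M\<^esub>"] by (simp add: monoid_algebra_simps one)
  then show ?thesis
    unfolding alg_hom_def by (auto intro!: ring_hom_memI closed addh m sm)
qed

end

section \<open>Free algebras and quotient algebras\<close>

lemma monoid_word_monoid: "monoid (word_monoid X)"
  by (rule monoidI) (auto simp: word_monoid_def)

lemma word_monoid_simps [simp]:
  "carrier (word_monoid X) = lists X" "u \<otimes>\<^bsub>word_monoid X\<^esub> v = u @ v" "\<one>\<^bsub>word_monoid X\<^esub> = []"
  by (simp_all add: word_monoid_def)

lemma unital_algebra_free_algebra: "unital_algebra (free_algebra X)"
  unfolding free_algebra_def by (rule monoid.unital_algebra_monoid_algebra[OF monoid_word_monoid])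

lemma free_algebra_simps:
  "\<one>\<^bsub>free_algebra X\<^esub> = single []"
  "\<zero>\<^bsub>free_algebra X\<^esub> = (\<lambda>_. 0)"
  "f \<oplus>\<^bsub>free_algebra X\<^esub> g = (\<lambda>x. f x + g x)"
  "c \<odot>\<^bsub>free_algebra X\<^esub> f = (\<lambda>x. c * f x)"
  "single u \<otimes>\<^bsub>free_algebra X\<^esub> single v = single (u @ v)"
  by (simp_all add: free_algebra_def monoid_algebra_simps single_mult)

lemma single_free_algebra [simp]: "w \<in> lists X \<Longrightarrow> single w \<in> carrier (free_algebra X)"
  by (simp add: free_algebra_def)

definition word_prod :: "('k, 'a, 'z) module_scheme \<Rightarrow> ('x \<Rightarrow> 'a) \<Rightarrow> 'x list \<Rightarrow> 'a" where
  "word_prod A g w = foldr (\<lambda>x y. g x \<otimes>\<^bsub>A\<^esub> y) w \<one>\<^bsub>A\<^esub>"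

lemma word_prod_simps [simp]:
  "word_prod A g [] = \<one>\<^bsub>A\<^esub>" "word_prod A g (x # w) = g x \<otimes>\<^bsub>A\<^esub> word_prod A g w"
  by (simp_all add: word_prod_def)

lemma word_prod_hom:
  assumes "ring A" "h \<in> ring_hom A B" "w \<in> lists X" "g \<in> X \<rightarrow> carrier A"
  shows "word_prod A g w \<in> carrier A" and "h (word_prod A g w) = word_prod B (\<lambda>x. h (g x)) w"
proof -
  interpret ring A by fact
  show "word_prod A g w \<in> carrier A"
    using assms(3,4) by (induction w) auto
  then have "word_prod A g w \<in> carrier A \<and> h (word_prod A g w) = word_prod B (\<lambda>x. h (g x)) w"
    using assms(3)
  proof (induction w)
    case Nil
    then show ?case using assms(2) by (simp add: ring_hom_one)
  next
    case (Cons a w)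
    have "word_prod A g w \<in> carrier A" using Cons(3) assms(4) by (induction w) auto
    then show ?case using Cons assms by (auto simp: ring_hom_mult Pi_iff)
  qed
  then show "h (word_prod A g w) = word_prod B (\<lambda>x. h (g x)) w" by blast
qed

context unital_algebra begin

lemma word_prod_closed: "g \<in> X \<rightarrow> carrier A \<Longrightarrow> w \<in> lists X \<Longrightarrow> word_prod A g w \<in> carrier A"
  by (induction w) auto

lemma word_prod_append:
  "g \<in> X \<rightarrow> carrier A \<Longrightarrow> u \<in> lists X \<Longrightarrow> v \<in> lists X \<Longrightarrow>
    word_prod A g (u @ v) = word_prod A g u \<otimes> word_prod A g v"
  by (induction u) (auto simp: word_prod_closed m_assoc Pi_iff)

lemma free_ext_alg_hom:
  assumes "g \<in> X \<rightarrow> carrier A"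
  shows "lin_ext A (word_prod A g) \<in> alg_hom (free_algebra X) A"
  unfolding free_algebra_def using assms
  by (intro lin_ext_alg_hom monoid_word_monoid)
    (auto simp: word_prod_append intro: word_prod_closed)

lemma free_ext_single [simp]:
  "g \<in> X \<rightarrow> carrier A \<Longrightarrow> w \<in> lists X \<Longrightarrow> lin_ext A (word_prod A g) (single w) = word_prod A g w"
  by (rule lin_ext_single) (rule word_prod_closed)

lemma ideal_rel_ideal:
  assumes "\<And>x y. (x, y) \<in> Rel \<Longrightarrow> x \<in> carrier A \<and> y \<in> carrier A"
  shows "ideal (rel_ideal A Rel) A"
    and "(x, y) \<in> Rel \<Longrightarrow> x \<ominus> y \<in> rel_ideal A Rel"
proof -
  let ?G = "{x \<ominus> y | x y. (x, y) \<in> Rel}"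
  have G: "?G \<subseteq> carrier A" using assms by auto
  then show "ideal (rel_ideal A Rel) A" unfolding rel_ideal_def by (rule genideal_ideal)
  show "x \<ominus> y \<in> rel_ideal A Rel" if "(x, y) \<in> Rel"
    unfolding rel_ideal_def using genideal_self[OF G] that by blast
qed

text \<open>The kernel is an ideal, so a map descends to a presented algebra as soon as it
  identifies the two sides of each relation.\<close>

lemma rel_ideal_minimal:
  assumes "ring B" "h \<in> ring_hom A B"
    and "\<And>x y. (x, y) \<in> Rel \<Longrightarrow> x \<in> carrier A \<and> y \<in> carrier A \<and> h x = h y"
  shows "rel_ideal A Rel \<subseteq> a_kernel A B h"
proof -
  interpret h: ring_hom_ring A B h
    using assms by (intro ring_hom_ringI2) (auto intro: ring_axioms)
  have "x \<ominus> y \<in> a_kernel A B h" if "(x, y) \<in> Rel" for x y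
  proof -
    have c: "x \<in> carrier A" "y \<in> carrier A" and e: "h x = h y"
      using assms(3)[OF that] by blast+
    have "h (x \<ominus> y) = h x \<ominus>\<^bsub>B\<^esub> h y"
      by (rule ring_hom_zero_minus(3)[OF ring_axioms assms(1,2) c])
    also have "\<dots> = \<zero>\<^bsub>B\<^esub>"
      unfolding e a_minus_def by (rule h.S.r_neg[OF h.hom_closed[OF c(2)]])
    finally show ?thesis using minus_closed[OF c] unfolding a_kernel_def' by blast
  qed
  then show ?thesis
    unfolding rel_ideal_def by (intro genideal_minimal[OF h.kernel_is_ideal]) blast
qed

end

lemma as_algebra_simps [simp]:
  "carrier (as_algebra R s) = carrier R" "\<one>\<^bsub>as_algebra R s\<^esub> = \<one>\<^bsub>R\<^esub>" "\<zero>\<^bsub>as_algebra R s\<^esub> = \<zero>\<^bsub>R\<^esub>"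
  "x \<oplus>\<^bsub>as_algebra R s\<^esub> y = x \<oplus>\<^bsub>R\<^esub> y" "x \<otimes>\<^bsub>as_algebra R s\<^esub> y = x \<otimes>\<^bsub>R\<^esub> y"
  "c \<odot>\<^bsub>as_algebra R s\<^esub> x = s c x"
  by (simp_all add: as_algebra_def)

lemma ring_as_algebra:
  assumes "ring R" shows "ring (as_algebra R s)"
proof -
  interpret ring R by fact
  show ?thesis
  proof (intro ringI abelian_groupI monoidI, unfold as_algebra_simps)
    fix x assume "x \<in> carrier R"
    then show "\<exists>y\<in>carrier R. y \<oplus>\<^bsub>R\<^esub> x = \<zero>\<^bsub>R\<^esub>"
      using l_neg[of x] by auto
  qed (auto simp: l_distr r_distr m_assoc a_assoc intro: a_comm)
qed

lemma ring_hom_as_algebra: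
  "ring_hom A (as_algebra R s) = ring_hom A R" "ring_hom (as_algebra R s) B = ring_hom R B"
  by (simp_all add: ring_hom_def)

text \<open>The scalar multiple of a coset is defined as a union over its elements. It is a single
  coset because an ideal absorbs scalars, by c i = (c 1) i.\<close>

lemma (in unital_algebra) quot_alg:
  assumes "ideal I A"
  shows quot_smult: "x \<in> carrier A \<Longrightarrow> c \<odot>\<^bsub>quot_alg A I\<^esub> (I +> x) = I +> (c \<odot> x)"
    and quot_hom: "(+>) I \<in> alg_hom A (quot_alg A I)"
    and quot_carrier: "carrier (quot_alg A I) = (+>) I ` carrier A"
    and quot_eq: "x \<in> carrier A \<Longrightarrow> y \<in> carrier A \<Longrightarrow> I +> x = I +> y \<longleftrightarrow> x \<ominus> y \<in> I"
    and unital_algebra_quot_alg: "unital_algebra (quot_alg A I)"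
proof -
  interpret I: ideal I A by fact
  have eq: "I +> x = I +> y \<longleftrightarrow> x \<ominus> y \<in> I" if "x \<in> carrier A" "y \<in> carrier A" for x y
    using quotient_eq_iff_same_a_r_cos[OF assms that] by blast
  show "x \<in> carrier A \<Longrightarrow> y \<in> carrier A \<Longrightarrow> I +> x = I +> y \<longleftrightarrow> x \<ominus> y \<in> I" by (rule eq)
  have Iscale: "c \<odot> i \<in> I" if "i \<in> I" for i c
  proof -
    have "(c \<odot> \<one>) \<otimes> i \<in> I" using that by (intro I.I_l_closed) auto
    then show ?thesis using that I.Icarr by (simp add: smult_mult_left)
  qed
  show sm: "c \<odot>\<^bsub>quot_alg A I\<^esub> (I +> x) = I +> (c \<odot> x)" if x: "x \<in> carrier A" for c x
  proof -
    have "I +> (c \<odot> y) = I +> (c \<odot> x)" if "y \<in> I +> x" for y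
    proof -
      have y: "y \<in> carrier A" using that x I.a_elemrcos_carrier by blast
      have "I +> y = I +> x" using I.a_repr_independence'[OF that x] by simp
      then have "y \<ominus> x \<in> I" using eq x y by blast
      then have "c \<odot> (y \<ominus> x) \<in> I" by (rule Iscale)
      then show ?thesis using x y by (simp add: eq smult_minus_right)
    qed
    moreover have "x \<in> I +> x" using x I.a_rcos_self by blast
    ultimately show ?thesis unfolding quot_alg_def as_algebra_simps by blast
  qed
  show car: "carrier (quot_alg A I) = (+>) I ` carrier A"
    by (auto simp: quot_alg_def FactRing_def A_RCOSETS_def')
  have rh: "(+>) I \<in> ring_hom A (quot_alg A I)"
    unfolding quot_alg_def ring_hom_as_algebra by (rule I.rcos_ring_hom)
  show h: "(+>) I \<in> alg_hom A (quot_alg A I)"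
    unfolding alg_hom_def using rh sm by auto
  have R: "ring (quot_alg A I)"
    unfolding quot_alg_def by (intro ring_as_algebra I.quotient_is_ring)
  note hh = ring_hom_add[OF rh, symmetric] ring_hom_mult[OF rh, symmetric]
  show "unital_algebra (quot_alg A I)"
    by (intro unital_algebra.intro R unital_algebra_axioms.intro)
      (auto simp: car sm hh smult_add_left smult_add_right smult_smult smult_mult_left smult_mult_right)
qed

text \<open>The lift chooses a representative of each coset; two choices differ by an element of
  \<open>I\<close>, which \<open>h\<close> kills.\<close>

lemma quot_alg_lift:
  assumes "unital_algebra A" "unital_algebra B" "ideal I A" "h \<in> alg_hom A B" "I \<subseteq> a_kernel A B h"
  shows "\<exists>g\<in>alg_hom (quot_alg A I) B. \<forall>x\<in>carrier A. g (I +>\<^bsub>A\<^esub> x) = h x"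
proof -
  interpret A: unital_algebra A by fact
  interpret B: unital_algebra B by fact
  interpret I: ideal I A by fact
  note q = A.quot_alg[OF assms(3)]
  define g where "g X = h (SOME x. x \<in> carrier A \<and> I +>\<^bsub>A\<^esub> x = X)" for X
  have g: "g (I +>\<^bsub>A\<^esub> x) = h x" if x: "x \<in> carrier A" for x
  proof -
    define y where "y = (SOME y. y \<in> carrier A \<and> I +>\<^bsub>A\<^esub> y = I +>\<^bsub>A\<^esub> x)"
    have y: "y \<in> carrier A" "I +>\<^bsub>A\<^esub> y = I +>\<^bsub>A\<^esub> x"
      unfolding y_def using someI[of "\<lambda>y. y \<in> carrier A \<and> I +>\<^bsub>A\<^esub> y = I +>\<^bsub>A\<^esub> x" x] x by auto
    then have "y \<ominus>\<^bsub>A\<^esub> x \<in> I" using q(4) x by blast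
    then have "h (y \<ominus>\<^bsub>A\<^esub> x) = \<zero>\<^bsub>B\<^esub>" using assms(5) by (auto simp: a_kernel_def')
    then have "h y \<ominus>\<^bsub>B\<^esub> h x = \<zero>\<^bsub>B\<^esub>"
      using ring_hom_zero_minus(3)[OF A.ring_axioms B.ring_axioms alg_homD(1)[OF assms(4)] y(1) x] by metis
    then have "h y = h x" using x y alg_homD(2)[OF assms(4)] by (simp add: B.minus_eq_zero_iff)
    then show ?thesis by (simp add: g_def y_def)
  qed
  note qh = alg_homD(3-6)[OF q(2), symmetric]
  have "g \<in> alg_hom (quot_alg A I) B"
    unfolding alg_hom_def
    by (auto intro!: ring_hom_memI simp: q(3) q(1) g qh alg_homD[OF assms(4)])
  then show ?thesis by (rule bexI[rotated]) (simp add: g)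
qed

section \<open>A solution of the braid relation\<close>

lemma qvar_nonzero [simp]: "qvar \<noteq> 0"
  by (simp add: qvar_def Zero_fract_def eq_fract)

text \<open>\<open>swap_coeff\<close>, \<open>keep_coeff\<close> and \<open>flip_coeff\<close> are
  the entries of an R-matrix of the queer superalgebra in braid form: a pair of indices is
  exchanged, kept, or reversed in both signs. The sign for two negative indices is that of
  exchanging two odd vectors.\<close>

definition swap_coeff :: "int \<Rightarrow> int \<Rightarrow> cq" where
  "swap_coeff a b = (if a < 0 \<and> b < 0 then - 1 else 1) *
     (if \<bar>a\<bar> = \<bar>b\<bar> then if 0 < b then qvar else inverse qvar else 1)"

text \<open>The guard makes 0 an inert letter, which every nonzero index passes with coefficient 1.
  Words are lists of arbitrary integers, and in this way the braid relation holds for all of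
  them.\<close>

definition keep_coeff :: "int \<Rightarrow> int \<Rightarrow> cq" where
  "keep_coeff a b = (if a \<noteq> 0 \<and> b < a then nu else 0)"

definition flip_coeff :: "int \<Rightarrow> int \<Rightarrow> cq" where
  "flip_coeff a b = (if a \<noteq> 0 \<and> a < - b then if a < 0 then nu else - nu else 0)"

text \<open>The braid operator in the first two of three places, as an operator on functions of
  triples; \<open>braid2\<close> acts in the last two. Since \<open>F\<close> is arbitrary, equality
  of values is equality of operators.\<close>

definition braid1 :: "(int \<Rightarrow> int \<Rightarrow> int \<Rightarrow> cq) \<Rightarrow> int \<Rightarrow> int \<Rightarrow> int \<Rightarrow> cq" where
  "braid1 F a b c = swap_coeff a b * F b a c + keep_coeff a b * F a b c + flip_coeff a b * F (- a) (- b) c"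

definition braid2 :: "(int \<Rightarrow> int \<Rightarrow> int \<Rightarrow> cq) \<Rightarrow> int \<Rightarrow> int \<Rightarrow> int \<Rightarrow> cq" where
  "braid2 F a b c = swap_coeff b c * F a c b + keep_coeff b c * F a b c + flip_coeff b c * F a (- b) (- c)"

text \<open>The coefficients depend only on the signs and on the order of the absolute values. Three
  distinct absolute values leave six arrangements with eight sign patterns each, and in these the
  identity holds with \<open>nu\<close> as a free parameter.\<close>

lemma braid_relation_pos3:
  fixes p r s :: int
  assumes "0 < p" "p < r" "r < s" "e \<in> {1, - 1}" "e' \<in> {1, - 1}" "e'' \<in> {1, - 1}"
    "(a, b, c) \<in> {(e * p, e' * r, e'' * s), (e * p, e' * s, e'' * r), (e * r, e' * p, e'' * s),
      (e * r, e' * s, e'' * p), (e * s, e' * p, e'' * r), (e * s, e' * r, e'' * p)}"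
  shows "braid2 (braid1 (braid2 F)) a b c = braid1 (braid2 (braid1 F)) a b c"
proof -
  have facts: "0 < r" "0 < s" "p < s" "\<not> r < p" "\<not> s < r" "\<not> s < p" "p \<noteq> r" "r \<noteq> p" "p \<noteq> s" "s \<noteq> p" "r \<noteq> s" "s \<noteq> r"
    "- p < r" "- p < s" "- r < p" "- r < s" "- s < p" "- s < r" "- p < p" "- r < r" "- s < s"
    "\<not> p < - r" "\<not> p < - s" "\<not> r < - p" "\<not> r < - s" "\<not> s < - p" "\<not> s < - r" "\<not> p < - p" "\<not> r < - r" "\<not> s < - s"
    "p \<noteq> 0" "r \<noteq> 0" "s \<noteq> 0" "\<not> p < 0" "\<not> r < 0" "\<not> s < 0" "\<bar>p\<bar> = p" "\<bar>r\<bar> = r" "\<bar>s\<bar> = s"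
    using assms(1-3) by linarith+
  show ?thesis
    using assms(4-7)
    by (elim insertE emptyE; simp only: prod.inject; elim conjE; hypsubst;
        simp add: braid1_def braid2_def swap_coeff_def keep_coeff_def flip_coeff_def assms(1-3) facts;
        simp add: algebra_simps)
qed

text \<open>When absolute values coincide, \<open>swap_coeff\<close> contributes q or its inverse,
  and the identity rests on nu = q - 1/q.\<close>

lemma braid_relation_pos2:
  fixes p r :: int
  assumes "0 < p" "p < r" "e \<in> {1, - 1}" "e' \<in> {1, - 1}" "e'' \<in> {1, - 1}"
    "(a, b, c) \<in> {(e * p, e' * p, e'' * r), (e * p, e' * r, e'' * p), (e * r, e' * p, e'' * p),
      (e * p, e' * r, e'' * r), (e * r, e' * p, e'' * r), (e * r, e' * r, e'' * p), (e * p, e' * p, e'' * p)}"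
  shows "braid2 (braid1 (braid2 F)) a b c = braid1 (braid2 (braid1 F)) a b c"
proof -
  have facts: "0 < r" "\<not> r < p" "p \<noteq> r" "r \<noteq> p" "- p < r" "- r < p" "- p < p" "- r < r"
    "\<not> p < - r" "\<not> r < - p" "\<not> p < - p" "\<not> r < - r"
    "p \<noteq> 0" "r \<noteq> 0" "\<not> p < 0" "\<not> r < 0" "\<bar>p\<bar> = p" "\<bar>r\<bar> = r"
    using assms(1,2) by linarith+
  show ?thesis
    using assms(3-6)
    by (elim insertE emptyE; simp only: prod.inject; elim conjE; hypsubst;
        simp add: braid1_def braid2_def swap_coeff_def keep_coeff_def flip_coeff_def assms(1,2) facts;
        simp add: nu_def field_simps)
qed

lemma braid_zero:
  "b \<noteq> 0 \<Longrightarrow> braid1 F 0 b c = F b 0 c" "c \<noteq> 0 \<Longrightarrow> braid2 F b 0 c = F b c 0"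
  by (simp_all add: braid1_def braid2_def swap_coeff_def keep_coeff_def flip_coeff_def)

text \<open>The entries are split into sign and absolute value, and the absolute values fall into
  one of the thirteen weak orders of three elements. Only the letter \<open>a\<close> may be 0; it
  is then moved through unchanged by \<open>braid_zero\<close>.\<close>

lemma braid_relation:
  assumes "b \<noteq> 0" "c \<noteq> 0"
  shows "braid2 (braid1 (braid2 F)) a b c = braid1 (braid2 (braid1 F)) a b c"
proof (cases "a = 0")
  case True
  have "braid2 (braid1 (braid2 F)) 0 b c = braid1 (braid2 (braid1 F)) 0 b c"
    using assms by (simp add: braid2_def[of "braid1 (braid2 F)"] braid_zero) (simp add: braid1_def)
  with True show ?thesis by simp
next
  case False
  have dec: "sgn x * \<bar>x\<bar> = x" "x \<noteq> 0 \<Longrightarrow> sgn x \<in> {1, - 1}" "x \<noteq> 0 \<Longrightarrow> 0 < \<bar>x\<bar>" for x :: int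
    by (simp_all add: sgn_mult_abs sgn_if)
  note s = dec(2)[OF False] dec(2)[OF assms(1)] dec(2)[OF assms(2)]
  define p r t where "p = \<bar>a\<bar>" and "r = \<bar>b\<bar>" and "t = \<bar>c\<bar>"
  have z: "0 < p" "0 < r" "0 < t"
    using False assms by (simp_all add: p_def r_def t_def)
  have "braid2 (braid1 (braid2 F)) (sgn a * p) (sgn b * r) (sgn c * t)
      = braid1 (braid2 (braid1 F)) (sgn a * p) (sgn b * r) (sgn c * t)"
  proof -
    have "(p < r \<and> r < t) \<or> (p < t \<and> t < r) \<or> (r < p \<and> p < t) \<or> (r < t \<and> t < p) \<or> (t < p \<and> p < r) \<or> (t < r \<and> r < p) \<or> (p = r \<and> p < t) \<or> (p = r \<and> t < p) \<or> (p = t \<and> p < r) \<or> (p = t \<and> r < p) \<or> (r = t \<and> p < r) \<or> (r = t \<and> r < p) \<or> (p = r \<and> r = t)"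
      using linorder_less_linear[of p r] linorder_less_linear[of r t] linorder_less_linear[of p t]
      by (elim disjE; (simp; fail | rule FalseE, linarith))
    then consider "p < r" "r < t" | "p < t" "t < r" | "r < p" "p < t" | "r < t" "t < p" | "t < p" "p < r" | "t < r" "r < p" | "p = r" "p < t" | "p = r" "t < p" | "p = t" "p < r" | "p = t" "r < p" | "r = t" "p < r" | "r = t" "r < p" | "p = r" "r = t"
      by (elim disjE conjE) (rule that; assumption)+
    then show ?thesis
    proof cases
      case 1 show ?thesis by (rule braid_relation_pos3[OF z(1) 1 s(1,2,3)]) blast
    next
      case 2 show ?thesis by (rule braid_relation_pos3[OF z(1) 2 s(1,2,3)]) blast
    next
      case 3 show ?thesis by (rule braid_relation_pos3[OF z(2) 3 s(1,2,3)]) blast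
    next
      case 4 show ?thesis by (rule braid_relation_pos3[OF z(2) 4 s(1,2,3)]) blast
    next
      case 5 show ?thesis by (rule braid_relation_pos3[OF z(3) 5 s(1,2,3)]) blast
    next
      case 6 show ?thesis by (rule braid_relation_pos3[OF z(3) 6 s(1,2,3)]) blast
    next
      case 7 show ?thesis by (rule braid_relation_pos2[OF z(1) 7(2) s(1,2,3)]) (unfold 7(1), blast)
    next
      case 8 show ?thesis by (rule braid_relation_pos2[OF z(3) 8(2) s(1,2,3)]) (unfold 8(1), blast)
    next
      case 9 show ?thesis by (rule braid_relation_pos2[OF z(1) 9(2) s(1,2,3)]) (unfold 9(1), blast)
    next
      case 10 show ?thesis by (rule braid_relation_pos2[OF z(2) 10(2) s(1,2,3)]) (unfold 10(1), blast)
    next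
      case 11 show ?thesis by (rule braid_relation_pos2[OF z(1) 11(2) s(1,2,3)]) (unfold 11(1), blast)
    next
      case 12 show ?thesis by (rule braid_relation_pos2[OF z(2) 12(2) s(1,2,3)]) (unfold 12(1), blast)
    next
      case 13
      \<comment> \<open>All three absolute values agree; \<open>p + 1\<close> merely fills the place
        of the larger value.\<close>
      have "p < p + 1" by simp
      then show ?thesis by (rule braid_relation_pos2[OF z(1) _ s(1,2,3)]) (unfold 13, blast)
    qed
  qed
  then show ?thesis unfolding p_def r_def t_def dec(1) .
qed

section \<open>The action on words\<close>

text \<open>An entry of the monodromy matrix: the index enters on the left as \<open>i\<close> and
  leaves on the right as \<open>j\<close>. At each letter it either passes, trades places with the
  letter, or trades places with both signs reversed; \<open>f\<close> is evaluated at the word left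
  behind.\<close>

primrec braid_op :: "int list \<Rightarrow> int \<Rightarrow> int \<Rightarrow> (int list \<Rightarrow> cq) \<Rightarrow> cq" where
  "braid_op [] i j f = (if i = j then f [] else 0)"
| "braid_op (x # w) i j f =
    swap_coeff x i * braid_op w i j (\<lambda>u. f (x # u))
    + keep_coeff x i * braid_op w x j (\<lambda>u. f (i # u))
    + flip_coeff x i * braid_op w (- x) j (\<lambda>u. f ((- i) # u))"

lemma braid_op_add: "braid_op w i j (\<lambda>u. f u + g u) = braid_op w i j f + braid_op w i j g"
  by (induction w arbitrary: i f g) (simp_all add: distrib_left)

lemma braid_op_smult: "braid_op w i j (\<lambda>u. c * f u) = c * braid_op w i j f"
  by (induction w arbitrary: i f) (simp_all add: algebra_simps)

text \<open>The travelling index never decreases: a nonzero \<open>keep_coeff x i\<close> replaces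
  \<open>i\<close> by x > i, and a nonzero \<open>flip_coeff x i\<close> replaces it by - x >
  i.\<close>

lemma braid_op_triangular: "j < i \<Longrightarrow> braid_op w i j f = 0"
  by (induction w arbitrary: i f) (auto simp: keep_coeff_def flip_coeff_def)

lemma braid_op_diag:
  "braid_op w i i f = prod_list (map (\<lambda>x. swap_coeff x i) w) * f w"
proof (induction w arbitrary: f)
  case (Cons x w)
  have *: "keep_coeff x i * braid_op w x i g = 0" "flip_coeff x i * braid_op w (- x) i g = 0" for g
    by (auto simp: keep_coeff_def flip_coeff_def braid_op_triangular)
  show ?case unfolding braid_op.simps * by (simp add: Cons)
qed simp

lemma braid_op_braid2:
  "braid_op w m c (\<lambda>u. braid_op (y # u) k d f) =
    swap_coeff y k * braid_op w m c (\<lambda>u. braid_op u k d (\<lambda>v. f (y # v)))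
    + keep_coeff y k * braid_op w m c (\<lambda>u. braid_op u y d (\<lambda>v. f (k # v)))
    + flip_coeff y k * braid_op w m c (\<lambda>u. braid_op u (- y) d (\<lambda>v. f ((- k) # v)))"
  by (simp add: braid_op_add braid_op_smult)

text \<open>The word is carried through the two auxiliary indices letter by letter; each step is the
  braid relation.\<close>

lemma braid_op_exchange:
  assumes "i \<noteq> 0" "k \<noteq> 0"
  shows "swap_coeff i k * braid_op w k c (\<lambda>u. braid_op u i d f)
      + keep_coeff i k * braid_op w i c (\<lambda>u. braid_op u k d f)
      + flip_coeff i k * braid_op w (- i) c (\<lambda>u. braid_op u (- k) d f)
    = swap_coeff d c * braid_op w i d (\<lambda>u. braid_op u k c f)
      + keep_coeff c d * braid_op w i c (\<lambda>u. braid_op u k d f)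
      + flip_coeff (- c) (- d) * braid_op w i (- c) (\<lambda>u. braid_op u k (- d) f)"
  using assms
proof (induction w arbitrary: i k f)
  case Nil
  have "swap_coeff i k * braid_op [] k c (\<lambda>u. braid_op u i d f)
      = swap_coeff d c * braid_op [] i d (\<lambda>u. braid_op u k c f)"
    "keep_coeff i k * braid_op [] i c (\<lambda>u. braid_op u k d f)
      = keep_coeff c d * braid_op [] i c (\<lambda>u. braid_op u k d f)"
    "flip_coeff i k * braid_op [] (- i) c (\<lambda>u. braid_op u (- k) d f)
      = flip_coeff (- c) (- d) * braid_op [] i (- c) (\<lambda>u. braid_op u k (- d) f)"
    by auto
  then show ?case by (simp only:)
next
  case (Cons x w)
  \<comment> \<open>A triple consists of two auxiliary indices and one letter. Passing the letter
    \<open>x\<close> through both indices is \<open>braid1 (braid2 _)\<close> at the triple (x, i',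
    k'), and \<open>G\<close> is what the rest of the word contributes once the letter
    \<open>y\<close> has come out last.\<close>
  define G where "G c d m r y = braid_op w m c (\<lambda>u. braid_op u r d (\<lambda>v. f (y # v)))" for c d m r y
  have two: "braid_op (x # w) i' c (\<lambda>u. braid_op u k' d f) = braid1 (braid2 (G c d)) x i' k'"
    for i' k' c d
    unfolding braid_op.simps(2)[of x w] braid_op_braid2
    by (simp add: braid1_def braid2_def G_def)
  define H where "H m r y = swap_coeff d c * G d c m r y + keep_coeff c d * G c d m r y
      + flip_coeff (- c) (- d) * G (- c) (- d) m r y" for m r y
  have IH: "braid1 (G c d) m r y = H m r y" if "m \<noteq> 0" "r \<noteq> 0" for m r y
    unfolding braid1_def H_def G_def by (rule Cons.IH[OF that])
  have "braid2 (braid1 (braid2 (G c d))) x i k = braid1 (braid2 (braid1 (G c d))) x i k"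
    by (rule braid_relation) (use Cons.prems in auto)
  also have "\<dots> = braid1 (braid2 H) x i k"
  \<comment> \<open>The induction hypothesis asks for nonzero indices. An inert letter 0 stays a
    letter, so that only \<open>i\<close> and \<open>k\<close> serve as indices; otherwise the
    indices are among the nonzero numbers obtained from x, i, k by changing signs.\<close>
  proof (cases "x = 0")
    case True
    then show ?thesis using Cons.prems by (simp add: braid_zero IH)
  next
    case False
    then show ?thesis
      using Cons.prems by (simp add: IH braid1_def[of "braid2 F" for F] braid2_def)
  qed
  also have "\<dots> = swap_coeff d c * braid1 (braid2 (G d c)) x i k
      + keep_coeff c d * braid1 (braid2 (G c d)) x i k
      + flip_coeff (- c) (- d) * braid1 (braid2 (G (- c) (- d))) x i k"
    by (simp add: braid1_def braid2_def H_def algebra_simps)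
  finally show ?case
    unfolding two braid2_def[of "braid1 F" for F] .
qed

text \<open>The parity of a word, negative letters being odd.\<close>

primrec word_sign :: "int list \<Rightarrow> 'k::comm_ring_1" where
  "word_sign [] = 1"
| "word_sign (x # w) = (if x < 0 then - 1 else 1) * word_sign w"

lemma word_sign_cases: "word_sign w = (1 :: 'k::comm_ring_1) \<or> word_sign w = (- 1 :: 'k)"
  by (induction w) auto

lemma word_sign_square [simp]: "word_sign w * word_sign w = (1 :: 'k::comm_ring_1)"
  using word_sign_cases[of w, where 'k = 'k] by auto

text \<open>Each elementary step preserves the joint parity of letter and index, so the parity of
  the word changes exactly when the index changes its sign.\<close>

lemma braid_op_word_sign:
  assumes "i \<noteq> 0"
  shows "braid_op w i j (\<lambda>u. word_sign u * f u)
    = (if (i < 0) = (j < 0) then 1 else - 1) * word_sign w * braid_op w i j f"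
  using assms
proof (induction w arbitrary: i f)
  case (Cons x w)
  have *: "braid_op w k j (\<lambda>u. word_sign (y # u) * f (y # u)) =
      (if y < 0 then - 1 else 1) * ((if (k < 0) = (j < 0) then 1 else - 1) * word_sign w * braid_op w k j (\<lambda>u. f (y # u)))"
    if "k \<noteq> 0" for k y
    using Cons.IH[OF that, of "\<lambda>u. f (y # u)"] by (simp add: mult.assoc braid_op_smult)
  show ?case
  proof (cases "x = 0")
    case True
    then have k: "keep_coeff x i = 0" "flip_coeff x i = 0" "swap_coeff x i = 1"
      using Cons.prems by (simp_all add: keep_coeff_def flip_coeff_def swap_coeff_def)
    show ?thesis unfolding braid_op.simps(2) k unfolding *[OF Cons.prems] using True by simp
  next
    case False
    then have x: "(- x < 0) = (\<not> x < 0)" "(- i < 0) = (\<not> i < 0)" using Cons.prems by auto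
    show ?thesis
      unfolding braid_op.simps(2)
      unfolding *[OF Cons.prems] *[OF False] *[of "- x", unfolded neg_equal_0_iff_equal, OF False]
      unfolding x word_sign.simps
      by (cases "x < 0"; cases "i < 0"; cases "j < 0") (simp_all add: algebra_simps)
  qed
qed simp

text \<open>\<open>braid_op\<close> alone obeys an exchange relation with the signs of
  \<open>swap_coeff\<close>, each depending on one pair of starting or final indices. The parity
  operator for negative \<open>j\<close> turns them into the sign given by the product of the two
  parities, and it also makes the diagonal operators for i and - i mutually inverse.\<close>

definition L_op :: "int \<Rightarrow> int \<Rightarrow> (int list \<Rightarrow> cq) \<Rightarrow> int list \<Rightarrow> cq" where
  "L_op i j f w = (if j < 0 then word_sign w else 1) * braid_op w i j f"

lemma L_op_L_op:
  assumes "i \<noteq> 0"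
  shows "L_op i j (L_op k l f) w = (if j < 0 then word_sign w else 1) *
    (if l < 0 then (if (i < 0) = (j < 0) then 1 else - 1) * word_sign w else 1) *
    braid_op w i j (\<lambda>u. braid_op u k l f)"
  unfolding L_op_def using braid_op_word_sign[OF assms, of w j] by (simp add: mult.assoc)

lemma qvar_powi_phi:
  "qvar powi phi j l = (if \<bar>j\<bar> = \<bar>l\<bar> \<and> l \<noteq> 0 then if 0 < l then qvar else inverse qvar else 1)"
  by (auto simp: phi_def sgn_if power_int_def)

text \<open>This is \<open>braid_op_exchange\<close> with final indices c = l and d = j; what
  remains is to match coefficients and signs.\<close>

lemma L_op_relation:
  assumes nz: "i \<noteq> 0" "j \<noteq> 0" "k \<noteq> 0" "l \<noteq> 0" and ord: "i \<le> j" "k \<le> l"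
  shows "(- 1) ^ (par i j * par k l) * qvar powi phi j l * L_op i j (L_op k l f) w
      + of_bool (k \<le> j \<and> j < l) * of_int (theta i j k) * nu * L_op i l (L_op k j f) w
      + of_bool (i \<le> - l \<and> - l < j \<and> j \<le> - k) * of_int (theta (- i) (- j) k) * nu
          * L_op i (- l) (L_op k (- j) f) w
    = qvar powi phi i k * L_op k l (L_op i j f) w
      + of_bool (k < i \<and> i \<le> l) * of_int (theta i j k) * nu * L_op i l (L_op k j f) w
      + of_bool (- l \<le> i \<and> i < - k \<and> - k \<le> j) * of_int (theta (- i) (- j) k) * nu
          * L_op (- i) l (L_op (- k) j f) w"
proof -
  define B where "B i j k l = braid_op w i j (\<lambda>u. braid_op u k l f)" for i j k l
  have B0: "j < i \<Longrightarrow> B i j k l = 0" "l < k \<Longrightarrow> B i j k l = 0" for i j k l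
    using braid_op_smult[of w i j 0] unfolding B_def by (auto simp: braid_op_triangular)
  have ex: "swap_coeff i k * B k l i j + keep_coeff i k * B i l k j + flip_coeff i k * B (- i) l (- k) j
    = swap_coeff j l * B i j k l + keep_coeff l j * B i l k j + flip_coeff (- l) (- j) * B i (- l) k (- j)"
    unfolding B_def by (rule braid_op_exchange[OF nz(1,3)])
  \<comment> \<open>The conditions in the defining relations contain more inequalities than
    \<open>keep_coeff\<close> and \<open>flip_coeff\<close> do. The additional ones ask for ordered
    index pairs, and where they fail \<open>B\<close> vanishes by triangularity.\<close>
  have b1: "of_bool (k \<le> j \<and> j < l) * of_int t * nu * (s * B i l k j) = s * of_int t * (keep_coeff l j * B i l k j)"
    for s and t :: int
    using B0(1)[where i="i" and j="l" and k="k" and l="j"] B0(2)[where i="i" and j="l" and k="k" and l="j"] nz by (auto simp: keep_coeff_def)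
  have b2: "of_bool (k < i \<and> i \<le> l) * of_int t * nu * (s * B i l k j) = s * of_int t * (keep_coeff i k * B i l k j)"
    for s and t :: int
    using B0(1)[where i="i" and j="l" and k="k" and l="j"] B0(2)[where i="i" and j="l" and k="k" and l="j"] nz by (auto simp: keep_coeff_def)
  have z: "\<not> i \<le> - l \<Longrightarrow> B i (- l) k (- j) = 0" "\<not> j \<le> - k \<Longrightarrow> B i (- l) k (- j) = 0"
    "\<not> - l \<le> i \<Longrightarrow> B (- i) l (- k) j = 0" "\<not> - k \<le> j \<Longrightarrow> B (- i) l (- k) j = 0"
    by (rule B0(1), linarith) (rule B0(2), linarith, rule B0(1), linarith, rule B0(2), linarith)
  have b3: "of_bool (i \<le> - l \<and> - l < j \<and> j \<le> - k) * of_int t * nu * (s * B i (- l) k (- j))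
      = s * of_int t * ((if 0 < l then 1 else - 1) * flip_coeff (- l) (- j) * B i (- l) k (- j))"
    for s and t :: int
    using z(1,2) nz by (cases "i \<le> - l"; cases "j \<le> - k") (auto simp: flip_coeff_def)
  have b4: "of_bool (- l \<le> i \<and> i < - k \<and> - k \<le> j) * of_int t * nu * (s * B (- i) l (- k) j)
      = s * of_int t * ((if i < 0 then 1 else - 1) * flip_coeff i k * B (- i) l (- k) j)"
    for s and t :: int
    using z(3,4) nz by (cases "- l \<le> i"; cases "- k \<le> j") (auto simp: flip_coeff_def)
  have q: "qvar powi phi j l = (if j < 0 \<and> l < 0 then - 1 else 1) * swap_coeff j l"
    "qvar powi phi i k = (if i < 0 \<and> k < 0 then - 1 else 1) * swap_coeff i k"
    using nz by (auto simp: qvar_powi_phi swap_coeff_def)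
  have LL: "L_op i j (L_op k l f) w = ((if j < 0 then word_sign w else 1) *
    (if l < 0 then (if (i < 0) = (j < 0) then 1 else - 1) * word_sign w else 1)) * B i j k l"
    if "i \<noteq> 0" for i j k l
    using L_op_L_op[OF that] unfolding B_def by simp
  have ni: "- i \<noteq> 0" using nz by simp
  have neg: "(- a < 0) = (\<not> a < 0)" if "a \<noteq> 0" for a :: int using that by auto
  note negs = neg[OF nz(1)] neg[OF nz(2)] neg[OF nz(3)] neg[OF nz(4)]
  have par: "par a b = (if (a < 0) = (b < 0) then 0 else 1)" if "a \<noteq> 0" "b \<noteq> 0" for a b
    using that by (auto simp: par_def zero_less_mult_iff not_less)
  have th: "theta a b c = (if (a < 0 \<and> b < 0) \<or> (a < 0 \<and> c < 0) \<or> (b < 0 \<and> c < 0) then - 1 else 1)"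
    if "a \<noteq> 0" "b \<noteq> 0" "c \<noteq> 0" for a b c
    using that by (auto simp: theta_def sgn_if)
  have neg0: "- a \<noteq> 0" if "a \<noteq> 0" for a :: int using that by simp
  have pos: "(0 < l) = (\<not> l < 0)" using nz by auto
  have ex': "swap_coeff j l * B i j k l = swap_coeff i k * B k l i j + keep_coeff i k * B i l k j
      + flip_coeff i k * B (- i) l (- k) j - keep_coeff l j * B i l k j - flip_coeff (- l) (- j) * B i (- l) k (- j)"
    using ex by (simp add: algebra_simps)
  note signs = par[OF nz(1,2)] par[OF nz(3,4)] th[OF nz(1-3)] th[OF neg0[OF nz(1)] neg0[OF nz(2)] nz(3)] negs pos
  show ?thesis
    unfolding LL[OF nz(1)] LL[OF nz(3)] LL[OF ni] b1 b2 b3 b4 q signs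
    by (rule disjE[OF word_sign_cases[of w, where 'k = cq]];
        cases "i < 0"; cases "j < 0"; cases "k < 0"; cases "l < 0"; simp; simp add: ex' algebra_simps)
qed

text \<open>The powers of q picked up by i and by - i cancel letter by letter. The signs left over
  multiply to the parity of the word, which the factor in \<open>L_op\<close> removes.\<close>

lemma L_op_inverse:
  assumes "i \<noteq> 0"
  shows "L_op i i (L_op (- i) (- i) f) w = f w"
proof -
  have "prod_list (map (\<lambda>x. swap_coeff x i) w) * prod_list (map (\<lambda>x. swap_coeff x (- i)) w) = (word_sign w :: cq)"
    using assms by (induction w) (auto simp: swap_coeff_def algebra_simps)
  then have "braid_op w i i (\<lambda>u. braid_op u (- i) (- i) f) = word_sign w * f w"
    by (simp add: braid_op_diag mult.assoc[symmetric])
  then show ?thesis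
    using L_op_L_op[OF assms, of i "- i" "- i" f w] assms by (auto simp: mult.assoc[symmetric])
qed

section \<open>Evaluation at $q = 1$\<close>

definition ev1 :: "cq \<Rightarrow> complex" where
  "ev1 x = (THE c. \<exists>f g. x = Fract f g \<and> poly g 1 \<noteq> 0 \<and> c = poly f 1 / poly g 1)"

lemma A1_cases:
  assumes "x \<in> A1"
  obtains f g where "x = Fract f g" "g \<noteq> 0" "poly g 1 \<noteq> 0"
proof -
  obtain f g where fg: "x = Fract f g" "poly g 1 \<noteq> 0"
    using assms unfolding A1_def by blast
  then have "g \<noteq> 0" by auto
  with fg that show thesis by blast
qed

lemma Fract_in_A1 [intro]: "poly g 1 \<noteq> 0 \<Longrightarrow> Fract f g \<in> A1"
  unfolding A1_def by blast

lemma ev1_Fract: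
  assumes "poly g 1 \<noteq> 0"
  shows "ev1 (Fract f g) = poly f 1 / poly g 1"
  unfolding ev1_def
proof (rule the_equality)
  fix c assume "\<exists>f' g'. Fract f g = Fract f' g' \<and> poly g' 1 \<noteq> 0 \<and> c = poly f' 1 / poly g' 1"
  then obtain f' g' where *: "Fract f g = Fract f' g'" "poly g' 1 \<noteq> 0" "c = poly f' 1 / poly g' 1"
    by blast
  have "g \<noteq> 0" "g' \<noteq> 0" using assms *(2) by auto
  with *(1) have "f * g' = f' * g" by (simp add: eq_fract)
  then have "poly f 1 * poly g' 1 = poly f' 1 * poly g 1" by (metis poly_mult)
  also have "poly f' 1 = c * poly g' 1" using * by simp
  finally have "poly f 1 = c * poly g 1" using *(2) by simp
  then show "c = poly f 1 / poly g 1" using assms by simp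
qed (use assms in blast)

lemma A1_add: "x \<in> A1 \<Longrightarrow> y \<in> A1 \<Longrightarrow> x + y \<in> A1"
  and ev1_add: "x \<in> A1 \<Longrightarrow> y \<in> A1 \<Longrightarrow> ev1 (x + y) = ev1 x + ev1 y"
  and A1_mult: "x \<in> A1 \<Longrightarrow> y \<in> A1 \<Longrightarrow> x * y \<in> A1"
  and ev1_mult: "x \<in> A1 \<Longrightarrow> y \<in> A1 \<Longrightarrow> ev1 (x * y) = ev1 x * ev1 y"
  by (elim A1_cases; auto simp: ev1_Fract field_simps intro!: Fract_in_A1)+

lemma A1_uminus: "x \<in> A1 \<Longrightarrow> - x \<in> A1"
  and ev1_uminus: "x \<in> A1 \<Longrightarrow> ev1 (- x) = - ev1 x"
  by (elim A1_cases; auto simp: ev1_Fract)+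

lemma A1_const: "Fract [:c:] 1 \<in> A1" and ev1_const: "ev1 (Fract [:c:] 1) = c"
  by (auto simp: ev1_Fract)

lemma A1_0: "0 \<in> A1" and ev1_0: "ev1 0 = 0"
  using A1_const[of 0] ev1_const[of 0] by (simp_all add: Zero_fract_def)

lemma A1_1: "1 \<in> A1" and ev1_1: "ev1 1 = 1"
  using A1_const[of 1] ev1_const[of 1] by (simp_all add: One_fract_def one_pCons)

lemma A1_diff: "x \<in> A1 \<Longrightarrow> y \<in> A1 \<Longrightarrow> x - y \<in> A1"
  and ev1_diff: "x \<in> A1 \<Longrightarrow> y \<in> A1 \<Longrightarrow> ev1 (x - y) = ev1 x - ev1 y"
  using A1_add[of x "- y"] ev1_add[of x "- y"] by (simp_all add: A1_uminus ev1_uminus)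

lemma A1_inverse: "x \<in> A1 \<Longrightarrow> ev1 x \<noteq> 0 \<Longrightarrow> inverse x \<in> A1"
  and ev1_inverse: "x \<in> A1 \<Longrightarrow> ev1 x \<noteq> 0 \<Longrightarrow> ev1 (inverse x) = inverse (ev1 x)"
  by (elim A1_cases; auto simp: ev1_Fract intro!: Fract_in_A1)+

lemma A1_qvar: "qvar \<in> A1" and ev1_qvar: "ev1 qvar = 1"
  by (auto simp: qvar_def ev1_Fract)

lemmas A1_closed = A1_add A1_mult A1_uminus A1_const A1_0 A1_1 A1_diff A1_qvar
lemmas ev1_simps = ev1_add ev1_mult ev1_uminus ev1_const ev1_0 ev1_1 ev1_diff ev1_qvar

lemma A1_of_int: "of_int k \<in> A1" and ev1_of_int: "ev1 (of_int k) = of_int k"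
proof -
  have *: "of_int k = (Fract [:of_int k:] 1 :: cq)"
  proof (induction k rule: int_induct[of _ 0])
    case base show ?case by (simp add: Zero_fract_def)
  next
    case (step1 i) then show ?case by (simp add: One_fract_def one_pCons)
  next
    case (step2 i) then show ?case by (simp add: One_fract_def one_pCons)
  qed
  show "of_int k \<in> A1" "ev1 (of_int k) = of_int k"
    unfolding * by (rule A1_const, rule ev1_const)
qed

lemma A1_inverse_qvar: "inverse qvar \<in> A1" and ev1_inverse_qvar: "ev1 (inverse qvar) = 1"
  using A1_inverse[OF A1_qvar] ev1_inverse[OF A1_qvar] by (simp_all add: ev1_qvar)

lemma A1_nu: "nu \<in> A1" and ev1_nu: "ev1 nu = 0"
  unfolding nu_def by (simp_all add: A1_closed ev1_simps A1_inverse_qvar ev1_inverse_qvar)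

lemma A1_inverse_qvar_plus_1: "inverse (qvar + 1) \<in> A1"
  and ev1_inverse_qvar_plus_1: "ev1 (inverse (qvar + 1)) = 1 / 2"
  using A1_inverse[of "qvar + 1"] ev1_inverse[of "qvar + 1"]
  by (simp_all add: A1_closed ev1_simps)

lemma qvar_plus_1_nonzero: "qvar + 1 \<noteq> 0" and qvar_neq_1: "qvar \<noteq> 1"
proof -
  show "qvar + 1 \<noteq> 0"
  proof
    assume "qvar + 1 = 0"
    then have "ev1 (qvar + 1) = 0" by (simp add: ev1_0)
    then show False by (simp add: ev1_simps A1_closed)
  qed
  show "qvar \<noteq> 1" by (simp add: qvar_def One_fract_def eq_fract one_pCons)
qed

text \<open>The second factor is a unit of \<open>A1\<close>, so \<open>nu\<close> and q - 1
  generate the same ideal there: dividing by \<open>nu\<close> in place of q - 1 costs only a unit,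
  whose value at q = 1 is 2.\<close>

lemma nu_factor: "nu = (qvar - 1) * ((qvar + 1) * inverse qvar)"
  by (simp add: nu_def field_simps)

lemma nu_nonzero [simp]: "nu \<noteq> 0"
  unfolding nu_factor using qvar_neq_1 qvar_plus_1_nonzero by simp

lemma nu_over_qvar_minus_1: "nu / (qvar - 1) \<in> A1"
proof -
  have "nu / (qvar - 1) = (qvar + 1) * inverse qvar"
    unfolding nu_factor using qvar_neq_1 by simp
  then show ?thesis by (simp add: A1_closed A1_inverse_qvar)
qed

text \<open>The origin of the halves: to first order nu is 2 (q - 1), while 1/q - 1 is - (q -
  1).\<close>

lemma qvar_minus_1_over_nu: "(qvar - 1) / nu \<in> A1" "ev1 ((qvar - 1) / nu) = 1 / 2"
  and inverse_qvar_minus_1_over_nu: "(inverse qvar - 1) / nu \<in> A1" "ev1 ((inverse qvar - 1) / nu) = - 1 / 2"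
proof -
  have 1: "(qvar - 1) / nu = qvar * inverse (qvar + 1)"
  proof -
    have "qvar * inverse (qvar + 1) * nu = (qvar - 1) * ((qvar + 1) * inverse (qvar + 1)) * (qvar * inverse qvar)"
      unfolding nu_factor by (simp only: mult_ac)
    then show ?thesis using qvar_plus_1_nonzero by (simp add: nonzero_divide_eq_eq)
  qed
  have "(inverse qvar - 1) = - (qvar - 1) * inverse qvar" by (simp add: field_simps)
  then have "(inverse qvar - 1) / nu = - (inverse qvar) * ((qvar - 1) / nu)" by (simp add: field_simps)
  also have "\<dots> = - inverse (qvar + 1)" unfolding 1 by simp
  finally have 2: "(inverse qvar - 1) / nu = - inverse (qvar + 1)" .
  show "(qvar - 1) / nu \<in> A1" "ev1 ((qvar - 1) / nu) = 1 / 2"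
    "(inverse qvar - 1) / nu \<in> A1" "ev1 ((inverse qvar - 1) / nu) = - 1 / 2"
    unfolding 1 2 by (simp_all add: A1_closed ev1_simps A1_inverse_qvar_plus_1 ev1_inverse_qvar_plus_1)
qed

text \<open>A numerator that vanishes at 1 is divisible by q - 1.\<close>

lemma J1_iff: "x \<in> J1 \<longleftrightarrow> x \<in> A1 \<and> ev1 x = 0"
proof
  assume "x \<in> J1"
  then show "x \<in> A1 \<and> ev1 x = 0"
    unfolding J1_def by (auto simp: A1_closed ev1_simps)
next
  assume x: "x \<in> A1 \<and> ev1 x = 0"
  then obtain f g where fg: "x = Fract f g" "g \<noteq> 0" "poly g 1 \<noteq> 0" by (blast elim: A1_cases)
  with x have "poly f 1 = 0" by (simp add: ev1_Fract)
  then obtain h where h: "f = [:- 1, 1:] * h" by (auto simp: poly_eq_0_iff_dvd dvd_def)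
  have "qvar - 1 = Fract [:- 1, 1:] 1"
    by (simp add: qvar_def One_fract_def one_pCons)
  then have "x = (qvar - 1) * Fract h g" using fg h by simp
  then show "x \<in> J1" unfolding J1_def using fg by blast
qed

section \<open>The limit of the action on words\<close>

definition specializes :: "('w \<Rightarrow> cq) \<Rightarrow> ('w \<Rightarrow> complex) \<Rightarrow> bool" where
  "specializes F f \<longleftrightarrow> (\<forall>w. F w \<in> A1 \<and> ev1 (F w) = f w)"

text \<open>The action on functions of words of the superderivation that turns a letter a into b and
  - a into - b. An odd operator picks up a sign at each negative letter that it passes.\<close>

primrec deriv_op :: "int list \<Rightarrow> int \<Rightarrow> int \<Rightarrow> (int list \<Rightarrow> complex) \<Rightarrow> complex" where
  "deriv_op [] a b f = 0"
| "deriv_op (x # w) a b f =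
    (if x < 0 \<and> (a < 0) \<noteq> (b < 0) then - 1 else 1) * deriv_op w a b (\<lambda>u. f (x # u))
    + (if x = a then f (b # w) else 0) + (if x = - a then f ((- b) # w) else 0)"

lemma specializes_Cons: "specializes F f \<Longrightarrow> specializes (\<lambda>u. F (x # u)) (\<lambda>u. f (x # u))"
  by (simp add: specializes_def)

lemma A1_word_sign: "word_sign w \<in> A1" and ev1_word_sign: "ev1 (word_sign w) = word_sign w"
proof -
  have "word_sign w \<in> A1 \<and> ev1 (word_sign w) = word_sign w"
    by (induction w) (auto simp: A1_closed ev1_simps)
  then show "word_sign w \<in> A1" "ev1 (word_sign w) = word_sign w" by auto
qed

lemma A1_swap_coeff: "swap_coeff x i \<in> A1"
  and ev1_swap_coeff: "ev1 (swap_coeff x i) = (if x < 0 \<and> i < 0 then - 1 else 1)"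
  by (auto simp: swap_coeff_def A1_closed ev1_simps A1_inverse_qvar ev1_inverse_qvar)

lemma specializes_braid_op_diag:
  assumes "specializes F f"
  shows "braid_op w i i F \<in> A1" "ev1 (braid_op w i i F) = (if i < 0 then word_sign w else 1) * f w"
proof -
  have "prod_list (map (\<lambda>x. swap_coeff x i) w) \<in> A1 \<and>
      ev1 (prod_list (map (\<lambda>x. swap_coeff x i) w)) = (if i < 0 then word_sign w else 1)"
    by (induction w) (auto simp: A1_closed ev1_simps A1_swap_coeff ev1_swap_coeff)
  then show "braid_op w i i F \<in> A1" "ev1 (braid_op w i i F) = (if i < 0 then word_sign w else 1) * f w"
    using assms unfolding braid_op_diag specializes_def by (auto simp: A1_closed ev1_simps)
qed

text \<open>Each trade costs a factor \<open>nu\<close>, so after one division by \<open>nu\<close>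
  the value at q = 1 retains the paths with a single trade. Such a path has index \<open>i\<close>
  before it and \<open>j\<close> after it: a letter j becomes i, or a letter - j becomes -
  i.\<close>

lemma specializes_braid_op:
  assumes "specializes F f" "i < j" "i \<noteq> 0" "j \<noteq> 0"
  shows "braid_op w i j F / nu \<in> A1 \<and>
    ev1 (braid_op w i j F / nu) = (if j < 0 then - word_sign w else 1) * deriv_op w j i f"
  using assms
proof (induction w arbitrary: i F f)
  case Nil
  then show ?case by (simp add: A1_0 ev1_0)
next
  case (Cons x w)
  \<comment> \<open>The part of the word behind a trade: at q = 1 it contributes only if the index
    has already reached \<open>j\<close>, being divisible by \<open>nu\<close> below
    \<open>j\<close> and zero above.\<close>
  have any: "braid_op w y j (\<lambda>u. F (z # u)) \<in> A1 \<and>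
      ev1 (braid_op w y j (\<lambda>u. F (z # u))) = (if y = j then (if y < 0 then word_sign w else 1) * f (z # w) else 0)"
    if "y \<noteq> 0" for y z
  proof -
    consider "y = j" | "y < j" | "j < y" by linarith
    then show ?thesis
    proof cases
      case 1
      then show ?thesis
        using specializes_braid_op_diag[OF specializes_Cons[OF Cons.prems(1), of z], of w j] by simp
    next
      case 2
      have *: "braid_op w y j (\<lambda>u. F (z # u)) = nu * (braid_op w y j (\<lambda>u. F (z # u)) / nu)" by simp
      have "braid_op w y j (\<lambda>u. F (z # u)) / nu \<in> A1"
        using Cons.IH[OF specializes_Cons[OF Cons.prems(1), of z] 2 that Cons.prems(4)] by blast
      then show ?thesis
        using 2 by (subst (1 2) *) (simp add: A1_mult A1_nu ev1_mult ev1_nu del: nonzero_mult_div_cancel_left times_divide_eq_right)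
    next
      case 3
      then show ?thesis by (simp add: braid_op_triangular A1_0 ev1_0)
    qed
  qed
  have IH: "braid_op w i j (\<lambda>u. F (x # u)) / nu \<in> A1"
    "ev1 (braid_op w i j (\<lambda>u. F (x # u)) / nu) = (if j < 0 then - word_sign w else 1) * deriv_op w j i (\<lambda>u. f (x # u))"
    using Cons.IH[OF specializes_Cons[OF Cons.prems(1), of x] Cons.prems(2-4)] by auto
  define k where "k = (if x \<noteq> 0 \<and> i < x then 1 else 0 :: int)"
  define l where "l = (if x \<noteq> 0 \<and> x < - i then if x < 0 then 1 else - 1 else 0 :: int)"
  have kl: "keep_coeff x i = nu * of_int k" "flip_coeff x i = nu * of_int l"
    by (auto simp: keep_coeff_def flip_coeff_def k_def l_def)
  have *: "braid_op (x # w) i j F / nu = swap_coeff x i * (braid_op w i j (\<lambda>u. F (x # u)) / nu)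
      + of_int k * braid_op w x j (\<lambda>u. F (i # u)) + of_int l * braid_op w (- x) j (\<lambda>u. F ((- i) # u))"
    unfolding braid_op.simps kl by (simp add: field_simps)
  show ?case
  proof (cases "x = 0")
    case True
    then have "k = 0" "l = 0" by (simp_all add: k_def l_def)
    then show ?thesis
      unfolding * using True Cons.prems(2-4) IH by (simp add: A1_closed ev1_simps A1_swap_coeff ev1_swap_coeff del: times_divide_eq_right)
  next
    case False
    then have nx: "- x \<noteq> 0" by simp
    define E where "E = braid_op (x # w) i j F / nu"
    have E: "E \<in> A1"
      unfolding E_def * using any[OF False] any[OF nx] IH
      by (simp add: A1_closed A1_swap_coeff A1_of_int del: times_divide_eq_right)
    have k: "of_int k * (if x = j then (if x < 0 then word_sign w else 1) * f (i # w) else 0)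
        = (if x = j then (if x < 0 then word_sign w else 1) * f (i # w) else 0)"
      using Cons.prems(2-4) by (auto simp: k_def)
    have l: "of_int l * (if - x = j then (if - x < 0 then word_sign w else 1) * f ((- i) # w) else 0)
        = (if x = - j then (if 0 < x then - word_sign w else 1) * f ((- i) # w) else 0)"
      using Cons.prems(2-4) by (auto simp: l_def)
    have "ev1 E =
        (if x < 0 \<and> i < 0 then - 1 else 1) * ((if j < 0 then - word_sign w else 1) * deriv_op w j i (\<lambda>u. f (x # u)))
        + of_int k * (if x = j then (if x < 0 then word_sign w else 1) * f (i # w) else 0)
        + of_int l * (if - x = j then (if - x < 0 then word_sign w else 1) * f ((- i) # w) else 0)"
      unfolding E_def * using any[OF False] any[OF nx] IH
      by (simp only: A1_closed A1_swap_coeff A1_of_int ev1_simps ev1_swap_coeff ev1_of_int)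
    also have "\<dots> = (if j < 0 then - word_sign (x # w) else 1) * deriv_op (x # w) j i f"
      unfolding k l deriv_op.simps word_sign.simps
    proof -
      have "(- j < 0) = (\<not> j < 0)" "(0 < - j) = (j < 0)" "(0 < j) = (\<not> j < 0)" using Cons.prems(4) by auto
      then show "(if x < 0 \<and> i < 0 then - 1 else 1) * ((if j < 0 then - word_sign w else 1) * deriv_op w j i (\<lambda>u. f (x # u)))
        + (if x = j then (if x < 0 then word_sign w else 1) * f (i # w) else 0)
        + (if x = - j then (if 0 < x then - word_sign w else 1) * f ((- i) # w) else 0)
        = (if j < 0 then - ((if x < 0 then - 1 else 1) * word_sign w) else 1) *
          ((if x < 0 \<and> (j < 0) \<noteq> (i < 0) then - 1 else 1) * deriv_op w j i (\<lambda>u. f (x # u))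
            + (if x = j then f (i # w) else 0) + (if x = - j then f ((- i) # w) else 0))"
        using Cons.prems(4)
        by (cases "x = j"; cases "x = - j"; cases "x < 0"; cases "i < 0"; cases "j < 0"; simp add: algebra_simps)
    qed
    finally show ?thesis using E unfolding E_def by blast
  qed
qed

lemma deriv_op_diag:
  assumes "i \<noteq> 0"
  shows "deriv_op w i i f = of_nat (length (filter (\<lambda>x. \<bar>x\<bar> = \<bar>i\<bar>) w)) * f w"
proof (induction w arbitrary: f)
  case (Cons x w)
  have "\<bar>x\<bar> = \<bar>i\<bar> \<longleftrightarrow> x = i \<or> x = - i" by linarith
  with Cons assms show ?case by (auto simp: algebra_simps)
qed simp

lemma specializes_L_op:
  assumes "specializes F f" "i < j" "i \<noteq> 0" "j \<noteq> 0"
  shows "specializes (\<lambda>w. L_op i j F w / nu) (\<lambda>w. (if j < 0 then - 1 else 1) * deriv_op w j i f)"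
proof -
  have "L_op i j F w / nu = (if j < 0 then word_sign w else 1) * (braid_op w i j F / nu)" for w
    by (simp add: L_op_def)
  then show ?thesis
    using specializes_braid_op[OF assms] unfolding specializes_def
    by (auto simp: A1_closed ev1_simps A1_word_sign ev1_word_sign mult.assoc[symmetric] simp del: times_divide_eq_right)
qed

text \<open>\<open>L_op i i\<close> multiplies by a power of q whose exponent counts the letters i
  and - i, up to the sign of i. To first order such a power is additive in its factors, each of
  which contributes a half.\<close>

lemma specializes_L_op_diag:
  assumes "specializes F f" "i \<noteq> 0"
  shows "specializes (\<lambda>w. (L_op i i F w - F w) / nu) (\<lambda>w. of_int (sgn i) / 2 * deriv_op w i i f)"
proof -
  define r where "r x = (if \<bar>x\<bar> = \<bar>i\<bar> then if 0 < i then qvar else inverse qvar else 1)" for x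
  have L: "L_op i i F w = prod_list (map r w) * F w" for w
  proof -
    have h: "(if i < 0 then word_sign w else 1) * prod_list (map (\<lambda>x. swap_coeff x i) w) = prod_list (map r w)"
    proof (induction w)
      case (Cons x w)
      have "(if i < 0 then word_sign (x # w) else 1) * prod_list (map (\<lambda>x. swap_coeff x i) (x # w))
          = r x * ((if i < 0 then word_sign w else 1) * prod_list (map (\<lambda>x. swap_coeff x i) w))"
        using assms(2) by (simp add: swap_coeff_def r_def)
      then show ?case unfolding Cons by simp
    qed simp
    show ?thesis by (simp only: L_op_def braid_op_diag mult.assoc[symmetric] h)
  qed
  have r: "r x \<in> A1" "ev1 (r x) = 1" "(r x - 1) / nu \<in> A1"
    "ev1 ((r x - 1) / nu) = (if \<bar>x\<bar> = \<bar>i\<bar> then of_int (sgn i) / 2 else 0)" for x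
    using assms(2) by (auto simp: r_def A1_closed ev1_simps A1_inverse_qvar ev1_inverse_qvar
        qvar_minus_1_over_nu inverse_qvar_minus_1_over_nu sgn_if)
  have P: "(prod_list (map r w) - 1) / nu \<in> A1 \<and> ev1 ((prod_list (map r w) - 1) / nu) =
      of_int (sgn i) / 2 * of_nat (length (filter (\<lambda>x. \<bar>x\<bar> = \<bar>i\<bar>) w))" for w
  proof (induction w)
    case Nil
    then show ?case by (simp add: A1_0 ev1_0)
  next
    case (Cons x w)
    have *: "(prod_list (map r (x # w)) - 1) / nu = r x * ((prod_list (map r w) - 1) / nu) + (r x - 1) / nu"
      by (simp add: field_simps)
    define p t where "p = (prod_list (map r w) - 1) / nu" and "t = (r x - 1) / nu"
    show ?case unfolding * p_def[symmetric] t_def[symmetric]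
      using Cons[folded p_def] r[of x, folded t_def]
      by (simp add: A1_closed ev1_simps algebra_simps)
  qed
  define p where "p w = (prod_list (map r w) - 1) / nu" for w
  have "(L_op i i F w - F w) / nu = p w * F w" for w
    unfolding L p_def by (simp add: field_simps)
  then show ?thesis
    using P[folded p_def] assms(1) unfolding specializes_def
    by (auto simp: A1_closed ev1_simps deriv_op_diag[OF assms(2)])
qed

section \<open>Independence of the limit operators\<close>

text \<open>One label from each of the pairs (a, c), (- a, - c), which denote the same element of
  q(n). The basis element is even exactly when c is positive.\<close>

definition qbasis :: "nat \<Rightarrow> (int \<times> int) set" where
  "qbasis n = {(a, c). 1 \<le> a \<and> a \<le> int n \<and> c \<noteq> 0 \<and> \<bar>c\<bar> \<le> int n}"

lemma finite_qbasis: "finite (qbasis n)"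
  by (rule finite_subset[of _ "{1..int n} \<times> {- int n..int n}"]) (auto simp: qbasis_def)

text \<open>The first letter acts outermost, hence is the first one to alter the word at which the
  value is taken.\<close>

definition deriv_word :: "(int \<times> int) list \<Rightarrow> (int list \<Rightarrow> complex) \<Rightarrow> int list \<Rightarrow> complex" where
  "deriv_word u f = foldr (\<lambda>(a, c) g w. deriv_op w a c g) u f"

lemma deriv_word_simps [simp]:
  "deriv_word [] f = f" "deriv_word ((a, c) # u) f = (\<lambda>w. deriv_op w a c (deriv_word u f))"
  by (simp_all add: deriv_word_def)

lemma deriv_op_positions:
  assumes "0 < a"
  shows "deriv_op w a c f = (\<Sum>k<length w. if \<bar>w ! k\<bar> = a
    then (if c < 0 then word_sign (take k w) else 1) * f (w[k := sgn (w ! k) * c]) else 0)"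
proof (induction w arbitrary: f)
  case (Cons x w)
  have "(\<Sum>k<length (x # w). if \<bar>(x # w) ! k\<bar> = a
      then (if c < 0 then word_sign (take k (x # w)) else 1) * f ((x # w)[k := sgn ((x # w) ! k) * c]) else 0)
    = (if \<bar>x\<bar> = a then f ((sgn x * c) # w) else 0)
      + (\<Sum>k<length w. if \<bar>w ! k\<bar> = a then (if c < 0 then word_sign (x # take k w) else 1) * f (x # w[k := sgn (w ! k) * c]) else 0)"
    unfolding length_Cons sum.lessThan_Suc_shift by (simp cong: if_cong)
  also have "(\<Sum>k<length w. if \<bar>w ! k\<bar> = a then (if c < 0 then word_sign (x # take k w) else 1) * f (x # w[k := sgn (w ! k) * c]) else 0)
    = (if x < 0 \<and> c < 0 then - 1 else 1) *
      (\<Sum>k<length w. if \<bar>w ! k\<bar> = a then (if c < 0 then word_sign (take k w) else 1) * f (x # w[k := sgn (w ! k) * c]) else 0)"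
    unfolding sum_distrib_left by (intro sum.cong) auto
  also have "(if \<bar>x\<bar> = a then f ((sgn x * c) # w) else 0) = (if x = a then f (c # w) else 0) + (if x = - a then f ((- c) # w) else 0)"
    using assms by (auto simp: sgn_if)
  finally have sum: "(\<Sum>k<length (x # w). if \<bar>(x # w) ! k\<bar> = a
      then (if c < 0 then word_sign (take k (x # w)) else 1) * f ((x # w)[k := sgn ((x # w) ! k) * c]) else 0)
    = (if x = a then f (c # w) else 0) + (if x = - a then f ((- c) # w) else 0)
      + (if x < 0 \<and> c < 0 then - 1 else 1) * deriv_op w a c (\<lambda>u. f (x # u))"
    unfolding Cons.IH .
  have "(x < 0 \<and> (a < 0) \<noteq> (c < 0)) = (x < 0 \<and> c < 0)" using assms by auto
  then show ?case unfolding sum by (simp only: deriv_op.simps add_ac)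
qed simp

text \<open>The type of operator that repairs position k. The operator (a, c) changes a letter of
  absolute value a into c times its sign, so this is the only type that produces the target letter.
  Equal letters count as no mismatch, whence no diagonal type occurs.\<close>

definition mismatch :: "int list \<Rightarrow> int list \<Rightarrow> nat \<Rightarrow> (int \<times> int) multiset" where
  "mismatch v w k = (if w ! k = v ! k then {#} else {#(\<bar>w ! k\<bar>, sgn (w ! k) * v ! k)#})"

definition mismatches :: "int list \<Rightarrow> int list \<Rightarrow> (int \<times> int) multiset" where
  "mismatches v w = (\<Sum>k<length w. mismatch v w k)"

lemma mismatches_update:
  assumes "k < length w"
  shows "mismatches v w = (\<Sum>l\<in>{..<length w} - {k}. mismatch v w l) + mismatch v w k"
    and "mismatches v (w[k := y]) = (\<Sum>l\<in>{..<length w} - {k}. mismatch v w l) + mismatch v (w[k := y]) k"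
proof -
  show "mismatches v w = (\<Sum>l\<in>{..<length w} - {k}. mismatch v w l) + mismatch v w k"
    unfolding mismatches_def using assms by (subst sum.remove[of _ k]) auto
  have "(\<Sum>l\<in>{..<length w} - {k}. mismatch v (w[k := y]) l) = (\<Sum>l\<in>{..<length w} - {k}. mismatch v w l)"
    by (intro sum.cong) (auto simp: mismatch_def)
  then show "mismatches v (w[k := y]) = (\<Sum>l\<in>{..<length w} - {k}. mismatch v w l) + mismatch v (w[k := y]) k"
    unfolding mismatches_def using assms by (subst sum.remove[of _ k]) auto
qed

lemma size_mismatch_le: "size (mismatch v w k) \<le> 1"
  by (simp add: mismatch_def)

text \<open>Each operator changes at most one letter, so it repairs at most one mismatch, and it can
  only repair one of its own type.\<close>

lemma mismatches_step:
  assumes "k < length w" "w ! k \<noteq> 0" "\<bar>w ! k\<bar> = a"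
  shows "size (mismatches v w) \<le> Suc (size (mismatches v (w[k := sgn (w ! k) * c])))"
    and "size (mismatches v w) = Suc (size (mismatches v (w[k := sgn (w ! k) * c]))) \<Longrightarrow>
      mismatch v w k = {#(a, c)#} \<and> mismatches v w = add_mset (a, c) (mismatches v (w[k := sgn (w ! k) * c]))"
    and "mismatch v w k = {#(a, c)#} \<Longrightarrow>
      mismatches v w = add_mset (a, c) (mismatches v (w[k := sgn (w ! k) * c]))"
proof -
  let ?w = "w[k := sgn (w ! k) * c]"
  note u = mismatches_update[OF assms(1), of v] 
  show "size (mismatches v w) \<le> Suc (size (mismatches v ?w))"
    unfolding u(1) u(2)[of "sgn (w ! k) * c"] using size_mismatch_le[of v w k] by simp
  have sg: "sgn (w ! k) * (sgn (w ! k) * x) = x" for x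
    using assms(2) by (simp add: sgn_if)
  have e: "mismatch v ?w k = {#} \<longleftrightarrow> sgn (w ! k) * c = v ! k"
    using assms(1) by (auto simp: mismatch_def)
  have e2: "sgn (w ! k) * c = v ! k \<Longrightarrow> sgn (w ! k) * v ! k = c"
    using sg[of c] by simp
  show "mismatch v w k = {#(a, c)#} \<and> mismatches v w = add_mset (a, c) (mismatches v ?w)"
    if s: "size (mismatches v w) = Suc (size (mismatches v ?w))"
  proof -
    have "size (mismatch v w k) = Suc (size (mismatch v ?w k))"
      using s unfolding u(1) u(2)[of "sgn (w ! k) * c"] by simp
    with size_mismatch_le[of v w k] have "mismatch v ?w k = {#}" "mismatch v w k \<noteq> {#}" by auto
    then have "mismatch v ?w k = {#}" "mismatch v w k = {#(a, c)#}"
      using e e2 assms(3) by (auto simp: mismatch_def split: if_splits)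
    then show ?thesis unfolding u(1) u(2)[of "sgn (w ! k) * c"] by simp
  qed
  show "mismatches v w = add_mset (a, c) (mismatches v ?w)" if "mismatch v w k = {#(a, c)#}"
  proof -
    have "sgn (w ! k) * v ! k = c" using that by (auto simp: mismatch_def split: if_splits)
    then have "sgn (w ! k) * c = v ! k" using sg[of "v ! k"] by simp
    then have "mismatch v ?w k = {#}" using e by simp
    with that show ?thesis unfolding u(1) u(2)[of "sgn (w ! k) * c"] by simp
  qed
qed

definition point :: "'w \<Rightarrow> 'w \<Rightarrow> complex" where
  "point v w = (if w = v then 1 else 0)"

lemma nonzero_update:
  fixes w :: "int list"
  assumes "0 \<notin> set w" "k < length w" "c \<noteq> 0"
  shows "0 \<notin> set (w[k := sgn (w ! k) * c])"
proof -
  have "w ! k \<noteq> 0" using assms(1) nth_mem[OF assms(2)] by metis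
  then have "sgn (w ! k) * c \<noteq> 0" using assms(3) by (simp add: sgn_0_0)
  then show ?thesis using assms(1) set_update_subset_insert[of w k "sgn (w ! k) * c"] by (metis insertE subsetD)
qed

text \<open>A nonzero value means that some sequence of one-letter changes leads from
  \<open>w\<close> to \<open>v\<close>, with one change per operator. If there are as many
  mismatches as operators, no change is wasted, and each operator repairs a mismatch of its own
  type.\<close>

lemma deriv_word_point_zero:
  assumes "set u \<subseteq> qbasis n" "0 \<notin> set w" "deriv_word u (point v) w \<noteq> 0"
  shows "size (mismatches v w) \<le> length u \<and> (size (mismatches v w) = length u \<longrightarrow> mismatches v w = mset u)"
  using assms
proof (induction u arbitrary: w)
  case Nil
  then show ?case by (auto simp: point_def mismatches_def mismatch_def split: if_splits)
next
  case (Cons x u)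
  obtain a c where x: "x = (a, c)" by (cases x)
  have ac: "0 < a" "c \<noteq> 0" using Cons.prems(1) by (auto simp: x qbasis_def)
  from Cons.prems(3) have "(\<Sum>k<length w. if \<bar>w ! k\<bar> = a
      then (if c < 0 then word_sign (take k w) else 1) * deriv_word u (point v) (w[k := sgn (w ! k) * c]) else 0) \<noteq> 0"
    by (simp add: x deriv_op_positions[OF ac(1)])
  then obtain k where k: "k \<in> {..<length w}" "(if \<bar>w ! k\<bar> = a
      then (if c < 0 then word_sign (take k w) else 1) * deriv_word u (point v) (w[k := sgn (w ! k) * c]) else 0) \<noteq> 0"
    by (rule sum.not_neutral_contains_not_neutral)
  then have k': "k < length w" "\<bar>w ! k\<bar> = a" "deriv_word u (point v) (w[k := sgn (w ! k) * c]) \<noteq> 0"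
    by (auto split: if_splits)
  have wk: "w ! k \<noteq> 0" using ac(1) k'(2) by auto
  have IH: "size (mismatches v (w[k := sgn (w ! k) * c])) \<le> length u \<and>
      (size (mismatches v (w[k := sgn (w ! k) * c])) = length u \<longrightarrow> mismatches v (w[k := sgn (w ! k) * c]) = mset u)"
    by (rule Cons.IH) (use Cons.prems(1,2) k' ac nonzero_update in auto)
  note st = mismatches_step[OF k'(1) wk k'(2), of v c]
  show ?case using st(1,2) IH by (auto simp: x)
qed

text \<open>There is no operator to spare, so the first one acts only where a mismatch has its type;
  anywhere else too many mismatches would be left over. An odd type that does not recur has exactly
  one such position, which will rule out cancellation.\<close>

lemma deriv_word_step:
  assumes "set ((a, c) # u) \<subseteq> qbasis n" "0 \<notin> set w" "mismatches v w = mset ((a, c) # u)"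
  shows "deriv_word ((a, c) # u) (point v) w =
    (\<Sum>k\<in>{k. k < length w \<and> mismatch v w k = {#(a, c)#}}.
      (if c < 0 then word_sign (take k w) else 1) * deriv_word u (point v) (w[k := sgn (w ! k) * c]))"
    and "{k. k < length w \<and> mismatch v w k = {#(a, c)#}} \<noteq> {}"
    and "k < length w \<Longrightarrow> mismatch v w k = {#(a, c)#} \<Longrightarrow>
      mismatches v (w[k := sgn (w ! k) * c]) = mset u \<and> 0 \<notin> set (w[k := sgn (w ! k) * c])"
    and "c < 0 \<Longrightarrow> (a, c) \<notin> set u \<Longrightarrow> \<exists>k. {k. k < length w \<and> mismatch v w k = {#(a, c)#}} = {k}"
proof -
  have ac: "0 < a" "c \<noteq> 0" using assms(1) by (auto simp: qbasis_def)
  let ?K = "{k. k < length w \<and> mismatch v w k = {#(a, c)#}}"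
  have mk: "\<bar>w ! k\<bar> = a" if "mismatch v w k = {#(a, c)#}" for k
    using that by (auto simp: mismatch_def split: if_splits)
  have wk: "w ! k \<noteq> 0" if "k < length w" for k using assms(2) that nth_mem by force
  show upd: "mismatches v (w[k := sgn (w ! k) * c]) = mset u \<and> 0 \<notin> set (w[k := sgn (w ! k) * c])"
    if "k < length w" "mismatch v w k = {#(a, c)#}" for k
    using mismatches_step(3)[OF that(1) wk[OF that(1)] mk[OF that(2)] that(2)] assms(3)
      nonzero_update[OF assms(2) that(1) ac(2)] by simp
  have zero: "deriv_word u (point v) (w[k := sgn (w ! k) * c]) = 0"
    if k: "k < length w" "\<bar>w ! k\<bar> = a" "mismatch v w k \<noteq> {#(a, c)#}" for k
  proof (rule ccontr)
    assume "deriv_word u (point v) (w[k := sgn (w ! k) * c]) \<noteq> 0"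
    then have "size (mismatches v (w[k := sgn (w ! k) * c])) \<le> length u"
      using deriv_word_point_zero[of u n "w[k := sgn (w ! k) * c]" v] assms(1)
        nonzero_update[OF assms(2) k(1) ac(2)] by auto
    with assms(3) mismatches_step(1,2)[OF k(1) wk[OF k(1)] k(2), of v c]
    have "mismatch v w k = {#(a, c)#}" by auto
    with k(3) show False ..
  qed
  show "deriv_word ((a, c) # u) (point v) w =
    (\<Sum>k\<in>?K. (if c < 0 then word_sign (take k w) else 1) * deriv_word u (point v) (w[k := sgn (w ! k) * c]))"
    unfolding deriv_word_simps deriv_op_positions[OF ac(1)]
    by (rule sum.mono_neutral_cong_right) (auto simp: zero mk)
  \<comment> \<open>Each position contributes at most one type, so multiplicities count
    positions.\<close>
  have card: "count (mismatches v w) x = card {k. k < length w \<and> mismatch v w k = {#x#}}" for x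
  proof -
    have "count (mismatches v w) x = (\<Sum>k<length w. if mismatch v w k = {#x#} then 1 else 0)"
      unfolding mismatches_def count_sum by (intro sum.cong) (auto simp: mismatch_def)
    also have "\<dots> = card {k. k < length w \<and> mismatch v w k = {#x#}}"
      by (simp add: sum.If_cases Collect_conj_eq lessThan_def)
    finally show ?thesis .
  qed
  show "?K \<noteq> {}"
  proof
    assume "?K = {}"
    then have "count (mismatches v w) (a, c) = 0" unfolding card by simp
    with assms(3) show False by simp
  qed
  show "\<exists>k. ?K = {k}" if "c < 0" "(a, c) \<notin> set u"
  proof -
    have "count (mismatches v w) (a, c) = 1" using that assms(3) by (simp add: count_eq_zero_iff)
    then show ?thesis unfolding card by (rule card_1_singletonE) blast
  qed
qed

text \<open>Even operators carry no signs: repeated types give several positions, but all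
  contributions are positive.\<close>

lemma deriv_word_even:
  assumes "set u \<subseteq> qbasis n" "\<forall>(a, c)\<in>set u. 0 < c" "0 \<notin> set w" "mismatches v w = mset u" "length v = length w"
  shows "\<exists>N>0. deriv_word u (point v) w = of_nat N"
  using assms
proof (induction u arbitrary: w)
  case Nil
  have "w ! k = v ! k" if "k < length w" for k
  proof -
    have "mismatch v w k = {#}"
      using Nil.prems(4) mismatches_update(1)[OF that, of v] by simp
    then show ?thesis by (simp add: mismatch_def split: if_splits)
  qed
  then have "w = v" using Nil.prems(5) by (intro nth_equalityI) auto
  then show ?case by (intro exI[of _ 1]) (simp add: point_def)
next
  case (Cons x u)
  obtain a c where x: "x = (a, c)" by (cases x)
  have c: "\<not> c < 0" using Cons.prems(2) by (auto simp: x)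
  let ?K = "{k. k < length w \<and> mismatch v w k = {#(a, c)#}}"
  note st = deriv_word_step[OF Cons.prems(1)[unfolded x] Cons.prems(3) Cons.prems(4)[unfolded x]]
  have "\<exists>N>0. deriv_word u (point v) (w[k := sgn (w ! k) * c]) = of_nat N" if "k \<in> ?K" for k
    by (rule Cons.IH) (use that Cons.prems st(3) in auto)
  then have "\<forall>k\<in>?K. \<exists>N. 0 < N \<and> deriv_word u (point v) (w[k := sgn (w ! k) * c]) = of_nat N" by blast
  from bchoice[OF this] obtain N where
    N: "\<And>k. k \<in> ?K \<Longrightarrow> 0 < N k \<and> deriv_word u (point v) (w[k := sgn (w ! k) * c]) = of_nat (N k)" by blast
  have "deriv_word (x # u) (point v) w = of_nat (\<Sum>k\<in>?K. N k)"
    unfolding x st(1) of_nat_sum using c N by (intro sum.cong) auto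
  moreover have "0 < (\<Sum>k\<in>?K. N k)"
    using st(2) N by (intro sum_pos) auto
  ultimately show ?case by blast
qed

text \<open>Signs come from odd operators only. Being distinct, each of them has a single place to
  act, so the value is a sign times a positive number.\<close>

lemma deriv_word_nonzero:
  assumes "set (u1 @ u2) \<subseteq> qbasis n" "\<forall>(a, c)\<in>set u1. c < 0" "distinct u1" "\<forall>(a, c)\<in>set u2. 0 < c"
    "0 \<notin> set w" "mismatches v w = mset (u1 @ u2)" "length v = length w"
  shows "deriv_word (u1 @ u2) (point v) w \<noteq> 0"
  using assms
proof (induction u1 arbitrary: w)
  case Nil
  then show ?case using deriv_word_even[of u2 n w v] by auto
next
  case (Cons x u1)
  obtain a c where x: "x = (a, c)" by (cases x)
  have c: "c < 0" "(a, c) \<notin> set (u1 @ u2)" using Cons.prems(2,3,4) by (auto simp: x)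
  have pr: "set ((a, c) # u1 @ u2) \<subseteq> qbasis n" "mismatches v w = mset ((a, c) # u1 @ u2)"
    using Cons.prems(1,6) by (simp_all add: x)
  note st = deriv_word_step[OF pr(1) Cons.prems(5) pr(2)]
  obtain k where k: "{k. k < length w \<and> mismatch v w k = {#(a, c)#}} = {k}" using st(4)[OF c] by blast
  then have k': "k < length w" "mismatch v w k = {#(a, c)#}" by auto
  have "deriv_word (u1 @ u2) (point v) (w[k := sgn (w ! k) * c]) \<noteq> 0"
    by (rule Cons.IH) (use Cons.prems st(3)[OF k'] in auto)
  moreover have "word_sign (take k w) \<noteq> (0::complex)"
    using word_sign_cases[of "take k w", where 'k = complex] by auto
  ultimately show ?case unfolding x append_Cons st(1) k using c by simp
qed

section \<open>Polynomials that vanish at all large integer points\<close>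

lemma vanishing_polynomial:
  fixes c :: "nat \<Rightarrow> complex"
  assumes "finite J" "\<And>N. N \<ge> K \<Longrightarrow> (\<Sum>j\<in>J. c j * of_nat N ^ j) = 0" "j \<in> J"
  shows "c j = 0"
proof -
  define p where "p = (\<Sum>j\<in>J. Polynomial.monom (c j) j)"
  have "{of_nat N | N. N \<ge> K} \<subseteq> {x. poly p x = 0}"
    using assms(2) by (auto simp: p_def poly_sum poly_monom)
  moreover have "infinite {of_nat N :: complex | N. N \<ge> K}"
  proof -
    have "infinite (of_nat ` {K..} :: complex set)"
      by (simp add: finite_image_iff inj_on_def infinite_Ici)
    then show ?thesis by (simp add: image_def Bex_def conj_commute)
  qed
  ultimately have "p = 0" using poly_roots_finite[of p] finite_subset by blast
  then have "Polynomial.coeff p j = 0" by simp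
  then show ?thesis using assms(1,3) by (simp add: p_def coeff_sum coeff_monom)
qed

text \<open>Induction on the variables. Grouping the sum by the exponent of \<open>b\<close> gives a
  polynomial in one variable, whose coefficients vanish for all large values of the other variables;
  the induction hypothesis applies to each coefficient.\<close>

lemma vanishing_multivariate_polynomial:
  fixes f :: "('a \<Rightarrow> nat) \<Rightarrow> complex"
  assumes "finite A" "finite S" "\<And>e a. e \<in> S \<Longrightarrow> a \<notin> A \<Longrightarrow> e a = 0"
    and "\<And>N. (\<And>a. N a \<ge> K a) \<Longrightarrow> (\<Sum>e\<in>S. f e * (\<Prod>a\<in>A. of_nat (N a) ^ e a)) = 0"
    and "e \<in> S"
  shows "f e = 0"
  using assms
proof (induction A arbitrary: S f e rule: finite_induct)
  case empty
  have "e' = e" if "e' \<in> S" for e'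
    using empty.prems(2)[OF that] empty.prems(2)[OF empty.prems(4)] by (simp add: fun_eq_iff)
  then have "S = {e}" using empty.prems(4) by blast
  then show ?case using empty.prems(3)[of K] by simp
next
  case (insert b A)
  let ?S = "{e'\<in>S. e' b = e b}"
  \<comment> \<open>Erasing the exponent of \<open>b\<close> meets the support condition for the
    smaller variable set. It is injective on \<open>?S\<close>, where that exponent is always
    \<open>e b\<close>.\<close>
  let ?d = "\<lambda>e'::'a \<Rightarrow> nat. e'(b := 0)"
  have inj: "inj_on ?d ?S"
    by (intro inj_onI) (metis (mono_tags, lifting) fun_upd_triv fun_upd_upd mem_Collect_eq)
  let ?f = "\<lambda>e'. f (e'(b := e b))"
  have restore: "(?d e')(b := e b) = e'" if "e' \<in> ?S" for e' using that by auto
  have "?f (?d e) = 0"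
  proof (rule insert.IH[where S = "?d ` ?S" and f = ?f and e = "?d e"])
    show "finite (?d ` ?S)" using insert.prems(1) by simp
    show "?d e \<in> ?d ` ?S" using insert.prems(4) by auto
    show "e' a = 0" if "e' \<in> ?d ` ?S" "a \<notin> A" for e' a
      using that insert.prems(2) by auto
    fix N :: "'a \<Rightarrow> nat" assume N: "\<And>a. K a \<le> N a"
    define c where "c j = (\<Sum>e'\<in>{e'\<in>S. e' b = j}. f e' * (\<Prod>a\<in>A. of_nat (N a) ^ e' a))" for j
    have "c (e b) = 0"
    proof (rule vanishing_polynomial[where J = "(\<lambda>e'. e' b) ` S" and K = "K b"])
      show "finite ((\<lambda>e'. e' b) ` S)" "e b \<in> (\<lambda>e'. e' b) ` S" using insert.prems by auto
      fix M assume M: "K b \<le> M"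
      let ?N = "N(b := M)"
      have "(\<Sum>e'\<in>S. f e' * (\<Prod>a\<in>insert b A. of_nat (?N a) ^ e' a)) = 0"
        by (rule insert.prems(3)) (use N M in auto)
      moreover have "(\<Prod>a\<in>insert b A. of_nat (?N a) ^ e' a :: complex) = (\<Prod>a\<in>A. of_nat (N a) ^ e' a) * of_nat M ^ e' b" for e'
      proof -
        have "(\<Prod>a\<in>A. of_nat (?N a) ^ e' a :: complex) = (\<Prod>a\<in>A. of_nat (N a) ^ e' a)"
          using insert.hyps by (intro prod.cong) auto
        then show ?thesis using insert.hyps by simp
      qed
      ultimately have "0 = (\<Sum>e'\<in>S. (f e' * (\<Prod>a\<in>A. of_nat (N a) ^ e' a)) * of_nat M ^ e' b)"
        by (simp add: mult.assoc)
      also have "\<dots> = (\<Sum>j\<in>(\<lambda>e'. e' b) ` S. \<Sum>e'\<in>{e'\<in>S. e' b = j}. (f e' * (\<Prod>a\<in>A. of_nat (N a) ^ e' a)) * of_nat M ^ e' b)"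
        using insert.prems(1) by (rule sum.image_gen)
      also have "\<dots> = (\<Sum>j\<in>(\<lambda>e'. e' b) ` S. c j * of_nat M ^ j)"
        unfolding c_def sum_distrib_right by (intro sum.cong) auto
      finally show "(\<Sum>j\<in>(\<lambda>e'. e' b) ` S. c j * of_nat M ^ j) = 0" by simp
    qed
    have "(\<Sum>e'\<in>?d ` ?S. ?f e' * (\<Prod>a\<in>A. of_nat (N a) ^ e' a))
        = (\<Sum>e'\<in>?S. ?f (?d e') * (\<Prod>a\<in>A. of_nat (N a) ^ (?d e') a))"
      by (simp add: sum.reindex[OF inj])
    also have "\<dots> = (\<Sum>e'\<in>?S. f e' * (\<Prod>a\<in>A. of_nat (N a) ^ e' a))"
      using insert.hyps restore by (intro sum.cong arg_cong2[where f = "(*)"] prod.cong) auto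
    also have "\<dots> = c (e b)" by (simp add: c_def)
    also have "\<dots> = 0" by fact
    finally show "(\<Sum>e'\<in>?d ` ?S. ?f e' * (\<Prod>a\<in>A. of_nat (N a) ^ e' a)) = 0" .
  qed
  then show ?case by simp
qed


text \<open>The ordered monomials of a Poincare-Birkhoff-Witt basis in the super case: weakly
  increasing, with no repetition among the letters satisfying \<open>sq\<close>, here the odd
  ones.\<close>

definition normal_words :: "('x \<Rightarrow> nat) \<Rightarrow> ('x \<Rightarrow> bool) \<Rightarrow> 'x set \<Rightarrow> 'x list set" where
  "normal_words key sq X = {w \<in> lists X. sorted (map key w) \<and> distinct (filter sq w)}"

lemma sorted_key_unique:
  assumes "sorted (map key u)" "sorted (map key v)" "mset u = mset v" "inj_on key (set u)"
  shows "u = v"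
proof -
  have "map key u = map key v"
    using assms(1-3) by (metis mset_map properties_for_sort sorted_sort_id)
  moreover have "set u = set v" using assms(3) by (metis set_mset_mset)
  ultimately show ?thesis using assms(4) by (metis inj_on_map_eq_map Un_absorb)
qed

lemma sorted_filter_split:
  assumes "sorted (map key w)" "\<And>x y. x \<in> set w \<Longrightarrow> y \<in> set w \<Longrightarrow> P x \<Longrightarrow> \<not> P y \<Longrightarrow> key x < (key y :: nat)"
  shows "w = filter P w @ filter (\<lambda>x. \<not> P x) w"
  using assms
proof (induction w)
  case (Cons c w)
  have IH: "w = filter P w @ filter (\<lambda>x. \<not> P x) w"
    by (rule Cons.IH) (use Cons.prems in auto)
  show ?case
  proof (cases "P c")
    case True
    then show ?thesis using IH by simp
  next
    case False
    have "filter P w = []"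
    proof (rule ccontr)
      assume "filter P w \<noteq> []"
      then obtain x where x: "x \<in> set w" "P x" by (auto simp: filter_empty_conv)
      then have "key x < key c" using Cons.prems(2)[of x c] False by simp
      moreover have "key c \<le> key x" using Cons.prems(1) x(1) by simp
      ultimately show False by simp
    qed
    with False IH show ?thesis by simp
  qed
qed simp

text \<open>The source and target of a test for \<open>u\<close>: each letter (a, c) of
  \<open>u\<close> contributes a to the source word and c to the target word. The common tail can be
  made long without creating mismatches.\<close>

lemma mismatches_append:
  assumes "\<And>x. x \<in> set u \<Longrightarrow> 0 < fst x \<and> fst x \<noteq> snd x"
  shows "mismatches (map snd u @ p) (map fst u @ p) = mset u"
  using assms
proof (induction u)
  case Nil
  then show ?case by (simp add: mismatches_def mismatch_def)
next
  case (Cons x u)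
  have "mismatch (snd x # map snd u @ p) (fst x # map fst u @ p) 0 = {#x#}"
    using Cons.prems[of x] by (simp add: mismatch_def)
  moreover have "mismatch (snd x # map snd u @ p) (fst x # map fst u @ p) (Suc k)
      = mismatch (map snd u @ p) (map fst u @ p) k" for k
    by (simp add: mismatch_def)
  ultimately have "mismatches (map snd (x # u) @ p) (map fst (x # u) @ p)
      = {#x#} + mismatches (map snd u @ p) (map fst u @ p)"
    unfolding mismatches_def by (simp add: sum.lessThan_Suc_shift del: sum.lessThan_Suc)
  then show ?case using Cons by simp
qed

abbreviation is_diag :: "int \<times> int \<Rightarrow> bool" where
  "is_diag x \<equiv> fst x = snd x"

definition occurrences :: "int list \<Rightarrow> int \<Rightarrow> nat" where
  "occurrences w a = length (filter (\<lambda>x. \<bar>x\<bar> = a) w)"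

lemma deriv_word_diag:
  assumes "\<forall>x\<in>set h. is_diag x \<and> 0 < fst x"
  shows "deriv_word (h @ u) g w = (\<Prod>x\<leftarrow>h. of_nat (occurrences w (fst x))) * deriv_word u g w"
  using assms
proof (induction h)
  case (Cons x h)
  obtain a where x: "x = (a, a)" "a \<noteq> 0" "0 < a" using Cons.prems by (cases x) auto
  have "deriv_word (h @ u) g w = (\<Prod>x\<leftarrow>h. of_nat (occurrences w (fst x))) * deriv_word u g w"
    by (rule Cons.IH) (use Cons.prems in auto)
  moreover have "deriv_word ((x # h) @ u) g w = of_nat (occurrences w a) * deriv_word (h @ u) g w"
    using x by (simp add: deriv_op_diag occurrences_def del: mult_cancel_left)
  ultimately show ?case by (simp only: x(1) list.map prod_list.Cons fst_conv mult.assoc)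
qed simp

lemma prod_list_count:
  fixes F :: "'a \<Rightarrow> complex"
  assumes "finite A" "set h \<subseteq> A"
  shows "(\<Prod>x\<leftarrow>h. F x) = (\<Prod>a\<in>A. F a ^ count (mset h) a)"
  using assms(2)
proof (induction h)
  case (Cons x h)
  have "(\<Prod>a\<in>A. F a ^ count (mset (x # h)) a) = (\<Prod>a\<in>A. (if a = x then F x else 1) * F a ^ count (mset h) a)"
    by (intro prod.cong) auto
  also have "\<dots> = F x * (\<Prod>a\<in>A. F a ^ count (mset h) a)"
    using assms(1) Cons.prems by (simp add: prod.distrib)
  finally show ?case using Cons by simp
qed simp

text \<open>Diagonal letters come first, so that they act on the unaltered test word and give
  polynomials in its letter counts. Odd letters precede the even off-diagonal ones, as the
  nonvanishing argument requires.\<close>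

definition basis_class :: "int \<times> int \<Rightarrow> nat" where
  "basis_class x = (if is_diag x then 0 else if snd x < 0 then 1 else 2)"

lemma normal_words_split:
  assumes "m \<in> normal_words key (\<lambda>x. snd x < 0) (qbasis n)"
    and cls: "\<forall>x\<in>qbasis n. \<forall>y\<in>qbasis n. basis_class x < basis_class y \<longrightarrow> key x < key y"
  defines "u \<equiv> filter (\<lambda>x. \<not> is_diag x) m"
  shows "m = filter is_diag m @ u" "u = filter (\<lambda>x. snd x < 0) u @ filter (\<lambda>x. \<not> snd x < 0) u"
    "distinct (filter (\<lambda>x. snd x < 0) u)" "sorted (map key u)" "sorted (map key m)" "set m \<subseteq> qbasis n"
    "set u \<subseteq> qbasis n"
proof -
  have m: "set m \<subseteq> qbasis n" "sorted (map key m)" "distinct (filter (\<lambda>x. snd x < 0) m)"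
    using assms(1) by (auto simp: normal_words_def)
  have c: "key x < key y" if "x \<in> set m" "y \<in> set m" "basis_class x < basis_class y" for x y
    using cls m(1) that by blast
  show "m = filter is_diag m @ u"
    unfolding u_def by (rule sorted_filter_split[OF m(2)]) (rule c, auto simp: basis_class_def)
  show su: "sorted (map key u)" unfolding u_def using m(2) by (rule sorted_filter)
  show "u = filter (\<lambda>x. snd x < 0) u @ filter (\<lambda>x. \<not> snd x < 0) u"
    by (rule sorted_filter_split[OF su]) (rule c, auto simp: basis_class_def u_def)
  show "distinct (filter (\<lambda>x. snd x < 0) u)"
    using distinct_filter[OF m(3), of "\<lambda>x. \<not> is_diag x"] by (simp add: u_def filter_filter conj_commute)
  show "sorted (map key m)" "set m \<subseteq> qbasis n" by fact+
  show "set u \<subseteq> qbasis n" unfolding u_def using m(1) by auto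
qed

text \<open>An argument by leading terms. Fix a nondiagonal part \<open>u0\<close> of maximal length
  among the monomials that occur, and a test word whose mismatches are exactly the letters of
  \<open>u0\<close>. Any other nondiagonal part is too short or has the wrong letters, and gives 0.
  The monomials that remain differ only in their diagonal letters; together they give a nonzero
  factor times a polynomial in the letter counts, which can be chosen freely above a bound.\<close>

lemma deriv_word_independent:
  fixes f :: "(int \<times> int) list \<Rightarrow> complex"
  assumes inj: "inj_on key (qbasis n)"
    and cls: "\<forall>x\<in>qbasis n. \<forall>y\<in>qbasis n. basis_class x < basis_class y \<longrightarrow> key x < key y"
    and fin: "finite {m. f m \<noteq> 0}"
    and nf: "{m. f m \<noteq> 0} \<subseteq> normal_words key (\<lambda>x. snd x < 0) (qbasis n)"
    and zero: "\<And>g w. (\<Sum>m\<in>{m. f m \<noteq> 0}. f m * deriv_word m g w) = 0"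
  shows "f m = 0"
proof (rule ccontr)
  assume "f m \<noteq> 0"
  define S where "S = {m. f m \<noteq> 0}"
  define up where "up = filter (\<lambda>x. \<not> is_diag x)"
  have S: "finite S" "S \<noteq> {}" using fin \<open>f m \<noteq> 0\<close> by (auto simp: S_def)
  define d where "d = Max ((\<lambda>m. length (up m)) ` S)"
  have le_d: "length (up m) \<le> d" if "m \<in> S" for m unfolding d_def using S that by auto
  have "d \<in> (\<lambda>m. length (up m)) ` S" unfolding d_def using S by (intro Max_in) auto
  then obtain m0 where m0: "m0 \<in> S" "length (up m0) = d" by auto
  define u0 where "u0 = up m0"
  have split: "m = filter is_diag m @ up m" "up m = filter (\<lambda>x. snd x < 0) (up m) @ filter (\<lambda>x. \<not> snd x < 0) (up m)"
    "distinct (filter (\<lambda>x. snd x < 0) (up m))" "sorted (map key (up m))" "sorted (map key m)" "set m \<subseteq> qbasis n"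
    "set (up m) \<subseteq> qbasis n" if "m \<in> S" for m
  proof -
    have "m \<in> normal_words key (\<lambda>x. snd x < 0) (qbasis n)" using nf that by (auto simp: S_def)
    note sp = normal_words_split[OF this cls]
    show "m = filter is_diag m @ up m" "up m = filter (\<lambda>x. snd x < 0) (up m) @ filter (\<lambda>x. \<not> snd x < 0) (up m)"
      "distinct (filter (\<lambda>x. snd x < 0) (up m))" "sorted (map key (up m))" "sorted (map key m)" "set m \<subseteq> qbasis n"
      "set (up m) \<subseteq> qbasis n"
      unfolding up_def by (fact sp)+
  qed
  define S0 where "S0 = {m \<in> S. up m = u0}"
  have S0: "finite S0" "m0 \<in> S0" using S m0 by (auto simp: S0_def u0_def)
  define A where "A = {1..int n}"
  \<comment> \<open>The exponents of the diagonal letters. With the nondiagonal part fixed they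
    determine the monomial, since it is sorted.\<close>
  define e where "e m = count (mset (map fst (filter is_diag m)))" for m :: "(int \<times> int) list"
  have inj_e: "inj_on e S0"
  proof (rule inj_onI)
    fix m m' assume mm: "m \<in> S0" "m' \<in> S0" "e m = e m'"
    have "mset (map fst (filter is_diag m)) = mset (map fst (filter is_diag m'))"
      using mm(3) unfolding e_def by (simp add: count_inject)
    then have "image_mset (\<lambda>a. (a, a)) (mset (map fst (filter is_diag m)))
        = image_mset (\<lambda>a. (a, a)) (mset (map fst (filter is_diag m')))" by simp
    moreover have "image_mset (\<lambda>a. (a, a)) (mset (map fst (filter is_diag m))) = mset (filter is_diag m)" for m :: "(int \<times> int) list"
      by (induction m) auto
    ultimately have "mset (filter is_diag m) = mset (filter is_diag m')" by simp
    moreover have "m \<in> S" "m' \<in> S" "up m = up m'" using mm by (auto simp: S0_def)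
    ultimately have "mset m = mset m'" using split(1) by (metis mset_append)
    then show "m = m'"
      using sorted_key_unique[OF split(5)[OF \<open>m \<in> S\<close>] split(5)[OF \<open>m' \<in> S\<close>]] inj
        inj_on_subset[OF inj split(6)[OF \<open>m \<in> S\<close>]] by blast
  qed
  define w0 where "w0 = map fst u0"
  have u0: "set u0 \<subseteq> qbasis n" "\<And>x. x \<in> set u0 \<Longrightarrow> 0 < fst x \<and> fst x \<noteq> snd x"
    using split(7)[OF m0(1)] unfolding u0_def up_def qbasis_def by auto
  have "f (inv_into S0 e (e m0)) = 0"
  proof (rule vanishing_multivariate_polynomial[where A = A and S = "e ` S0" and f = "\<lambda>e'. f (inv_into S0 e e')" and K = "occurrences w0"])
    show "finite A" "finite (e ` S0)" "e m0 \<in> e ` S0" using S0 by (auto simp: A_def)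
    show "e' a = 0" if e': "e' \<in> e ` S0" and a: "a \<notin> A" for e' a
    proof -
      obtain m where m: "m \<in> S" "e' = e m" using e' by (auto simp: S0_def)
      have "a \<notin> set (map fst (filter is_diag m))" using split(6)[OF m(1)] a by (auto simp: A_def qbasis_def)
      then show ?thesis unfolding m(2) e_def by (simp add: count_eq_zero_iff)
    qed
    fix N :: "int \<Rightarrow> nat" assume N: "\<And>a. occurrences w0 a \<le> N a"
    \<comment> \<open>Padding raises the number of letters with absolute value a from its count in
      \<open>w0\<close> to \<open>N a\<close>.\<close>
    define p where "p = concat (map (\<lambda>a. replicate (N a - occurrences w0 a) a) [1..int n])"
    define w where "w = w0 @ p"
    define v where "v = map snd u0 @ p"
    have occ_concat: "occurrences (concat (map (\<lambda>a. replicate (M a) a) as)) b = (if b \<in> set as then M b else 0)"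
      if "distinct as" "\<forall>a\<in>set as. 0 < a" for as M b
      using that by (induction as) (auto simp: occurrences_def filter_replicate)
    have occ: "occurrences w a = N a" if "a \<in> A" for a
    proof -
      have "occurrences w a = occurrences w0 a + occurrences p a" by (simp add: w_def occurrences_def)
      also have "occurrences p a = N a - occurrences w0 a"
        unfolding p_def by (subst occ_concat) (use that in \<open>auto simp: A_def\<close>)
      finally show ?thesis using N[of a] by simp
    qed
    have z: "0 \<notin> fst ` set u0" using u0(2) by force
    have w: "0 \<notin> set w" "length v = length w" "mismatches v w = mset u0"
      using z mismatches_append[of u0 p, OF u0(2)] by (simp_all add: w_def v_def w0_def p_def)
    \<comment> \<open>\<open>C\<close> may depend on \<open>N\<close> through the padding. It is
      nonzero for each \<open>N\<close> and is cancelled for each one separately, so that only a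
      genuine polynomial in \<open>N\<close> remains.\<close>
    define C where "C = deriv_word u0 (point v) w"
    have "deriv_word (filter (\<lambda>x. snd x < 0) u0 @ filter (\<lambda>x. \<not> snd x < 0) u0) (point v) w \<noteq> 0"
      using split(2,3)[OF m0(1)] u0(1) w unfolding u0_def[symmetric]
      by (intro deriv_word_nonzero[where n = n]) (auto simp: qbasis_def simp flip: mset_append)
    then have C: "C \<noteq> 0" unfolding C_def using split(2)[OF m0(1)] unfolding u0_def[symmetric] by simp
    have trm: "f m * deriv_word m (point v) w = f m * (\<Prod>a\<in>A. of_nat (N a) ^ e m a) * deriv_word (up m) (point v) w"
      if "m \<in> S" for m
    proof -
      have h: "\<forall>x\<in>set (filter is_diag m). is_diag x \<and> 0 < fst x"
        using split(6)[OF that] by (auto simp: qbasis_def)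
      have hA: "set (map fst (filter is_diag m)) \<subseteq> A"
        using split(6)[OF that] by (auto simp: qbasis_def A_def)
      have "deriv_word m (point v) w = (\<Prod>x\<leftarrow>filter is_diag m. of_nat (occurrences w (fst x))) * deriv_word (up m) (point v) w"
        using deriv_word_diag[OF h, of "up m" "point v" w] split(1)[OF that] by simp
      also have "(\<Prod>x\<leftarrow>filter is_diag m. of_nat (occurrences w (fst x)) :: complex)
          = (\<Prod>a\<leftarrow>map fst (filter is_diag m). of_nat (occurrences w a))"
        by (simp add: comp_def)
      also have "\<dots> = (\<Prod>a\<in>A. of_nat (occurrences w a) ^ e m a)"
        unfolding e_def by (rule prod_list_count) (use hA in \<open>auto simp: A_def\<close>)
      also have "\<dots> = (\<Prod>a\<in>A. of_nat (N a) ^ e m a)" by (intro prod.cong) (auto simp: occ)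
      finally show ?thesis by simp
    qed
    have vanish: "deriv_word (up m) (point v) w = 0" if "m \<in> S" "m \<notin> S0" for m
    proof (rule ccontr)
      assume "deriv_word (up m) (point v) w \<noteq> 0"
      then have "size (mset u0) \<le> length (up m)" "size (mset u0) = length (up m) \<longrightarrow> mset u0 = mset (up m)"
        using deriv_word_point_zero[OF split(7)[OF that(1)] w(1), of v, unfolded w(3)] by blast+
      then have "mset u0 = mset (up m)" using le_d[OF that(1)] m0(2) by (simp add: u0_def)
      moreover have "inj_on key (set u0)" using inj_on_subset[OF inj u0(1)] .
      ultimately have "u0 = up m"
        using sorted_key_unique[of key u0 "up m"] split(4)[OF m0(1)] split(4)[OF that(1)] unfolding u0_def by blast
      with that show False by (simp add: S0_def)
    qed
    have "0 = (\<Sum>m\<in>S. f m * (\<Prod>a\<in>A. of_nat (N a) ^ e m a) * deriv_word (up m) (point v) w)"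
      using zero[of "point v" w] trm unfolding S_def[symmetric] by simp
    also have "\<dots> = (\<Sum>m\<in>S0. f m * (\<Prod>a\<in>A. of_nat (N a) ^ e m a) * deriv_word (up m) (point v) w)"
      by (rule sum.mono_neutral_right) (use S vanish in \<open>auto simp: S0_def\<close>)
    also have "\<dots> = (\<Sum>m\<in>S0. f m * (\<Prod>a\<in>A. of_nat (N a) ^ e m a)) * C"
      unfolding sum_distrib_right by (intro sum.cong) (auto simp: S0_def C_def)
    finally have "(\<Sum>m\<in>S0. f m * (\<Prod>a\<in>A. of_nat (N a) ^ e m a)) = 0" using C by simp
    moreover have "(\<Sum>e'\<in>e ` S0. f (inv_into S0 e e') * (\<Prod>a\<in>A. of_nat (N a) ^ e' a))
        = (\<Sum>m\<in>S0. f m * (\<Prod>a\<in>A. of_nat (N a) ^ e m a))"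
      using inj_e by (simp add: sum.reindex inv_into_f_f)
    ultimately show "(\<Sum>e'\<in>e ` S0. f (inv_into S0 e e') * (\<Prod>a\<in>A. of_nat (N a) ^ e' a)) = 0" by simp
  qed
  then have "f m0 = 0" using inv_into_f_f[OF inj_e S0(2)] by simp
  with m0(1) show False by (simp add: S_def)
qed

text \<open>A lexicographic order: the factor \<open>K\<close> exceeds all values of an arbitrary
  injection, so the class decides first.\<close>

lemma key_exists:
  "\<exists>key :: int \<times> int \<Rightarrow> nat. inj_on key (qbasis n) \<and>
    (\<forall>x\<in>qbasis n. \<forall>y\<in>qbasis n. basis_class x < basis_class y \<longrightarrow> key x < key y)"
proof -
  obtain g :: "int \<times> int \<Rightarrow> nat" where g: "inj_on g (qbasis n)"
    using finite_imp_inj_to_nat_seg[OF finite_qbasis, of n] by blast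
  define K where "K = Suc (Max (insert 0 (g ` qbasis n)))"
  have K: "g x < K" if "x \<in> qbasis n" for x
    unfolding K_def less_Suc_eq_le using that finite_qbasis by (intro Max_ge) auto
  define key where "key x = basis_class x * K + g x" for x
  have "inj_on key (qbasis n)"
  proof (rule inj_onI)
    fix x y assume xy: "x \<in> qbasis n" "y \<in> qbasis n" "key x = key y"
    have "key x mod K = g x" "key y mod K = g y"
      unfolding key_def using K[OF xy(1)] K[OF xy(2)] by simp_all
    then have "g x = g y" unfolding xy(3) by simp
    then show "x = y" using g xy(1,2) by (auto dest: inj_onD)
  qed
  moreover have "key x < key y" if "x \<in> qbasis n" "y \<in> qbasis n" "basis_class x < basis_class y" for x y
  proof -
    have "key x < Suc (basis_class x) * K" using K[OF that(1)] by (simp add: key_def)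
    also have "\<dots> \<le> basis_class y * K" using that(3) by (intro mult_le_mono1) simp
    also have "\<dots> \<le> key y" by (simp add: key_def)
    finally show ?thesis .
  qed
  ultimately show ?thesis by blast
qed

section \<open>Straightening words into normal form\<close>

text \<open>An inductive span keeps closure arguments free of coefficient families;
  \<open>lspan_lin_ext\<close> recovers one at the end.\<close>

inductive_set lspan for A :: "('k, 'a, 'z) module_scheme" and S :: "'a set" where
  zero: "\<zero>\<^bsub>A\<^esub> \<in> lspan A S"
| add: "x \<in> S \<Longrightarrow> z \<in> lspan A S \<Longrightarrow> c \<odot>\<^bsub>A\<^esub> x \<oplus>\<^bsub>A\<^esub> z \<in> lspan A S"

context unital_algebra begin

lemma lspan_closed: "S \<subseteq> carrier A \<Longrightarrow> z \<in> lspan A S \<Longrightarrow> z \<in> carrier A"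
  by (erule lspan.induct) (simp_all add: subsetD)

lemma lspan_base: "S \<subseteq> carrier A \<Longrightarrow> x \<in> S \<Longrightarrow> x \<in> lspan A S"
  using lspan.add[OF _ lspan.zero, of x S A 1] by (simp add: subsetD)

lemma lspan_add:
  assumes "S \<subseteq> carrier A" "y \<in> lspan A S" "z \<in> lspan A S"
  shows "y \<oplus> z \<in> lspan A S"
  using assms(2)
proof (induction rule: lspan.induct)
  case zero
  then show ?case using assms lspan_closed by simp
next
  case (add x y c)
  have "c \<odot> x \<oplus> (y \<oplus> z) \<in> lspan A S" using add by (intro lspan.add)
  moreover have "x \<in> carrier A" "y \<in> carrier A" "z \<in> carrier A"
    using add assms lspan_closed[OF assms(1)] by (simp_all add: subsetD)
  ultimately show ?case by (simp add: a_assoc)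
qed

lemma lspan_smult:
  assumes "S \<subseteq> carrier A" "z \<in> lspan A S"
  shows "c \<odot> z \<in> lspan A S"
  using assms(2)
proof (induction rule: lspan.induct)
  case zero
  then show ?case by (simp add: lspan.zero)
next
  case (add x y d)
  have "x \<in> carrier A" "y \<in> carrier A"
    using add assms lspan_closed[OF assms(1)] by (simp_all add: subsetD)
  moreover have "(c * d) \<odot> x \<oplus> c \<odot> y \<in> lspan A S" using add by (intro lspan.add)
  ultimately show ?case by (simp add: smult_add_right smult_smult)
qed

lemma lspan_subset:
  assumes "S' \<subseteq> carrier A" "S \<subseteq> lspan A S'" "z \<in> lspan A S"
  shows "z \<in> lspan A S'"
  using assms(3)
  by (induction rule: lspan.induct)
    (use assms(1,2) in \<open>auto intro!: lspan.zero lspan_add lspan_smult\<close>)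

lemma lspan_mult_left:
  assumes "S \<subseteq> carrier A" "y \<in> carrier A" "z \<in> lspan A S"
  shows "y \<otimes> z \<in> lspan A ((\<otimes>) y ` S)"
  using assms(3)
proof (induction rule: lspan.induct)
  case zero
  then show ?case using assms by (simp add: lspan.zero)
next
  case (add x z c)
  have c: "x \<in> carrier A" "z \<in> carrier A"
    using add assms lspan_closed[OF assms(1)] by (simp_all add: subsetD)
  have "c \<odot> (y \<otimes> x) \<oplus> y \<otimes> z \<in> lspan A ((\<otimes>) y ` S)"
    using add by (intro lspan.add) simp_all
  with c assms(2) show ?case by (simp add: r_distr smult_mult_right)
qed

lemma lspan_mult_right:
  assumes "S \<subseteq> carrier A" "y \<in> carrier A" "z \<in> lspan A S"
  shows "z \<otimes> y \<in> lspan A ((\<lambda>x. x \<otimes> y) ` S)"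
  using assms(3)
proof (induction rule: lspan.induct)
  case zero
  then show ?case using assms by (simp add: lspan.zero)
next
  case (add x z c)
  have c: "x \<in> carrier A" "z \<in> carrier A"
    using add assms lspan_closed[OF assms(1)] by (simp_all add: subsetD)
  have "c \<odot> (x \<otimes> y) \<oplus> z \<otimes> y \<in> lspan A ((\<lambda>x. x \<otimes> y) ` S)"
    using add by (intro lspan.add) simp_all
  with c assms(2) show ?case by (simp add: l_distr smult_mult_left)
qed

lemma lspan_lin_ext:
  assumes "\<phi> \<in> W \<rightarrow> carrier A" "z \<in> lspan A (\<phi> ` W)"
  shows "\<exists>f. finite {m. f m \<noteq> 0} \<and> {m. f m \<noteq> 0} \<subseteq> W \<and> z = lin_ext A \<phi> f"
  using assms(2)
proof (induction rule: lspan.induct)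
  case zero
  show ?case by (rule exI[of _ "\<lambda>_. 0"]) simp
next
  case (add x z c)
  obtain m f where m: "m \<in> W" "x = \<phi> m" and f: "finite {m. f m \<noteq> 0}" "{m. f m \<noteq> 0} \<subseteq> W" "z = lin_ext A \<phi> f"
    using add by auto
  let ?g = "\<lambda>x. c * single m x"
  have s: "{x. ?g x \<noteq> 0} \<subseteq> {m}" "{x. single m x \<noteq> (0 :: 'k)} \<subseteq> {m}" by (auto simp: single_def)
  note fs = finite_subset[OF s(1)] finite_subset[OF s(2)]
  have pm: "\<phi> m \<in> carrier A" using assms(1) m(1) by auto
  have "lin_ext A \<phi> ?g = c \<odot> x"
    using s(2) fs pm by (subst lin_ext_smult) (auto simp: m(2))
  moreover have "lin_ext A \<phi> (\<lambda>x. ?g x + f x) = lin_ext A \<phi> ?g \<oplus> lin_ext A \<phi> f"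
    using s(1) fs f(1,2) m(1) assms(1) by (intro lin_ext_add) auto
  moreover have "{x. ?g x + f x \<noteq> 0} \<subseteq> insert m {m. f m \<noteq> 0}" using s(1) by auto
  ultimately show ?case
    using f m(1) by (intro exI[of _ "\<lambda>x. ?g x + f x"]) (auto intro: finite_subset)
qed

end

text \<open>Equal letters form a block in a sorted list, because no other letter shares their
  key.\<close>

lemma sorted_repeated_adjacent:
  assumes "sorted (map key w)" "inj_on key (set w)" "\<not> distinct (filter sq w)"
  shows "\<exists>u b v. w = u @ b # b # v \<and> sq b"
  using assms
proof (induction w)
  case (Cons c w)
  show ?case
  proof (cases "distinct (filter sq w)")
    case True
    then have c: "sq c" "c \<in> set w" using Cons.prems(3) by (auto split: if_splits)
    then obtain d v where w: "w = d # v" by (cases w) auto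
    have "key c \<le> key d" "key d \<le> key c" using Cons.prems(1) c(2) by (auto simp: w)
    then have "key c = key d" by (rule antisym)
    then have "c = d" using inj_onD[OF Cons.prems(2), of c d] by (simp add: w)
    with c(1) w show ?thesis by (intro exI[of _ "[]"]) auto
  next
    case False
    then obtain u b v where "w = u @ b # b # v" "sq b" using Cons by auto
    then show ?thesis by (intro exI[of _ "c # u"]) auto
  qed
qed simp

text \<open>Exchanges and squares hold up to linear combinations of generators, that is, up to words
  one letter shorter. The scalar \<open>s\<close> may depend on the pair, which covers the sign of
  two odd generators.\<close>

locale straightening = unital_algebra A for A :: "('k::comm_ring_1, 'a, 'z) module_scheme" (structure) +
  fixes y :: "'x \<Rightarrow> 'a" and X :: "'x set" and key :: "'x \<Rightarrow> nat" and sq :: "'x \<Rightarrow> bool"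
  assumes y: "y \<in> X \<rightarrow> carrier A" and inj_key: "inj_on key X"
    and swap: "\<And>b c. b \<in> X \<Longrightarrow> c \<in> X \<Longrightarrow> \<exists>s. \<exists>z\<in>lspan A (y ` X). y b \<otimes> y c = s \<odot> (y c \<otimes> y b) \<oplus> z"
    and square: "\<And>b. b \<in> X \<Longrightarrow> sq b \<Longrightarrow> y b \<otimes> y b \<in> lspan A (y ` X)"
begin

definition P where "P = word_prod A y"

definition below where "below d = P ` {w \<in> lists X. length w < d}"

lemma P_closed: "w \<in> lists X \<Longrightarrow> P w \<in> carrier A"
  unfolding P_def by (rule word_prod_closed[OF y])

lemma P_simps [simp]: "P [] = \<one>" "P (b # w) = y b \<otimes> P w"
  by (simp_all add: P_def)

lemma yc: "b \<in> X \<Longrightarrow> y b \<in> carrier A"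
  using y by auto

lemma below_closed: "below d \<subseteq> carrier A"
  unfolding below_def using P_closed by blast

lemma y_closed: "y ` X \<subseteq> carrier A"
  using yc by blast

lemma cons_below:
  assumes "b \<in> X" "z \<in> lspan A (below d)"
  shows "y b \<otimes> z \<in> lspan A (below (Suc d))"
proof (rule lspan_subset[OF below_closed _ lspan_mult_left[OF below_closed yc[OF assms(1)] assms(2)]])
  show "(\<otimes>) (y b) ` below d \<subseteq> lspan A (below (Suc d))"
  proof (rule image_subsetI)
    fix p assume "p \<in> below d"
    then obtain w where w: "w \<in> lists X" "length w < d" "p = P w" by (auto simp: below_def)
    have "P (b # w) \<in> below (Suc d)"
      unfolding below_def by (rule imageI) (use w(1,2) assms(1) in simp)
    then show "y b \<otimes> p \<in> lspan A (below (Suc d))"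
      unfolding w(3) P_simps(2)[symmetric] by (rule lspan_base[OF below_closed])
  qed
qed

lemma lspan_mult_word:
  assumes "z \<in> lspan A (y ` X)" "w \<in> lists X"
  shows "z \<otimes> P w \<in> lspan A (below (Suc (Suc (length w))))"
proof (rule lspan_subset[OF below_closed _ lspan_mult_right[OF y_closed P_closed[OF assms(2)] assms(1)]])
  show "(\<lambda>x. x \<otimes> P w) ` y ` X \<subseteq> lspan A (below (Suc (Suc (length w))))"
  proof (rule image_subsetI)
    fix p assume "p \<in> y ` X"
    then obtain b where b: "b \<in> X" "p = y b" by blast
    have "P (b # w) \<in> below (Suc (Suc (length w)))"
      unfolding below_def by (rule imageI) (use assms(2) b(1) in simp)
    then show "p \<otimes> P w \<in> lspan A (below (Suc (Suc (length w))))"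
      unfolding b(2) P_simps(2)[symmetric] by (rule lspan_base[OF below_closed])
  qed
qed

text \<open>Insertion sort carried out in the algebra: moving a generator past one of smaller key
  costs a scalar and an error consisting of shorter words.\<close>

lemma insort_below:
  assumes "b \<in> X" "v \<in> lists X"
  shows "\<exists>s. \<exists>z\<in>lspan A (below (Suc (length v))). y b \<otimes> P v = s \<odot> P (insort_key key b v) \<oplus> z"
  using assms(2)
proof (induction v)
  case Nil
  show ?case
    by (rule exI[of _ 1], rule bexI[of _ \<zero>]) (use yc[OF assms(1)] in \<open>simp_all add: lspan.zero\<close>)
next
  case (Cons c v)
  have c: "c \<in> X" "v \<in> lists X" using Cons by simp_all
  show ?case
  proof (cases "key b \<le> key c")
    case True
    have "y b \<otimes> P (c # v) \<in> carrier A"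
      using P_closed[of "b # c # v"] assms(1) c by simp
    then show ?thesis
      using True by (intro exI[of _ 1] bexI[of _ \<zero>]) (simp_all add: lspan.zero)
  next
    case False
    obtain s0 z0 where z0: "z0 \<in> lspan A (y ` X)" "y b \<otimes> y c = s0 \<odot> (y c \<otimes> y b) \<oplus> z0"
      using swap[OF assms(1) c(1)] by blast
    obtain s1 z1 where z1: "z1 \<in> lspan A (below (Suc (length v)))" "y b \<otimes> P v = s1 \<odot> P (insort_key key b v) \<oplus> z1"
      using Cons.IH by blast
    have iv: "insort_key key b v \<in> lists X" using assms(1) c(2) by (simp add: in_lists_conv_set set_insort_key)
    note cl = yc[OF assms(1)] yc[OF c(1)] P_closed[OF c(2)] P_closed[OF iv]
      lspan_closed[OF y_closed z0(1)] lspan_closed[OF below_closed z1(1)]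
    let ?z = "s0 \<odot> (y c \<otimes> z1) \<oplus> z0 \<otimes> P v"
    have "y b \<otimes> P (c # v) = (y b \<otimes> y c) \<otimes> P v" using cl by (simp add: m_assoc)
    also have "\<dots> = s0 \<odot> (y c \<otimes> (y b \<otimes> P v)) \<oplus> z0 \<otimes> P v"
      unfolding z0(2) using cl by (simp add: l_distr smult_mult_left m_assoc)
    also have "\<dots> = (s0 * s1) \<odot> P (c # insort_key key b v) \<oplus> ?z"
      unfolding z1(2) using cl by (simp add: r_distr smult_mult_right smult_add_right smult_smult a_assoc)
    finally have "y b \<otimes> P (c # v) = (s0 * s1) \<odot> P (insort_key key b (c # v)) \<oplus> ?z" using False by simp
    moreover have "?z \<in> lspan A (below (Suc (length (c # v))))"
      using lspan_smult[OF below_closed cons_below[OF c(1) z1(1)], of s0] lspan_mult_word[OF z0(1) c(2)]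
      by (simp add: lspan_add[OF below_closed])
    ultimately show ?thesis by blast
  qed
qed

lemma sort_below:
  assumes "w \<in> lists X"
  shows "\<exists>s. \<exists>z\<in>lspan A (below (length w)). P w = s \<odot> P (sort_key key w) \<oplus> z"
  using assms
proof (induction w)
  case Nil
  show ?case by (rule exI[of _ 1], rule bexI[of _ \<zero>]) (simp_all add: lspan.zero)
next
  case (Cons b w)
  have b: "b \<in> X" "w \<in> lists X" using Cons by simp_all
  obtain s z where z: "z \<in> lspan A (below (length w))" "P w = s \<odot> P (sort_key key w) \<oplus> z"
    using Cons.IH by blast
  have sw: "sort_key key w \<in> lists X" using b(2) by (simp add: in_lists_conv_set)
  obtain s' z' where z': "z' \<in> lspan A (below (Suc (length (sort_key key w))))"
    "y b \<otimes> P (sort_key key w) = s' \<odot> P (insort_key key b (sort_key key w)) \<oplus> z'"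
    using insort_below[OF b(1) sw] by blast
  have iv: "insort_key key b (sort_key key w) \<in> lists X" using b(1) sw by (simp add: in_lists_conv_set set_insort_key)
  note cl = yc[OF b(1)] P_closed[OF sw] P_closed[OF iv] lspan_closed[OF below_closed z(1)] lspan_closed[OF below_closed z'(1)]
  have "P (b # w) = s \<odot> (y b \<otimes> P (sort_key key w)) \<oplus> y b \<otimes> z"
    unfolding P_simps z(2) using cl by (simp add: r_distr smult_mult_right)
  also have "\<dots> = (s * s') \<odot> P (sort_key key (b # w)) \<oplus> (s \<odot> z' \<oplus> y b \<otimes> z)"
    unfolding z'(2) using cl by (simp add: smult_add_right smult_smult a_assoc)
  finally have "P (b # w) = (s * s') \<odot> P (sort_key key (b # w)) \<oplus> (s \<odot> z' \<oplus> y b \<otimes> z)" .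
  moreover have "s \<odot> z' \<oplus> y b \<otimes> z \<in> lspan A (below (length (b # w)))"
    using lspan_smult[OF below_closed z'(1), of s] cons_below[OF b(1) z(1)] by (simp add: lspan_add[OF below_closed])
  ultimately show ?case by blast
qed

lemma repeated_below:
  assumes "u @ b # b # v \<in> lists X" "sq b"
  shows "P (u @ b # b # v) \<in> lspan A (below (length (u @ b # b # v)))"
  using assms(1)
proof (induction u)
  case Nil
  then have b: "b \<in> X" "v \<in> lists X" by simp_all
  have "P (b # b # v) = (y b \<otimes> y b) \<otimes> P v" using yc[OF b(1)] P_closed[OF b(2)] by (simp add: m_assoc)
  then show ?case using lspan_mult_word[OF square[OF b(1) assms(2)] b(2)] by simp
next
  case (Cons c u)
  then show ?case using cons_below[of c "P (u @ b # b # v)" "length (u @ b # b # v)"] by simp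
qed

text \<open>Induction on the length. Modulo shorter words a word is a multiple of its sorted form,
  and that is either normal or contains a square and so reduces to shorter words itself.\<close>

lemma word_in_span:
  assumes "w \<in> lists X"
  shows "P w \<in> lspan A (P ` normal_words key sq X)"
proof -
  let ?N = "P ` normal_words key sq X"
  have N: "?N \<subseteq> carrier A" using P_closed by (auto simp: normal_words_def)
  have "below d \<subseteq> lspan A ?N" for d
  proof (induction d)
    case 0
    then show ?case by (simp add: below_def)
  next
    case (Suc d)
    show ?case
    proof
      fix p assume "p \<in> below (Suc d)"
      then obtain w where w: "w \<in> lists X" "length w < Suc d" "p = P w" by (auto simp: below_def)
      show "p \<in> lspan A ?N"
      proof (cases "length w < d")
        case True
        then show ?thesis using Suc w by (auto simp: below_def)
      next
        case False
        then have d: "length w = d" using w(2) by simp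
        obtain s z where z: "z \<in> lspan A (below d)" "P w = s \<odot> P (sort_key key w) \<oplus> z"
          using sort_below[OF w(1)] d by blast
        have sw: "sort_key key w \<in> lists X" "length (sort_key key w) = d"
          using w(1) d by (simp_all add: in_lists_conv_set)
        have "P (sort_key key w) \<in> lspan A ?N"
        proof (cases "distinct (filter sq (sort_key key w))")
          case True
          then have "sort_key key w \<in> normal_words key sq X" using sw(1) by (simp add: normal_words_def)
          then show ?thesis by (intro lspan_base[OF N] imageI)
        next
          case False
          have "inj_on key (set (sort_key key w))"
            by (rule inj_on_subset[OF inj_key]) (use w(1) in \<open>simp add: in_lists_conv_set subset_iff\<close>)
          then obtain u b v where ub: "sort_key key w = u @ b # b # v" "sq b"
            using sorted_repeated_adjacent[of key "sort_key key w" sq] False by (auto simp: sorted_sort_key)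
          have "P (sort_key key w) \<in> lspan A (below d)"
            using repeated_below[OF _ ub(2), of u v] sw unfolding ub(1) by simp
          then show ?thesis by (rule lspan_subset[OF N Suc])
        qed
        then show ?thesis
          unfolding w(3) z(2) using lspan_subset[OF N Suc z(1)] by (intro lspan_add[OF N] lspan_smult[OF N])
      qed
    qed
  qed
  then have "P w \<in> lspan A ?N" if "w \<in> lists X" for w
    using that unfolding below_def by (metis (mono_tags, lifting) imageI lessI mem_Collect_eq subsetD)
  then show ?thesis using assms .
qed

end

section \<open>The representation of the quantum superalgebra on words\<close>

definition op_algebra :: "('k::comm_ring_1, ('w \<Rightarrow> 'k) \<Rightarrow> 'w \<Rightarrow> 'k) module" where
  "op_algebra =
    \<lparr>carrier = {T. (\<forall>f g. T (\<lambda>w. f w + g w) = (\<lambda>w. T f w + T g w)) \<and> (\<forall>c f. T (\<lambda>w. c * f w) = (\<lambda>w. c * T f w))},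
     mult = (\<circ>), one = id, zero = (\<lambda>_ _. 0), add = (\<lambda>S T f w. S f w + T f w),
     module.smult = (\<lambda>c T f w. c * T f w)\<rparr>"

lemma op_algebra_simps [simp]:
  "S \<otimes>\<^bsub>op_algebra\<^esub> T = S \<circ> T" "\<one>\<^bsub>op_algebra\<^esub> = id" "\<zero>\<^bsub>op_algebra\<^esub> = (\<lambda>_ _. 0)"
  "S \<oplus>\<^bsub>op_algebra\<^esub> T = (\<lambda>f w. S f w + T f w)" "c \<odot>\<^bsub>op_algebra\<^esub> T = (\<lambda>f w. c * T f w)"
  by (simp_all add: op_algebra_def)

lemma op_algebra_carrierI:
  assumes "\<And>f g w. T (\<lambda>w. f w + g w) w = T f w + T g w" "\<And>c f w. T (\<lambda>w. c * f w) w = c * T f w"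
  shows "T \<in> carrier op_algebra"
  using assms by (auto simp: op_algebra_def fun_eq_iff)

lemma op_algebra_carrierD:
  assumes "T \<in> carrier op_algebra"
  shows "T (\<lambda>w. f w + g w) = (\<lambda>w. T f w + T g w)" "T (\<lambda>w. c * f w) = (\<lambda>w. c * T f w)"
  using assms by (auto simp: op_algebra_def)

lemma unital_algebra_op_algebra: "unital_algebra (op_algebra :: ('k::comm_ring_1, ('w \<Rightarrow> 'k) \<Rightarrow> 'w \<Rightarrow> 'k) module)"
proof -
  let ?O = "op_algebra :: ('k, ('w \<Rightarrow> 'k) \<Rightarrow> 'w \<Rightarrow> 'k) module"
  note D = op_algebra_carrierD
  have abel: "abelian_group ?O"
  proof (rule abelian_groupI)
    fix S T U assume S: "S \<in> carrier ?O" and T: "T \<in> carrier ?O"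
    show "S \<oplus>\<^bsub>?O\<^esub> T \<in> carrier ?O"
      by (rule op_algebra_carrierI) (simp_all add: D[OF S] D[OF T] algebra_simps)
  next
    show "\<zero>\<^bsub>?O\<^esub> \<in> carrier ?O" by (rule op_algebra_carrierI) simp_all
  next
    fix T assume T: "T \<in> carrier ?O"
    have "(\<lambda>f w. - T f w) \<in> carrier ?O"
      by (rule op_algebra_carrierI) (simp_all add: D[OF T] algebra_simps)
    then show "\<exists>S\<in>carrier ?O. S \<oplus>\<^bsub>?O\<^esub> T = \<zero>\<^bsub>?O\<^esub>"
      by (rule bexI[rotated]) simp
  qed (simp_all add: add_ac)
  have mon: "monoid ?O"
  proof (rule monoidI)
    fix S T U assume S: "S \<in> carrier ?O" and T: "T \<in> carrier ?O"
    show "S \<otimes>\<^bsub>?O\<^esub> T \<in> carrier ?O"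
      by (rule op_algebra_carrierI) (simp_all add: D[OF S] D[OF T])
  next
    show "\<one>\<^bsub>?O\<^esub> \<in> carrier ?O" by (rule op_algebra_carrierI) simp_all
  qed (simp_all add: comp_assoc)
  have ring: "ring ?O"
    by (rule ringI[OF abel mon]) (simp_all add: comp_def D)
  show ?thesis
  proof (intro unital_algebra.intro unital_algebra_axioms.intro)
    show "ring ?O" by (rule ring)
  next
    fix S c assume S: "S \<in> carrier ?O"
    show "c \<odot>\<^bsub>?O\<^esub> S \<in> carrier ?O"
      by (rule op_algebra_carrierI) (simp_all add: D[OF S] algebra_simps)
  qed (simp_all add: algebra_simps comp_def D)
qed

lemma op_algebra_finsum:
  fixes T :: "'i \<Rightarrow> ('w \<Rightarrow> 'k::comm_ring_1) \<Rightarrow> 'w \<Rightarrow> 'k"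
  assumes "finite I" "T \<in> I \<rightarrow> carrier op_algebra"
  shows "finsum op_algebra T I f w = (\<Sum>i\<in>I. T i f w)"
proof -
  interpret O: unital_algebra "op_algebra :: ('k, ('w \<Rightarrow> 'k) \<Rightarrow> 'w \<Rightarrow> 'k) module"
    by (rule unital_algebra_op_algebra)
  show ?thesis using assms
  proof (induction I rule: finite_induct)
    case (insert x F)
    then have "T \<in> F \<rightarrow> carrier op_algebra" "T x \<in> carrier op_algebra" by auto
    then show ?case using insert by simp
  qed simp
qed

lemma L_op_carrier: "L_op i j \<in> carrier op_algebra"
  by (rule op_algebra_carrierI) (simp_all add: L_op_def braid_op_add braid_op_smult algebra_simps)

text \<open>\<open>x\<close> is a total family because a term whose coefficient is 0 may carry an
  index pair that is not ordered. The same computation serves the quotient map and the maps to other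
  algebras.\<close>

lemma Lrel_hom:
  assumes "unital_algebra B" "h \<in> alg_hom (Lfree n) B"
    and x: "\<And>i j. x i j \<in> carrier B" "\<And>i j. (i, j) \<in> Lidx n \<Longrightarrow> h (single [(i, j)]) = x i j"
    and ij: "(i, j) \<in> Lidx n" and kl: "(k, l) \<in> Lidx n"
  shows "Lrel_lhs n i j k l \<in> carrier (Lfree n)" "Lrel_rhs n i j k l \<in> carrier (Lfree n)"
    and "h (Lrel_lhs n i j k l) =
      ((- 1) ^ (par i j * par k l) * qvar powi phi j l) \<odot>\<^bsub>B\<^esub> (x i j \<otimes>\<^bsub>B\<^esub> x k l)
      \<oplus>\<^bsub>B\<^esub> (of_bool (k \<le> j \<and> j < l) * of_int (theta i j k) * nu) \<odot>\<^bsub>B\<^esub> (x i l \<otimes>\<^bsub>B\<^esub> x k j)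
      \<oplus>\<^bsub>B\<^esub> (of_bool (i \<le> - l \<and> - l < j \<and> j \<le> - k) * of_int (theta (- i) (- j) k) * nu)
          \<odot>\<^bsub>B\<^esub> (x i (- l) \<otimes>\<^bsub>B\<^esub> x k (- j))"
    and "h (Lrel_rhs n i j k l) =
      (qvar powi phi i k) \<odot>\<^bsub>B\<^esub> (x k l \<otimes>\<^bsub>B\<^esub> x i j)
      \<oplus>\<^bsub>B\<^esub> (of_bool (k < i \<and> i \<le> l) * of_int (theta i j k) * nu) \<odot>\<^bsub>B\<^esub> (x i l \<otimes>\<^bsub>B\<^esub> x k j)
      \<oplus>\<^bsub>B\<^esub> (of_bool (- l \<le> i \<and> i < - k \<and> - k \<le> j) * of_int (theta (- i) (- j) k) * nu)
          \<odot>\<^bsub>B\<^esub> (x (- i) l \<otimes>\<^bsub>B\<^esub> x (- k) j)"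
proof -
  interpret B: unital_algebra B by fact
  interpret F: unital_algebra "Lfree n" unfolding Lfree_def by (rule unital_algebra_free_algebra)
  note hh = alg_homD[OF assms(2)]
  have mono: "Lmono a b c d \<in> carrier (Lfree n) \<and> h (Lmono a b c d) = x a b \<otimes>\<^bsub>B\<^esub> x c d"
    if "(a, b) \<in> Lidx n" "(c, d) \<in> Lidx n" for a b c d
  proof -
    have s: "single [(a, b)] \<in> carrier (Lfree n)" "single [(c, d)] \<in> carrier (Lfree n)"
      using that by (simp_all add: Lfree_def)
    have "Lmono a b c d = single [(a, b)] \<otimes>\<^bsub>Lfree n\<^esub> single [(c, d)]"
      by (simp add: Lmono_def Lfree_def free_algebra_simps)
    then show ?thesis using s hh(4)[OF s] x(2)[OF that(1)] x(2)[OF that(2)] by simp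
  qed
  \<comment> \<open>If the condition fails, the monomial may lie outside the free algebra, but its
    multiple by 0 is still the zero function.\<close>
  have tm: "(of_bool P * t * u) \<odot>\<^bsub>Lfree n\<^esub> Lmono a b c d \<in> carrier (Lfree n) \<and>
      h ((of_bool P * t * u) \<odot>\<^bsub>Lfree n\<^esub> Lmono a b c d) = (of_bool P * t * u) \<odot>\<^bsub>B\<^esub> (x a b \<otimes>\<^bsub>B\<^esub> x c d)"
    if "P \<Longrightarrow> (a, b) \<in> Lidx n \<and> (c, d) \<in> Lidx n" for P t u a b c d
  proof (cases P)
    case True
    with that show ?thesis using mono[of a b c d] hh(6) by simp
  next
    case False
    have "(0::cq) \<odot>\<^bsub>Lfree n\<^esub> Lmono a b c d = \<zero>\<^bsub>Lfree n\<^esub>"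
      by (simp add: Lfree_def free_algebra_simps)
    moreover have "h \<zero>\<^bsub>Lfree n\<^esub> = \<zero>\<^bsub>B\<^esub>"
      by (rule ring_hom_zero_minus(1)[OF F.ring_axioms B.ring_axioms hh(1)])
    ultimately show ?thesis using False x(1) by simp
  qed
  have idx: "a \<noteq> 0" "\<bar>a\<bar> \<le> int n" "- a \<noteq> 0" "\<bar>- a\<bar> \<le> int n" if "a \<in> {i, j, k, l}" for a
    using that ij kl by (auto simp: Lidx_def)
  have t: "h ((c::cq) \<odot>\<^bsub>Lfree n\<^esub> Lmono i j k l) = c \<odot>\<^bsub>B\<^esub> (x i j \<otimes>\<^bsub>B\<^esub> x k l)"
    "h (c \<odot>\<^bsub>Lfree n\<^esub> Lmono k l i j) = c \<odot>\<^bsub>B\<^esub> (x k l \<otimes>\<^bsub>B\<^esub> x i j)"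
    "c \<odot>\<^bsub>Lfree n\<^esub> Lmono i j k l \<in> carrier (Lfree n)" "c \<odot>\<^bsub>Lfree n\<^esub> Lmono k l i j \<in> carrier (Lfree n)" for c
    using mono[OF ij kl] mono[OF kl ij] by (simp_all add: hh(6))
  have t1: "k \<le> j \<and> j < l \<Longrightarrow> (i, l) \<in> Lidx n \<and> (k, j) \<in> Lidx n"
    and t2: "i \<le> - l \<and> - l < j \<and> j \<le> - k \<Longrightarrow> (i, - l) \<in> Lidx n \<and> (k, - j) \<in> Lidx n"
    and t3: "k < i \<and> i \<le> l \<Longrightarrow> (i, l) \<in> Lidx n \<and> (k, j) \<in> Lidx n"
    and t4: "- l \<le> i \<and> i < - k \<and> - k \<le> j \<Longrightarrow> (- i, l) \<in> Lidx n \<and> (- k, j) \<in> Lidx n"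
    using ij kl unfolding Lidx_def by auto
  note terms = tm[OF t1] tm[OF t2] tm[OF t3] tm[OF t4]
  show "Lrel_lhs n i j k l \<in> carrier (Lfree n)" "Lrel_rhs n i j k l \<in> carrier (Lfree n)"
    unfolding Lrel_lhs_def Lrel_rhs_def using terms t(3,4) by (auto intro!: F.a_closed)
  show "h (Lrel_lhs n i j k l) =
      ((- 1) ^ (par i j * par k l) * qvar powi phi j l) \<odot>\<^bsub>B\<^esub> (x i j \<otimes>\<^bsub>B\<^esub> x k l)
      \<oplus>\<^bsub>B\<^esub> (of_bool (k \<le> j \<and> j < l) * of_int (theta i j k) * nu) \<odot>\<^bsub>B\<^esub> (x i l \<otimes>\<^bsub>B\<^esub> x k j)
      \<oplus>\<^bsub>B\<^esub> (of_bool (i \<le> - l \<and> - l < j \<and> j \<le> - k) * of_int (theta (- i) (- j) k) * nu)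
          \<odot>\<^bsub>B\<^esub> (x i (- l) \<otimes>\<^bsub>B\<^esub> x k (- j))"
    unfolding Lrel_lhs_def using terms t F.a_closed by (simp only: hh(3))
  show "h (Lrel_rhs n i j k l) =
      (qvar powi phi i k) \<odot>\<^bsub>B\<^esub> (x k l \<otimes>\<^bsub>B\<^esub> x i j)
      \<oplus>\<^bsub>B\<^esub> (of_bool (k < i \<and> i \<le> l) * of_int (theta i j k) * nu) \<odot>\<^bsub>B\<^esub> (x i l \<otimes>\<^bsub>B\<^esub> x k j)
      \<oplus>\<^bsub>B\<^esub> (of_bool (- l \<le> i \<and> i < - k \<and> - k \<le> j) * of_int (theta (- i) (- j) k) * nu)
          \<odot>\<^bsub>B\<^esub> (x (- i) l \<otimes>\<^bsub>B\<^esub> x (- k) j)"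
    unfolding Lrel_rhs_def using terms t F.a_closed by (simp only: hh(3))
qed

section \<open>Presentation and universal property of the quantum superalgebra\<close>

lemma
  shows unital_algebra_Lfree: "unital_algebra (Lfree n)"
    and ideal_Uq_ideal: "ideal (Uq_ideal n) (Lfree n)"
    and unital_algebra_Uq: "unital_algebra (Uq n)"
    and Lgen_closed: "(i, j) \<in> Lidx n \<Longrightarrow> Lgen n i j \<in> carrier (Uq n)"
    and Lgen_inverse: "(i, i) \<in> Lidx n \<Longrightarrow> Lgen n i i \<otimes>\<^bsub>Uq n\<^esub> Lgen n (- i) (- i) = \<one>\<^bsub>Uq n\<^esub>"
    and Lgen_relation: "(i, j) \<in> Lidx n \<Longrightarrow> (k, l) \<in> Lidx n \<Longrightarrow>
      (\<And>i j. x i j \<in> carrier (Uq n)) \<Longrightarrow> (\<And>i j. (i, j) \<in> Lidx n \<Longrightarrow> Lgen n i j = x i j) \<Longrightarrow>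
      ((- 1) ^ (par i j * par k l) * qvar powi phi j l) \<odot>\<^bsub>Uq n\<^esub> (x i j \<otimes>\<^bsub>Uq n\<^esub> x k l)
      \<oplus>\<^bsub>Uq n\<^esub> (of_bool (k \<le> j \<and> j < l) * of_int (theta i j k) * nu) \<odot>\<^bsub>Uq n\<^esub> (x i l \<otimes>\<^bsub>Uq n\<^esub> x k j)
      \<oplus>\<^bsub>Uq n\<^esub> (of_bool (i \<le> - l \<and> - l < j \<and> j \<le> - k) * of_int (theta (- i) (- j) k) * nu)
          \<odot>\<^bsub>Uq n\<^esub> (x i (- l) \<otimes>\<^bsub>Uq n\<^esub> x k (- j))
      = (qvar powi phi i k) \<odot>\<^bsub>Uq n\<^esub> (x k l \<otimes>\<^bsub>Uq n\<^esub> x i j)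
      \<oplus>\<^bsub>Uq n\<^esub> (of_bool (k < i \<and> i \<le> l) * of_int (theta i j k) * nu) \<odot>\<^bsub>Uq n\<^esub> (x i l \<otimes>\<^bsub>Uq n\<^esub> x k j)
      \<oplus>\<^bsub>Uq n\<^esub> (of_bool (- l \<le> i \<and> i < - k \<and> - k \<le> j) * of_int (theta (- i) (- j) k) * nu)
          \<odot>\<^bsub>Uq n\<^esub> (x (- i) l \<otimes>\<^bsub>Uq n\<^esub> x (- k) j)"
    and Uq_lift: "unital_algebra B \<Longrightarrow> (\<And>i j. y i j \<in> carrier B) \<Longrightarrow>
      (\<And>i. (i, i) \<in> Lidx n \<Longrightarrow> y i i \<otimes>\<^bsub>B\<^esub> y (- i) (- i) = \<one>\<^bsub>B\<^esub>) \<Longrightarrow>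
      (\<And>i j k l. (i, j) \<in> Lidx n \<Longrightarrow> (k, l) \<in> Lidx n \<Longrightarrow>
        ((- 1) ^ (par i j * par k l) * qvar powi phi j l) \<odot>\<^bsub>B\<^esub> (y i j \<otimes>\<^bsub>B\<^esub> y k l)
        \<oplus>\<^bsub>B\<^esub> (of_bool (k \<le> j \<and> j < l) * of_int (theta i j k) * nu) \<odot>\<^bsub>B\<^esub> (y i l \<otimes>\<^bsub>B\<^esub> y k j)
        \<oplus>\<^bsub>B\<^esub> (of_bool (i \<le> - l \<and> - l < j \<and> j \<le> - k) * of_int (theta (- i) (- j) k) * nu)
            \<odot>\<^bsub>B\<^esub> (y i (- l) \<otimes>\<^bsub>B\<^esub> y k (- j))
        = (qvar powi phi i k) \<odot>\<^bsub>B\<^esub> (y k l \<otimes>\<^bsub>B\<^esub> y i j)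
        \<oplus>\<^bsub>B\<^esub> (of_bool (k < i \<and> i \<le> l) * of_int (theta i j k) * nu) \<odot>\<^bsub>B\<^esub> (y i l \<otimes>\<^bsub>B\<^esub> y k j)
        \<oplus>\<^bsub>B\<^esub> (of_bool (- l \<le> i \<and> i < - k \<and> - k \<le> j) * of_int (theta (- i) (- j) k) * nu)
            \<odot>\<^bsub>B\<^esub> (y (- i) l \<otimes>\<^bsub>B\<^esub> y (- k) j)) \<Longrightarrow>
      \<exists>\<rho>\<in>alg_hom (Uq n) B. \<forall>i j. (i, j) \<in> Lidx n \<longrightarrow> \<rho> (Lgen n i j) = y i j"
proof -
  let ?F = "Lfree n"
  let ?Rel = "{(Lmono i i (-i) (-i), \<one>\<^bsub>Lfree n\<^esub>) | i. (i, i) \<in> Lidx n}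
    \<union> {(Lrel_lhs n i j k l, Lrel_rhs n i j k l) | i j k l. (i, j) \<in> Lidx n \<and> (k, l) \<in> Lidx n}"
  show F': "unital_algebra ?F" unfolding Lfree_def by (rule unital_algebra_free_algebra)
  interpret F: unital_algebra ?F by (rule F')
  have s: "single [(i, j)] \<in> carrier ?F" if "(i, j) \<in> Lidx n" for i j
    using that by (simp add: Lfree_def)
  have id: "(\<lambda>x. x) \<in> alg_hom ?F ?F" by (auto simp: alg_hom_def ring_hom_def)
  have rel_closed: "Lrel_lhs n i j k l \<in> carrier ?F" "Lrel_rhs n i j k l \<in> carrier ?F"
    if "(i, j) \<in> Lidx n" "(k, l) \<in> Lidx n" for i j k l
    using Lrel_hom(1,2)[OF F' id, where x = "\<lambda>i j. if (i, j) \<in> Lidx n then single [(i, j)] else \<zero>\<^bsub>?F\<^esub>"] s that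
    by auto
  have neg: "(- i, - i) \<in> Lidx n" if "(i, i) \<in> Lidx n" for i using that by (auto simp: Lidx_def)
  have mono: "Lmono i i (- i) (- i) = single [(i, i)] \<otimes>\<^bsub>?F\<^esub> single [(- i, - i)]" for i
    by (simp add: Lmono_def Lfree_def free_algebra_simps)
  have rel: "x \<in> carrier ?F \<and> y \<in> carrier ?F" if "(x, y) \<in> ?Rel" for x y
    using that rel_closed s neg by (auto simp: mono)
  have I: "Uq_ideal n = rel_ideal ?F ?Rel" unfolding Uq_ideal_def ..
  show ideal: "ideal (Uq_ideal n) ?F" unfolding I using F.ideal_rel_ideal(1)[of ?Rel] rel by blast
  note q = F.quot_alg[OF ideal, folded Uq_def]
  show U: "unital_algebra (Uq n)" by (rule q(5))
  interpret U: unital_algebra "Uq n" by (rule U)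
  note qh = alg_homD[OF q(2)]
  show "(i, j) \<in> Lidx n \<Longrightarrow> Lgen n i j \<in> carrier (Uq n)" for i j
    unfolding Lgen_def using qh(2) s by blast
  have eq: "Uq_ideal n +>\<^bsub>?F\<^esub> x = Uq_ideal n +>\<^bsub>?F\<^esub> y" if "(x, y) \<in> ?Rel" for x y
    using F.ideal_rel_ideal(2)[of ?Rel, OF rel that] rel[OF that] q(4)[of x y] unfolding I by blast
  show "Lgen n i i \<otimes>\<^bsub>Uq n\<^esub> Lgen n (- i) (- i) = \<one>\<^bsub>Uq n\<^esub>" if "(i, i) \<in> Lidx n" for i
  proof -
    have "Uq_ideal n +>\<^bsub>?F\<^esub> Lmono i i (- i) (- i) = Uq_ideal n +>\<^bsub>?F\<^esub> \<one>\<^bsub>?F\<^esub>"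
      by (rule eq) (use that in blast)
    then show ?thesis using qh(4)[OF s[OF that] s[OF neg[OF that]]] qh(5) by (simp add: mono Lgen_def)
  qed
  show "((- 1) ^ (par i j * par k l) * qvar powi phi j l) \<odot>\<^bsub>Uq n\<^esub> (x i j \<otimes>\<^bsub>Uq n\<^esub> x k l)
      \<oplus>\<^bsub>Uq n\<^esub> (of_bool (k \<le> j \<and> j < l) * of_int (theta i j k) * nu) \<odot>\<^bsub>Uq n\<^esub> (x i l \<otimes>\<^bsub>Uq n\<^esub> x k j)
      \<oplus>\<^bsub>Uq n\<^esub> (of_bool (i \<le> - l \<and> - l < j \<and> j \<le> - k) * of_int (theta (- i) (- j) k) * nu)
          \<odot>\<^bsub>Uq n\<^esub> (x i (- l) \<otimes>\<^bsub>Uq n\<^esub> x k (- j))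
      = (qvar powi phi i k) \<odot>\<^bsub>Uq n\<^esub> (x k l \<otimes>\<^bsub>Uq n\<^esub> x i j)
      \<oplus>\<^bsub>Uq n\<^esub> (of_bool (k < i \<and> i \<le> l) * of_int (theta i j k) * nu) \<odot>\<^bsub>Uq n\<^esub> (x i l \<otimes>\<^bsub>Uq n\<^esub> x k j)
      \<oplus>\<^bsub>Uq n\<^esub> (of_bool (- l \<le> i \<and> i < - k \<and> - k \<le> j) * of_int (theta (- i) (- j) k) * nu)
          \<odot>\<^bsub>Uq n\<^esub> (x (- i) l \<otimes>\<^bsub>Uq n\<^esub> x (- k) j)"
    if ij: "(i, j) \<in> Lidx n" and kl: "(k, l) \<in> Lidx n" and x: "\<And>i j. x i j \<in> carrier (Uq n)"
      and xL: "\<And>i j. (i, j) \<in> Lidx n \<Longrightarrow> Lgen n i j = x i j" for i j k l x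
  proof -
    have e: "Uq_ideal n +>\<^bsub>?F\<^esub> Lrel_lhs n i j k l = Uq_ideal n +>\<^bsub>?F\<^esub> Lrel_rhs n i j k l"
      by (rule eq) (use ij kl in blast)
    note xL' = xL[unfolded Lgen_def]
    show ?thesis
      by (rule trans[OF Lrel_hom(3)[OF U q(2) x xL' ij kl, symmetric] trans[OF e Lrel_hom(4)[OF U q(2) x xL' ij kl]]])
  qed
  assume B: "unital_algebra B" and y: "\<And>i j. y i j \<in> carrier B"
    and inv: "\<And>i. (i, i) \<in> Lidx n \<Longrightarrow> y i i \<otimes>\<^bsub>B\<^esub> y (- i) (- i) = \<one>\<^bsub>B\<^esub>"
    and r: "\<And>i j k l. (i, j) \<in> Lidx n \<Longrightarrow> (k, l) \<in> Lidx n \<Longrightarrow>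
        ((- 1) ^ (par i j * par k l) * qvar powi phi j l) \<odot>\<^bsub>B\<^esub> (y i j \<otimes>\<^bsub>B\<^esub> y k l)
        \<oplus>\<^bsub>B\<^esub> (of_bool (k \<le> j \<and> j < l) * of_int (theta i j k) * nu) \<odot>\<^bsub>B\<^esub> (y i l \<otimes>\<^bsub>B\<^esub> y k j)
        \<oplus>\<^bsub>B\<^esub> (of_bool (i \<le> - l \<and> - l < j \<and> j \<le> - k) * of_int (theta (- i) (- j) k) * nu)
            \<odot>\<^bsub>B\<^esub> (y i (- l) \<otimes>\<^bsub>B\<^esub> y k (- j))
        = (qvar powi phi i k) \<odot>\<^bsub>B\<^esub> (y k l \<otimes>\<^bsub>B\<^esub> y i j)
        \<oplus>\<^bsub>B\<^esub> (of_bool (k < i \<and> i \<le> l) * of_int (theta i j k) * nu) \<odot>\<^bsub>B\<^esub> (y i l \<otimes>\<^bsub>B\<^esub> y k j)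
        \<oplus>\<^bsub>B\<^esub> (of_bool (- l \<le> i \<and> i < - k \<and> - k \<le> j) * of_int (theta (- i) (- j) k) * nu)
            \<odot>\<^bsub>B\<^esub> (y (- i) l \<otimes>\<^bsub>B\<^esub> y (- k) j)"
  interpret B: unital_algebra B by (rule B)
  let ?y = "\<lambda>(i, j). y i j"
  define h where "h = lin_ext B (word_prod B ?y)"
  have yc: "?y \<in> Lidx n \<rightarrow> carrier B" using y by auto
  have h: "h \<in> alg_hom ?F B" unfolding h_def Lfree_def by (rule B.free_ext_alg_hom[OF yc])
  have h1: "h (single [(i, j)]) = y i j" if "(i, j) \<in> Lidx n" for i j
    unfolding h_def using B.free_ext_single[OF yc, of "[(i, j)]"] that y by simp
  have k: "Uq_ideal n \<subseteq> a_kernel ?F B h"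
    unfolding I
  proof (rule F.rel_ideal_minimal[OF B.ring_axioms alg_homD(1)[OF h]])
    fix u v assume uv: "(u, v) \<in> ?Rel"
    have "h u = h v"
      using uv
    proof
      assume "(u, v) \<in> {(Lmono i i (-i) (-i), \<one>\<^bsub>Lfree n\<^esub>) | i. (i, i) \<in> Lidx n}"
      then obtain i where i: "(i, i) \<in> Lidx n" "u = Lmono i i (- i) (- i)" "v = \<one>\<^bsub>?F\<^esub>" by blast
      then show ?thesis
        using alg_homD(4)[OF h s[OF i(1)] s[OF neg[OF i(1)]]] alg_homD(5)[OF h] inv[OF i(1)]
        by (simp add: mono h1 neg)
    next
      assume "(u, v) \<in> {(Lrel_lhs n i j k l, Lrel_rhs n i j k l) | i j k l. (i, j) \<in> Lidx n \<and> (k, l) \<in> Lidx n}"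
      then obtain i j k l where *: "(i, j) \<in> Lidx n" "(k, l) \<in> Lidx n"
        "u = Lrel_lhs n i j k l" "v = Lrel_rhs n i j k l" by blast
      show ?thesis
        unfolding *(3,4)
        by (rule trans[OF Lrel_hom(3)[OF B h y h1 *(1,2)] trans[OF r[OF *(1,2)] Lrel_hom(4)[OF B h y h1 *(1,2), symmetric]]])
    qed
    with rel[OF uv] show "u \<in> carrier ?F \<and> v \<in> carrier ?F \<and> h u = h v" by blast
  qed
  obtain \<rho> where \<rho>: "\<rho> \<in> alg_hom (Uq n) B" "\<forall>x\<in>carrier ?F. \<rho> (Uq_ideal n +>\<^bsub>?F\<^esub> x) = h x"
    using quot_alg_lift[OF F' B ideal h k, folded Uq_def] by (elim bexE)
  have "\<rho> (Lgen n i j) = y i j" if "(i, j) \<in> Lidx n" for i j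
    using bspec[OF \<rho>(2) s[OF that]] h1[OF that] by (simp add: Lgen_def)
  with \<rho>(1) show "\<exists>\<rho>\<in>alg_hom (Uq n) B. \<forall>i j. (i, j) \<in> Lidx n \<longrightarrow> \<rho> (Lgen n i j) = y i j"
    by (intro bexI[of _ \<rho>]) auto
qed

lemma word_representation:
  "\<exists>\<rho>\<in>alg_hom (Uq n) op_algebra. \<forall>i j. (i, j) \<in> Lidx n \<longrightarrow> \<rho> (Lgen n i j) = L_op i j"
proof (rule Uq_lift[OF unital_algebra_op_algebra L_op_carrier])
    fix i assume "(i, i) \<in> Lidx n"
    then show "L_op i i \<otimes>\<^bsub>op_algebra\<^esub> L_op (- i) (- i) = \<one>\<^bsub>op_algebra\<^esub>"
      by (simp add: Lidx_def fun_eq_iff L_op_inverse)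
  next
    fix i j k l assume "(i, j) \<in> Lidx n" "(k, l) \<in> Lidx n"
    then have "i \<noteq> 0" "j \<noteq> 0" "k \<noteq> 0" "l \<noteq> 0" "i \<le> j" "k \<le> l" by (auto simp: Lidx_def)
    note rel = L_op_relation[OF this]
    show "((- 1) ^ (par i j * par k l) * qvar powi phi j l) \<odot>\<^bsub>op_algebra\<^esub> (L_op i j \<otimes>\<^bsub>op_algebra\<^esub> L_op k l)
        \<oplus>\<^bsub>op_algebra\<^esub> (of_bool (k \<le> j \<and> j < l) * of_int (theta i j k) * nu) \<odot>\<^bsub>op_algebra\<^esub> (L_op i l \<otimes>\<^bsub>op_algebra\<^esub> L_op k j)
        \<oplus>\<^bsub>op_algebra\<^esub> (of_bool (i \<le> - l \<and> - l < j \<and> j \<le> - k) * of_int (theta (- i) (- j) k) * nu)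
            \<odot>\<^bsub>op_algebra\<^esub> (L_op i (- l) \<otimes>\<^bsub>op_algebra\<^esub> L_op k (- j))
        = (qvar powi phi i k) \<odot>\<^bsub>op_algebra\<^esub> (L_op k l \<otimes>\<^bsub>op_algebra\<^esub> L_op i j)
        \<oplus>\<^bsub>op_algebra\<^esub> (of_bool (k < i \<and> i \<le> l) * of_int (theta i j k) * nu) \<odot>\<^bsub>op_algebra\<^esub> (L_op i l \<otimes>\<^bsub>op_algebra\<^esub> L_op k j)
        \<oplus>\<^bsub>op_algebra\<^esub> (of_bool (- l \<le> i \<and> i < - k \<and> - k \<le> j) * of_int (theta (- i) (- j) k) * nu)
            \<odot>\<^bsub>op_algebra\<^esub> (L_op (- i) l \<otimes>\<^bsub>op_algebra\<^esub> L_op (- k) j)"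
      by (rule ext, rule ext) (simp only: op_algebra_simps o_apply, rule rel)
qed

section \<open>Tensor products of algebras\<close>

text \<open>The free abelian group behind a tensor product is an integral monoid ring; this allows
  \<open>lin_ext\<close> to map it to an arbitrary ring.\<close>

lemma ring_int_algebra:
  assumes "ring A"
  shows "unital_algebra (as_algebra A (\<lambda>c::int. \<lambda>x. [c] \<cdot>\<^bsub>A\<^esub> x))"
proof -
  interpret ring A by fact
  show ?thesis
    by (intro unital_algebra.intro ring_as_algebra assms unital_algebra_axioms.intro)
      (simp_all add: add.int_pow_mult add.int_pow_mult_distrib a_comm add.int_pow_pow mult.commute add_pow_ldistr_int add_pow_rdistr_int)
qed

locale tensor_setup = B: ring B + U: ring U
  for B :: "('r, 'b, 'z) module_scheme" and U :: "('r, 'u, 'y) module_scheme" +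
  fixes R :: "'r set"
  assumes smultB: "r \<in> R \<Longrightarrow> b \<in> carrier B \<Longrightarrow> r \<odot>\<^bsub>B\<^esub> b \<in> carrier B"
    and smultU: "r \<in> R \<Longrightarrow> u \<in> carrier U \<Longrightarrow> r \<odot>\<^bsub>U\<^esub> u \<in> carrier U"
begin

abbreviation "F \<equiv> (monoid_algebra (B \<times>\<times> U) :: (int, 'b \<times> 'u \<Rightarrow> int) module)"
abbreviation "T \<equiv> tensor_alg R B U"
abbreviation "I \<equiv> tensor_ideal R B U"
abbreviation "pt \<equiv> pure_tensor R B U"

lemma monoid_prod: "monoid (B \<times>\<times> U)"
  by (intro DirProd_monoid B.monoid_axioms U.monoid_axioms)

lemma unital_algebra_F: "unital_algebra F"
  by (rule monoid.unital_algebra_monoid_algebra[OF monoid_prod])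

sublocale F: unital_algebra F by (rule unital_algebra_F)

definition tensor_rels :: "(('b \<times> 'u \<Rightarrow> int) \<times> ('b \<times> 'u \<Rightarrow> int)) set" where
  "tensor_rels =
  {(single (b \<oplus>\<^bsub>B\<^esub> b', u), single (b, u) \<oplus>\<^bsub>F\<^esub> single (b', u)) | b b' u.
      b \<in> carrier B \<and> b' \<in> carrier B \<and> u \<in> carrier U}
  \<union> {(single (b, u \<oplus>\<^bsub>U\<^esub> u'), single (b, u) \<oplus>\<^bsub>F\<^esub> single (b, u')) | b u u'.
      b \<in> carrier B \<and> u \<in> carrier U \<and> u' \<in> carrier U}
  \<union> {(single (r \<odot>\<^bsub>B\<^esub> b, u), single (b, r \<odot>\<^bsub>U\<^esub> u)) | r b u.
      r \<in> R \<and> b \<in> carrier B \<and> u \<in> carrier U}"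

lemma tensor_ideal_eq: "I = rel_ideal F tensor_rels"
  unfolding tensor_ideal_def tensor_rels_def Let_def ..

lemma single_F: "b \<in> carrier B \<Longrightarrow> u \<in> carrier U \<Longrightarrow> single (b, u) \<in> carrier F"
  by (intro single_carrier) simp

lemma tensor_rels_closed: "(x, y) \<in> tensor_rels \<Longrightarrow> x \<in> carrier F \<and> y \<in> carrier F"
  unfolding tensor_rels_def by (auto intro!: single_F smultB smultU F.a_closed)

lemma ideal_tensor_ideal: "ideal I F"
  unfolding tensor_ideal_eq using F.ideal_rel_ideal(1)[of tensor_rels] tensor_rels_closed by blast

lemma tensor_ring: "ring T"
  unfolding tensor_alg_def Let_def by (intro ring_as_algebra ideal.quotient_is_ring[OF ideal_tensor_ideal])

lemma tensor_hom: "(+>\<^bsub>F\<^esub>) I \<in> ring_hom F T"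
  unfolding tensor_alg_def Let_def ring_hom_as_algebra by (rule ideal.rcos_ring_hom[OF ideal_tensor_ideal])

lemma tensor_carrier: "carrier T = (+>\<^bsub>F\<^esub>) I ` carrier F"
  by (auto simp: tensor_alg_def Let_def FactRing_def A_RCOSETS_def')

lemma tensor_eq:
  assumes "(x, y) \<in> tensor_rels" shows "I +>\<^bsub>F\<^esub> x = I +>\<^bsub>F\<^esub> y"
proof -
  have "x \<ominus>\<^bsub>F\<^esub> y \<in> I"
    unfolding tensor_ideal_eq using F.ideal_rel_ideal(2)[of tensor_rels, OF _ assms] tensor_rels_closed by blast
  then show ?thesis
    using tensor_rels_closed[OF assms] F.quot_alg(4)[OF ideal_tensor_ideal, of x y] by blast
qed

lemma pt_closed: "b \<in> carrier B \<Longrightarrow> u \<in> carrier U \<Longrightarrow> pt b u \<in> carrier T"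
  unfolding pure_tensor_def tensor_carrier using single_F by blast

lemma pt_add_left:
  assumes "b \<in> carrier B" "b' \<in> carrier B" "u \<in> carrier U"
  shows "pt (b \<oplus>\<^bsub>B\<^esub> b') u = pt b u \<oplus>\<^bsub>T\<^esub> pt b' u"
proof -
  have "pt (b \<oplus>\<^bsub>B\<^esub> b') u = I +>\<^bsub>F\<^esub> (single (b, u) \<oplus>\<^bsub>F\<^esub> single (b', u))"
    unfolding pure_tensor_def by (rule tensor_eq) (use assms in \<open>unfold tensor_rels_def, blast\<close>)
  then show ?thesis
    unfolding pure_tensor_def using ring_hom_add[OF tensor_hom single_F[OF assms(1,3)] single_F[OF assms(2,3)]] by simp
qed

lemma pt_add_right:
  assumes "b \<in> carrier B" "u \<in> carrier U" "u' \<in> carrier U"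
  shows "pt b (u \<oplus>\<^bsub>U\<^esub> u') = pt b u \<oplus>\<^bsub>T\<^esub> pt b u'"
proof -
  have "pt b (u \<oplus>\<^bsub>U\<^esub> u') = I +>\<^bsub>F\<^esub> (single (b, u) \<oplus>\<^bsub>F\<^esub> single (b, u'))"
    unfolding pure_tensor_def by (rule tensor_eq) (use assms in \<open>unfold tensor_rels_def, blast\<close>)
  then show ?thesis
    unfolding pure_tensor_def using ring_hom_add[OF tensor_hom single_F[OF assms(1,2)] single_F[OF assms(1,3)]] by simp
qed

lemma pt_balanced:
  assumes "r \<in> R" "b \<in> carrier B" "u \<in> carrier U"
  shows "pt (r \<odot>\<^bsub>B\<^esub> b) u = pt b (r \<odot>\<^bsub>U\<^esub> u)"
  unfolding pure_tensor_def by (rule tensor_eq) (use assms in \<open>unfold tensor_rels_def, blast\<close>)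

lemma pt_mult:
  assumes "b \<in> carrier B" "b' \<in> carrier B" "u \<in> carrier U" "u' \<in> carrier U"
  shows "pt b u \<otimes>\<^bsub>T\<^esub> pt b' u' = pt (b \<otimes>\<^bsub>B\<^esub> b') (u \<otimes>\<^bsub>U\<^esub> u')"
  unfolding pure_tensor_def
  using ring_hom_mult[OF tensor_hom single_F[OF assms(1,3)] single_F[OF assms(2,4)]] by (simp add: single_mult)

lemma pt_one: "pt \<one>\<^bsub>B\<^esub> \<one>\<^bsub>U\<^esub> = \<one>\<^bsub>T\<^esub>"
  unfolding pure_tensor_def using ring_hom_one[OF tensor_hom] by (simp add: monoid_algebra_simps)

lemma pt_right_hom: "pt \<one>\<^bsub>B\<^esub> \<in> ring_hom U T"
  by (rule ring_hom_memI) (simp_all add: pt_closed pt_add_right pt_mult pt_one)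

lemma tensor_smult: "b \<odot>\<^bsub>T\<^esub> t = pt b \<one>\<^bsub>U\<^esub> \<otimes>\<^bsub>T\<^esub> t"
  by (simp add: tensor_alg_def Let_def)

text \<open>Balancing moves b = r 1 to the other side: the tensor of b and u equals that of 1 and r
  u. Such tensors are closed under sums and integer multiples, so they exhaust the product.\<close>

lemma pt_right_surj:
  assumes B: "\<And>b. b \<in> carrier B \<Longrightarrow> \<exists>r\<in>R. b = r \<odot>\<^bsub>B\<^esub> \<one>\<^bsub>B\<^esub>"
  shows "carrier T = pt \<one>\<^bsub>B\<^esub> ` carrier U"
proof
  show "pt \<one>\<^bsub>B\<^esub> ` carrier U \<subseteq> carrier T" using pt_closed by auto
next
  interpret T: ring T by (rule tensor_ring)
  let ?S = "pt \<one>\<^bsub>B\<^esub> ` carrier U"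
  note h = tensor_hom
  have "I +>\<^bsub>F\<^esub> f \<in> ?S" if "f \<in> carrier F" for f
    using that
  proof (induction rule: monoid_algebra_induct)
    case zero
    have z: "pt \<one>\<^bsub>B\<^esub> \<zero>\<^bsub>U\<^esub> = \<zero>\<^bsub>T\<^esub>"
      by (rule ring_hom_zero_minus(1)[OF U.ring_axioms tensor_ring pt_right_hom])
    have "I +>\<^bsub>F\<^esub> (\<lambda>_. 0) = \<zero>\<^bsub>T\<^esub>"
      using ring_hom_zero_minus(1)[OF F.ring_axioms tensor_ring h] by (simp add: monoid_algebra_simps(3))
    then show ?case unfolding z[symmetric] by (rule image_eqI[OF _ U.zero_closed])
  next
    case (add c m f)
    obtain b u where m: "m = (b, u)" "b \<in> carrier B" "u \<in> carrier U"
      using add(1) by auto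
    obtain r where r: "r \<in> R" "b = r \<odot>\<^bsub>B\<^esub> \<one>\<^bsub>B\<^esub>" using B[OF m(2)] by blast
    define v where "v = r \<odot>\<^bsub>U\<^esub> u"
    have v: "v \<in> carrier U" unfolding v_def by (rule smultU[OF r(1) m(3)])
    have p: "pt b u = pt \<one>\<^bsub>B\<^esub> v" unfolding r(2) v_def by (rule pt_balanced) (use r m in auto)
    have s: "single m \<in> carrier F" using m single_F by simp
    have c: "I +>\<^bsub>F\<^esub> (c \<odot>\<^bsub>F\<^esub> single m) \<in> ?S"
    proof (induction c rule: int_induct[of _ 0])
      case base
      have "I +>\<^bsub>F\<^esub> (0 \<odot>\<^bsub>F\<^esub> single m) = \<zero>\<^bsub>T\<^esub>"
        using ring_hom_zero_minus(1)[OF F.ring_axioms tensor_ring h] F.smult_0[OF s] by simp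
      then show ?case
        unfolding ring_hom_zero_minus(1)[OF U.ring_axioms tensor_ring pt_right_hom, symmetric]
        by (rule image_eqI[OF _ U.zero_closed])
    next
      case (step1 i)
      then obtain w where w: "w \<in> carrier U" "I +>\<^bsub>F\<^esub> (i \<odot>\<^bsub>F\<^esub> single m) = pt \<one>\<^bsub>B\<^esub> w" by auto
      have "I +>\<^bsub>F\<^esub> ((i + 1) \<odot>\<^bsub>F\<^esub> single m) = pt \<one>\<^bsub>B\<^esub> w \<oplus>\<^bsub>T\<^esub> pt b u"
        using ring_hom_add[OF h F.smult_closed[OF s] s] w s
        by (simp only: F.smult_add_left F.smult_1) (simp add: m pure_tensor_def)
      also have "\<dots> = pt \<one>\<^bsub>B\<^esub> (w \<oplus>\<^bsub>U\<^esub> v)" unfolding p using w v by (simp add: pt_add_right)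
      finally show ?case by (rule image_eqI[OF _ U.a_closed[OF w(1) v]])
    next
      case (step2 i)
      then obtain w where w: "w \<in> carrier U" "I +>\<^bsub>F\<^esub> (i \<odot>\<^bsub>F\<^esub> single m) = pt \<one>\<^bsub>B\<^esub> w" by auto
      have "(i - 1) \<odot>\<^bsub>F\<^esub> single m = i \<odot>\<^bsub>F\<^esub> single m \<ominus>\<^bsub>F\<^esub> single m"
        unfolding a_minus_def using F.smult_add_left[OF s, of i "- 1"] F.smult_uminus_left[OF s, of 1] s by simp
      then have "I +>\<^bsub>F\<^esub> ((i - 1) \<odot>\<^bsub>F\<^esub> single m) = pt \<one>\<^bsub>B\<^esub> w \<ominus>\<^bsub>T\<^esub> pt b u"
        using ring_hom_zero_minus(3)[OF F.ring_axioms tensor_ring h F.smult_closed[OF s] s] w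
        by (simp add: m pure_tensor_def)
      also have "\<dots> = pt \<one>\<^bsub>B\<^esub> (w \<ominus>\<^bsub>U\<^esub> v)" unfolding p
        using ring_hom_zero_minus(3)[OF U.ring_axioms tensor_ring pt_right_hom w(1) v] by simp
      finally show ?case by (rule image_eqI[OF _ U.minus_closed[OF w(1) v]])
    qed
    obtain w w' where w: "w \<in> carrier U" "I +>\<^bsub>F\<^esub> (c \<odot>\<^bsub>F\<^esub> single m) = pt \<one>\<^bsub>B\<^esub> w"
      "w' \<in> carrier U" "I +>\<^bsub>F\<^esub> f = pt \<one>\<^bsub>B\<^esub> w'"
      using c add by auto
    have "(\<lambda>x. c * single m x + f x) = c \<odot>\<^bsub>F\<^esub> single m \<oplus>\<^bsub>F\<^esub> f"
      by (simp add: monoid_algebra_simps)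
    then have "I +>\<^bsub>F\<^esub> (\<lambda>x. c * single m x + f x) = pt \<one>\<^bsub>B\<^esub> w \<oplus>\<^bsub>T\<^esub> pt \<one>\<^bsub>B\<^esub> w'"
      using ring_hom_add[OF h F.smult_closed[OF s] add(2)] w by simp
    also have "\<dots> = pt \<one>\<^bsub>B\<^esub> (w \<oplus>\<^bsub>U\<^esub> w')" using w by (simp add: pt_add_right)
    finally show ?case by (rule image_eqI[OF _ U.a_closed[OF w(1,3)]])
  qed
  then show "carrier T \<subseteq> ?S" unfolding tensor_carrier by blast
qed

text \<open>\<open>comm\<close> is what makes (b, u) \<mapsto> \<alpha> b \<beta> u multiplicative.
  The three families of relations then follow from additivity on either side and from
  \<open>bal\<close>.\<close>

lemma tensor_lift:
  assumes A: "ring A" and \<alpha>: "\<alpha> \<in> ring_hom B A" and \<beta>: "\<beta> \<in> ring_hom U A"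
    and comm: "\<And>b u. b \<in> carrier B \<Longrightarrow> u \<in> carrier U \<Longrightarrow> \<beta> u \<otimes>\<^bsub>A\<^esub> \<alpha> b = \<alpha> b \<otimes>\<^bsub>A\<^esub> \<beta> u"
    and bal: "\<And>r b u. r \<in> R \<Longrightarrow> b \<in> carrier B \<Longrightarrow> u \<in> carrier U \<Longrightarrow>
      \<alpha> (r \<odot>\<^bsub>B\<^esub> b) \<otimes>\<^bsub>A\<^esub> \<beta> u = \<alpha> b \<otimes>\<^bsub>A\<^esub> \<beta> (r \<odot>\<^bsub>U\<^esub> u)"
  shows "\<exists>g\<in>ring_hom T A. \<forall>b\<in>carrier B. \<forall>u\<in>carrier U. g (pt b u) = \<alpha> b \<otimes>\<^bsub>A\<^esub> \<beta> u"
proof -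
  interpret A: ring A by (rule A)
  define A' where "A' = as_algebra A (\<lambda>c::int. \<lambda>x. [c] \<cdot>\<^bsub>A\<^esub> x)"
  have A'alg: "unital_algebra A'" unfolding A'_def by (rule ring_int_algebra[OF A])
  interpret A': unital_algebra A' by (rule A'alg)
  have A's: "carrier A' = carrier A" "\<one>\<^bsub>A'\<^esub> = \<one>\<^bsub>A\<^esub>" "x \<otimes>\<^bsub>A'\<^esub> y = x \<otimes>\<^bsub>A\<^esub> y" "x \<oplus>\<^bsub>A'\<^esub> y = x \<oplus>\<^bsub>A\<^esub> y" for x y
    by (simp_all add: A'_def)
  note ac = ring_hom_closed[OF \<alpha>] and bc = ring_hom_closed[OF \<beta>]
  define \<phi> where "\<phi> = (\<lambda>(b, u). \<alpha> b \<otimes>\<^bsub>A\<^esub> \<beta> u)"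
  have c: "\<phi> \<in> carrier (B \<times>\<times> U) \<rightarrow> carrier A'"
    by (auto simp: \<phi>_def A's intro!: A.m_closed ac bc)
  have m: "\<phi> (x \<otimes>\<^bsub>B \<times>\<times> U\<^esub> y) = \<phi> x \<otimes>\<^bsub>A'\<^esub> \<phi> y"
    if "x \<in> carrier (B \<times>\<times> U)" "y \<in> carrier (B \<times>\<times> U)" for x y
  proof -
    obtain b u b' u' where xy: "x = (b, u)" "y = (b', u')" by (cases x, cases y) auto
    with that have car: "b \<in> carrier B" "u \<in> carrier U" "b' \<in> carrier B" "u' \<in> carrier U" by auto
    have "\<phi> (x \<otimes>\<^bsub>B \<times>\<times> U\<^esub> y) = \<alpha> b \<otimes>\<^bsub>A\<^esub> \<alpha> b' \<otimes>\<^bsub>A\<^esub> (\<beta> u \<otimes>\<^bsub>A\<^esub> \<beta> u')"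
      using car by (simp add: xy \<phi>_def ring_hom_mult[OF \<alpha>] ring_hom_mult[OF \<beta>])
    also have "\<dots> = \<alpha> b \<otimes>\<^bsub>A\<^esub> (\<alpha> b' \<otimes>\<^bsub>A\<^esub> \<beta> u) \<otimes>\<^bsub>A\<^esub> \<beta> u'"
      using car ac bc by (simp add: A.m_assoc)
    also have "\<alpha> b' \<otimes>\<^bsub>A\<^esub> \<beta> u = \<beta> u \<otimes>\<^bsub>A\<^esub> \<alpha> b'" using comm car by simp
    also have "\<alpha> b \<otimes>\<^bsub>A\<^esub> (\<beta> u \<otimes>\<^bsub>A\<^esub> \<alpha> b') \<otimes>\<^bsub>A\<^esub> \<beta> u' = \<phi> x \<otimes>\<^bsub>A'\<^esub> \<phi> y"
      using car ac bc by (simp add: A.m_assoc A's xy \<phi>_def)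
    finally show ?thesis .
  qed
  have one: "\<phi> \<one>\<^bsub>B \<times>\<times> U\<^esub> = \<one>\<^bsub>A'\<^esub>"
    by (simp add: \<phi>_def A's ring_hom_one[OF \<alpha>] ring_hom_one[OF \<beta>])
  define h where "h = lin_ext A' \<phi>"
  have h: "h \<in> alg_hom F A'" unfolding h_def
    by (rule A'.lin_ext_alg_hom[OF monoid_prod c one m])
  have h1: "h (single (b, u)) = \<alpha> b \<otimes>\<^bsub>A\<^esub> \<beta> u" if "b \<in> carrier B" "u \<in> carrier U" for b u
  proof -
    have "\<phi> (b, u) \<in> carrier A'" using c that by auto
    then have "h (single (b, u)) = \<phi> (b, u)" unfolding h_def by (rule A'.lin_ext_single)
    then show ?thesis by (simp add: \<phi>_def)
  qed
  have k: "I \<subseteq> a_kernel F A' h"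
    unfolding tensor_ideal_eq
  proof (rule F.rel_ideal_minimal[OF A'.ring_axioms alg_homD(1)[OF h]])
    fix x y assume xy: "(x, y) \<in> tensor_rels"
    have "h x = h y"
    proof -
      from xy have "(\<exists>b b' u. (x = single (b \<oplus>\<^bsub>B\<^esub> b', u) \<and> y = single (b, u) \<oplus>\<^bsub>F\<^esub> single (b', u)) \<and>
            b \<in> carrier B \<and> b' \<in> carrier B \<and> u \<in> carrier U)
        \<or> (\<exists>b u u'. (x = single (b, u \<oplus>\<^bsub>U\<^esub> u') \<and> y = single (b, u) \<oplus>\<^bsub>F\<^esub> single (b, u')) \<and>
            b \<in> carrier B \<and> u \<in> carrier U \<and> u' \<in> carrier U)
        \<or> (\<exists>r b u. (x = single (r \<odot>\<^bsub>B\<^esub> b, u) \<and> y = single (b, r \<odot>\<^bsub>U\<^esub> u)) \<and>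
            r \<in> R \<and> b \<in> carrier B \<and> u \<in> carrier U)"
        unfolding tensor_rels_def by (simp only: Un_iff mem_Collect_eq prod.inject disj_assoc)
      then show ?thesis
      proof (elim disjE exE conjE)
        fix b b' u
        assume c: "b \<in> carrier B" "b' \<in> carrier B" "u \<in> carrier U"
          and e: "x = single (b \<oplus>\<^bsub>B\<^esub> b', u)" "y = single (b, u) \<oplus>\<^bsub>F\<^esub> single (b', u)"
        show ?thesis unfolding e alg_homD(3)[OF h single_F[OF c(1,3)] single_F[OF c(2,3)]]
          using c by (simp add: h1 A's ring_hom_add[OF \<alpha>] A.l_distr ac bc)
      next
        fix b u u'
        assume c: "b \<in> carrier B" "u \<in> carrier U" "u' \<in> carrier U"
          and e: "x = single (b, u \<oplus>\<^bsub>U\<^esub> u')" "y = single (b, u) \<oplus>\<^bsub>F\<^esub> single (b, u')"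
        show ?thesis unfolding e alg_homD(3)[OF h single_F[OF c(1,2)] single_F[OF c(1,3)]]
          using c by (simp add: h1 A's ring_hom_add[OF \<beta>] A.r_distr ac bc)
      next
        fix r b u
        assume c: "r \<in> R" "b \<in> carrier B" "u \<in> carrier U"
          and e: "x = single (r \<odot>\<^bsub>B\<^esub> b, u)" "y = single (b, r \<odot>\<^bsub>U\<^esub> u)"
        show ?thesis unfolding e using c by (simp add: h1 smultB smultU bal)
      qed
    qed
    then show "x \<in> carrier F \<and> y \<in> carrier F \<and> h x = h y" using tensor_rels_closed[OF xy] by blast
  qed
  obtain g where g: "g \<in> alg_hom (quot_alg F I) A'" "\<forall>x\<in>carrier F. g (I +>\<^bsub>F\<^esub> x) = h x"
    using quot_alg_lift[OF unital_algebra_F A'alg ideal_tensor_ideal h k] by (elim bexE)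
  have "ring_hom (quot_alg F I) A' = ring_hom T A"
    unfolding quot_alg_def tensor_alg_def Let_def A'_def ring_hom_as_algebra ..
  then have "g \<in> ring_hom T A" using alg_homD(1)[OF g(1)] by simp
  moreover have "g (pt b u) = \<alpha> b \<otimes>\<^bsub>A\<^esub> \<beta> u" if "b \<in> carrier B" "u \<in> carrier U" for b u
    unfolding pure_tensor_def using bspec[OF g(2) single_F[OF that]] h1[OF that] by simp
  ultimately show ?thesis by (intro bexI[of _ g]) auto
qed

end

section \<open>The residue field\<close>

lemma A1_alg_simps:
  "carrier A1_alg = A1" "x \<otimes>\<^bsub>A1_alg\<^esub> y = x * y" "\<one>\<^bsub>A1_alg\<^esub> = 1" "\<zero>\<^bsub>A1_alg\<^esub> = 0"
  "x \<oplus>\<^bsub>A1_alg\<^esub> y = x + y" "r \<odot>\<^bsub>A1_alg\<^esub> x = r * x"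
  by (simp_all add: A1_alg_def)

lemma ring_A1_alg: "ring A1_alg"
proof (intro ringI abelian_groupI monoidI, unfold A1_alg_simps)
  fix x assume "x \<in> A1"
  then show "\<exists>y\<in>A1. y + x = 0" by (intro bexI[of _ "- x"]) (simp_all add: A1_closed)
qed (simp_all add: A1_closed algebra_simps)

interpretation A1: ring A1_alg by (rule ring_A1_alg)

lemma A1_alg_uminus: "x \<in> A1 \<Longrightarrow> \<ominus>\<^bsub>A1_alg\<^esub> x = - x"
  using A1.minus_equality[of "- x" x] by (simp add: A1_alg_simps A1_closed)

lemma ideal_J1: "ideal J1 A1_alg"
proof (rule idealI[OF ring_A1_alg])
  show "subgroup J1 (add_monoid A1_alg)"
  proof (rule A1.add.subgroupI)
    show "J1 \<subseteq> carrier A1_alg" by (auto simp: J1_iff A1_alg_simps)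
    show "J1 \<noteq> {}" using J1_iff[of 0] by (auto simp: A1_0 ev1_0)
    show "\<ominus>\<^bsub>A1_alg\<^esub> x \<in> J1" if "x \<in> J1" for x
      using that by (simp add: J1_iff A1_alg_uminus A1_closed ev1_simps)
    show "x \<oplus>\<^bsub>A1_alg\<^esub> y \<in> J1" if "x \<in> J1" "y \<in> J1" for x y
      using that by (simp add: J1_iff A1_alg_simps A1_closed ev1_simps)
  qed
qed (auto simp: J1_iff A1_alg_simps A1_closed ev1_simps)

definition residue :: "cq \<Rightarrow> cq set" where
  "residue x = J1 +>\<^bsub>A1_alg\<^esub> x"

lemma residue_eq_iff: "x \<in> A1 \<Longrightarrow> y \<in> A1 \<Longrightarrow> residue x = residue y \<longleftrightarrow> ev1 x = ev1 y"
  using A1.quotient_eq_iff_same_a_r_cos[OF ideal_J1, of x y]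
  by (auto simp: residue_def A1_alg_simps a_minus_def A1_alg_uminus J1_iff A1_closed ev1_simps)

lemma residue_const_eq: "x \<in> A1 \<Longrightarrow> residue_const (ev1 x) = residue x"
  unfolding residue_const_def residue_def[symmetric] by (simp add: residue_eq_iff A1_const ev1_const)

lemma ring_residue_field: "ring residue_field"
  unfolding residue_field_def quot_alg_def by (intro ring_as_algebra ideal.quotient_is_ring[OF ideal_J1])

lemma carrier_residue_field: "carrier residue_field = residue ` A1"
  unfolding residue_field_def quot_alg_def residue_def
  by (auto simp: FactRing_def A_RCOSETS_def' A1_alg_simps)

lemma residue_hom: "residue \<in> ring_hom A1_alg residue_field"
  unfolding residue_field_def quot_alg_def ring_hom_as_algebra residue_def by (rule ideal.rcos_ring_hom[OF ideal_J1])

lemma residue_arith: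
  "x \<in> A1 \<Longrightarrow> y \<in> A1 \<Longrightarrow> residue x \<oplus>\<^bsub>residue_field\<^esub> residue y = residue (x + y)"
  "x \<in> A1 \<Longrightarrow> y \<in> A1 \<Longrightarrow> residue x \<otimes>\<^bsub>residue_field\<^esub> residue y = residue (x * y)"
  "\<one>\<^bsub>residue_field\<^esub> = residue 1"
  using ring_hom_add[OF residue_hom, of x y] ring_hom_mult[OF residue_hom, of x y] ring_hom_one[OF residue_hom]
  by (simp_all add: A1_alg_simps)

lemma residue_smult:
  assumes "r \<in> A1" "x \<in> A1"
  shows "r \<odot>\<^bsub>residue_field\<^esub> residue x = residue (r * x)"
proof -
  interpret J1: ideal J1 A1_alg by (rule ideal_J1)
  have "residue (r * y) = residue (r * x)" if "y \<in> residue x" for y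
  proof -
    have y: "y \<in> A1"
      using that assms J1.a_elemrcos_carrier[of x y] by (auto simp: residue_def A1_alg_simps)
    have "residue y = residue x"
      using J1.a_repr_independence'[of y x] that assms by (simp add: residue_def A1_alg_simps)
    then show ?thesis using assms y by (simp add: residue_eq_iff A1_closed ev1_simps)
  qed
  moreover have "x \<in> residue x"
    using J1.a_rcos_self[of x] assms by (simp add: residue_def A1_alg_simps)
  ultimately have "(\<Union>y\<in>residue x. residue (r * y)) = residue (r * x)" by blast
  then show ?thesis
    by (simp add: residue_field_def quot_alg_def A1_alg_simps residue_def)
qed

text \<open>Evaluation at q = 1 on residue classes, inverse to \<open>residue_const\<close>.\<close>

definition residue_ev :: "cq set \<Rightarrow> complex" where
  "residue_ev b = ev1 (SOME x. x \<in> A1 \<and> residue x = b)"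

lemma residue_ev: "x \<in> A1 \<Longrightarrow> residue_ev (residue x) = ev1 x"
  unfolding residue_ev_def
  using someI[of "\<lambda>y. y \<in> A1 \<and> residue y = residue x" x] residue_eq_iff by blast

section \<open>The integral form\<close>

context unital_algebra begin

lemma gen_subalgebra_closed:
  assumes "S \<subseteq> carrier A" shows "gen_subalgebra R A S \<subseteq> carrier A"
proof
  fix x assume "x \<in> gen_subalgebra R A S"
  then show "x \<in> carrier A"
    by induction (use assms in auto)
qed

lemma gen_subalgebra_uminus:
  "S \<subseteq> carrier A \<Longrightarrow> - 1 \<in> R \<Longrightarrow> x \<in> gen_subalgebra R A S \<Longrightarrow> \<ominus> x \<in> gen_subalgebra R A S"
  using smult_minus1[of x] gen_subalgebra_closed[of S R] gen_subalgebra.scale[of "- 1" R x A S] by auto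

lemma ring_gen_subalgebra:
  assumes "S \<subseteq> carrier A" "- 1 \<in> R"
  shows "ring (A\<lparr>carrier := gen_subalgebra R A S\<rparr>)"
  by (rule subring_is_ring, rule subringI)
    (use gen_subalgebra_closed[OF assms(1)] gen_subalgebra_uminus[OF assms] in
      \<open>auto intro: gen_subalgebra.intros\<close>)

lemma gen_subalgebra_mono:
  assumes "S \<subseteq> gen_subalgebra R A S'" shows "gen_subalgebra R A S \<subseteq> gen_subalgebra R A S'"
proof
  fix x assume "x \<in> gen_subalgebra R A S"
  then show "x \<in> gen_subalgebra R A S'"
    by induction (use assms in \<open>auto intro: gen_subalgebra.intros\<close>)
qed

end

lemma Lidx_uminus: "(i, i) \<in> Lidx n \<Longrightarrow> (- i, - i) \<in> Lidx n"
  by (auto simp: Lidx_def)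

text \<open>The inverse of L_ii is again a generator, the one for - i. Hence negative powers are
  products of generators too, and \<open>P\<close> has to be closed only under products.\<close>

lemma qpow_induct:
  assumes "P \<one>\<^bsub>Uq n\<^esub>"
    and "\<And>x y. x \<in> carrier (Uq n) \<Longrightarrow> y \<in> carrier (Uq n) \<Longrightarrow> P x \<Longrightarrow> P y \<Longrightarrow> P (x \<otimes>\<^bsub>Uq n\<^esub> y)"
    and "\<And>i. (i, i) \<in> Lidx n \<Longrightarrow> P (Lgen n i i)"
  shows "qpow n h \<in> carrier (Uq n)" "P (qpow n h)"
proof -
  interpret U: unital_algebra "Uq n" by (rule unital_algebra_Uq)
  let ?P = "\<lambda>x. x \<in> carrier (Uq n) \<and> P x"
  have nat_pow: "?P (x [^]\<^bsub>Uq n\<^esub> (k::nat))" if "?P x" for x k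
    by (induction k) (use that assms(1,2) in auto)
  have int_pow: "?P (Lgen n (int i) (int i) [^]\<^bsub>Uq n\<^esub> (z::int))" if i: "i \<in> {1..n}" for i z
  proof -
    let ?x = "Lgen n (int i) (int i)" and ?y = "Lgen n (- int i) (- int i)"
    have idx: "(int i, int i) \<in> Lidx n" "(- int i, - int i) \<in> Lidx n" using i by (auto simp: Lidx_def)
    have x: "?P ?x" "?P ?y" using idx Lgen_closed assms(3) by auto
    have xy: "?x \<otimes>\<^bsub>Uq n\<^esub> ?y = \<one>\<^bsub>Uq n\<^esub>" "?y \<otimes>\<^bsub>Uq n\<^esub> ?x = \<one>\<^bsub>Uq n\<^esub>"
      using Lgen_inverse[OF idx(1)] Lgen_inverse[OF idx(2)] by simp_all
    have pow: "?x [^]\<^bsub>Uq n\<^esub> (k::nat) \<otimes>\<^bsub>Uq n\<^esub> ?y [^]\<^bsub>Uq n\<^esub> k = \<one>\<^bsub>Uq n\<^esub>"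
      "?y [^]\<^bsub>Uq n\<^esub> (k::nat) \<otimes>\<^bsub>Uq n\<^esub> ?x [^]\<^bsub>Uq n\<^esub> k = \<one>\<^bsub>Uq n\<^esub>" for k
    proof -
      have "?x [^]\<^bsub>Uq n\<^esub> (k::nat) \<otimes>\<^bsub>Uq n\<^esub> ?y [^]\<^bsub>Uq n\<^esub> k = (?x \<otimes>\<^bsub>Uq n\<^esub> ?y) [^]\<^bsub>Uq n\<^esub> k"
        "?y [^]\<^bsub>Uq n\<^esub> (k::nat) \<otimes>\<^bsub>Uq n\<^esub> ?x [^]\<^bsub>Uq n\<^esub> k = (?y \<otimes>\<^bsub>Uq n\<^esub> ?x) [^]\<^bsub>Uq n\<^esub> k"
        by (rule U.pow_mult_distrib[symmetric]; simp only: x xy)+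
      then show "?x [^]\<^bsub>Uq n\<^esub> (k::nat) \<otimes>\<^bsub>Uq n\<^esub> ?y [^]\<^bsub>Uq n\<^esub> k = \<one>\<^bsub>Uq n\<^esub>"
        "?y [^]\<^bsub>Uq n\<^esub> (k::nat) \<otimes>\<^bsub>Uq n\<^esub> ?x [^]\<^bsub>Uq n\<^esub> k = \<one>\<^bsub>Uq n\<^esub>"
        by (simp_all only: xy U.nat_pow_one)
    qed
    have inv: "inv\<^bsub>Uq n\<^esub> (?x [^]\<^bsub>Uq n\<^esub> (k::nat)) = ?y [^]\<^bsub>Uq n\<^esub> k" for k
      using U.inv_unique'[of "?x [^]\<^bsub>Uq n\<^esub> k" "?y [^]\<^bsub>Uq n\<^esub> k"] pow x by simp
    have eq: "?x [^]\<^bsub>Uq n\<^esub> z = (if z < 0 then ?y [^]\<^bsub>Uq n\<^esub> nat (- z) else ?x [^]\<^bsub>Uq n\<^esub> nat z)"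
      using inv[of "nat (- z)"] by (simp add: int_pow_def nat_pow_def)
    show ?thesis unfolding eq using nat_pow[OF x(1), of "nat z"] nat_pow[OF x(2), of "nat (- z)"] by (cases "z < 0") (simp_all only: if_True if_False simp_thms)
  qed
  have "?P (foldr (\<lambda>i x. (Lgen n (int i) (int i) [^]\<^bsub>Uq n\<^esub> h i) \<otimes>\<^bsub>Uq n\<^esub> x) xs \<one>\<^bsub>Uq n\<^esub>)"
    if "set xs \<subseteq> {1..n}" for xs
    using that
  proof (induction xs)
    case Nil
    show ?case using assms(1) by simp
  next
    case (Cons i xs)
    then have "i \<in> {1..n}" "set xs \<subseteq> {1..n}" by auto
    with int_pow[OF this(1), of "h i"] Cons.IH show ?case
      unfolding foldr.simps o_apply by (intro conjI U.m_closed assms(2)) simp_all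
  qed
  moreover have "set [1..<Suc n] \<subseteq> {1..n}" by auto
  ultimately show "qpow n h \<in> carrier (Uq n)" "P (qpow n h)"
    unfolding qpow_def by blast+
qed

definition UA1_gens :: "nat \<Rightarrow> ((int \<times> int) list \<Rightarrow> cq) set set" where
  "UA1_gens n = e_gen n ` {1..int n - 1} \<union> ebar_gen n ` {1..int n - 1}
    \<union> f_gen n ` {1..int n - 1} \<union> fbar_gen n ` {1..int n - 1}
    \<union> qpow n ` Pvee n \<union> kbar_gen n ` {1..int n} \<union> qpow_diff n ` Pvee n"

lemma UA1_gens_closed: "UA1_gens n \<subseteq> carrier (Uq n)"
proof -
  interpret U: unital_algebra "Uq n" by (rule unital_algebra_Uq)
  have q: "qpow n h \<in> carrier (Uq n)" for h
    by (rule qpow_induct(1)[where P = "\<lambda>_. True"]) auto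
  have L: "Lgen n i j \<in> carrier (Uq n)" if "i \<noteq> 0" "j \<noteq> 0" "\<bar>i\<bar> \<le> int n" "\<bar>j\<bar> \<le> int n" "i \<le> j" for i j
    using that by (intro Lgen_closed) (auto simp: Lidx_def)
  show ?thesis
    unfolding UA1_gens_def
    by (auto simp: e_gen_def f_gen_def ebar_gen_def fbar_gen_def kbar_gen_def qpow_diff_def
        intro!: U.smult_closed L q U.minus_closed)
qed

lemma UA1_simps:
  "carrier (UA1 n) = gen_subalgebra A1 (Uq n) (UA1_gens n)"
  "x \<otimes>\<^bsub>UA1 n\<^esub> y = x \<otimes>\<^bsub>Uq n\<^esub> y" "x \<oplus>\<^bsub>UA1 n\<^esub> y = x \<oplus>\<^bsub>Uq n\<^esub> y"
  "\<one>\<^bsub>UA1 n\<^esub> = \<one>\<^bsub>Uq n\<^esub>" "\<zero>\<^bsub>UA1 n\<^esub> = \<zero>\<^bsub>Uq n\<^esub>" "c \<odot>\<^bsub>UA1 n\<^esub> x = c \<odot>\<^bsub>Uq n\<^esub> x"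
  by (simp_all add: UA1_def UA1_gens_def)

lemma UA1_eq: "UA1 n = (Uq n)\<lparr>carrier := gen_subalgebra A1 (Uq n) (UA1_gens n)\<rparr>"
  by (simp add: UA1_def UA1_gens_def)

lemma ring_UA1: "ring (UA1 n)"
  unfolding UA1_eq
  by (rule unital_algebra.ring_gen_subalgebra[OF unital_algebra_Uq UA1_gens_closed])
    (simp add: A1_closed)

section \<open>The classical limit\<close>

interpretation CL: tensor_setup residue_field "UA1 n" A1 for n
proof (intro tensor_setup.intro ring_residue_field ring_UA1 tensor_setup_axioms.intro)
  show "r \<odot>\<^bsub>residue_field\<^esub> b \<in> carrier residue_field" if "r \<in> A1" "b \<in> carrier residue_field" for r b
    using that by (auto simp: carrier_residue_field residue_smult A1_closed)
  show "r \<odot>\<^bsub>UA1 n\<^esub> u \<in> carrier (UA1 n)" if "r \<in> A1" "u \<in> carrier (UA1 n)" for r u n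
    using that by (auto simp: UA1_simps intro: gen_subalgebra.scale)
qed

text \<open>The specialization u \<mapsto> 1 \<otimes> u, through which the classical limit is
  handled from here on.\<close>

definition spec1 :: "nat \<Rightarrow> ((int \<times> int) list \<Rightarrow> cq) set
    \<Rightarrow> (cq set \<times> ((int \<times> int) list \<Rightarrow> cq) set \<Rightarrow> int) set" where
  "spec1 n = pure_tensor A1 residue_field (UA1 n) \<one>\<^bsub>residue_field\<^esub>"

lemma classical_limit_eq:
  "classical_limit n = as_algebra (CL.T n) (\<lambda>c t. residue_const c \<odot>\<^bsub>CL.T n\<^esub> t)"
  by (simp add: classical_limit_def Let_def)

lemma spec1_hom: "spec1 n \<in> ring_hom (UA1 n) (classical_limit n)"
  unfolding classical_limit_eq ring_hom_as_algebra spec1_def by (rule CL.pt_right_hom)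

text \<open>\<open>A1\<close> maps onto the residue field, so every scalar can be moved into the
  right-hand factor.\<close>

lemma spec1_surj: "carrier (classical_limit n) = spec1 n ` carrier (UA1 n)"
  unfolding classical_limit_eq as_algebra_simps spec1_def
proof (rule CL.pt_right_surj)
  show "\<exists>r\<in>A1. b = r \<odot>\<^bsub>residue_field\<^esub> \<one>\<^bsub>residue_field\<^esub>" if "b \<in> carrier residue_field" for b
    using that by (auto simp: carrier_residue_field residue_arith(3) residue_smult A1_closed)
qed

lemma residue_closed: "x \<in> A1 \<Longrightarrow> residue x \<in> carrier residue_field"
  by (simp add: carrier_residue_field)

lemma spec1_smult_aux:
  assumes "u \<in> carrier (UA1 n)"
  shows "c \<odot>\<^bsub>classical_limit n\<^esub> spec1 n u = pure_tensor A1 residue_field (UA1 n) (residue_const c) u"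
proof -
  interpret RF: ring residue_field by (rule ring_residue_field)
  have c: "residue_const c \<in> carrier residue_field"
    using residue_const_eq[of "Fract [:c:] 1"] by (simp add: A1_const ev1_const residue_closed)
  show ?thesis
    unfolding classical_limit_eq as_algebra_simps CL.tensor_smult spec1_def
    using assms c by (simp add: CL.pt_mult)
qed

lemma spec1_smult:
  assumes "r \<in> A1" "u \<in> carrier (UA1 n)"
  shows "spec1 n (r \<odot>\<^bsub>Uq n\<^esub> u) = ev1 r \<odot>\<^bsub>classical_limit n\<^esub> spec1 n u"
proof -
  have "spec1 n (r \<odot>\<^bsub>Uq n\<^esub> u) = pure_tensor A1 residue_field (UA1 n) (r \<odot>\<^bsub>residue_field\<^esub> \<one>\<^bsub>residue_field\<^esub>) u"
    unfolding spec1_def UA1_simps(6)[symmetric]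
    by (rule CL.pt_balanced[symmetric]) (use assms in \<open>auto simp: residue_arith residue_closed A1_closed\<close>)
  also have "r \<odot>\<^bsub>residue_field\<^esub> \<one>\<^bsub>residue_field\<^esub> = residue_const (ev1 r)"
    using assms by (simp add: residue_arith(3) residue_smult residue_const_eq A1_closed)
  finally show ?thesis by (simp add: spec1_smult_aux assms)
qed

text \<open>Every element has the form \<open>spec1 n u\<close>, and complex scalars act through
  residue classes of constants, so the axioms become identities between pure tensors.\<close>

lemma unital_algebra_classical_limit: "unital_algebra (classical_limit n)"
proof -
  let ?C = "classical_limit n" and ?p = "pure_tensor A1 residue_field (UA1 n)"
  have ring: "ring ?C" unfolding classical_limit_eq by (intro ring_as_algebra CL.tensor_ring)
  have ops: "x \<oplus>\<^bsub>?C\<^esub> y = x \<oplus>\<^bsub>CL.T n\<^esub> y" "x \<otimes>\<^bsub>?C\<^esub> y = x \<otimes>\<^bsub>CL.T n\<^esub> y" for x y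
    by (simp_all add: classical_limit_eq)
  have rc: "residue_const c = residue (Fract [:c:] 1)" for c
    using residue_const_eq[OF A1_const, of c] by (simp add: ev1_const)
  have c: "residue_const c \<in> carrier residue_field" for c
    unfolding rc by (rule residue_closed[OF A1_const])
  have rca: "residue_const (c + d) = residue_const c \<oplus>\<^bsub>residue_field\<^esub> residue_const d"
    "residue_const (c * d) = residue_const c \<otimes>\<^bsub>residue_field\<^esub> residue_const d"
    "residue_const 1 = \<one>\<^bsub>residue_field\<^esub>" for c d
  proof -
    have "Fract [:c + d:] 1 = Fract [:c:] 1 + Fract [:d:] 1" "Fract [:c * d:] 1 = Fract [:c:] 1 * Fract [:d:] 1"
      "Fract [:1:] 1 = (1 :: cq)" for c d :: complex
      by (simp_all add: One_fract_def one_pCons mult.commute)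
    then show "residue_const (c + d) = residue_const c \<oplus>\<^bsub>residue_field\<^esub> residue_const d"
      "residue_const (c * d) = residue_const c \<otimes>\<^bsub>residue_field\<^esub> residue_const d"
      "residue_const 1 = \<one>\<^bsub>residue_field\<^esub>" for c d
      unfolding rc by (simp_all only: residue_arith A1_const)
  qed
  have one: "\<one>\<^bsub>residue_field\<^esub> \<in> carrier residue_field"
    by (simp add: residue_arith residue_closed A1_closed)
  interpret RF: ring residue_field by (rule ring_residue_field)
  have comm: "residue_const c \<otimes>\<^bsub>residue_field\<^esub> \<one>\<^bsub>residue_field\<^esub> = \<one>\<^bsub>residue_field\<^esub> \<otimes>\<^bsub>residue_field\<^esub> residue_const c" for c
    using c by simp
  note sm = spec1_smult_aux
  have smt: "c' \<odot>\<^bsub>?C\<^esub> ?p (residue_const c) u = ?p (residue_const (c' * c)) u" if "u \<in> carrier (UA1 n)" for c c' u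
    unfolding classical_limit_eq as_algebra_simps CL.tensor_smult
    using that c by (simp add: CL.pt_mult rca(2))
  show ?thesis
  proof (intro unital_algebra.intro ring unital_algebra_axioms.intro, unfold spec1_surj)
    fix x c d assume "x \<in> spec1 n ` carrier (UA1 n)"
    then obtain u where u: "x = spec1 n u" "u \<in> carrier (UA1 n)" by blast
    obtain r where r: "r \<in> A1" "ev1 r = c" using A1_const ev1_const by blast
    have "r \<odot>\<^bsub>UA1 n\<^esub> u \<in> carrier (UA1 n)" by (rule CL.smultU[OF r(1) u(2)])
    then show "c \<odot>\<^bsub>?C\<^esub> x \<in> spec1 n ` carrier (UA1 n)"
      unfolding u(1) r(2)[symmetric] spec1_smult[OF r(1) u(2), symmetric] UA1_simps by blast
    show "(c + d) \<odot>\<^bsub>?C\<^esub> x = c \<odot>\<^bsub>?C\<^esub> x \<oplus>\<^bsub>?C\<^esub> d \<odot>\<^bsub>?C\<^esub> x"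
      using u(2) c by (simp add: u(1) sm rca CL.pt_add_left ops)
    show "c \<odot>\<^bsub>?C\<^esub> (d \<odot>\<^bsub>?C\<^esub> x) = (c * d) \<odot>\<^bsub>?C\<^esub> x"
      using u(2) by (simp add: u(1) sm smt)
    show "1 \<odot>\<^bsub>?C\<^esub> x = x"
      unfolding u(1) sm[OF u(2)] rca(3) by (simp add: spec1_def)
  next
    fix x y c assume "x \<in> spec1 n ` carrier (UA1 n)" "y \<in> spec1 n ` carrier (UA1 n)"
    then obtain u v where u: "x = spec1 n u" "u \<in> carrier (UA1 n)" "y = spec1 n v" "v \<in> carrier (UA1 n)" by blast
    have a: "spec1 n u \<oplus>\<^bsub>?C\<^esub> spec1 n v = spec1 n (u \<oplus>\<^bsub>UA1 n\<^esub> v)"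
      "spec1 n u \<otimes>\<^bsub>?C\<^esub> spec1 n v = spec1 n (u \<otimes>\<^bsub>UA1 n\<^esub> v)"
      using u by (simp_all add: ring_hom_add[OF spec1_hom] ring_hom_mult[OF spec1_hom])
    show "c \<odot>\<^bsub>?C\<^esub> (x \<oplus>\<^bsub>?C\<^esub> y) = c \<odot>\<^bsub>?C\<^esub> x \<oplus>\<^bsub>?C\<^esub> c \<odot>\<^bsub>?C\<^esub> y"
      unfolding u(1,3) a(1) sm[OF u(2)] sm[OF u(4)] sm[OF ring.ring_simprules(1)[OF ring_UA1 u(2,4)]]
      unfolding ops by (rule CL.pt_add_right[OF c u(2,4)])
    show "c \<odot>\<^bsub>?C\<^esub> x \<otimes>\<^bsub>?C\<^esub> y = c \<odot>\<^bsub>?C\<^esub> (x \<otimes>\<^bsub>?C\<^esub> y)"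
      unfolding u(1,3) a(2) sm[OF u(2)] sm[OF ring.ring_simprules(5)[OF ring_UA1 u(2,4)]]
      unfolding ops spec1_def CL.pt_mult[OF c one u(2,4)] by (simp add: c)
    show "x \<otimes>\<^bsub>?C\<^esub> (c \<odot>\<^bsub>?C\<^esub> y) = c \<odot>\<^bsub>?C\<^esub> (x \<otimes>\<^bsub>?C\<^esub> y)"
      unfolding u(1,3) a(2) sm[OF u(4)] sm[OF ring.ring_simprules(5)[OF ring_UA1 u(2,4)]]
      unfolding ops spec1_def CL.pt_mult[OF one c u(2,4)] by (simp add: c)
  qed
qed

text \<open>The residue field is sent to the scalars of \<open>A\<close> by evaluation at q = 1.
  These commute with everything, and \<open>sm\<close> is the balancing condition.\<close>

lemma classical_limit_lift:
  assumes A: "unital_algebra A" and \<beta>: "\<beta> \<in> ring_hom (UA1 n) A"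
    and sm: "\<And>r u. r \<in> A1 \<Longrightarrow> u \<in> carrier (UA1 n) \<Longrightarrow> \<beta> (r \<odot>\<^bsub>Uq n\<^esub> u) = ev1 r \<odot>\<^bsub>A\<^esub> \<beta> u"
  shows "\<exists>g\<in>alg_hom (classical_limit n) A. \<forall>u\<in>carrier (UA1 n). g (spec1 n u) = \<beta> u"
proof -
  interpret A: unital_algebra A by (rule A)
  interpret RF: ring residue_field by (rule ring_residue_field)
  define \<alpha> where "\<alpha> b = residue_ev b \<odot>\<^bsub>A\<^esub> \<one>\<^bsub>A\<^esub>" for b
  note bc = ring_hom_closed[OF \<beta>]
  have \<alpha>: "\<alpha> \<in> ring_hom residue_field A"
  proof (rule ring_hom_memI)
    fix b b' assume "b \<in> carrier residue_field" "b' \<in> carrier residue_field"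
    then obtain x y where "b = residue x" "x \<in> A1" "b' = residue y" "y \<in> A1" by (auto simp: carrier_residue_field)
    then show "\<alpha> (b \<otimes>\<^bsub>residue_field\<^esub> b') = \<alpha> b \<otimes>\<^bsub>A\<^esub> \<alpha> b'" "\<alpha> (b \<oplus>\<^bsub>residue_field\<^esub> b') = \<alpha> b \<oplus>\<^bsub>A\<^esub> \<alpha> b'"
      by (simp_all add: \<alpha>_def residue_arith residue_ev A1_closed ev1_simps A.smult_add_left
          A.smult_mult_left A.smult_smult)
  qed (simp_all add: \<alpha>_def residue_arith residue_ev A1_closed ev1_simps)
  have comm: "\<beta> u \<otimes>\<^bsub>A\<^esub> \<alpha> b = \<alpha> b \<otimes>\<^bsub>A\<^esub> \<beta> u" if "u \<in> carrier (UA1 n)" for b u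
    using bc[OF that] by (simp add: \<alpha>_def A.smult_mult_left A.smult_mult_right)
  have bal: "\<alpha> (r \<odot>\<^bsub>residue_field\<^esub> b) \<otimes>\<^bsub>A\<^esub> \<beta> u = \<alpha> b \<otimes>\<^bsub>A\<^esub> \<beta> (r \<odot>\<^bsub>UA1 n\<^esub> u)"
    if r: "r \<in> A1" and b: "b \<in> carrier residue_field" and u: "u \<in> carrier (UA1 n)" for r b u
  proof -
    obtain x where x: "b = residue x" "x \<in> A1" using b by (auto simp: carrier_residue_field)
    show ?thesis
      using r x(2) bc[OF u] sm[OF r u]
      by (simp add: x(1) \<alpha>_def residue_smult residue_ev A1_closed ev1_simps UA1_simps(6)
          A.smult_mult_left A.smult_smult mult.commute)
  qed
  obtain g where g: "g \<in> ring_hom (CL.T n) A"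
    "\<forall>b\<in>carrier residue_field. \<forall>u\<in>carrier (UA1 n). g (pure_tensor A1 residue_field (UA1 n) b u) = \<alpha> b \<otimes>\<^bsub>A\<^esub> \<beta> u"
  proof -
    have "\<exists>g\<in>ring_hom (CL.T n) A. \<forall>b\<in>carrier residue_field. \<forall>u\<in>carrier (UA1 n).
        g (pure_tensor A1 residue_field (UA1 n) b u) = \<alpha> b \<otimes>\<^bsub>A\<^esub> \<beta> u"
      by (rule CL.tensor_lift[OF A.ring_axioms \<alpha> \<beta>]) (rule comm bal; assumption)+
    then show thesis using that by (elim bexE)
  qed
  have gs: "g (pure_tensor A1 residue_field (UA1 n) (residue x) u) = ev1 x \<odot>\<^bsub>A\<^esub> \<beta> u"
    if "x \<in> A1" "u \<in> carrier (UA1 n)" for x u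
    using bspec[OF bspec[OF g(2) residue_closed[OF that(1)]] that(2)] bc[OF that(2)] that
    by (simp add: \<alpha>_def residue_ev A.smult_mult_left)
  have g1: "g (spec1 n u) = \<beta> u" if "u \<in> carrier (UA1 n)" for u
    using gs[OF A1_1 that] bc[OF that] by (simp add: spec1_def residue_arith(3) ev1_1)
  have "g \<in> alg_hom (classical_limit n) A"
    unfolding alg_hom_def
  proof (intro CollectI conjI allI ballI)
    show "g \<in> ring_hom (classical_limit n) A"
      unfolding classical_limit_eq ring_hom_as_algebra by (rule g(1))
    fix c x assume "x \<in> carrier (classical_limit n)"
    then obtain u where u: "x = spec1 n u" "u \<in> carrier (UA1 n)" unfolding spec1_surj by blast
    show "g (c \<odot>\<^bsub>classical_limit n\<^esub> x) = c \<odot>\<^bsub>A\<^esub> g x"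
      unfolding u(1) spec1_smult_aux[OF u(2)] g1[OF u(2)]
      using gs[OF A1_const u(2), of c] residue_const_eq[OF A1_const, of c] by (simp add: ev1_const)
  qed
  then show ?thesis using g1 by (intro bexI[of _ g]) auto
qed

section \<open>Reduced generators of the integral form\<close>

context unital_algebra begin

lemma smult_left_cancel:
  fixes c d :: 'k
  assumes "d * c = 1" "x \<in> carrier A" "y \<in> carrier A" "c \<odot> x = c \<odot> y"
  shows "x = y"
proof -
  have "d \<odot> (c \<odot> x) = d \<odot> (c \<odot> y)" by (simp only: assms(4))
  then show ?thesis using assms(1-3) by (simp add: smult_smult)
qed

lemma add_cancel: "x \<in> carrier A \<Longrightarrow> z \<in> carrier A \<Longrightarrow> x \<oplus> z \<oplus> \<ominus> x = z"
  by (simp add: a_comm[of x z] a_assoc r_neg)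

text \<open>Intended for v = nu, with \<open>a\<close>, \<open>b\<close>, \<open>x\<close> the
  reduced generators at (i, j), (j, l), (i, l) and \<open>d\<close> the generator at (j, j). Every
  term carries two factors v, and the invertibility of \<open>d\<close> isolates x.\<close>

lemma commutator_solve:
  assumes c: "a \<in> carrier A" "b \<in> carrier A" "x \<in> carrier A" "d \<in> carrier A" "e \<in> carrier A"
    and de: "d \<otimes> e = \<one>" and t: "t * t = 1" and v: "v' * v = 1"
    and rel: "s \<odot> ((v \<odot> a) \<otimes> (v \<odot> b)) \<oplus> (t * v) \<odot> ((v \<odot> x) \<otimes> d) = (v \<odot> b) \<otimes> (v \<odot> a)"
  shows "x = t \<odot> ((b \<otimes> a \<oplus> (- s) \<odot> (a \<otimes> b)) \<otimes> e)"
proof -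
  have "v \<odot> (v \<odot> (s \<odot> (a \<otimes> b) \<oplus> t \<odot> (x \<otimes> d))) = v \<odot> (v \<odot> (b \<otimes> a))"
    using rel c by (simp add: smult_mult_left smult_mult_right smult_smult smult_add_right mult_ac)
  note e1 = this
  have e2: "v \<odot> (s \<odot> (a \<otimes> b) \<oplus> t \<odot> (x \<otimes> d)) = v \<odot> (b \<otimes> a)"
    by (rule smult_left_cancel[OF v _ _ e1]) (use c in simp_all)
  have eq: "s \<odot> (a \<otimes> b) \<oplus> t \<odot> (x \<otimes> d) = b \<otimes> a"
    by (rule smult_left_cancel[OF v _ _ e2]) (use c in simp_all)
  have "b \<otimes> a \<oplus> (- s) \<odot> (a \<otimes> b) = t \<odot> (x \<otimes> d)"
    unfolding eq[symmetric] using c by (simp add: smult_uminus_left add_cancel)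
  then have "t \<odot> ((b \<otimes> a \<oplus> (- s) \<odot> (a \<otimes> b)) \<otimes> e) = t \<odot> (t \<odot> (x \<otimes> (d \<otimes> e)))"
    using c by (simp add: smult_mult_left m_assoc)
  then show ?thesis using c t de by (simp add: smult_smult)
qed

lemma expand_product:
  assumes "x \<in> carrier A" "y \<in> carrier A"
  shows "(a \<odot> \<one> \<oplus> v \<odot> x) \<otimes> (b \<odot> \<one> \<oplus> v \<odot> y)
    = (a * b) \<odot> \<one> \<oplus> v \<odot> ((a \<odot> y \<oplus> b \<odot> x) \<oplus> v \<odot> (x \<otimes> y))"
  using assms by (simp add: l_distr r_distr smult_mult_left smult_mult_right smult_smult smult_add_right a_ac mult_ac)

text \<open>Each product of generators is a scalar plus v times a remainder. Once the scalars
  balance, v can be cancelled from what is left.\<close>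

lemma divide_relation:
  fixes c1 c2 c3 c4 c5 c6 :: 'k
  assumes w: "w1 \<in> carrier A" "w2 \<in> carrier A" "w3 \<in> carrier A" "w4 \<in> carrier A" "w5 \<in> carrier A" "w6 \<in> carrier A"
    and v: "v' * v = 1"
    and sc: "c1 * a1 + c2 * a2 + c3 * a3 = c4 * a4 + c5 * a5 + c6 * a6"
    and rel: "c1 \<odot> (a1 \<odot> \<one> \<oplus> v \<odot> w1) \<oplus> c2 \<odot> (a2 \<odot> \<one> \<oplus> v \<odot> w2) \<oplus> c3 \<odot> (a3 \<odot> \<one> \<oplus> v \<odot> w3)
      = c4 \<odot> (a4 \<odot> \<one> \<oplus> v \<odot> w4) \<oplus> c5 \<odot> (a5 \<odot> \<one> \<oplus> v \<odot> w5) \<oplus> c6 \<odot> (a6 \<odot> \<one> \<oplus> v \<odot> w6)"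
  shows "c1 \<odot> w1 \<oplus> c2 \<odot> w2 \<oplus> c3 \<odot> w3 = c4 \<odot> w4 \<oplus> c5 \<odot> w5 \<oplus> c6 \<odot> w6"
proof -
  have *: "c1 \<odot> (a1 \<odot> \<one> \<oplus> v \<odot> w1) \<oplus> c2 \<odot> (a2 \<odot> \<one> \<oplus> v \<odot> w2) \<oplus> c3 \<odot> (a3 \<odot> \<one> \<oplus> v \<odot> w3)
      = (c1 * a1 + c2 * a2 + c3 * a3) \<odot> \<one> \<oplus> v \<odot> (c1 \<odot> w1 \<oplus> c2 \<odot> w2 \<oplus> c3 \<odot> w3)"
    if "w1 \<in> carrier A" "w2 \<in> carrier A" "w3 \<in> carrier A" for c1 c2 c3 a1 a2 a3 w1 w2 w3
    using that by (simp add: smult_add_right smult_add_left smult_smult a_ac mult.commute)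
  have "v \<odot> (c1 \<odot> w1 \<oplus> c2 \<odot> w2 \<oplus> c3 \<odot> w3) = v \<odot> (c4 \<odot> w4 \<oplus> c5 \<odot> w5 \<oplus> c6 \<odot> w6)"
    using rel unfolding *[OF w(1-3)] *[OF w(4-6)] sc using w by simp
  then show ?thesis by (rule smult_left_cancel[OF v, rotated 2]) (use w in simp_all)
qed

end

text \<open>The value 0 outside \<open>Lidx n\<close> makes this family, and with it
  \<open>Lext\<close>, total, as \<open>Lgen_relation\<close> demands of its
  \<open>x\<close>.\<close>

definition redL :: "nat \<Rightarrow> int \<Rightarrow> int \<Rightarrow> ((int \<times> int) list \<Rightarrow> cq) set" where
  "redL n i j = (if (i, j) \<in> Lidx n
    then (1 / nu) \<odot>\<^bsub>Uq n\<^esub> (Lgen n i j \<ominus>\<^bsub>Uq n\<^esub> of_bool (i = j) \<odot>\<^bsub>Uq n\<^esub> \<one>\<^bsub>Uq n\<^esub>) else \<zero>\<^bsub>Uq n\<^esub>)"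

definition Lext :: "nat \<Rightarrow> int \<Rightarrow> int \<Rightarrow> ((int \<times> int) list \<Rightarrow> cq) set" where
  "Lext n i j = of_bool (i = j) \<odot>\<^bsub>Uq n\<^esub> \<one>\<^bsub>Uq n\<^esub> \<oplus>\<^bsub>Uq n\<^esub> nu \<odot>\<^bsub>Uq n\<^esub> redL n i j"

interpretation U: unital_algebra "Uq n" for n by (rule unital_algebra_Uq)

lemma redL_closed [simp]: "redL n i j \<in> carrier (Uq n)"
  unfolding redL_def using Lgen_closed[of i j n] by simp

lemma Lext_closed [simp]: "Lext n i j \<in> carrier (Uq n)"
  unfolding Lext_def by simp

lemma Lgen_Lext: "(i, j) \<in> Lidx n \<Longrightarrow> Lgen n i j = Lext n i j"
proof -
  assume ij: "(i, j) \<in> Lidx n"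
  have c: "Lgen n i j \<in> carrier (Uq n)" by (rule Lgen_closed[OF ij])
  let ?d = "of_bool (i = j) \<odot>\<^bsub>Uq n\<^esub> \<one>\<^bsub>Uq n\<^esub>"
  have d: "?d \<in> carrier (Uq n)" by simp
  have "nu \<odot>\<^bsub>Uq n\<^esub> redL n i j = Lgen n i j \<ominus>\<^bsub>Uq n\<^esub> ?d"
    using ij c d by (simp add: redL_def U.smult_smult)
  then show ?thesis
    unfolding Lext_def a_minus_def using c d by (simp add: U.a_lcomm U.r_neg)
qed

lemma redL_off: "(i, j) \<in> Lidx n \<Longrightarrow> i \<noteq> j \<Longrightarrow> redL n i j = (1 / nu) \<odot>\<^bsub>Uq n\<^esub> Lgen n i j"
  using Lgen_closed[of i j n] by (simp add: redL_def a_minus_def)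

lemma UA1_subset: "carrier (UA1 n) \<subseteq> carrier (Uq n)"
  unfolding UA1_simps by (rule U.gen_subalgebra_closed[OF UA1_gens_closed])

lemmas UA1_intros = gen_subalgebra.intros[where R = A1 and A = "Uq n" and S = "UA1_gens n" for n, folded UA1_simps(1)]

lemma qpow_single:
  assumes "i \<in> {1..n}"
  shows "qpow n (\<lambda>j. if j = i then 1 else 0) = Lgen n (int i) (int i)"
    and "qpow n (\<lambda>j. if j = i then - 1 else 0) = Lgen n (- int i) (- int i)"
proof -
  have idx: "(int i, int i) \<in> Lidx n" "(- int i, - int i) \<in> Lidx n" using assms by (auto simp: Lidx_def)
  have x: "Lgen n (int i) (int i) \<in> carrier (Uq n)" "Lgen n (- int i) (- int i) \<in> carrier (Uq n)"
    using idx Lgen_closed by auto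
  have fold: "foldr (\<lambda>j x. (Lgen n (int j) (int j) [^]\<^bsub>Uq n\<^esub> (if j = i then z else (0::int))) \<otimes>\<^bsub>Uq n\<^esub> x) xs \<one>\<^bsub>Uq n\<^esub>
      = (if i \<in> set xs then Lgen n (int i) (int i) [^]\<^bsub>Uq n\<^esub> z else \<one>\<^bsub>Uq n\<^esub>)"
    if "distinct xs" "Lgen n (int i) (int i) [^]\<^bsub>Uq n\<^esub> z \<in> carrier (Uq n)" for z xs
    using that(1) by (induction xs) (use that(2) in simp, use that(2) in clarsimp)
  have p1: "Lgen n (int i) (int i) [^]\<^bsub>Uq n\<^esub> (1::int) = Lgen n (int i) (int i)"
    using x by (simp add: int_pow_def)
  have inv: "inv\<^bsub>Uq n\<^esub> (Lgen n (int i) (int i)) = Lgen n (- int i) (- int i)"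
    using U.inv_unique'[OF x] Lgen_inverse[OF idx(1)] Lgen_inverse[OF idx(2)] by simp
  have p2: "Lgen n (int i) (int i) [^]\<^bsub>Uq n\<^esub> (- 1::int) = Lgen n (- int i) (- int i)"
    using x inv by (simp add: int_pow_def)
  have i: "i \<in> set [1..<Suc n]" using assms by auto
  show "qpow n (\<lambda>j. if j = i then 1 else 0) = Lgen n (int i) (int i)"
    unfolding qpow_def using fold[of "[1..<Suc n]" 1] p1 x i by simp
  show "qpow n (\<lambda>j. if j = i then - 1 else 0) = Lgen n (- int i) (- int i)"
    unfolding qpow_def using fold[of "[1..<Suc n]" "- 1"] p2 x i by simp
qed

text \<open>For h = k_i or h = - k_i the element (q^h - 1) / (q - 1) differs from the reduced
  diagonal generator by the factor (q - 1) / nu in \<open>A1\<close>.\<close>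

lemma redL_diag_in_UA1:
  assumes "i \<noteq> 0" "\<bar>i\<bar> \<le> int n"
  shows "redL n i i \<in> carrier (UA1 n)" "Lgen n i i \<in> carrier (UA1 n)"
proof -
  define h where "h = (\<lambda>j. if j = nat \<bar>i\<bar> then sgn i else (0::int))"
  have h: "h \<in> Pvee n" using assms by (auto simp: Pvee_def h_def)
  have n: "nat \<bar>i\<bar> \<in> {1..n}" using assms by auto
  have q: "qpow n h = Lgen n i i"
  proof (cases "0 < i")
    case True
    then have "h = (\<lambda>j. if j = nat \<bar>i\<bar> then 1 else 0)" by (auto simp: h_def)
    then show ?thesis using qpow_single(1)[OF n] True by simp
  next
    case False
    then have "h = (\<lambda>j. if j = nat \<bar>i\<bar> then - 1 else 0)" using assms by (auto simp: h_def)
    then show ?thesis using qpow_single(2)[OF n] False by simp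
  qed
  have idx: "(i, i) \<in> Lidx n" using assms by (simp add: Lidx_def)
  have L: "Lgen n i i \<in> carrier (Uq n)" by (rule Lgen_closed[OF idx])
  have eq: "redL n i i = ((qvar - 1) / nu) \<odot>\<^bsub>Uq n\<^esub> qpow_diff n h"
    using idx L qvar_neq_1 by (simp add: redL_def qpow_diff_def q U.smult_smult)
  have gens: "qpow_diff n h \<in> UA1_gens n" "qpow n h \<in> UA1_gens n" using h by (simp_all add: UA1_gens_def)
  show "redL n i i \<in> carrier (UA1 n)"
    unfolding eq by (rule UA1_intros(3)[OF qvar_minus_1_over_nu(1) UA1_intros(1)[OF gens(1)]])
  show "Lgen n i i \<in> carrier (UA1 n)"
    unfolding q[symmetric] by (rule UA1_intros(1)[OF gens(2)])
qed

text \<open>In the relation for (i, j) and (j, l) the second term is nu L_il L_jj. The hypotheses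
  \<open>ne\<close> make the powers of q trivial, and \<open>no\<close> removes the terms with
  reversed signs. As L_jj has its inverse in the integral form, the entry at (i, l) becomes a
  commutator times that inverse.\<close>

lemma redL_commutator:
  assumes nz: "i \<noteq> 0" "j \<noteq> 0" "l \<noteq> 0" and bd: "\<bar>i\<bar> \<le> int n" "\<bar>j\<bar> \<le> int n" "\<bar>l\<bar> \<le> int n"
    and ord: "i < j" "j < l" and ne: "\<bar>j\<bar> \<noteq> \<bar>l\<bar>" "\<bar>i\<bar> \<noteq> \<bar>j\<bar>"
    and no: "\<not> (i \<le> - l \<and> - l < j \<and> j \<le> - j)" "\<not> (- l \<le> i \<and> i < - j \<and> - j \<le> j)"
    and UA: "redL n i j \<in> carrier (UA1 n)" "redL n j l \<in> carrier (UA1 n)"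
  shows "redL n i l \<in> carrier (UA1 n)"
proof -
  have idx: "(i, j) \<in> Lidx n" "(j, l) \<in> Lidx n" "(j, j) \<in> Lidx n" "(i, l) \<in> Lidx n" using nz bd ord by (auto simp: Lidx_def)
  let ?s = "(- 1) ^ (par i j * par j l) :: cq" and ?t = "of_int (theta i j j) :: cq"
  have off: "Lext n a b = nu \<odot>\<^bsub>Uq n\<^esub> redL n a b" if "a \<noteq> b" for a b
    unfolding Lext_def using that by simp
  have "?s \<odot>\<^bsub>Uq n\<^esub> (Lext n i j \<otimes>\<^bsub>Uq n\<^esub> Lext n j l) \<oplus>\<^bsub>Uq n\<^esub> (?t * nu) \<odot>\<^bsub>Uq n\<^esub> (Lext n i l \<otimes>\<^bsub>Uq n\<^esub> Lext n j j)
      = Lext n j l \<otimes>\<^bsub>Uq n\<^esub> Lext n i j"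
  proof -
    have z: "of_bool (i \<le> - l \<and> - l < j \<and> j \<le> - j) = (0 :: cq)" "of_bool (- l \<le> i \<and> i < - j \<and> - j \<le> j) = (0 :: cq)"
      using no by (simp_all only: of_bool_eq)
    show ?thesis
      using Lgen_relation[OF idx(1,2) Lext_closed Lgen_Lext] ord ne unfolding z
      by (simp add: phi_def)
  qed
  then have "?s \<odot>\<^bsub>Uq n\<^esub> ((nu \<odot>\<^bsub>Uq n\<^esub> redL n i j) \<otimes>\<^bsub>Uq n\<^esub> (nu \<odot>\<^bsub>Uq n\<^esub> redL n j l))
      \<oplus>\<^bsub>Uq n\<^esub> (?t * nu) \<odot>\<^bsub>Uq n\<^esub> ((nu \<odot>\<^bsub>Uq n\<^esub> redL n i l) \<otimes>\<^bsub>Uq n\<^esub> Lgen n j j)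
      = (nu \<odot>\<^bsub>Uq n\<^esub> redL n j l) \<otimes>\<^bsub>Uq n\<^esub> (nu \<odot>\<^bsub>Uq n\<^esub> redL n i j)"
    unfolding Lgen_Lext[OF idx(3)] off[of i j, OF less_imp_neq[OF ord(1)]] off[of j l, OF less_imp_neq[OF ord(2)]]
      off[of i l, OF less_imp_neq[OF less_trans[OF ord]]] .
  then have "redL n i l = ?t \<odot>\<^bsub>Uq n\<^esub> ((redL n j l \<otimes>\<^bsub>Uq n\<^esub> redL n i j
      \<oplus>\<^bsub>Uq n\<^esub> (- ?s) \<odot>\<^bsub>Uq n\<^esub> (redL n i j \<otimes>\<^bsub>Uq n\<^esub> redL n j l)) \<otimes>\<^bsub>Uq n\<^esub> Lgen n (- j) (- j))"
  proof (rule U.commutator_solve[rotated -1])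
    show "Lgen n j j \<otimes>\<^bsub>Uq n\<^esub> Lgen n (- j) (- j) = \<one>\<^bsub>Uq n\<^esub>" by (rule Lgen_inverse[OF idx(3)])
    show "?t * ?t = 1" using nz by (auto simp: theta_def sgn_if)
    show "inverse nu * nu = 1" by simp
  qed (simp_all add: Lgen_closed idx Lidx_uminus)
  moreover have "?t \<in> A1" by (rule A1_of_int)
  moreover have "- ?s \<in> A1" using A1_of_int[of "- ((- 1) ^ (par i j * par j l))"] by simp
  moreover have "Lgen n (- j) (- j) \<in> carrier (UA1 n)" using nz bd by (intro redL_diag_in_UA1) auto
  ultimately show ?thesis using UA by (auto intro!: UA1_intros(3-5))
qed

text \<open>The given generators sit at neighbouring indices or at (- l, l). All other entries are
  reached by increasing the distance one step at a time through \<open>redL_commutator\<close>,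
  separately for two positive, two negative and mixed indices.\<close>

lemma redL_in_UA1:
  assumes "(i, j) \<in> Lidx n" shows "redL n i j \<in> carrier (UA1 n)"
proof -
  have gen: "redL n i j \<in> carrier (UA1 n)" if "(i, j) \<in> Lidx n" "i \<noteq> j"
    "(c / nu) \<odot>\<^bsub>Uq n\<^esub> Lgen n i j \<in> UA1_gens n" "c * c = 1" "c \<in> A1" for i j c
  proof -
    have "redL n i j = c \<odot>\<^bsub>Uq n\<^esub> ((c / nu) \<odot>\<^bsub>Uq n\<^esub> Lgen n i j)"
      using that(4) by (simp add: redL_off[OF that(1,2)] U.smult_smult Lgen_closed[OF that(1)])
    then show ?thesis by (simp only: UA1_intros(3)[OF that(5) UA1_intros(1)[OF that(3)]])
  qed
  have m1: "- 1 \<in> A1" "(1::cq) \<in> A1" by (simp_all add: A1_closed)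
  have mem: "e_gen n i \<in> UA1_gens n" "f_gen n i \<in> UA1_gens n" "ebar_gen n i \<in> UA1_gens n"
    "fbar_gen n i \<in> UA1_gens n" if "i \<in> {1..int n - 1}" for i
    using that by (simp_all only: UA1_gens_def Un_iff imageI simp_thms)
  have e: "redL n (- i - 1) (- i) \<in> carrier (UA1 n)" "redL n i (i + 1) \<in> carrier (UA1 n)"
    "redL n (- i - 1) i \<in> carrier (UA1 n)" "redL n (- i) (i + 1) \<in> carrier (UA1 n)"
    if "i \<in> {1..int n - 1}" for i
    using that by (auto simp: Lidx_def
      intro!: gen[OF _ _ mem(1)[OF that, unfolded e_gen_def] _ m1(1)] gen[OF _ _ mem(2)[OF that, unfolded f_gen_def] _ m1(2)]
        gen[OF _ _ mem(3)[OF that, unfolded ebar_gen_def] _ m1(1)] gen[OF _ _ mem(4)[OF that, unfolded fbar_gen_def] _ m1(1)])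
  have k: "redL n (- i) i \<in> carrier (UA1 n)" if "i \<in> {1..int n}" for i
  proof -
    have "kbar_gen n i \<in> UA1_gens n" using that by (simp only: UA1_gens_def Un_iff imageI simp_thms)
    from gen[OF _ _ this[unfolded kbar_gen_def] _ m1(1)] show ?thesis using that by (simp add: Lidx_def)
  qed
  have pos: "redL n i (i + int d) \<in> carrier (UA1 n)" if "1 \<le> i" "i + int d \<le> int n" "1 \<le> d" for i d
    using that
  proof (induction d)
    case (Suc d)
    show ?case
    proof (cases "d = 0")
      case True
      then show ?thesis using e(2)[of i] Suc by simp
    next
      case False
      have next_index: "i + int (Suc d) = (i + int d) + 1" by simp
      show ?thesis
        unfolding next_index
        by (rule redL_commutator[where j = "i + int d"]) (use Suc False e(2)[of "i + int d"] in auto)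
    qed
  qed simp
  have neg: "redL n (- i - int d) (- i) \<in> carrier (UA1 n)" if "1 \<le> i" "i + int d \<le> int n" "1 \<le> d" for i d
    using that
  proof (induction d)
    case (Suc d)
    show ?case
    proof (cases "d = 0")
      case True
      then show ?thesis using e(1)[of i] Suc by simp
    next
      case False
      have "redL n (- (i + int d) - 1) (- (i + int d)) \<in> carrier (UA1 n)" using e(1)[of "i + int d"] Suc.prems by simp
      then have 1: "redL n (- i - int (Suc d)) (- i - int d) \<in> carrier (UA1 n)" by (simp add: algebra_simps)
      show ?thesis
        by (rule redL_commutator[where j = "- i - int d"]) (use Suc False 1 in auto)
    qed
  qed simp
  have up: "redL n (- i) (i + int d) \<in> carrier (UA1 n)" if "1 \<le> i" "i + int d \<le> int n" for i d
    using that
  proof (induction d)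
    case 0
    then show ?case using k[of i] by simp
  next
    case (Suc d)
    show ?case
    \<comment> \<open>The first step cannot be a commutator through the index i, since
      \<open>redL_commutator\<close> excludes indices of equal absolute value next to each other;
      the generator \<open>fbar_gen\<close> supplies it.\<close>
    proof (cases "d = 0")
      case True
      then show ?thesis using e(4)[of i] Suc by simp
    next
      case False
      have next_index: "i + int (Suc d) = (i + int d) + 1" by simp
      show ?thesis
        unfolding next_index
        by (rule redL_commutator[where j = "i + int d"]) (use Suc False e(2)[of "i + int d"] in auto)
    qed
  qed
  have down: "redL n (- i - int d) i \<in> carrier (UA1 n)" if "1 \<le> i" "i + int d \<le> int n" for i d
    using that
  proof (induction d)
    case 0
    then show ?case using k[of i] by simp
  next
    case (Suc d)
    show ?case
    proof (cases "d = 0")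
      case True
      then show ?thesis using e(3)[of i] Suc by simp
    next
      case False
      \<comment> \<open>The path runs through - i - 1, an entry with two negative indices followed
        by the one of \<open>ebar_gen\<close>. Running through - i would meet the index i of equal
        absolute value.\<close>
      have 1: "redL n (- i - int (Suc d)) (- i - 1) \<in> carrier (UA1 n)"
      proof -
        have eq: "- (i + 1) - int d = - i - int (Suc d)" "- (i + 1) = - i - 1" by simp_all
        have "redL n (- (i + 1) - int d) (- (i + 1)) \<in> carrier (UA1 n)" using Suc.prems False by (intro neg) auto
        then show ?thesis by (simp only: eq[symmetric])
      qed
      have 2: "redL n (- i - 1) i \<in> carrier (UA1 n)" using e(3)[of i] Suc.prems by simp
      show ?thesis
        by (rule redL_commutator[where j = "- i - 1"]) (use Suc False 1 2 in auto)
    qed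
  qed
  have ij: "i \<noteq> 0" "j \<noteq> 0" "\<bar>i\<bar> \<le> int n" "\<bar>j\<bar> \<le> int n" "i \<le> j" using assms by (auto simp: Lidx_def)
  consider "i = j" | "0 < i" "i < j" | "j < 0" "i < j" | "i < 0" "0 < j" "- i \<le> j" | "i < 0" "0 < j" "j < - i"
    using ij by linarith
  then show ?thesis
  proof cases
    case 1
    then show ?thesis using redL_diag_in_UA1[of i] ij by simp
  next
    case 2
    then show ?thesis using pos[of i "nat (j - i)"] ij by simp
  next
    case 3
    then show ?thesis using neg[of "- j" "nat (j - i)"] ij by simp
  next
    case 4
    then show ?thesis using up[of "- i" "nat (j + i)"] ij by simp
  next
    case 5
    then show ?thesis using down[of j "nat (- i - j)"] ij by simp
  qed
qed

definition reduced_gens :: "nat \<Rightarrow> ((int \<times> int) list \<Rightarrow> cq) set set" where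
  "reduced_gens n = {redL n i j | i j. (i, j) \<in> Lidx n}"

lemma UA1_reduced: "carrier (UA1 n) = gen_subalgebra A1 (Uq n) (reduced_gens n)"
proof
  show "gen_subalgebra A1 (Uq n) (reduced_gens n) \<subseteq> carrier (UA1 n)"
    unfolding UA1_simps
    by (rule U.gen_subalgebra_mono) (use redL_in_UA1 in \<open>auto simp: reduced_gens_def UA1_simps\<close>)
next
  let ?G = "gen_subalgebra A1 (Uq n) (reduced_gens n)"
  have GU: "?G \<subseteq> carrier (Uq n)" by (rule U.gen_subalgebra_closed) (auto simp: reduced_gens_def)
  have r: "redL n i j \<in> ?G" if "(i, j) \<in> Lidx n" for i j
    using that by (intro gen_subalgebra.gen) (auto simp: reduced_gens_def)
  \<comment> \<open>The quotient by q - 1 is carried along with u because (x y - 1) / (q - 1) is (x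
    - 1) / (q - 1) times y plus (y - 1) / (q - 1). On a diagonal generator it is nu / (q - 1) times
    the reduced one.\<close>
  let ?P = "\<lambda>u. u \<in> ?G \<and> (1 / (qvar - 1)) \<odot>\<^bsub>Uq n\<^esub> (u \<ominus>\<^bsub>Uq n\<^esub> \<one>\<^bsub>Uq n\<^esub>) \<in> ?G"
  have q: "?P (qpow n h)" for h
  proof (rule qpow_induct(2)[where P = ?P])
    have z: "\<one>\<^bsub>Uq n\<^esub> \<ominus>\<^bsub>Uq n\<^esub> \<one>\<^bsub>Uq n\<^esub> = \<zero>\<^bsub>Uq n\<^esub>" by (simp add: U.minus_eq_zero_iff)
    have "\<zero>\<^bsub>Uq n\<^esub> \<in> ?G"
      using gen_subalgebra.scale[OF A1_0 gen_subalgebra.one, of "Uq n" "reduced_gens n"] by simp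
    then show "?P \<one>\<^bsub>Uq n\<^esub>" unfolding z by (simp add: gen_subalgebra.one)
  next
    fix x y assume c: "x \<in> carrier (Uq n)" "y \<in> carrier (Uq n)" and P: "?P x" "?P y"
    let ?c = "1 / (qvar - 1)"
    have "?c \<odot>\<^bsub>Uq n\<^esub> (x \<otimes>\<^bsub>Uq n\<^esub> y \<ominus>\<^bsub>Uq n\<^esub> \<one>\<^bsub>Uq n\<^esub>)
        = (?c \<odot>\<^bsub>Uq n\<^esub> (x \<ominus>\<^bsub>Uq n\<^esub> \<one>\<^bsub>Uq n\<^esub>)) \<otimes>\<^bsub>Uq n\<^esub> y \<oplus>\<^bsub>Uq n\<^esub> ?c \<odot>\<^bsub>Uq n\<^esub> (y \<ominus>\<^bsub>Uq n\<^esub> \<one>\<^bsub>Uq n\<^esub>)"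
    proof -
      have "x \<otimes>\<^bsub>Uq n\<^esub> y \<ominus>\<^bsub>Uq n\<^esub> \<one>\<^bsub>Uq n\<^esub> = (x \<ominus>\<^bsub>Uq n\<^esub> \<one>\<^bsub>Uq n\<^esub>) \<otimes>\<^bsub>Uq n\<^esub> y \<oplus>\<^bsub>Uq n\<^esub> (y \<ominus>\<^bsub>Uq n\<^esub> \<one>\<^bsub>Uq n\<^esub>)"
        unfolding a_minus_def using c by (simp add: U.l_distr U.l_minus U.a_assoc U.r_neg2 U.r_neg1)
      then show ?thesis using c by (simp add: U.smult_add_right U.smult_mult_left)
    qed
    then show "?P (x \<otimes>\<^bsub>Uq n\<^esub> y)" using P by (auto intro!: gen_subalgebra.add gen_subalgebra.mult)
  next
    fix i assume i: "(i, i) \<in> Lidx n"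
    have L: "Lgen n i i = \<one>\<^bsub>Uq n\<^esub> \<oplus>\<^bsub>Uq n\<^esub> nu \<odot>\<^bsub>Uq n\<^esub> redL n i i"
      unfolding Lgen_Lext[OF i] Lext_def by simp
    have "(1 / (qvar - 1)) \<odot>\<^bsub>Uq n\<^esub> (Lgen n i i \<ominus>\<^bsub>Uq n\<^esub> \<one>\<^bsub>Uq n\<^esub>) = (nu / (qvar - 1)) \<odot>\<^bsub>Uq n\<^esub> redL n i i"
      unfolding L a_minus_def by (simp add: U.a_ac U.r_neg1 U.r_neg2 U.r_neg U.smult_smult)
    moreover have "Lgen n i i \<in> ?G"
      unfolding L by (intro gen_subalgebra.add gen_subalgebra.one gen_subalgebra.scale A1_nu r i)
    ultimately show "?P (Lgen n i i)"
      by (auto intro!: gen_subalgebra.scale nu_over_qvar_minus_1 r i)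
  qed
  have L: "(c / nu) \<odot>\<^bsub>Uq n\<^esub> Lgen n i j \<in> ?G" if "(i, j) \<in> Lidx n" "i \<noteq> j" "c \<in> A1" for i j c
  proof -
    have "(c / nu) \<odot>\<^bsub>Uq n\<^esub> Lgen n i j = c \<odot>\<^bsub>Uq n\<^esub> redL n i j"
      by (simp add: redL_off[OF that(1,2)] U.smult_smult Lgen_closed[OF that(1)])
    then show ?thesis using r[OF that(1)] that(3) by (simp add: gen_subalgebra.scale)
  qed
  have m1: "- 1 \<in> A1" "(1::cq) \<in> A1" by (simp_all add: A1_closed)
  have "e_gen n i \<in> ?G" "f_gen n i \<in> ?G" "ebar_gen n i \<in> ?G" "fbar_gen n i \<in> ?G" if "i \<in> {1..int n - 1}" for i
    unfolding e_gen_def f_gen_def ebar_gen_def fbar_gen_def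
    by (rule L; use that m1 in \<open>simp add: Lidx_def\<close>)+
  moreover have "kbar_gen n i \<in> ?G" if "i \<in> {1..int n}" for i
    unfolding kbar_gen_def by (rule L; use that m1 in \<open>simp add: Lidx_def\<close>)
  moreover have "qpow n h \<in> ?G" "qpow_diff n h \<in> ?G" for h
    using q[of h] unfolding qpow_diff_def by blast+
  ultimately have "UA1_gens n \<subseteq> ?G"
    unfolding UA1_gens_def by (intro Un_least image_subsetI)
  then show "carrier (UA1 n) \<subseteq> ?G"
    unfolding UA1_simps by (rule U.gen_subalgebra_mono)
qed

section \<open>The limit of the defining relations\<close>

context unital_algebra begin

text \<open>The second division. The common first-order part \<open>y\<close> of the two opposite
  products is fixed by \<open>s\<close> and cancels; it reappears only through
  \<open>\<kappa>1\<close> and \<open>\<kappa>4\<close>, the first-order parts of the powers of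
  q.\<close>

lemma divide_relation_again:
  fixes s \<kappa>1 \<kappa>4 d2 d3 d5 d6 :: 'k
  assumes w: "y \<in> carrier A" "z1 \<in> carrier A" "z4 \<in> carrier A" "w2 \<in> carrier A" "w3 \<in> carrier A" "w5 \<in> carrier A" "w6 \<in> carrier A"
    and v: "v' * v = 1" and s: "s \<odot> y = y"
    and rel: "(s * (1 + v * \<kappa>1)) \<odot> (y \<oplus> v \<odot> z1) \<oplus> (d2 * v) \<odot> w2 \<oplus> (d3 * v) \<odot> w3
      = (1 + v * \<kappa>4) \<odot> (y \<oplus> v \<odot> z4) \<oplus> (d5 * v) \<odot> w5 \<oplus> (d6 * v) \<odot> w6"
  shows "\<kappa>1 \<odot> y \<oplus> (s * (1 + v * \<kappa>1)) \<odot> z1 \<oplus> d2 \<odot> w2 \<oplus> d3 \<odot> w3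
    = \<kappa>4 \<odot> y \<oplus> (1 + v * \<kappa>4) \<odot> z4 \<oplus> d5 \<odot> w5 \<oplus> d6 \<odot> w6"
proof -
  have *: "(s * (1 + v * \<kappa>)) \<odot> (y \<oplus> v \<odot> z) \<oplus> (d * v) \<odot> w \<oplus> (d' * v) \<odot> w'
      = y \<oplus> v \<odot> (\<kappa> \<odot> y \<oplus> (s * (1 + v * \<kappa>)) \<odot> z \<oplus> d \<odot> w \<oplus> d' \<odot> w')"
    if "z \<in> carrier A" "w \<in> carrier A" "w' \<in> carrier A" "s \<odot> y = y" for s \<kappa> d d' z w w'
  proof -
    have "(s * (1 + v * \<kappa>)) \<odot> y = (1 + v * \<kappa>) \<odot> (s \<odot> y)" using w(1) by (simp add: smult_smult mult.commute)
    also have "\<dots> = y \<oplus> v \<odot> (\<kappa> \<odot> y)" unfolding that(4) using w(1) by (simp add: smult_add_left smult_smult)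
    finally have y: "(s * (1 + v * \<kappa>)) \<odot> y = y \<oplus> v \<odot> (\<kappa> \<odot> y)" .
    have "(s * (1 + v * \<kappa>)) \<odot> (y \<oplus> v \<odot> z) = (s * (1 + v * \<kappa>)) \<odot> y \<oplus> v \<odot> ((s * (1 + v * \<kappa>)) \<odot> z)"
      using w(1) that(1) by (simp add: smult_add_right smult_smult mult.commute)
    moreover have "(d * v) \<odot> w = v \<odot> (d \<odot> w)" "(d' * v) \<odot> w' = v \<odot> (d' \<odot> w')"
      using that(2,3) by (simp_all add: smult_smult mult.commute)
    ultimately show ?thesis unfolding y using w(1) that(1-3) by (simp add: smult_add_right a_assoc)
  qed
  have "y \<oplus> v \<odot> (\<kappa>1 \<odot> y \<oplus> (s * (1 + v * \<kappa>1)) \<odot> z1 \<oplus> d2 \<odot> w2 \<oplus> d3 \<odot> w3)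
      = y \<oplus> v \<odot> (\<kappa>4 \<odot> y \<oplus> (1 + v * \<kappa>4) \<odot> z4 \<oplus> d5 \<odot> w5 \<oplus> d6 \<odot> w6)"
    using rel *[OF w(2) w(4,5) s] *[of z4 w5 w6 1, OF w(3) w(6,7)] w(1) by simp
  then have e: "v \<odot> (\<kappa>1 \<odot> y \<oplus> (s * (1 + v * \<kappa>1)) \<odot> z1 \<oplus> d2 \<odot> w2 \<oplus> d3 \<odot> w3)
      = v \<odot> (\<kappa>4 \<odot> y \<oplus> (1 + v * \<kappa>4) \<odot> z4 \<oplus> d5 \<odot> w5 \<oplus> d6 \<odot> w6)"
    using w by simp
  show ?thesis by (rule smult_left_cancel[OF v _ _ e]) (use w in simp_all)
qed

text \<open>Solves the limit relation for the product \<open>p\<close>, moving \<open>s\<close>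
  across by s s = 1. The factor \<open>r\<close> will be the product of the signs that normalize the
  two Lie generators.\<close>

lemma solve_relation:
  fixes s e2 e3 e5 e6 r :: 'k
  assumes c: "p \<in> carrier A" "q \<in> carrier A" "u1 \<in> carrier A" "u2 \<in> carrier A" "w1 \<in> carrier A" "w2 \<in> carrier A"
      "z1 \<in> carrier A" "z2 \<in> carrier A" and s: "s * s = 1"
    and rel: "s \<odot> p \<oplus> e2 \<odot> (u1 \<oplus> u2) \<oplus> e3 \<odot> (w1 \<oplus> w2) = q \<oplus> e5 \<odot> (u1 \<oplus> u2) \<oplus> e6 \<odot> (z1 \<oplus> z2)"
  shows "r \<odot> p = (r * s) \<odot> q \<oplus> ((r * s * (e5 - e2)) \<odot> u1 \<oplus> (r * s * (e5 - e2)) \<odot> u2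
    \<oplus> ((r * s * e6) \<odot> z1 \<oplus> (- (r * s * e3)) \<odot> w1) \<oplus> ((r * s * e6) \<odot> z2 \<oplus> (- (r * s * e3)) \<odot> w2))"
proof -
  let ?u = "u1 \<oplus> u2" and ?w = "w1 \<oplus> w2" and ?z = "z1 \<oplus> z2"
  have uc: "?u \<in> carrier A" "?w \<in> carrier A" "?z \<in> carrier A" using c by simp_all
  have diff: "(e5 - e2) \<odot> ?u = e5 \<odot> ?u \<oplus> (- e2) \<odot> ?u"
    by (simp only: diff_conv_add_uminus smult_add_left uc)
  have "s \<odot> p = (s \<odot> p \<oplus> e2 \<odot> ?u \<oplus> e3 \<odot> ?w) \<oplus> ((- e2) \<odot> ?u \<oplus> (- e3) \<odot> ?w)"
    using c(1) uc by (simp add: smult_uminus_left a_ac r_neg1 r_neg2 r_neg)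
  also have "\<dots> = q \<oplus> (e5 - e2) \<odot> ?u \<oplus> (e6 \<odot> ?z \<oplus> (- e3) \<odot> ?w)"
    unfolding rel diff using c(2) uc by (simp add: a_ac)
  finally have sp: "s \<odot> p = q \<oplus> (e5 - e2) \<odot> ?u \<oplus> (e6 \<odot> ?z \<oplus> (- e3) \<odot> ?w)" .
  have "r \<odot> p = (r * s) \<odot> (s \<odot> p)" using c(1) s by (simp add: smult_smult mult.assoc)
  also have "\<dots> = (r * s) \<odot> q \<oplus> ((r * s * (e5 - e2)) \<odot> ?u \<oplus> ((r * s * e6) \<odot> ?z \<oplus> (- (r * s * e3)) \<odot> ?w))"
    unfolding sp using c(2) uc by (simp add: smult_add_right smult_smult a_assoc)
  also have "(r * s * (e5 - e2)) \<odot> ?u \<oplus> ((r * s * e6) \<odot> ?z \<oplus> (- (r * s * e3)) \<odot> ?w)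
      = (r * s * (e5 - e2)) \<odot> u1 \<oplus> (r * s * (e5 - e2)) \<odot> u2
    \<oplus> ((r * s * e6) \<odot> z1 \<oplus> (- (r * s * e3)) \<odot> w1) \<oplus> ((r * s * e6) \<odot> z2 \<oplus> (- (r * s * e3)) \<odot> w2)"
    using c by (simp only: smult_add_right a_ac smult_closed a_closed)
  finally show ?thesis .
qed

end

interpretation C: unital_algebra "classical_limit n" for n by (rule unital_algebra_classical_limit)

lemma redL_UA1 [simp]: "redL n i j \<in> carrier (UA1 n)"
proof (cases "(i, j) \<in> Lidx n")
  case True
  then show ?thesis by (rule redL_in_UA1)
next
  case False
  then show ?thesis using UA1_intros(3)[OF A1_0 UA1_intros(2)] by (simp add: redL_def)
qed

lemma UA1_zero [simp]: "\<zero>\<^bsub>Uq n\<^esub> \<in> carrier (UA1 n)"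
  using UA1_intros(3)[OF A1_0 UA1_intros(2)] by simp

definition Llim :: "nat \<Rightarrow> int \<Rightarrow> int \<Rightarrow> (cq set \<times> ((int \<times> int) list \<Rightarrow> cq) set \<Rightarrow> int) set" where
  "Llim n i j = spec1 n (redL n i j)"

lemma spec1_arith:
  assumes "u \<in> carrier (UA1 n)" "v \<in> carrier (UA1 n)"
  shows "spec1 n (u \<oplus>\<^bsub>Uq n\<^esub> v) = spec1 n u \<oplus>\<^bsub>classical_limit n\<^esub> spec1 n v"
    "spec1 n (u \<otimes>\<^bsub>Uq n\<^esub> v) = spec1 n u \<otimes>\<^bsub>classical_limit n\<^esub> spec1 n v"
    "spec1 n u \<in> carrier (classical_limit n)"
  using ring_hom_add[OF spec1_hom assms] ring_hom_mult[OF spec1_hom assms] ring_hom_closed[OF spec1_hom assms(1)]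
  by (simp_all add: UA1_simps)

lemma spec1_zero: "spec1 n \<zero>\<^bsub>Uq n\<^esub> = \<zero>\<^bsub>classical_limit n\<^esub>"
  using ring_hom_zero_minus(1)[OF ring_UA1 C.ring_axioms spec1_hom] by (simp add: UA1_simps)

lemma Llim_closed [simp]: "Llim n i j \<in> carrier (classical_limit n)"
  unfolding Llim_def by (rule spec1_arith(3)[OF redL_UA1 redL_UA1])

text \<open>The coefficient of nu, at q = 1, in the product of \<delta>_ab + nu X_ab and \<delta>_cd
  + nu X_cd.\<close>

definition Llim_sum :: "nat \<Rightarrow> int \<Rightarrow> int \<Rightarrow> int \<Rightarrow> int \<Rightarrow> (cq set \<times> ((int \<times> int) list \<Rightarrow> cq) set \<Rightarrow> int) set" where
  "Llim_sum n a b c d = of_bool (a = b) \<odot>\<^bsub>classical_limit n\<^esub> Llim n c d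
    \<oplus>\<^bsub>classical_limit n\<^esub> of_bool (c = d) \<odot>\<^bsub>classical_limit n\<^esub> Llim n a b"

lemma A1_of_bool: "of_bool P \<in> A1" "ev1 (of_bool P) = of_bool P"
  by (cases P; simp add: A1_closed ev1_simps)+

lemma qvar_powi_split:
  "\<exists>\<kappa>\<in>A1. qvar powi phi j l = 1 + nu * \<kappa> \<and> ev1 \<kappa> = of_int (phi j l) / 2"
proof -
  have "phi j l = 1 \<or> phi j l = 0 \<or> phi j l = - 1" by (auto simp: phi_def sgn_if)
  then show ?thesis
  proof (elim disjE)
    assume p: "phi j l = 1"
    show ?thesis
      by (rule bexI[of _ "(qvar - 1) / nu"]) (simp_all add: p qvar_minus_1_over_nu)
  next
    assume p: "phi j l = 0"
    show ?thesis by (rule bexI[of _ 0]) (simp_all add: p A1_closed ev1_simps)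
  next
    assume p: "phi j l = - 1"
    show ?thesis
      by (rule bexI[of _ "(inverse qvar - 1) / nu"])
        (simp_all add: p inverse_qvar_minus_1_over_nu power_int_minus)
  qed
qed

text \<open>With products expanded as \<delta>\<delta> + nu (y + nu z), the scalar parts cancel
  first. The parts y of the two opposite products coincide and cancel next. In the terms that have
  an explicit factor \<open>nu\<close> only y survives at q = 1, while z survives only in the two
  main products.\<close>

lemma limit_relation:
  assumes ij: "(i, j) \<in> Lidx n" and kl: "(k, l) \<in> Lidx n"
  shows "(of_int (phi j l) / 2) \<odot>\<^bsub>classical_limit n\<^esub> Llim_sum n i j k l
      \<oplus>\<^bsub>classical_limit n\<^esub> (- 1) ^ (par i j * par k l) \<odot>\<^bsub>classical_limit n\<^esub> (Llim n i j \<otimes>\<^bsub>classical_limit n\<^esub> Llim n k l)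
      \<oplus>\<^bsub>classical_limit n\<^esub> (of_bool (k \<le> j \<and> j < l) * of_int (theta i j k)) \<odot>\<^bsub>classical_limit n\<^esub> Llim_sum n i l k j
      \<oplus>\<^bsub>classical_limit n\<^esub> (of_bool (i \<le> - l \<and> - l < j \<and> j \<le> - k) * of_int (theta (- i) (- j) k))
          \<odot>\<^bsub>classical_limit n\<^esub> Llim_sum n i (- l) k (- j)
    = (of_int (phi i k) / 2) \<odot>\<^bsub>classical_limit n\<^esub> Llim_sum n i j k l
      \<oplus>\<^bsub>classical_limit n\<^esub> Llim n k l \<otimes>\<^bsub>classical_limit n\<^esub> Llim n i j
      \<oplus>\<^bsub>classical_limit n\<^esub> (of_bool (k < i \<and> i \<le> l) * of_int (theta i j k)) \<odot>\<^bsub>classical_limit n\<^esub> Llim_sum n i l k j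
      \<oplus>\<^bsub>classical_limit n\<^esub> (of_bool (- l \<le> i \<and> i < - k \<and> - k \<le> j) * of_int (theta (- i) (- j) k))
          \<odot>\<^bsub>classical_limit n\<^esub> Llim_sum n (- i) l (- k) j"
proof -
  let ?T = "classical_limit n" and ?U = "Uq n"
  define y where "y a b c d = of_bool (a = b) \<odot>\<^bsub>?U\<^esub> redL n c d \<oplus>\<^bsub>?U\<^esub> of_bool (c = d) \<odot>\<^bsub>?U\<^esub> redL n a b" for a b c d
  define z where "z a b c d = redL n a b \<otimes>\<^bsub>?U\<^esub> redL n c d" for a b c d
  define W where "W a b c d = y a b c d \<oplus>\<^bsub>?U\<^esub> nu \<odot>\<^bsub>?U\<^esub> z a b c d" for a b c d
  have yz: "y a b c d \<in> carrier (UA1 n)" "z a b c d \<in> carrier (UA1 n)" "W a b c d \<in> carrier (UA1 n)" for a b c d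
    unfolding y_def z_def W_def by (auto intro!: UA1_intros(3-5) A1_of_bool A1_nu)
  have yzU: "y a b c d \<in> carrier ?U" "z a b c d \<in> carrier ?U" "W a b c d \<in> carrier ?U" for a b c d
    by (rule subsetD[OF UA1_subset yz(1)], rule subsetD[OF UA1_subset yz(2)], rule subsetD[OF UA1_subset yz(3)])
  have LL: "Lext n a b \<otimes>\<^bsub>?U\<^esub> Lext n c d = (of_bool (a = b) * of_bool (c = d)) \<odot>\<^bsub>?U\<^esub> \<one>\<^bsub>?U\<^esub> \<oplus>\<^bsub>?U\<^esub> nu \<odot>\<^bsub>?U\<^esub> W a b c d" for a b c d
    unfolding Lext_def W_def y_def z_def by (rule U.expand_product) simp_all
  define s :: cq where "s = (- 1) ^ (par i j * par k l)"
  define d2 :: cq where "d2 = of_bool (k \<le> j \<and> j < l) * of_int (theta i j k)"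
  define d3 :: cq where "d3 = of_bool (i \<le> - l \<and> - l < j \<and> j \<le> - k) * of_int (theta (- i) (- j) k)"
  define d5 :: cq where "d5 = of_bool (k < i \<and> i \<le> l) * of_int (theta i j k)"
  define d6 :: cq where "d6 = of_bool (- l \<le> i \<and> i < - k \<and> - k \<le> j) * of_int (theta (- i) (- j) k)"
  obtain \<kappa>1 where k1: "\<kappa>1 \<in> A1" "qvar powi phi j l = 1 + nu * \<kappa>1" "ev1 \<kappa>1 = of_int (phi j l) / 2"
    using qvar_powi_split by blast
  obtain \<kappa>4 where k4: "\<kappa>4 \<in> A1" "qvar powi phi i k = 1 + nu * \<kappa>4" "ev1 \<kappa>4 = of_int (phi i k) / 2"
    using qvar_powi_split by blast
  have nz: "i \<noteq> 0" "j \<noteq> 0" "k \<noteq> 0" "l \<noteq> 0" "i \<le> j" "k \<le> l" using ij kl by (auto simp: Lidx_def)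
  have v: "inverse nu * nu = 1" by simp
  have rel: "(s * (1 + nu * \<kappa>1)) \<odot>\<^bsub>?U\<^esub> W i j k l \<oplus>\<^bsub>?U\<^esub> (d2 * nu) \<odot>\<^bsub>?U\<^esub> W i l k j \<oplus>\<^bsub>?U\<^esub> (d3 * nu) \<odot>\<^bsub>?U\<^esub> W i (- l) k (- j)
      = (1 + nu * \<kappa>4) \<odot>\<^bsub>?U\<^esub> W k l i j \<oplus>\<^bsub>?U\<^esub> (d5 * nu) \<odot>\<^bsub>?U\<^esub> W i l k j \<oplus>\<^bsub>?U\<^esub> (d6 * nu) \<odot>\<^bsub>?U\<^esub> W (- i) l (- k) j"
  proof (rule U.divide_relation[OF yzU(3) yzU(3) yzU(3) yzU(3) yzU(3) yzU(3) v])
    show "(s * (1 + nu * \<kappa>1)) \<odot>\<^bsub>?U\<^esub> ((of_bool (i = j) * of_bool (k = l)) \<odot>\<^bsub>?U\<^esub> \<one>\<^bsub>?U\<^esub> \<oplus>\<^bsub>?U\<^esub> nu \<odot>\<^bsub>?U\<^esub> W i j k l)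
      \<oplus>\<^bsub>?U\<^esub> (d2 * nu) \<odot>\<^bsub>?U\<^esub> ((of_bool (i = l) * of_bool (k = j)) \<odot>\<^bsub>?U\<^esub> \<one>\<^bsub>?U\<^esub> \<oplus>\<^bsub>?U\<^esub> nu \<odot>\<^bsub>?U\<^esub> W i l k j)
      \<oplus>\<^bsub>?U\<^esub> (d3 * nu) \<odot>\<^bsub>?U\<^esub> ((of_bool (i = - l) * of_bool (k = - j)) \<odot>\<^bsub>?U\<^esub> \<one>\<^bsub>?U\<^esub> \<oplus>\<^bsub>?U\<^esub> nu \<odot>\<^bsub>?U\<^esub> W i (- l) k (- j))
      = (1 + nu * \<kappa>4) \<odot>\<^bsub>?U\<^esub> ((of_bool (k = l) * of_bool (i = j)) \<odot>\<^bsub>?U\<^esub> \<one>\<^bsub>?U\<^esub> \<oplus>\<^bsub>?U\<^esub> nu \<odot>\<^bsub>?U\<^esub> W k l i j)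
      \<oplus>\<^bsub>?U\<^esub> (d5 * nu) \<odot>\<^bsub>?U\<^esub> ((of_bool (i = l) * of_bool (k = j)) \<odot>\<^bsub>?U\<^esub> \<one>\<^bsub>?U\<^esub> \<oplus>\<^bsub>?U\<^esub> nu \<odot>\<^bsub>?U\<^esub> W i l k j)
      \<oplus>\<^bsub>?U\<^esub> (d6 * nu) \<odot>\<^bsub>?U\<^esub> ((of_bool (- i = l) * of_bool (- k = j)) \<odot>\<^bsub>?U\<^esub> \<one>\<^bsub>?U\<^esub> \<oplus>\<^bsub>?U\<^esub> nu \<odot>\<^bsub>?U\<^esub> W (- i) l (- k) j)"
      unfolding LL[symmetric] s_def d2_def d3_def d5_def d6_def k1(2)[symmetric] k4(2)[symmetric]
      by (rule Lgen_relation[OF ij kl Lext_closed Lgen_Lext])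
    \<comment> \<open>Two diagonal generators are even and lead to the same power of q on both
      sides. The scalars of the other terms agree as well: under the respective equalities of
      indices their conditions coincide.\<close>
    have "s * (1 + nu * \<kappa>1) * (of_bool (i = j) * of_bool (k = l)) = (1 + nu * \<kappa>4) * (of_bool (k = l) * of_bool (i = j))"
      using nz k1(2) k4(2) by (cases "i = j"; cases "k = l") (simp_all add: s_def par_def zero_less_mult_iff)
    moreover have "d2 * (of_bool (i = l) * of_bool (k = j)) = d5 * (of_bool (i = l) * of_bool (k = j))"
      using nz by (auto simp: d2_def d5_def)
    moreover have "d3 * (of_bool (i = - l) * of_bool (k = - j)) = d6 * (of_bool (- i = l) * of_bool (- k = j))"
      using nz by (auto simp: d3_def d6_def)
    ultimately show "s * (1 + nu * \<kappa>1) * (of_bool (i = j) * of_bool (k = l)) + d2 * nu * (of_bool (i = l) * of_bool (k = j))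
        + d3 * nu * (of_bool (i = - l) * of_bool (k = - j))
      = (1 + nu * \<kappa>4) * (of_bool (k = l) * of_bool (i = j)) + d5 * nu * (of_bool (i = l) * of_bool (k = j))
        + d6 * nu * (of_bool (- i = l) * of_bool (- k = j))"
      by (simp only: mult.assoc mult.left_commute[of _ nu])
  qed
  have ysym: "y k l i j = y i j k l" unfolding y_def by (rule U.a_comm) simp_all
  \<comment> \<open>If \<open>y\<close> is not 0, one of the two pairs is diagonal, hence even, and
    the sign is 1.\<close>
  have sy: "s \<odot>\<^bsub>?U\<^esub> y i j k l = y i j k l"
    using nz unfolding y_def s_def
    by (cases "i = j"; cases "k = l") (simp_all add: par_def zero_less_mult_iff)
  have rel2: "\<kappa>1 \<odot>\<^bsub>?U\<^esub> y i j k l \<oplus>\<^bsub>?U\<^esub> (s * (1 + nu * \<kappa>1)) \<odot>\<^bsub>?U\<^esub> z i j k l \<oplus>\<^bsub>?U\<^esub> d2 \<odot>\<^bsub>?U\<^esub> W i l k j \<oplus>\<^bsub>?U\<^esub> d3 \<odot>\<^bsub>?U\<^esub> W i (- l) k (- j)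
    = \<kappa>4 \<odot>\<^bsub>?U\<^esub> y i j k l \<oplus>\<^bsub>?U\<^esub> (1 + nu * \<kappa>4) \<odot>\<^bsub>?U\<^esub> z k l i j \<oplus>\<^bsub>?U\<^esub> d5 \<odot>\<^bsub>?U\<^esub> W i l k j \<oplus>\<^bsub>?U\<^esub> d6 \<odot>\<^bsub>?U\<^esub> W (- i) l (- k) j"
    by (rule U.divide_relation_again[OF yzU(1) yzU(2) yzU(2) yzU(3) yzU(3) yzU(3) yzU(3) v sy])
      (use rel in \<open>simp only: W_def[of i j k l] W_def[of k l i j] ysym\<close>)
  have coeffs: "s \<in> A1" "d2 \<in> A1" "d3 \<in> A1" "d5 \<in> A1" "d6 \<in> A1"
    "ev1 s = (- 1) ^ (par i j * par k l)" "ev1 d2 = of_bool (k \<le> j \<and> j < l) * of_int (theta i j k)"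
    "ev1 d3 = of_bool (i \<le> - l \<and> - l < j \<and> j \<le> - k) * of_int (theta (- i) (- j) k)"
    "ev1 d5 = of_bool (k < i \<and> i \<le> l) * of_int (theta i j k)"
    "ev1 d6 = of_bool (- l \<le> i \<and> i < - k \<and> - k \<le> j) * of_int (theta (- i) (- j) k)"
    using A1_of_int[of "(- 1) ^ (par i j * par k l)"] ev1_of_int[of "(- 1) ^ (par i j * par k l)"]
    by (simp_all add: s_def d2_def d3_def d5_def d6_def A1_mult A1_of_bool A1_of_int ev1_mult ev1_of_int)
  have ky: "s * (1 + nu * \<kappa>1) \<in> A1" "ev1 (s * (1 + nu * \<kappa>1)) = ev1 s" "1 + nu * \<kappa>4 \<in> A1" "ev1 (1 + nu * \<kappa>4) = 1"
    using coeffs(1) k1(1) k4(1) by (simp_all add: A1_closed A1_nu ev1_simps ev1_nu)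
  have sy': "spec1 n (y a b c d) = Llim_sum n a b c d" for a b c d
    unfolding y_def Llim_sum_def Llim_def
    by (simp add: spec1_arith(1) spec1_smult A1_of_bool UA1_intros(3))
  have sz: "spec1 n (z a b c d) = Llim n a b \<otimes>\<^bsub>?T\<^esub> Llim n c d" for a b c d
    unfolding z_def Llim_def by (simp add: spec1_arith(2))
  have YT: "Llim_sum n a b c d \<in> carrier ?T" for a b c d unfolding Llim_sum_def by simp
  have sW: "spec1 n (W a b c d) = Llim_sum n a b c d" for a b c d
    unfolding W_def using yz
    by (simp add: spec1_arith(1) spec1_smult A1_nu ev1_nu UA1_intros(3) sy' sz YT)
  have "spec1 n (\<kappa>1 \<odot>\<^bsub>?U\<^esub> y i j k l \<oplus>\<^bsub>?U\<^esub> (s * (1 + nu * \<kappa>1)) \<odot>\<^bsub>?U\<^esub> z i j k l \<oplus>\<^bsub>?U\<^esub> d2 \<odot>\<^bsub>?U\<^esub> W i l k j \<oplus>\<^bsub>?U\<^esub> d3 \<odot>\<^bsub>?U\<^esub> W i (- l) k (- j))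
    = spec1 n (\<kappa>4 \<odot>\<^bsub>?U\<^esub> y i j k l \<oplus>\<^bsub>?U\<^esub> (1 + nu * \<kappa>4) \<odot>\<^bsub>?U\<^esub> z k l i j \<oplus>\<^bsub>?U\<^esub> d5 \<odot>\<^bsub>?U\<^esub> W i l k j \<oplus>\<^bsub>?U\<^esub> d6 \<odot>\<^bsub>?U\<^esub> W (- i) l (- k) j)"
    by (simp only: rel2)
  then show ?thesis
    using yz coeffs ky k1(1,3) k4(1,3)
    by (simp add: spec1_arith(1) spec1_smult UA1_intros(3,4) sy' sz sW)
qed

lemma (in unital_algebra) left_cancel:
  "x \<in> carrier A \<Longrightarrow> y \<in> carrier A \<Longrightarrow> z \<in> carrier A \<Longrightarrow> x \<oplus> y = x \<oplus> z \<longleftrightarrow> y = z"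
  by simp

text \<open>The first-order part of L_aa times L_{-a,-a} = 1.\<close>

lemma Llim_uminus_diag:
  assumes "a \<noteq> 0" "\<bar>a\<bar> \<le> int n"
  shows "Llim n (- a) (- a) = (- 1) \<odot>\<^bsub>classical_limit n\<^esub> Llim n a a"
proof -
  let ?U = "Uq n" and ?T = "classical_limit n"
  have idx: "(a, a) \<in> Lidx n" "(- a, - a) \<in> Lidx n" using assms by (auto simp: Lidx_def)
  let ?x = "redL n a a" and ?y = "redL n (- a) (- a)"
  let ?w = "(1 \<odot>\<^bsub>?U\<^esub> ?y \<oplus>\<^bsub>?U\<^esub> 1 \<odot>\<^bsub>?U\<^esub> ?x) \<oplus>\<^bsub>?U\<^esub> nu \<odot>\<^bsub>?U\<^esub> (?x \<otimes>\<^bsub>?U\<^esub> ?y)"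
  have wc: "?w \<in> carrier ?U" by simp
  have "(1 \<odot>\<^bsub>?U\<^esub> \<one>\<^bsub>?U\<^esub> \<oplus>\<^bsub>?U\<^esub> nu \<odot>\<^bsub>?U\<^esub> ?x) \<otimes>\<^bsub>?U\<^esub> (1 \<odot>\<^bsub>?U\<^esub> \<one>\<^bsub>?U\<^esub> \<oplus>\<^bsub>?U\<^esub> nu \<odot>\<^bsub>?U\<^esub> ?y) = \<one>\<^bsub>?U\<^esub>"
    using Lgen_inverse[OF idx(1)] unfolding Lgen_Lext[OF idx(1)] Lgen_Lext[OF idx(2)] Lext_def by simp
  then have "\<one>\<^bsub>?U\<^esub> \<oplus>\<^bsub>?U\<^esub> nu \<odot>\<^bsub>?U\<^esub> ?w = \<one>\<^bsub>?U\<^esub> \<oplus>\<^bsub>?U\<^esub> nu \<odot>\<^bsub>?U\<^esub> \<zero>\<^bsub>?U\<^esub>"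
    unfolding U.expand_product[OF redL_closed redL_closed] by simp
  then have "nu \<odot>\<^bsub>?U\<^esub> ?w = nu \<odot>\<^bsub>?U\<^esub> \<zero>\<^bsub>?U\<^esub>" using wc by simp
  then have w0: "?w = \<zero>\<^bsub>?U\<^esub>" by (rule U.smult_left_cancel[of "inverse nu" nu, rotated 3]) (use wc in simp_all)
  have "spec1 n ?w = Llim n (- a) (- a) \<oplus>\<^bsub>?T\<^esub> Llim n a a"
    by (simp add: Llim_def[symmetric] spec1_arith(1,2) spec1_smult A1_nu ev1_nu UA1_intros(3,4,5) A1_closed ev1_simps)
  then have "Llim n (- a) (- a) \<oplus>\<^bsub>?T\<^esub> Llim n a a = \<zero>\<^bsub>?T\<^esub>" unfolding w0 by (simp add: spec1_zero)
  then have "Llim n (- a) (- a) = \<ominus>\<^bsub>?T\<^esub> Llim n a a" by (rule C.minus_equality[symmetric]) simp_all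
  then show ?thesis by (simp add: C.smult_minus1)
qed

abbreviation sgc :: "int \<Rightarrow> complex" where
  "sgc a \<equiv> of_int (sgn a)"

text \<open>The image in the classical limit of the sum of the matrix units at \<open>(a, c)\<close> and \<open>(- a, - c)\<close>.\<close>

definition lie_gen :: "nat \<Rightarrow> int \<Rightarrow> int \<Rightarrow> (cq set \<times> ((int \<times> int) list \<Rightarrow> cq) set \<Rightarrow> int) set" where
  "lie_gen n a c = (if c < a then sgc a \<odot>\<^bsub>classical_limit n\<^esub> Llim n c a
    else if a < c then (- sgc a) \<odot>\<^bsub>classical_limit n\<^esub> Llim n (- c) (- a)
    else (2 * sgc a) \<odot>\<^bsub>classical_limit n\<^esub> Llim n a a)"

lemma lie_gen_closed [simp]: "lie_gen n a c \<in> carrier (classical_limit n)"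
  unfolding lie_gen_def by simp

lemma lie_gen_uminus:
  assumes "a \<noteq> 0" "\<bar>a\<bar> \<le> int n"
  shows "lie_gen n (- a) (- c) = lie_gen n a c"
  using Llim_uminus_diag[OF assms] by (simp add: lie_gen_def C.smult_smult sgn_minus)

text \<open>The commutator with sign \<open>s\<close> of E_ac + E_{-a,-c} and E_bd + E_{-b,-d}. The
  first two terms come from factors with matching signs, the other two from factors with opposite
  signs.\<close>

definition lie_bracket :: "nat \<Rightarrow> complex \<Rightarrow> int \<Rightarrow> int \<Rightarrow> int \<Rightarrow> int \<Rightarrow>
    (cq set \<times> ((int \<times> int) list \<Rightarrow> cq) set \<Rightarrow> int) set" where
  "lie_bracket n s a c b d =
    (of_bool (c = b) \<odot>\<^bsub>classical_limit n\<^esub> lie_gen n a d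
      \<oplus>\<^bsub>classical_limit n\<^esub> (- (s * of_bool (d = a))) \<odot>\<^bsub>classical_limit n\<^esub> lie_gen n b c)
    \<oplus>\<^bsub>classical_limit n\<^esub> of_bool (c = - b) \<odot>\<^bsub>classical_limit n\<^esub> lie_gen n a (- d)
    \<oplus>\<^bsub>classical_limit n\<^esub> (- (s * of_bool (d = - a))) \<odot>\<^bsub>classical_limit n\<^esub> lie_gen n b (- c)"

lemma lie_bracket_closed [simp]: "lie_bracket n s a c b d \<in> carrier (classical_limit n)"
  unfolding lie_bracket_def by simp

lemma lie_bracket_uminus:
  assumes "a \<noteq> 0" "\<bar>a\<bar> \<le> int n" "b \<noteq> 0" "\<bar>b\<bar> \<le> int n"
  shows "lie_bracket n s (- a) (- c) b d = lie_bracket n s a c b d"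
    "lie_bracket n s a c (- b) (- d) = lie_bracket n s a c b d"
proof -
  have f: "lie_gen n (- a) d = lie_gen n a (- d)" "lie_gen n (- a) (- d) = lie_gen n a d"
      "lie_gen n (- b) c = lie_gen n b (- c)" "lie_gen n (- b) (- c) = lie_gen n b c"
    using lie_gen_uminus[OF assms(1,2), of "- d"] lie_gen_uminus[OF assms(1,2), of d]
      lie_gen_uminus[OF assms(3,4), of "- c"] lie_gen_uminus[OF assms(3,4), of c] by simp_all
  have e: "- c = b \<longleftrightarrow> c = - b" "- c = - b \<longleftrightarrow> c = b" "d = - (- a) \<longleftrightarrow> d = a"
     "- d = a \<longleftrightarrow> d = - a" "- d = - a \<longleftrightarrow> d = a" "c = - (- b) \<longleftrightarrow> c = b" by auto
  show "lie_bracket n s (- a) (- c) b d = lie_bracket n s a c b d"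
    unfolding lie_bracket_def f e minus_minus by (simp add: C.a_ac)
  show "lie_bracket n s a c (- b) (- d) = lie_bracket n s a c b d"
    unfolding lie_bracket_def f e minus_minus by (simp add: C.a_ac)
qed

lemma (in unital_algebra) smult_cong_if:
  assumes "P \<Longrightarrow> \<alpha> \<odot> x = y" "x \<in> carrier A" "y \<in> carrier A"
  shows "\<alpha> \<odot> (of_bool P \<odot> x) = of_bool P \<odot> y"
  using assms by (cases P) simp_all

text \<open>This is \<open>limit_relation\<close> at i = c, j = a, k = d, l = b, without first-order
  part since neither pair is diagonal. After multiplication by sgn a sgn b the four terms of the
  bracket are matched one at a time in \<open>T1\<close> to \<open>T4\<close>.\<close>

lemma lie_relation_off_diagonal:
  assumes nz: "a \<noteq> 0" "c \<noteq> 0" "b \<noteq> 0" "d \<noteq> 0"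
    and bd: "\<bar>a\<bar> \<le> int n" "\<bar>c\<bar> \<le> int n" "\<bar>b\<bar> \<le> int n" "\<bar>d\<bar> \<le> int n"
    and ord: "c < a" "d < b"
  shows "lie_gen n a c \<otimes>\<^bsub>classical_limit n\<^esub> lie_gen n b d
    = (- 1) ^ (par c a * par d b) \<odot>\<^bsub>classical_limit n\<^esub> (lie_gen n b d \<otimes>\<^bsub>classical_limit n\<^esub> lie_gen n a c)
      \<oplus>\<^bsub>classical_limit n\<^esub> lie_bracket n ((- 1) ^ (par c a * par d b)) a c b d"
proof -
  let ?T = "classical_limit n"
  define s :: complex where "s = (- 1) ^ (par c a * par d b)"
  define r :: complex where "r = sgc a * sgc b"
  define e2 :: complex where "e2 = of_bool (d \<le> a \<and> a < b) * of_int (theta c a d)"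
  define e3 :: complex where "e3 = of_bool (c \<le> - b \<and> - b < a \<and> a \<le> - d) * of_int (theta (- c) (- a) d)"
  define e5 :: complex where "e5 = of_bool (d < c \<and> c \<le> b) * of_int (theta c a d)"
  define e6 :: complex where "e6 = of_bool (- b \<le> c \<and> c < - d \<and> - d \<le> a) * of_int (theta (- c) (- a) d)"
  have idx: "(c, a) \<in> Lidx n" "(d, b) \<in> Lidx n" using nz bd ord by (auto simp: Lidx_def)
  have Y0: "Llim_sum n c a d b = \<zero>\<^bsub>?T\<^esub>" using ord by (simp add: Llim_sum_def)
  have rel: "s \<odot>\<^bsub>?T\<^esub> (Llim n c a \<otimes>\<^bsub>?T\<^esub> Llim n d b) \<oplus>\<^bsub>?T\<^esub> e2 \<odot>\<^bsub>?T\<^esub> Llim_sum n c b d a \<oplus>\<^bsub>?T\<^esub> e3 \<odot>\<^bsub>?T\<^esub> Llim_sum n c (- b) d (- a)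
      = Llim n d b \<otimes>\<^bsub>?T\<^esub> Llim n c a \<oplus>\<^bsub>?T\<^esub> e5 \<odot>\<^bsub>?T\<^esub> Llim_sum n c b d a \<oplus>\<^bsub>?T\<^esub> e6 \<odot>\<^bsub>?T\<^esub> Llim_sum n (- c) b (- d) a"
    using limit_relation[OF idx] unfolding Y0 s_def[symmetric] e2_def[symmetric] e3_def[symmetric] e5_def[symmetric] e6_def[symmetric]
    by (simp only: C.smult_zero C.l_zero C.smult_closed C.m_closed Llim_closed)
  have ss: "s * s = 1" by (simp add: s_def flip: power_add)
  have sg: "r = sgc a * sgc b" "sgn a = 1 \<or> sgn a = - 1" using nz by (auto simp: r_def sgn_if)
  note S = C.solve_relation[OF _ _ _ _ _ _ _ _ ss rel[unfolded Llim_sum_def], of r]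
  have t: "lie_gen n a c = sgc a \<odot>\<^bsub>?T\<^esub> Llim n c a" "lie_gen n b d = sgc b \<odot>\<^bsub>?T\<^esub> Llim n d b" using ord by (simp_all add: lie_gen_def)
  have p: "lie_gen n a c \<otimes>\<^bsub>?T\<^esub> lie_gen n b d = r \<odot>\<^bsub>?T\<^esub> (Llim n c a \<otimes>\<^bsub>?T\<^esub> Llim n d b)"
    "s \<odot>\<^bsub>?T\<^esub> (lie_gen n b d \<otimes>\<^bsub>?T\<^esub> lie_gen n a c) = (r * s) \<odot>\<^bsub>?T\<^esub> (Llim n d b \<otimes>\<^bsub>?T\<^esub> Llim n c a)"
    unfolding t r_def by (simp_all add: C.smult_mult_left C.smult_mult_right C.smult_smult mult_ac)
  have sb: "s = (if a * c < 0 \<and> b * d < 0 then - 1 else 1)"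
    using nz by (auto simp: s_def par_def zero_less_mult_iff mult_less_0_iff)
  have T1: "(r * s * (e5 - e2)) \<odot>\<^bsub>?T\<^esub> (of_bool (c = b) \<odot>\<^bsub>?T\<^esub> Llim n d a) = of_bool (c = b) \<odot>\<^bsub>?T\<^esub> lie_gen n a d"
  proof (rule C.smult_cong_if)
    assume cb: "c = b"
    have "r * s * (e5 - e2) = sgc a"
      using nz ord cb by (auto simp: r_def sb e5_def e2_def theta_def sgn_if mult_less_0_iff)
    then show "(r * s * (e5 - e2)) \<odot>\<^bsub>?T\<^esub> Llim n d a = lie_gen n a d" using ord cb by (simp add: lie_gen_def)
  qed simp_all
  have T3: "(r * s * (e5 - e2)) \<odot>\<^bsub>?T\<^esub> (of_bool (d = a) \<odot>\<^bsub>?T\<^esub> Llim n c b) = (- (s * of_bool (d = a))) \<odot>\<^bsub>?T\<^esub> lie_gen n b c"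
  proof -
    have "(r * s * (e5 - e2)) \<odot>\<^bsub>?T\<^esub> (of_bool (d = a) \<odot>\<^bsub>?T\<^esub> Llim n c b) = of_bool (d = a) \<odot>\<^bsub>?T\<^esub> ((- s) \<odot>\<^bsub>?T\<^esub> lie_gen n b c)"
    proof (rule C.smult_cong_if)
      assume da: "d = a"
      have "r * s * (e5 - e2) = - s * sgc b"
        using nz ord da by (auto simp: r_def sb e5_def e2_def theta_def sgn_if mult_less_0_iff)
      then show "(r * s * (e5 - e2)) \<odot>\<^bsub>?T\<^esub> Llim n c b = (- s) \<odot>\<^bsub>?T\<^esub> lie_gen n b c" using ord da by (simp add: lie_gen_def C.smult_smult)
    qed simp_all
    then show ?thesis by (simp add: C.smult_smult mult.commute)
  qed
  have T2: "(r * s * e6) \<odot>\<^bsub>?T\<^esub> (of_bool (- c = b) \<odot>\<^bsub>?T\<^esub> Llim n (- d) a) \<oplus>\<^bsub>?T\<^esub> (- (r * s * e3)) \<odot>\<^bsub>?T\<^esub> (of_bool (c = - b) \<odot>\<^bsub>?T\<^esub> Llim n d (- a))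
     = of_bool (c = - b) \<odot>\<^bsub>?T\<^esub> lie_gen n a (- d)"
  proof (cases "c = - b")
    case True
    have th: "r * s * of_int (theta (- c) (- a) d) = sgc a" if "- b < a" "d < b"
      using nz that True by (auto simp: r_def sb theta_def sgn_if mult_less_0_iff zero_less_mult_iff)
    have c6: "r * s * e6 = of_bool (- d \<le> a) * sgc a" "r * s * e3 = of_bool (a \<le> - d) * sgc a"
      using ord True th by (auto simp: e6_def e3_def mult.assoc)
    consider "- d < a" | "- d = a" | "a < - d" by linarith
    then show ?thesis
    proof cases
      case 2
      have d: "d = - a" using 2 by simp
      \<comment> \<open>At d = - a both reversed terms are present, and since the diagonal entries
        at a and - a are opposite, they add up. This is why \<open>lie_gen\<close> doubles on the
        diagonal.\<close>
      have "lie_gen n a a = sgc a \<odot>\<^bsub>?T\<^esub> Llim n a a \<oplus>\<^bsub>?T\<^esub> (- sgc a) \<odot>\<^bsub>?T\<^esub> ((- 1) \<odot>\<^bsub>?T\<^esub> Llim n a a)"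
        using C.smult_add_left[of "Llim n a a" n "sgc a" "sgc a"] by (simp add: lie_gen_def C.smult_smult)
      then show ?thesis unfolding c6 unfolding d minus_minus Llim_uminus_diag[OF nz(1) bd(1)] using True by simp
    qed (use True in \<open>simp_all add: c6 lie_gen_def\<close>)
  next
    case False
    then have "- c \<noteq> b" by auto
    then show ?thesis using False by simp
  qed
  have T4: "(r * s * e6) \<odot>\<^bsub>?T\<^esub> (of_bool (- d = a) \<odot>\<^bsub>?T\<^esub> Llim n (- c) b) \<oplus>\<^bsub>?T\<^esub> (- (r * s * e3)) \<odot>\<^bsub>?T\<^esub> (of_bool (d = - a) \<odot>\<^bsub>?T\<^esub> Llim n c (- b))
     = (- (s * of_bool (d = - a))) \<odot>\<^bsub>?T\<^esub> lie_gen n b (- c)"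
  proof (cases "d = - a")
    case True
    have th: "r * of_int (theta (- c) (- a) d) = - sgc b"
      using nz ord True by (auto simp: r_def theta_def sgn_if)
    then have th': "r * (s * of_int (theta (- c) (- a) d)) = - (s * sgc b)" by (simp only: mult.left_commute[of r s] mult_minus_right)
    have c6: "r * s * e6 = of_bool (- b \<le> c) * (- s * sgc b)" "r * s * e3 = of_bool (c \<le> - b) * (- s * sgc b)"
      using ord True th' by (auto simp: e6_def e3_def mult.assoc)
    consider "- b < c" | "- b = c" | "c < - b" by linarith
    then show ?thesis
    proof cases
      case 2
      have c: "c = - b" using 2 by simp
      have "(- s) \<odot>\<^bsub>?T\<^esub> lie_gen n b b = (- s * sgc b) \<odot>\<^bsub>?T\<^esub> Llim n b b \<oplus>\<^bsub>?T\<^esub> (s * sgc b) \<odot>\<^bsub>?T\<^esub> ((- 1) \<odot>\<^bsub>?T\<^esub> Llim n b b)"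
        using C.smult_add_left[of "Llim n b b" n "- s * sgc b" "- s * sgc b"] by (simp add: lie_gen_def C.smult_smult mult_ac)
      then show ?thesis unfolding c6 unfolding c minus_minus Llim_uminus_diag[OF nz(3) bd(3)] using True by simp
    qed (use True in \<open>simp_all add: c6 lie_gen_def C.smult_smult\<close>)
  next
    case False
    then have "- d \<noteq> a" by auto
    then show ?thesis using False by simp
  qed
  show ?thesis
    unfolding s_def[symmetric] p lie_bracket_def T1[symmetric] T3[symmetric] T2[symmetric] T4[symmetric]
    by (rule S) simp_all
qed

lemma (in unital_algebra) solve_diagonal:
  assumes c: "p \<in> carrier A" "q \<in> carrier A" "x \<in> carrier A"
    and rel: "\<alpha> \<odot> x \<oplus> p \<oplus> \<beta> \<odot> x = \<gamma> \<odot> x \<oplus> q \<oplus> \<delta> \<odot> x"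
  shows "p = q \<oplus> (\<gamma> + \<delta> + - \<alpha> + - \<beta>) \<odot> x"
proof -
  have "p = (\<alpha> \<odot> x \<oplus> p \<oplus> \<beta> \<odot> x) \<oplus> ((- \<alpha>) \<odot> x \<oplus> (- \<beta>) \<odot> x)"
    using c by (simp add: smult_uminus_left a_ac r_neg1 r_neg2 r_neg)
  also have "\<dots> = q \<oplus> (\<gamma> + \<delta> + - \<alpha> + - \<beta>) \<odot> x"
    unfolding rel using c by (simp only: smult_add_left a_ac smult_closed a_closed)
  finally show ?thesis .
qed

text \<open>Commutation with a diagonal generator multiplies \<open>lie_gen n b d\<close> by a
  weight \<open>\<epsilon>\<close>. It combines the halves from the powers of q with whole units
  from \<open>e2\<close> and \<open>e5\<close>.\<close>

lemma lie_relation_diagonal: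
  assumes nz: "a \<noteq> 0" "b \<noteq> 0" "d \<noteq> 0"
    and bd: "\<bar>a\<bar> \<le> int n" "\<bar>b\<bar> \<le> int n" "\<bar>d\<bar> \<le> int n"
    and ord: "d \<le> b"
  shows "lie_gen n a a \<otimes>\<^bsub>classical_limit n\<^esub> lie_gen n b d
    = lie_gen n b d \<otimes>\<^bsub>classical_limit n\<^esub> lie_gen n a a \<oplus>\<^bsub>classical_limit n\<^esub> lie_bracket n 1 a a b d"
proof -
  let ?T = "classical_limit n"
  have idx: "(a, a) \<in> Lidx n" "(d, b) \<in> Lidx n" using nz bd ord by (auto simp: Lidx_def)
  have z: "of_bool (a \<le> - b \<and> - b < a \<and> a \<le> - d) = (0 :: complex)" "of_bool (- b \<le> a \<and> a < - d \<and> - d \<le> a) = (0 :: complex)"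
    by auto
  have s: "(- 1) ^ (par a a * par d b) = (1 :: complex)" using nz by (simp add: par_def zero_less_mult_iff)
  define x where "x = Llim n d b"
  have xc: "x \<in> carrier ?T" by (simp add: x_def)
  define m :: complex where "m = (if b = d then 2 else 1)"
  define r :: complex where "r = 2 * sgc a * (m * sgc b)"
  define \<epsilon> :: complex where "\<epsilon> = of_bool (a = b) - of_bool (d = a) + of_bool (a = - b) - of_bool (d = - a)"
  have t: "lie_gen n a a = (2 * sgc a) \<odot>\<^bsub>?T\<^esub> Llim n a a" "lie_gen n b d = (m * sgc b) \<odot>\<^bsub>?T\<^esub> x"
    using ord by (auto simp: lie_gen_def m_def x_def)
  have p: "lie_gen n a a \<otimes>\<^bsub>?T\<^esub> lie_gen n b d = r \<odot>\<^bsub>?T\<^esub> (Llim n a a \<otimes>\<^bsub>?T\<^esub> x)"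
    "lie_gen n b d \<otimes>\<^bsub>?T\<^esub> lie_gen n a a = r \<odot>\<^bsub>?T\<^esub> (x \<otimes>\<^bsub>?T\<^esub> Llim n a a)"
    unfolding t r_def using xc by (simp_all add: C.smult_mult_left C.smult_mult_right C.smult_smult mult_ac)
  have B: "lie_bracket n 1 a a b d = \<epsilon> \<odot>\<^bsub>?T\<^esub> lie_gen n b d"
  proof -
    have f: "lie_gen n (- b) (- d) = lie_gen n b d" by (rule lie_gen_uminus[OF nz(2) bd(2)])
    have "of_bool (a = b) \<odot>\<^bsub>?T\<^esub> lie_gen n a d = (of_bool (a = b)) \<odot>\<^bsub>?T\<^esub> lie_gen n b d"
      "(- (1 * of_bool (d = a))) \<odot>\<^bsub>?T\<^esub> lie_gen n b a = (- of_bool (d = a)) \<odot>\<^bsub>?T\<^esub> lie_gen n b d"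
      "of_bool (a = - b) \<odot>\<^bsub>?T\<^esub> lie_gen n a (- d) = (of_bool (a = - b)) \<odot>\<^bsub>?T\<^esub> lie_gen n b d"
      "(- (1 * of_bool (d = - a))) \<odot>\<^bsub>?T\<^esub> lie_gen n b (- a) = (- of_bool (d = - a)) \<odot>\<^bsub>?T\<^esub> lie_gen n b d"
      subgoal by (cases "a = b") simp_all
      subgoal by (cases "d = a") simp_all
      subgoal using f by (cases "a = - b") auto
      subgoal using f by (cases "d = - a") auto
      done
    then show ?thesis
      unfolding lie_bracket_def \<epsilon>_def diff_conv_add_uminus by (simp only: C.smult_add_left lie_gen_closed C.a_assoc C.a_closed C.smult_closed)
  qed
  show ?thesis
  proof (cases "d = b")
    case True
    have z': "of_bool (d \<le> a \<and> a < b) = (0 :: complex)" "of_bool (d < a \<and> a \<le> b) = (0 :: complex)" using True by auto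
    have "Llim n a a \<otimes>\<^bsub>?T\<^esub> x = x \<otimes>\<^bsub>?T\<^esub> Llim n a a"
    proof -
      have Yc: "Llim_sum n a a b b \<in> carrier ?T" "Llim_sum n a b b a \<in> carrier ?T" "Llim_sum n a (- b) b (- a) \<in> carrier ?T" "Llim_sum n (- a) b (- b) a \<in> carrier ?T"
        by (simp_all add: Llim_sum_def)
      have "of_int (phi a b) / 2 \<odot>\<^bsub>?T\<^esub> Llim_sum n a a b b \<oplus>\<^bsub>?T\<^esub> Llim n a a \<otimes>\<^bsub>?T\<^esub> Llim n b b
          = of_int (phi a b) / 2 \<odot>\<^bsub>?T\<^esub> Llim_sum n a a b b \<oplus>\<^bsub>?T\<^esub> Llim n b b \<otimes>\<^bsub>?T\<^esub> Llim n a a"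
        using limit_relation[OF idx, unfolded True] Yc
        unfolding z[unfolded True] z'[unfolded True] s[unfolded True] mult_zero_left
        by (simp only: C.smult_0 C.r_zero C.smult_1 C.smult_closed C.a_closed C.m_closed Llim_closed)
      then show ?thesis unfolding x_def True using Yc by (simp only: C.left_cancel C.smult_closed C.m_closed Llim_closed)
    qed
    moreover have "\<epsilon> = 0" using True by (auto simp: \<epsilon>_def)
    ultimately show ?thesis unfolding p B using xc by simp
  next
    case False
    define \<mu> :: complex where "\<mu> = of_bool (a = b) + of_bool (d = a)"
    have Y1: "Llim_sum n a a d b = x" using False by (simp add: Llim_sum_def x_def)
    have Y2: "Llim_sum n a b d a = \<mu> \<odot>\<^bsub>?T\<^esub> x"
    proof -
      have "of_bool (a = b) \<odot>\<^bsub>?T\<^esub> Llim n d a = of_bool (a = b) \<odot>\<^bsub>?T\<^esub> x" "of_bool (d = a) \<odot>\<^bsub>?T\<^esub> Llim n a b = of_bool (d = a) \<odot>\<^bsub>?T\<^esub> x"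
        unfolding x_def
        subgoal by (cases "a = b") simp_all
        subgoal by (cases "d = a") simp_all
        done
      then show ?thesis unfolding Llim_sum_def \<mu>_def using xc by (simp only: C.smult_add_left)
    qed
    define \<alpha> :: complex where "\<alpha> = of_int (phi a b) / 2"
    define \<gamma> :: complex where "\<gamma> = of_int (phi a d) / 2"
    define e2 :: complex where "e2 = of_bool (d \<le> a \<and> a < b) * of_int (theta a a d)"
    define e5 :: complex where "e5 = of_bool (d < a \<and> a \<le> b) * of_int (theta a a d)"
    have "\<alpha> \<odot>\<^bsub>?T\<^esub> x \<oplus>\<^bsub>?T\<^esub> 1 \<odot>\<^bsub>?T\<^esub> (Llim n a a \<otimes>\<^bsub>?T\<^esub> x) \<oplus>\<^bsub>?T\<^esub> e2 \<odot>\<^bsub>?T\<^esub> (\<mu> \<odot>\<^bsub>?T\<^esub> x) \<oplus>\<^bsub>?T\<^esub> 0 \<odot>\<^bsub>?T\<^esub> Llim_sum n a (- b) d (- a)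
        = \<gamma> \<odot>\<^bsub>?T\<^esub> x \<oplus>\<^bsub>?T\<^esub> x \<otimes>\<^bsub>?T\<^esub> Llim n a a \<oplus>\<^bsub>?T\<^esub> e5 \<odot>\<^bsub>?T\<^esub> (\<mu> \<odot>\<^bsub>?T\<^esub> x) \<oplus>\<^bsub>?T\<^esub> 0 \<odot>\<^bsub>?T\<^esub> Llim_sum n (- a) b (- d) a"
      using limit_relation[OF idx] unfolding z s mult_zero_left Y1 Y2 \<alpha>_def[symmetric] \<gamma>_def[symmetric] e2_def[symmetric] e5_def[symmetric] x_def[symmetric] .
    moreover have "Llim_sum n a (- b) d (- a) \<in> carrier ?T" "Llim_sum n (- a) b (- d) a \<in> carrier ?T" by (simp_all add: Llim_sum_def)
    ultimately have rel: "\<alpha> \<odot>\<^bsub>?T\<^esub> x \<oplus>\<^bsub>?T\<^esub> (Llim n a a \<otimes>\<^bsub>?T\<^esub> x) \<oplus>\<^bsub>?T\<^esub> (e2 * \<mu>) \<odot>\<^bsub>?T\<^esub> x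
        = \<gamma> \<odot>\<^bsub>?T\<^esub> x \<oplus>\<^bsub>?T\<^esub> x \<otimes>\<^bsub>?T\<^esub> Llim n a a \<oplus>\<^bsub>?T\<^esub> (e5 * \<mu>) \<odot>\<^bsub>?T\<^esub> x"
      using xc by (simp only: C.smult_0 C.r_zero C.smult_smult C.smult_1 C.smult_closed C.a_closed C.m_closed Llim_closed)
    have sol: "Llim n a a \<otimes>\<^bsub>?T\<^esub> x = x \<otimes>\<^bsub>?T\<^esub> Llim n a a \<oplus>\<^bsub>?T\<^esub> (\<gamma> + e5 * \<mu> + - \<alpha> + - (e2 * \<mu>)) \<odot>\<^bsub>?T\<^esub> x"
      by (rule C.solve_diagonal[OF _ _ xc rel]) (use xc in simp_all)
    \<comment> \<open>For a = b and d different from both a and - a, the unit sgn a in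
      \<open>e5\<close> is reduced by half of sgn a from \<open>\<alpha>\<close>; doubling and
      multiplying by sgn a gives 1.\<close>
    have co: "2 * sgc a * (\<gamma> + e5 * \<mu> + - \<alpha> + - (e2 * \<mu>)) = \<epsilon>"
      using nz ord False
      by (cases "a = b"; cases "d = a"; cases "a = - b"; cases "d = - a")
        (auto simp: \<gamma>_def \<alpha>_def \<mu>_def \<epsilon>_def e5_def e2_def phi_def theta_def sgn_if)
    have "lie_gen n a a \<otimes>\<^bsub>?T\<^esub> lie_gen n b d = r \<odot>\<^bsub>?T\<^esub> (x \<otimes>\<^bsub>?T\<^esub> Llim n a a) \<oplus>\<^bsub>?T\<^esub> (\<epsilon> * (m * sgc b)) \<odot>\<^bsub>?T\<^esub> x"
      unfolding p sol co[symmetric] r_def using xc by (simp add: C.smult_add_right C.smult_smult mult_ac)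
    then show ?thesis unfolding p(2) B unfolding t using xc by (simp add: C.smult_smult)
  qed
qed

lemma par_uminus: "par (- a) (- b) = par a b" and par_commute: "par a b = par b a"
  by (simp_all add: par_def mult.commute)

text \<open>If the second generator is diagonal, the relation with the two factors interchanged
  applies. A diagonal generator is even, so the bracket is then antisymmetric.\<close>

lemma lie_relation_ordered:
  assumes nz: "a \<noteq> 0" "c \<noteq> 0" "b \<noteq> 0" "d \<noteq> 0"
    and bd: "\<bar>a\<bar> \<le> int n" "\<bar>c\<bar> \<le> int n" "\<bar>b\<bar> \<le> int n" "\<bar>d\<bar> \<le> int n"
    and ord: "c \<le> a" "d \<le> b"
  shows "lie_gen n a c \<otimes>\<^bsub>classical_limit n\<^esub> lie_gen n b d
    = (- 1) ^ (par c a * par d b) \<odot>\<^bsub>classical_limit n\<^esub> (lie_gen n b d \<otimes>\<^bsub>classical_limit n\<^esub> lie_gen n a c)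
      \<oplus>\<^bsub>classical_limit n\<^esub> lie_bracket n ((- 1) ^ (par c a * par d b)) a c b d"
proof -
  let ?T = "classical_limit n"
  have p: "par a a = 0" "par b b = 0" using nz by (auto simp: par_def zero_less_mult_iff)
  consider "c < a" "d < b" | "c = a" | "d = b" using ord by linarith
  then show ?thesis
  proof cases
    case 1
    then show ?thesis by (rule lie_relation_off_diagonal[OF nz bd])
  next
    case 2
    then show ?thesis using lie_relation_diagonal[OF nz(1,3,4) bd(1,3,4) ord(2)] p by simp
  next
    case 3
    have e: "lie_bracket n 1 a c b b = \<ominus>\<^bsub>?T\<^esub> lie_bracket n 1 b b a c"
    proof -
      have q: "b = c \<longleftrightarrow> c = b" "b = - c \<longleftrightarrow> c = - b" "b = - a \<longleftrightarrow> a = - b" "(b = a) = (a = b)" by auto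
      have f: "lie_gen n a (- b) = lie_gen n (- a) b" using lie_gen_uminus[OF nz(1) bd(1), of "- b"] by simp
      show ?thesis unfolding lie_bracket_def q mult_1 
        by (simp add: C.smult_uminus_left C.minus_add C.a_ac)
    qed
    have d: "lie_gen n b b \<otimes>\<^bsub>?T\<^esub> lie_gen n a c = lie_gen n a c \<otimes>\<^bsub>?T\<^esub> lie_gen n b b \<oplus>\<^bsub>?T\<^esub> lie_bracket n 1 b b a c"
      by (rule lie_relation_diagonal) (use nz bd ord in simp_all)
    have "lie_gen n a c \<otimes>\<^bsub>?T\<^esub> lie_gen n b b = lie_gen n b b \<otimes>\<^bsub>?T\<^esub> lie_gen n a c \<oplus>\<^bsub>?T\<^esub> lie_bracket n 1 a c b b"
      unfolding d e by (simp add: C.a_assoc C.r_neg)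
    then show ?thesis using 3 p by simp
  qed
qed

text \<open>The labels (a, c) and (- a, - c) name the same generator, so both pairs may be taken in
  decreasing order.\<close>

theorem lie_relation:
  assumes nz: "a \<noteq> 0" "c \<noteq> 0" "b \<noteq> 0" "d \<noteq> 0"
    and bd: "\<bar>a\<bar> \<le> int n" "\<bar>c\<bar> \<le> int n" "\<bar>b\<bar> \<le> int n" "\<bar>d\<bar> \<le> int n"
  shows "lie_gen n a c \<otimes>\<^bsub>classical_limit n\<^esub> lie_gen n b d
    = (- 1) ^ (par a c * par b d) \<odot>\<^bsub>classical_limit n\<^esub> (lie_gen n b d \<otimes>\<^bsub>classical_limit n\<^esub> lie_gen n a c)
      \<oplus>\<^bsub>classical_limit n\<^esub> lie_bracket n ((- 1) ^ (par a c * par b d)) a c b d"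
proof -
  have f: "lie_gen n (- a) (- c) = lie_gen n a c" "lie_gen n (- b) (- d) = lie_gen n b d"
    using lie_gen_uminus nz bd by simp_all
  have g: "lie_bracket n s (- a) (- c) (- b) (- d) = lie_bracket n s a c b d" 
    "lie_bracket n s (- a) (- c) b d = lie_bracket n s a c b d"
    "lie_bracket n s a c (- b) (- d) = lie_bracket n s a c b d" for s
    using lie_bracket_uminus[OF nz(1) bd(1) nz(3) bd(3)] lie_bracket_uminus(1)[of a n "- b" s c "- d"] nz bd by simp_all
  consider "c \<le> a" "d \<le> b" | "- c \<le> - a" "d \<le> b" | "c \<le> a" "- d \<le> - b" | "- c \<le> - a" "- d \<le> - b" by linarith
  then show ?thesis
  proof cases
    case 1
    show ?thesis using lie_relation_ordered[OF nz bd 1] unfolding par_commute[of c a] par_commute[of d b] .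
  next
    case 2
    show ?thesis
      using lie_relation_ordered[of "- a" "- c" b d n] nz bd 2
      unfolding par_uminus f g par_commute[of c a] par_commute[of d b] by simp
  next
    case 3
    show ?thesis
      using lie_relation_ordered[of a c "- b" "- d" n] nz bd 3
      unfolding par_uminus f g par_commute[of c a] par_commute[of d b] by simp
  next
    case 4
    show ?thesis
      using lie_relation_ordered[of "- a" "- c" "- b" "- d" n] nz bd 4
      unfolding par_uminus f g par_commute[of c a] par_commute[of d b] by simp
  qed
qed

section \<open>The action of the classical limit on words\<close>

lemma specializes_unique: "specializes F g \<Longrightarrow> specializes F h \<Longrightarrow> g = h"
  by (rule ext) (auto simp: specializes_def)

lemma specializes_add: "specializes F f \<Longrightarrow> specializes G g \<Longrightarrow> specializes (\<lambda>w. F w + G w) (\<lambda>w. f w + g w)"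
  by (simp add: specializes_def A1_closed ev1_simps)

lemma specializes_scale: "r \<in> A1 \<Longrightarrow> specializes F f \<Longrightarrow> specializes (\<lambda>w. r * F w) (\<lambda>w. ev1 r * f w)"
  by (simp add: specializes_def A1_closed ev1_simps)

lemma deriv_op_uminus:
  assumes "a \<noteq> 0" "b \<noteq> 0"
  shows "deriv_op w (- a) (- b) f = deriv_op w a b f"
proof (induction w arbitrary: f)
  case (Cons x w)
  have "x = - a \<longleftrightarrow> - x = a" "- x = - a \<longleftrightarrow> x = a" by auto
  then show ?case using Cons assms by auto
qed simp

text \<open>One choice of integral function above a complex one; the limit of an operator will not
  depend on the choice.\<close>

definition constant_lift :: "('w \<Rightarrow> complex) \<Rightarrow> 'w \<Rightarrow> cq" where
  "constant_lift f w = Fract [:f w:] 1"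

lemma specializes_constant_lift: "specializes (constant_lift f) f"
  by (simp add: specializes_def constant_lift_def A1_const ev1_const)

interpretation O: unital_algebra "op_algebra :: ('k::comm_ring_1, ('w \<Rightarrow> 'k) \<Rightarrow> 'w \<Rightarrow> 'k) module"
  by (rule unital_algebra_op_algebra)

lemma op_algebra_minus:
  assumes "S \<in> carrier op_algebra" "T \<in> carrier op_algebra"
  shows "S \<ominus>\<^bsub>op_algebra\<^esub> T = (\<lambda>f w. S f w - T f w)"
  unfolding a_minus_def O.smult_minus1[OF assms(2)] by simp

definition redL_limit :: "int \<Rightarrow> int \<Rightarrow> (int list \<Rightarrow> complex) \<Rightarrow> int list \<Rightarrow> complex" where
  "redL_limit i j f w = (if i = j then of_int (sgn i) / 2 else if j < 0 then - 1 else 1) * deriv_op w j i f"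

text \<open>Reduction at q = 1 of an operator from the integral form depends only on the reduction
  of its argument. This holds for the reduced generators by explicit computation, and scalars from
  \<open>A1\<close>, sums and products inherit it.\<close>

theorem limit_action:
  "\<exists>\<Phi>\<in>alg_hom (classical_limit n) op_algebra. \<forall>a c. (a, c) \<in> qbasis n \<longrightarrow> \<Phi> (lie_gen n a c) = (\<lambda>f w. deriv_op w a c f)"
proof -
  obtain \<rho> where \<rho>: "\<rho> \<in> alg_hom (Uq n) op_algebra" and L: "\<And>i j. (i, j) \<in> Lidx n \<Longrightarrow> \<rho> (Lgen n i j) = L_op i j"
    using word_representation[of n] by blast
  note h = alg_homD[OF \<rho>]
  have \<rho>_redL: "\<rho> (redL n i j) = (\<lambda>F w. (1 / nu) * (L_op i j F w - of_bool (i = j) * F w))" if ij: "(i, j) \<in> Lidx n" for i j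
  proof -
    have c: "Lgen n i j \<in> carrier (Uq n)" "of_bool (i = j) \<odot>\<^bsub>Uq n\<^esub> \<one>\<^bsub>Uq n\<^esub> \<in> carrier (Uq n)"
      using Lgen_closed[OF ij] by simp_all
    have one: "\<rho> (of_bool (i = j) \<odot>\<^bsub>Uq n\<^esub> \<one>\<^bsub>Uq n\<^esub>) = (\<lambda>F w. of_bool (i = j) * F w)"
      unfolding h(6)[OF U.one_closed] h(5) by simp
    have "\<rho> (Lgen n i j \<ominus>\<^bsub>Uq n\<^esub> of_bool (i = j) \<odot>\<^bsub>Uq n\<^esub> \<one>\<^bsub>Uq n\<^esub>) = (\<lambda>F w. L_op i j F w - of_bool (i = j) * F w)"
      unfolding ring_hom_zero_minus(3)[OF U.ring_axioms O.ring_axioms h(1) c]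
      unfolding op_algebra_minus[OF h(2)[OF c(1)] h(2)[OF c(2)]]
      unfolding one L[OF ij] ..
    then show ?thesis
      using ij h(6)[OF U.minus_closed[OF c], of "1 / nu"] by (simp add: redL_def)
  qed
  have generator: "specializes (\<rho> (redL n i j) F) (redL_limit i j f)" if "(i, j) \<in> Lidx n" "specializes F f" for i j F f
  proof (cases "i = j")
    case True
    have "i \<noteq> 0" using that(1) by (simp add: Lidx_def)
    from specializes_L_op_diag[OF that(2) this] show ?thesis
      unfolding \<rho>_redL[OF that(1)] redL_limit_def using True by simp
  next
    case False
    have "i < j" "i \<noteq> 0" "j \<noteq> 0" using that(1) False by (auto simp: Lidx_def)
    from specializes_L_op[OF that(2) this] show ?thesis
      unfolding \<rho>_redL[OF that(1)] redL_limit_def using False by (simp cong: if_cong)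
  qed
  define \<beta> where "\<beta> u f w = ev1 (\<rho> u (constant_lift f) w)" for u f w
  have UAc: "u \<in> carrier (Uq n)" if "u \<in> carrier (UA1 n)" for u using that UA1_subset by (rule subsetD[rotated])
  \<comment> \<open>The existence of \<open>\<Psi>\<close> says two things at once: the operator
    preserves functions with values in \<open>A1\<close>, and it induces a well defined map on their
    values at q = 1.\<close>
  have ex: "\<exists>\<Psi>. \<forall>F f. specializes F f \<longrightarrow> specializes (\<rho> u F) (\<Psi> f)" if "u \<in> carrier (UA1 n)" for u
    using that unfolding UA1_reduced
  proof (induction rule: gen_subalgebra.induct)
    case (gen x)
    then obtain i j where "x = redL n i j" "(i, j) \<in> Lidx n" by (auto simp: reduced_gens_def)
    then show ?case using generator by (intro exI[of _ "redL_limit i j"]) simp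
  next
    case one
    show ?case by (rule exI[of _ id]) (simp add: h(5))
  next
    case (scale r x)
    then obtain \<Psi> where \<Psi>: "\<forall>F f. specializes F f \<longrightarrow> specializes (\<rho> x F) (\<Psi> f)" by blast
    have x: "x \<in> carrier (Uq n)" by (rule UAc) (use scale(2) in \<open>simp only: UA1_reduced\<close>)
    show ?case
      by (rule exI[of _ "\<lambda>f w. ev1 r * \<Psi> f w"]) (use \<Psi> scale(1) in \<open>simp add: h(6)[OF x] specializes_scale\<close>)
  next
    case (add x y)
    then obtain \<Psi> \<Psi>' where \<Psi>: "\<forall>F f. specializes F f \<longrightarrow> specializes (\<rho> x F) (\<Psi> f)"
      "\<forall>F f. specializes F f \<longrightarrow> specializes (\<rho> y F) (\<Psi>' f)" by blast
    have x: "x \<in> carrier (Uq n)" "y \<in> carrier (Uq n)"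
      by (rule UAc, use add(1,2) in \<open>simp only: UA1_reduced\<close>)+
    show ?case
      by (rule exI[of _ "\<lambda>f w. \<Psi> f w + \<Psi>' f w"]) (use \<Psi> in \<open>simp add: h(3)[OF x] specializes_add\<close>)
  next
    case (mult x y)
    then obtain \<Psi> \<Psi>' where \<Psi>: "\<forall>F f. specializes F f \<longrightarrow> specializes (\<rho> x F) (\<Psi> f)"
      "\<forall>F f. specializes F f \<longrightarrow> specializes (\<rho> y F) (\<Psi>' f)" by blast
    have x: "x \<in> carrier (Uq n)" "y \<in> carrier (Uq n)"
      by (rule UAc, use mult(1,2) in \<open>simp only: UA1_reduced\<close>)+
    show ?case
      by (rule exI[of _ "\<lambda>f. \<Psi> (\<Psi>' f)"]) (use \<Psi> in \<open>simp add: h(4)[OF x]\<close>)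
  qed
  have \<beta>: "specializes (\<rho> u F) (\<beta> u f)" if u: "u \<in> carrier (UA1 n)" and F: "specializes F f" for u F f
  proof -
    obtain \<Psi> where \<Psi>: "\<forall>F f. specializes F f \<longrightarrow> specializes (\<rho> u F) (\<Psi> f)" using ex[OF u] by blast
    have "\<beta> u f = \<Psi> f"
      using \<Psi> specializes_constant_lift[of f] by (auto simp: \<beta>_def specializes_def fun_eq_iff)
    then show ?thesis using \<Psi> F by simp
  qed
  have \<beta>_eq: "\<beta> u f = g" if "u \<in> carrier (UA1 n)" "specializes F f" "specializes (\<rho> u F) g" for u F f g
    by (rule specializes_unique[OF \<beta>[OF that(1,2)] that(3)])
  note lift = specializes_constant_lift
  have hom: "\<beta> \<in> ring_hom (UA1 n) op_algebra"
  proof (rule ring_hom_memI, unfold UA1_simps(2-5))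
    fix u assume u: "u \<in> carrier (UA1 n)"
    note D = op_algebra_carrierD[OF h(2)[OF UAc[OF u]]]
    show "\<beta> u \<in> carrier op_algebra"
    proof (rule op_algebra_carrierI)
      fix f g :: "int list \<Rightarrow> complex" and w
      have "\<beta> u (\<lambda>w. f w + g w) = (\<lambda>w. \<beta> u f w + \<beta> u g w)"
        by (rule \<beta>_eq[OF u specializes_add[OF lift[of f] lift[of g]]], unfold D)
          (rule specializes_add[OF \<beta>[OF u lift] \<beta>[OF u lift]])
      then show "\<beta> u (\<lambda>w. f w + g w) w = \<beta> u f w + \<beta> u g w" by simp
    next
      fix c :: complex and f :: "int list \<Rightarrow> complex" and w
      have "specializes (\<lambda>w. Fract [:c:] 1 * constant_lift f w) (\<lambda>w. c * f w)"
        using specializes_scale[OF A1_const lift, of c f] by (simp add: ev1_const)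
      moreover have "specializes (\<lambda>w. Fract [:c:] 1 * \<rho> u (constant_lift f) w) (\<lambda>w. c * \<beta> u f w)"
        using specializes_scale[OF A1_const \<beta>[OF u lift], of c f] by (simp add: ev1_const)
      ultimately have "\<beta> u (\<lambda>w. c * f w) = (\<lambda>w. c * \<beta> u f w)" using \<beta>_eq[OF u, of "\<lambda>w. Fract [:c:] 1 * constant_lift f w"] by (simp only: D)
      then show "\<beta> u (\<lambda>w. c * f w) w = c * \<beta> u f w" by simp
    qed
  next
    fix u v assume u: "u \<in> carrier (UA1 n)" and v: "v \<in> carrier (UA1 n)"
    have uv: "u \<otimes>\<^bsub>Uq n\<^esub> v \<in> carrier (UA1 n)" "u \<oplus>\<^bsub>Uq n\<^esub> v \<in> carrier (UA1 n)" by (rule UA1_intros(5)[OF u v], rule UA1_intros(4)[OF u v])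
    show "\<beta> (u \<otimes>\<^bsub>Uq n\<^esub> v) = \<beta> u \<otimes>\<^bsub>op_algebra\<^esub> \<beta> v"
    proof
      fix f
      show "\<beta> (u \<otimes>\<^bsub>Uq n\<^esub> v) f = (\<beta> u \<otimes>\<^bsub>op_algebra\<^esub> \<beta> v) f"
        by (rule \<beta>_eq[OF uv(1) lift]) (simp add: h(4)[OF UAc[OF u] UAc[OF v]] \<beta>[OF u \<beta>[OF v lift]])
    qed
    show "\<beta> (u \<oplus>\<^bsub>Uq n\<^esub> v) = \<beta> u \<oplus>\<^bsub>op_algebra\<^esub> \<beta> v"
    proof
      fix f
      show "\<beta> (u \<oplus>\<^bsub>Uq n\<^esub> v) f = (\<beta> u \<oplus>\<^bsub>op_algebra\<^esub> \<beta> v) f"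
        by (rule \<beta>_eq[OF uv(2) lift]) (simp add: h(3)[OF UAc[OF u] UAc[OF v]] specializes_add[OF \<beta>[OF u lift] \<beta>[OF v lift]])
    qed
  next
    show "\<beta> \<one>\<^bsub>Uq n\<^esub> = \<one>\<^bsub>op_algebra\<^esub>"
    proof
      fix f
      show "\<beta> \<one>\<^bsub>Uq n\<^esub> f = \<one>\<^bsub>op_algebra\<^esub> f"
        by (rule \<beta>_eq[OF UA1_intros(2) lift]) (simp add: h(5) lift)
    qed
  qed
  have sm: "\<beta> (r \<odot>\<^bsub>Uq n\<^esub> u) = ev1 r \<odot>\<^bsub>op_algebra\<^esub> \<beta> u" if r: "r \<in> A1" and u: "u \<in> carrier (UA1 n)" for r u
  proof
    fix f
    show "\<beta> (r \<odot>\<^bsub>Uq n\<^esub> u) f = (ev1 r \<odot>\<^bsub>op_algebra\<^esub> \<beta> u) f"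
      by (rule \<beta>_eq[OF UA1_intros(3)[OF r u] lift]) (simp add: h(6)[OF UAc[OF u]] specializes_scale[OF r \<beta>[OF u lift]])
  qed
  obtain \<Phi> where \<Phi>: "\<Phi> \<in> alg_hom (classical_limit n) op_algebra"
    and \<Phi>_spec: "\<And>u. u \<in> carrier (UA1 n) \<Longrightarrow> \<Phi> (spec1 n u) = \<beta> u"
    using classical_limit_lift[OF unital_algebra_op_algebra hom sm] by blast
  have X: "\<Phi> (Llim n i j) = redL_limit i j" if "(i, j) \<in> Lidx n" for i j
  proof
    fix f
    show "\<Phi> (Llim n i j) f = redL_limit i j f"
      unfolding Llim_def \<Phi>_spec[OF redL_UA1] by (rule \<beta>_eq[OF redL_UA1 lift generator[OF that lift]])
  qed
  have "\<Phi> (lie_gen n a c) = (\<lambda>f w. deriv_op w a c f)" if ac: "(a, c) \<in> qbasis n" for a c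
  proof -
    have b: "1 \<le> a" "a \<le> int n" "c \<noteq> 0" "\<bar>c\<bar> \<le> int n" using ac by (auto simp: qbasis_def)
    note sm = alg_homD(6)[OF \<Phi> Llim_closed]
    consider "c < a" | "a < c" | "c = a" by linarith
    then show ?thesis
    proof cases
      case 1
      then have "(c, a) \<in> Lidx n" using b by (auto simp: Lidx_def)
      then show ?thesis using 1 b by (simp add: lie_gen_def sm X redL_limit_def fun_eq_iff)
    next
      case 2
      then have "(- c, - a) \<in> Lidx n" using b by (auto simp: Lidx_def)
      then show ?thesis using 2 b by (simp add: lie_gen_def sm X redL_limit_def fun_eq_iff deriv_op_uminus)
    next
      case 3
      then have "(a, a) \<in> Lidx n" using b by (auto simp: Lidx_def)
      then show ?thesis using 3 b by (simp add: lie_gen_def sm X redL_limit_def fun_eq_iff)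
    qed
  qed
  with \<Phi> show ?thesis by blast
qed

section \<open>The queer Lie superalgebra in signed coordinates\<close>

text \<open>
  Rows and columns of a \<open>2n \<times> 2n\<close> matrix are labelled by \<open>1, \<dots>, n, - 1, \<dots>, - n\<close>, in this order;
  the matrices of the queer Lie superalgebra are then those with symmetric entries under
  \<open>(u, v) \<mapsto> (- u, - v)\<close>.
\<close>

definition sindex :: "nat \<Rightarrow> nat \<Rightarrow> int" where
  "sindex n i = (if i < n then int i + 1 else int n - int i - 1)"

definition spos :: "nat \<Rightarrow> int \<Rightarrow> nat" where
  "spos n u = (if 0 < u then nat u - 1 else n + nat (- u) - 1)"

definition sindices :: "nat \<Rightarrow> int set" where
  "sindices n = {u. u \<noteq> 0 \<and> \<bar>u\<bar> \<le> int n}"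

lemma finite_sindices: "finite (sindices n)"
  by (rule finite_subset[of _ "{- int n..int n}"]) (auto simp: sindices_def)

lemma sindices_uminus: "u \<in> sindices n \<Longrightarrow> - u \<in> sindices n"
  by (simp add: sindices_def)

lemma qbasis_sindices: "(a, c) \<in> qbasis n \<Longrightarrow> a \<in> sindices n \<and> c \<in> sindices n"
  by (auto simp: qbasis_def sindices_def)

lemma spos_sindex: "u \<in> sindices n \<Longrightarrow> spos n u < 2 * n \<and> sindex n (spos n u) = u"
  by (auto simp: sindices_def spos_def sindex_def)

lemma sindex_spos: "i < 2 * n \<Longrightarrow> sindex n i \<in> sindices n \<and> spos n (sindex n i) = i"
  by (auto simp: sindices_def spos_def sindex_def)

lemma sindex_sign: "i < 2 * n \<Longrightarrow> 0 < sindex n i \<longleftrightarrow> i < n"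
  by (auto simp: sindex_def)

lemma sum_sindex: "(\<Sum>i<2 * n. f (sindex n i)) = (\<Sum>u\<in>sindices n. f u)"
proof (rule sum.reindex_bij_witness[where i = "spos n" and j = "sindex n"])
qed (use spos_sindex sindex_spos in auto)

definition qmat :: "nat \<Rightarrow> (int \<Rightarrow> int \<Rightarrow> complex) \<Rightarrow> complex mat" where
  "qmat n m = mat (2 * n) (2 * n) (\<lambda>(i, j). m (sindex n i) (sindex n j))"

lemma qmat_cong: "(\<And>u v. u \<in> sindices n \<Longrightarrow> v \<in> sindices n \<Longrightarrow> m u v = m' u v) \<Longrightarrow> qmat n m = qmat n m'"
  unfolding qmat_def by (rule cong_mat) (auto simp: sindex_spos)

lemma qmat_entry: "u \<in> sindices n \<Longrightarrow> v \<in> sindices n \<Longrightarrow> qmat n m $$ (spos n u, spos n v) = m u v"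
  using spos_sindex[of u n] spos_sindex[of v n] by (simp add: qmat_def)

lemma qmat_arith:
  "qmat n m + qmat n m' = qmat n (\<lambda>u v. m u v + m' u v)"
  "qmat n m - qmat n m' = qmat n (\<lambda>u v. m u v - m' u v)"
  "c \<cdot>\<^sub>m qmat n m = qmat n (\<lambda>u v. c * m u v)"
  by (rule eq_matI; simp add: qmat_def)+

lemma qmat_mult: "qmat n m * qmat n m' = qmat n (\<lambda>u w. \<Sum>v\<in>sindices n. m u v * m' v w)"
proof (rule eq_matI)
  fix i j assume "i < dim_row (qmat n (\<lambda>u w. \<Sum>v\<in>sindices n. m u v * m' v w))"
    and "j < dim_col (qmat n (\<lambda>u w. \<Sum>v\<in>sindices n. m u v * m' v w))"
  then have ij: "i < 2 * n" "j < 2 * n" by (simp_all add: qmat_def)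
  have "(qmat n m * qmat n m') $$ (i, j) = (\<Sum>k<2 * n. m (sindex n i) (sindex n k) * m' (sindex n k) (sindex n j))"
    using ij by (simp add: qmat_def scalar_prod_def atLeast0LessThan)
  also have "\<dots> = (\<Sum>v\<in>sindices n. m (sindex n i) v * m' v (sindex n j))" by (rule sum_sindex)
  finally show "(qmat n m * qmat n m') $$ (i, j) = qmat n (\<lambda>u w. \<Sum>v\<in>sindices n. m u v * m' v w) $$ (i, j)"
    using ij by (simp add: qmat_def)
qed (simp_all add: qmat_def)

definition symmetric :: "(int \<Rightarrow> int \<Rightarrow> complex) \<Rightarrow> bool" where
  "symmetric m \<longleftrightarrow> (\<forall>u v. m (- u) (- v) = m u v)"

definition of_parity :: "nat \<Rightarrow> (int \<Rightarrow> int \<Rightarrow> complex) \<Rightarrow> bool" where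
  "of_parity p m \<longleftrightarrow> (\<forall>u v. u \<noteq> 0 \<longrightarrow> v \<noteq> 0 \<longrightarrow> par u v \<noteq> p \<longrightarrow> m u v = 0)"

lemma four_block_qmat:
  assumes A: "A \<in> carrier_mat n n" and B: "B \<in> carrier_mat n n"
  shows "\<exists>m. four_block_mat A B B A = qmat n m \<and> symmetric m
    \<and> (B = 0\<^sub>m n n \<longrightarrow> of_parity 0 m) \<and> (A = 0\<^sub>m n n \<longrightarrow> of_parity 1 m)"
proof -
  \<comment> \<open>\<open>symmetric\<close> is required at all integers; the value 0 outside
    \<open>sindices n\<close> meets it.\<close>
  define m where "m u v = (if u \<in> sindices n \<and> v \<in> sindices n
    then (if 0 < u * v then A else B) $$ (nat \<bar>u\<bar> - 1, nat \<bar>v\<bar> - 1) else 0)" for u v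
  have r: "nat \<bar>u\<bar> - 1 < n" if "u \<in> sindices n" for u using that by (auto simp: sindices_def)
  have "of_parity 0 m" if "B = 0\<^sub>m n n"
    using that r by (auto simp: of_parity_def m_def par_def)
  moreover have "of_parity 1 m" if "A = 0\<^sub>m n n"
    using that r by (auto simp: of_parity_def m_def par_def)
  moreover have "symmetric m" by (simp add: symmetric_def m_def sindices_def)
  moreover have "four_block_mat A B B A = qmat n m"
  proof (rule eq_matI)
    fix i j assume "i < dim_row (qmat n m)" "j < dim_col (qmat n m)"
    then have ij: "i < 2 * n" "j < 2 * n" by (simp_all add: qmat_def)
    have s: "sindex n i \<in> sindices n" "sindex n j \<in> sindices n" using ij sindex_spos by auto
    have "four_block_mat A B B A $$ (i, j) = m (sindex n i) (sindex n j)"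
      using ij A B s unfolding m_def
      by (auto simp: sindex_def zero_less_mult_iff nat_diff_distrib' intro!: arg_cong2[where f = "\<lambda>i j. _ $$ (i, j)"])
    then show "four_block_mat A B B A $$ (i, j) = qmat n m $$ (i, j)" using ij by (simp add: qmat_def)
  qed (use A B in \<open>simp_all add: qmat_def\<close>)
  ultimately show ?thesis by (intro exI conjI impI)
qed

lemma qmat_four_block:
  fixes n :: nat
  assumes "symmetric m"
  defines "A \<equiv> mat n n (\<lambda>(i, j). m (int i + 1) (int j + 1))"
    and "B \<equiv> mat n n (\<lambda>(i, j). m (int i + 1) (- int j - 1))"
  shows "qmat n m = four_block_mat A B B A"
proof (rule eq_matI)
  have s: "m (- u) (- v) = m u v" for u v using assms(1) by (simp add: symmetric_def)
  fix i j assume "i < dim_row (four_block_mat A B B A)" "j < dim_col (four_block_mat A B B A)"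
  then have ij: "i < 2 * n" "j < 2 * n" by (simp_all add: A_def B_def)
  consider "i < n" "j < n" | "i < n" "\<not> j < n" | "\<not> i < n" "j < n" | "\<not> i < n" "\<not> j < n" by blast
  then show "qmat n m $$ (i, j) = four_block_mat A B B A $$ (i, j)"
  proof cases
    case 2
    then have "int n - int j - 1 = - int (j - n) - 1" by simp
    then show ?thesis using ij 2 by (simp add: qmat_def A_def B_def sindex_def)
  next
    case 3
    have e: "int n - int i - 1 = - (int (i - n) + 1)" "int j + 1 = - (- int j - 1)" using 3 by simp_all
    have "m (int n - int i - 1) (int j + 1) = m (int (i - n) + 1) (- int j - 1)"
      by (subst e(1), subst e(2), rule s)
    then show ?thesis using ij 3 by (simp add: qmat_def A_def B_def sindex_def)
  next
    case 4
    have e: "int n - int i - 1 = - (int (i - n) + 1)" "int n - int j - 1 = - (int (j - n) + 1)" using 4 by simp_all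
    have "m (int n - int i - 1) (int n - int j - 1) = m (int (i - n) + 1) (int (j - n) + 1)"
      by (subst e(1), subst e(2), rule s)
    then show ?thesis using ij 4 by (simp add: qmat_def A_def B_def sindex_def)
  qed (use ij in \<open>simp add: qmat_def A_def B_def sindex_def\<close>)
qed (simp_all add: qmat_def A_def B_def)

lemma queer_lie_simps [simp]:
  "ladd (queer_lie n) = (+)" "lscale (queer_lie n) = (\<lambda>c M. c \<cdot>\<^sub>m M)" "bracket (queer_lie n) = super_commutator n"
  by (simp_all add: queer_lie_def)

lemma space_queer_lie: "space (queer_lie n) = {qmat n m | m. symmetric m}"
proof
  show "space (queer_lie n) \<subseteq> {qmat n m | m. symmetric m}"
  proof
    fix M assume "M \<in> space (queer_lie n)"
    then obtain A B where "M = four_block_mat A B B A" "A \<in> carrier_mat n n" "B \<in> carrier_mat n n"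
      by (auto simp: queer_lie_def)
    then obtain m where "M = qmat n m" "symmetric m" using four_block_qmat[of A n B] by auto
    then show "M \<in> {qmat n m | m. symmetric m}" by auto
  qed
  show "{qmat n m | m. symmetric m} \<subseteq> space (queer_lie n)"
  proof
    fix M assume "M \<in> {qmat n m | m. symmetric m}"
    then obtain m where m: "M = qmat n m" "symmetric m" by blast
    show "M \<in> space (queer_lie n)"
      unfolding m(1) qmat_four_block[OF m(2)] queer_lie_def
      by (simp, intro exI conjI, rule refl) simp_all
  qed
qed

lemma part_queer_lie:
  assumes "p \<in> {0, 1}"
  shows "part (queer_lie n) p = {qmat n m | m. symmetric m \<and> of_parity p m}"
proof
  show "part (queer_lie n) p \<subseteq> {qmat n m | m. symmetric m \<and> of_parity p m}"
  proof
    fix M assume M: "M \<in> part (queer_lie n) p"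
    show "M \<in> {qmat n m | m. symmetric m \<and> of_parity p m}"
    proof (cases "p = 0")
      case True
      then obtain A where "M = four_block_mat A (0\<^sub>m n n) (0\<^sub>m n n) A" "A \<in> carrier_mat n n"
        using M by (auto simp: queer_lie_def)
      then obtain m where "M = qmat n m" "symmetric m" "of_parity p m"
        using four_block_qmat[of A n "0\<^sub>m n n"] True by auto
      then show ?thesis by auto
    next
      case False
      then obtain B where "M = four_block_mat (0\<^sub>m n n) B B (0\<^sub>m n n)" "B \<in> carrier_mat n n"
        using M by (auto simp: queer_lie_def)
      then obtain m where "M = qmat n m" "symmetric m" "of_parity p m"
        using four_block_qmat[of "0\<^sub>m n n" n B] False assms by auto
      then show ?thesis by auto
    qed
  qed
  show "{qmat n m | m. symmetric m \<and> of_parity p m} \<subseteq> part (queer_lie n) p"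
  proof
    fix M assume "M \<in> {qmat n m | m. symmetric m \<and> of_parity p m}"
    then obtain m where m: "M = qmat n m" "symmetric m" "of_parity p m" by blast
    show "M \<in> part (queer_lie n) p"
    proof (cases "p = 0")
      case True
      have z: "mat n n (\<lambda>(i, j). m (int i + 1) (- int j - 1)) = 0\<^sub>m n n"
        using m(3) True by (intro eq_matI) (auto simp: of_parity_def par_def zero_less_mult_iff)
      show ?thesis
        unfolding m(1) qmat_four_block[OF m(2)] z using True
        by (auto simp: queer_lie_def intro!: exI[of _ "mat n n _"])
    next
      case False
      have z: "mat n n (\<lambda>(i, j). m (int i + 1) (int j + 1)) = 0\<^sub>m n n"
        using m(3) False by (intro eq_matI) (auto simp: of_parity_def par_def zero_less_mult_iff)
      show ?thesis
        unfolding m(1) qmat_four_block[OF m(2)] z using False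
        by (auto simp: queer_lie_def intro!: exI[of _ "mat n n _"])
    qed
  qed
qed

definition sbracket :: "nat \<Rightarrow> complex \<Rightarrow> (int \<Rightarrow> int \<Rightarrow> complex) \<Rightarrow> (int \<Rightarrow> int \<Rightarrow> complex) \<Rightarrow> int \<Rightarrow> int \<Rightarrow> complex" where
  "sbracket n s m m' u w = (\<Sum>v\<in>sindices n. m u v * m' v w) - s * (\<Sum>v\<in>sindices n. m' u v * m v w)"

lemma symmetric_sbracket:
  assumes "symmetric m" "symmetric m'"
  shows "symmetric (sbracket n s m m')"
proof -
  have "(\<Sum>v\<in>sindices n. f (- u) v * g v (- w)) = (\<Sum>v\<in>sindices n. f u v * g v w)"
    if f: "symmetric f" and g: "symmetric g" for f g u w
  proof (rule sum.reindex_bij_witness[where i = uminus and j = uminus])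
    fix v
    show "f u (- v) * g (- v) w = f (- u) v * g v (- w)"
      using f[unfolded symmetric_def, rule_format, of u "- v"] g[unfolded symmetric_def, rule_format, of "- v" w] by simp
  qed (auto simp: sindices_uminus)
  then show ?thesis using assms by (simp add: symmetric_def[of "sbracket n s m m'"] sbracket_def)
qed

lemma mat_component_qmat:
  "mat_component n p (qmat n m) = qmat n (\<lambda>u v. if (0 < u * v) = (p = 0) then m u v else 0)"
proof (rule eq_matI)
  fix i j assume "i < dim_row (qmat n (\<lambda>u v. if (0 < u * v) = (p = 0) then m u v else 0))"
    and "j < dim_col (qmat n (\<lambda>u v. if (0 < u * v) = (p = 0) then m u v else 0))"
  then have ij: "i < 2 * n" "j < 2 * n" by (simp_all add: qmat_def)
  have "0 < sindex n i * sindex n j \<longleftrightarrow> (i < n \<longleftrightarrow> j < n)"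
    using sindex_sign[OF ij(1)] sindex_sign[OF ij(2)] sindex_spos[OF ij(1)] sindex_spos[OF ij(2)]
    by (auto simp: zero_less_mult_iff sindices_def)
  then show "mat_component n p (qmat n m) $$ (i, j) = qmat n (\<lambda>u v. if (0 < u * v) = (p = 0) then m u v else 0) $$ (i, j)"
    using ij by (cases "p = 0") (simp_all add: qmat_def mat_component_def)
qed (simp_all add: qmat_def mat_component_def)

text \<open>For homogeneous matrices only one of the four commutators in the bilinear extension is
  nonzero.\<close>

lemma super_commutator_qmat:
  assumes p: "p \<in> {0, 1}" "of_parity p m" and r: "r \<in> {0, 1}" "of_parity r m'"
  shows "super_commutator n (qmat n m) (qmat n m') = qmat n (sbracket n ((- 1) ^ (p * r)) m m')"
proof -
  have c: "mat_component n q (qmat n m) = qmat n (if q = p then m else (\<lambda>_ _. 0))"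
    if "q \<in> {0, 1}" "p \<in> {0, 1}" "of_parity p m" for q p m
    unfolding mat_component_qmat
    by (rule qmat_cong) (use that in \<open>auto simp: of_parity_def par_def sindices_def\<close>)
  have z: "(0::nat) \<in> {0, 1}" "(1::nat) \<in> {0, 1}" by simp_all
  show ?thesis
    unfolding super_commutator_def Let_def c[OF z(1) p] c[OF z(2) p] c[OF z(1) r] c[OF z(2) r] qmat_mult qmat_arith
    by (rule qmat_cong) (use p(1) r(1) in \<open>auto simp: sbracket_def\<close>)
qed

definition unit_entry :: "int \<times> int \<Rightarrow> int \<Rightarrow> int \<Rightarrow> complex" where
  "unit_entry x u v = of_bool (u = fst x \<and> v = snd x) + of_bool (u = - fst x \<and> v = - snd x)"

lemma symmetric_unit_entry: "symmetric (unit_entry x)"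
proof -
  have "- u = a \<longleftrightarrow> u = - a" for u a :: int by auto
  then show ?thesis by (auto simp: symmetric_def unit_entry_def)
qed

lemma unit_entry_uminus: "unit_entry (- a, - c) = unit_entry (a, c)"
  by (intro ext) (simp add: unit_entry_def)

lemma of_parity_unit_entry: "of_parity (par a c) (unit_entry (a, c))"
  by (auto simp: of_parity_def unit_entry_def par_def)

lemma symmetric_expansion:
  assumes "symmetric m" "u \<in> sindices n" "v \<in> sindices n"
  shows "m u v = (\<Sum>x\<in>qbasis n. m (fst x) (snd x) * unit_entry x u v)"
proof -
  define y where "y = (if 0 < u then (u, v) else (- u, - v))"
  have y: "y \<in> qbasis n" "m (fst y) (snd y) = m u v"
    using assms by (auto simp: y_def qbasis_def sindices_def symmetric_def)
  have "unit_entry x u v = of_bool (x = y)" if "x \<in> qbasis n" for x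
    using that assms(2) by (auto simp: y_def unit_entry_def qbasis_def sindices_def)
  then have "(\<Sum>x\<in>qbasis n. m (fst x) (snd x) * unit_entry x u v) = (\<Sum>x\<in>qbasis n. if x = y then m (fst y) (snd y) else 0)"
    by (intro sum.cong) auto
  then show ?thesis using y finite_qbasis by simp
qed

text \<open>The step receives \<open>c x \<noteq> 0\<close>, so that for a homogeneous combination
  only unit entries of its own parity come up.\<close>

lemma combination_induct [consumes 1, case_names zero add]:
  assumes "finite S" "P (\<lambda>_ _. 0)"
    and "\<And>x f. x \<in> S \<Longrightarrow> c x \<noteq> 0 \<Longrightarrow> P f \<Longrightarrow> P (\<lambda>u v. c x * unit_entry x u v + f u v)"
  shows "P (\<lambda>u v. \<Sum>x\<in>S. c x * unit_entry x u v)"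
  using assms
proof (induction S rule: finite_induct)
  case (insert x S)
  have IH: "P (\<lambda>u v. \<Sum>x\<in>S. c x * unit_entry x u v)" using insert by blast
  show ?case
  proof (cases "c x = 0")
    case True
    then show ?thesis using IH insert(1,2) by simp
  next
    case False
    have "P (\<lambda>u v. c x * unit_entry x u v + (\<Sum>x\<in>S. c x * unit_entry x u v))"
      by (rule insert(5)[OF insertI1 False IH])
    then show ?thesis using insert(1,2) by simp
  qed
qed simp

text \<open>The four terms are grouped as in \<open>lie_bracket\<close>, so that a linear map
  carries one expression term by term into the other.\<close>

lemma sbracket_unit_entry:
  assumes "a \<in> sindices n" "c \<in> sindices n" "b \<in> sindices n" "d \<in> sindices n"
  shows "sbracket n s (unit_entry (a, c)) (unit_entry (b, d)) u w
    = (of_bool (c = b) * unit_entry (a, d) u w + - (s * of_bool (d = a)) * unit_entry (b, c) u w)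
      + of_bool (c = - b) * unit_entry (a, - d) u w + - (s * of_bool (d = - a)) * unit_entry (b, - c) u w"
proof -
  have *: "(\<Sum>v\<in>sindices n. unit_entry (a, c) u v * unit_entry (b, d) v w)
    = of_bool (c = b) * unit_entry (a, d) u w + of_bool (c = - b) * unit_entry (a, - d) u w"
    if c: "c \<in> sindices n" for a b c d
  proof -
    have n: "c \<noteq> - c" using c by (auto simp: sindices_def)
    have "(\<Sum>v\<in>sindices n. unit_entry (a, c) u v * unit_entry (b, d) v w)
        = (\<Sum>v\<in>{c, - c}. unit_entry (a, c) u v * unit_entry (b, d) v w)"
      by (rule sum.mono_neutral_right[OF finite_sindices])
        (use c in \<open>auto simp: sindices_uminus unit_entry_def\<close>)
    also have "\<dots> = unit_entry (a, c) u c * unit_entry (b, d) c w + unit_entry (a, c) u (- c) * unit_entry (b, d) (- c) w"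
      using n by simp
    also have "\<dots> = of_bool (c = b) * unit_entry (a, d) u w + of_bool (c = - b) * unit_entry (a, - d) u w"
    proof -
      have e: "- c = b \<longleftrightarrow> c = - b" "- c = - b \<longleftrightarrow> c = b" "- c = c \<longleftrightarrow> False" using n by auto
      show ?thesis using n unfolding unit_entry_def fst_conv snd_conv e minus_minus
        by (cases "c = b"; cases "c = - b") (auto simp: of_bool_conj algebra_simps)
    qed
    finally show ?thesis .
  qed
  show ?thesis unfolding sbracket_def *[OF assms(2)] *[OF assms(4)] by (simp add: algebra_simps)
qed

section \<open>The linear map from matrices to the classical limit\<close>

definition lie_map :: "nat \<Rightarrow> (int \<Rightarrow> int \<Rightarrow> complex) \<Rightarrow> (cq set \<times> ((int \<times> int) list \<Rightarrow> cq) set \<Rightarrow> int) set" where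
  "lie_map n m = (\<Oplus>\<^bsub>classical_limit n\<^esub>x\<in>qbasis n. m (fst x) (snd x) \<odot>\<^bsub>classical_limit n\<^esub> lie_gen n (fst x) (snd x))"

lemma lie_map_closed [simp]: "lie_map n m \<in> carrier (classical_limit n)"
  unfolding lie_map_def by (rule C.finsum_closed) simp

lemma lie_map_cong:
  assumes "\<And>u v. u \<in> sindices n \<Longrightarrow> v \<in> sindices n \<Longrightarrow> m u v = m' u v"
  shows "lie_map n m = lie_map n m'"
  unfolding lie_map_def by (rule C.finsum_cong') (auto simp: qbasis_sindices assms)

lemma lie_map_add: "lie_map n (\<lambda>u v. m u v + m' u v) = lie_map n m \<oplus>\<^bsub>classical_limit n\<^esub> lie_map n m'"
  unfolding lie_map_def by (subst C.finsum_addf[symmetric]) (auto simp: C.smult_add_left intro!: C.finsum_cong')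

lemma lie_map_smult: "lie_map n (\<lambda>u v. c * m u v) = c \<odot>\<^bsub>classical_limit n\<^esub> lie_map n m"
  unfolding lie_map_def by (subst C.smult_finsum) (auto simp: C.smult_smult finite_qbasis intro!: C.finsum_cong')

lemma lie_map_zero: "lie_map n (\<lambda>_ _. 0) = \<zero>\<^bsub>classical_limit n\<^esub>"
  using lie_map_smult[of n 0 "\<lambda>_ _. 0"] by simp

lemma lie_map_unit_entry:
  assumes "a \<in> sindices n" "c \<in> sindices n"
  shows "lie_map n (unit_entry (a, c)) = lie_gen n a c"
proof -
  have *: "lie_map n (unit_entry x) = lie_gen n (fst x) (snd x)" if x: "x \<in> qbasis n" for x
  proof -
    have e: "unit_entry x (fst y) (snd y) = of_bool (y = x)" if "y \<in> qbasis n" for y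
      using x that by (auto simp: unit_entry_def qbasis_def prod_eq_iff)
    have "lie_map n (unit_entry x)
      = (\<Oplus>\<^bsub>classical_limit n\<^esub>y\<in>qbasis n. if y = x then lie_gen n (fst y) (snd y) else \<zero>\<^bsub>classical_limit n\<^esub>)"
      unfolding lie_map_def by (rule C.finsum_cong') (auto simp: e)
    also have "\<dots> = lie_gen n (fst x) (snd x)"
      using C.add.finprod_singleton_swap[OF x finite_qbasis, of "\<lambda>y. lie_gen n (fst y) (snd y)" n] by (simp add: Pi_iff)
    finally show ?thesis .
  qed
  show ?thesis
  proof (cases "0 < a")
    case True
    then show ?thesis using *[of "(a, c)"] assms by (auto simp: qbasis_def sindices_def)
  next
    case False
    then have "(- a, - c) \<in> qbasis n" using assms by (auto simp: qbasis_def sindices_def)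
    from *[OF this] show ?thesis
      using lie_gen_uminus[of a n c] assms by (simp add: unit_entry_uminus sindices_def)
  qed
qed

lemma lie_map_relation_unit:
  assumes "a \<in> sindices n" "c \<in> sindices n" "b \<in> sindices n" "d \<in> sindices n"
    and s: "s = (- 1) ^ (par a c * par b d)"
  shows "lie_map n (unit_entry (a, c)) \<otimes>\<^bsub>classical_limit n\<^esub> lie_map n (unit_entry (b, d))
    = s \<odot>\<^bsub>classical_limit n\<^esub> (lie_map n (unit_entry (b, d)) \<otimes>\<^bsub>classical_limit n\<^esub> lie_map n (unit_entry (a, c)))
      \<oplus>\<^bsub>classical_limit n\<^esub> lie_map n (sbracket n s (unit_entry (a, c)) (unit_entry (b, d)))"
proof -
  have "lie_map n (sbracket n s (unit_entry (a, c)) (unit_entry (b, d))) = lie_bracket n s a c b d"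
    unfolding sbracket_unit_entry[OF assms(1-4), abs_def] lie_bracket_def lie_map_add lie_map_smult
    using assms(1-4) by (simp only: lie_map_unit_entry sindices_uminus)
  then show ?thesis
    using lie_relation[of a c b d n] assms by (simp add: lie_map_unit_entry sindices_def)
qed

lemma (in unital_algebra) relation_linear:
  assumes c: "x \<in> carrier A" "x' \<in> carrier A" "y \<in> carrier A" "z \<in> carrier A" "z' \<in> carrier A"
  shows "x \<otimes> y = s \<odot> (y \<otimes> x) \<oplus> z \<Longrightarrow> x' \<otimes> y = s \<odot> (y \<otimes> x') \<oplus> z' \<Longrightarrow>
      (c \<odot> x \<oplus> x') \<otimes> y = s \<odot> (y \<otimes> (c \<odot> x \<oplus> x')) \<oplus> (c \<odot> z \<oplus> z')"
    and "y \<otimes> x = s \<odot> (x \<otimes> y) \<oplus> z \<Longrightarrow> y \<otimes> x' = s \<odot> (x' \<otimes> y) \<oplus> z' \<Longrightarrow>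
      y \<otimes> (c \<odot> x \<oplus> x') = s \<odot> ((c \<odot> x \<oplus> x') \<otimes> y) \<oplus> (c \<odot> z \<oplus> z')"
  using assms
  by (simp_all add: l_distr r_distr smult_mult_left smult_mult_right smult_add_right smult_smult a_ac mult.commute)

lemma sbracket_linear:
  "sbracket n s (\<lambda>u v. c * m1 u v + m2 u v) m = (\<lambda>u v. c * sbracket n s m1 m u v + sbracket n s m2 m u v)"
  "sbracket n s m (\<lambda>u v. c * m1 u v + m2 u v) = (\<lambda>u v. c * sbracket n s m m1 u v + sbracket n s m m2 u v)"
  by (intro ext; simp add: sbracket_def algebra_simps sum.distrib sum_distrib_left)+

lemma sbracket_zero: "sbracket n s (\<lambda>_ _. 0) m = (\<lambda>_ _. 0)" "sbracket n s m (\<lambda>_ _. 0) = (\<lambda>_ _. 0)"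
  by (intro ext; simp add: sbracket_def)+

text \<open>Bilinearity reduces the relation to unit entries. Those with nonzero coefficients have
  parities p and r, so the same sign \<open>s\<close> serves for all of them.\<close>

lemma lie_map_relation:
  assumes m: "symmetric m" "of_parity p m" and m': "symmetric m'" "of_parity r m'"
  defines "s \<equiv> (- 1) ^ (p * r)"
  shows "lie_map n m \<otimes>\<^bsub>classical_limit n\<^esub> lie_map n m'
    = s \<odot>\<^bsub>classical_limit n\<^esub> (lie_map n m' \<otimes>\<^bsub>classical_limit n\<^esub> lie_map n m)
      \<oplus>\<^bsub>classical_limit n\<^esub> lie_map n (sbracket n s m m')"
proof -
  let ?T = "classical_limit n"
  define R where "R f g \<longleftrightarrow> lie_map n f \<otimes>\<^bsub>?T\<^esub> lie_map n g
    = s \<odot>\<^bsub>?T\<^esub> (lie_map n g \<otimes>\<^bsub>?T\<^esub> lie_map n f) \<oplus>\<^bsub>?T\<^esub> lie_map n (sbracket n s f g)" for f g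
  have lin: "R f1 g \<Longrightarrow> R f2 g \<Longrightarrow> R (\<lambda>u v. c * f1 u v + f2 u v) g"
    "R g f1 \<Longrightarrow> R g f2 \<Longrightarrow> R g (\<lambda>u v. c * f1 u v + f2 u v)" for f1 f2 g c
    unfolding R_def sbracket_linear lie_map_add lie_map_smult
    by (rule C.relation_linear; simp)+
  have zero: "R (\<lambda>_ _. 0) g" "R g (\<lambda>_ _. 0)" for g
    unfolding R_def sbracket_zero lie_map_zero by simp_all
  define e where "e f = (\<lambda>u v. \<Sum>x\<in>qbasis n. f (fst x) (snd x) * unit_entry x u v)" for f :: "int \<Rightarrow> int \<Rightarrow> complex"
  have e: "f u v = e f u v" if "symmetric f" "u \<in> sindices n" "v \<in> sindices n" for f u v
    unfolding e_def by (rule symmetric_expansion[OF that])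
  have unit: "R (unit_entry x) (unit_entry y)" if "x \<in> qbasis n" "y \<in> qbasis n" "m (fst x) (snd x) \<noteq> 0" "m' (fst y) (snd y) \<noteq> 0" for x y
  proof -
    obtain a c b d where xy: "x = (a, c)" "y = (b, d)" by (cases x, cases y)
    have i: "a \<in> sindices n" "c \<in> sindices n" "b \<in> sindices n" "d \<in> sindices n"
      using that(1,2) qbasis_sindices[of a c n] qbasis_sindices[of b d n] by (simp_all add: xy)
    have "par a c = p" "par b d = r" using that(3,4) m(2) m'(2) i by (auto simp: of_parity_def xy sindices_def)
    then show ?thesis unfolding R_def xy by (intro lie_map_relation_unit[OF i]) (simp add: s_def)
  qed
  have left: "R (e m) (unit_entry y)" if "y \<in> qbasis n" "m' (fst y) (snd y) \<noteq> 0" for y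
    unfolding e_def
    by (rule combination_induct[where P = "\<lambda>f. R f (unit_entry y)", OF finite_qbasis zero(1)])
      (rule lin(1)[OF unit[OF _ that(1) _ that(2)]])
  have "R (e m) (e m')"
    unfolding e_def[of m']
    by (rule combination_induct[where P = "R (e m)", OF finite_qbasis zero(2)])
      (rule lin(2)[OF left])
  moreover have "lie_map n (e m) = lie_map n m" "lie_map n (e m') = lie_map n m'"
    using m(1) m'(1) by (auto intro!: lie_map_cong simp: e[symmetric])
  moreover have "lie_map n (sbracket n s (e m) (e m')) = lie_map n (sbracket n s m m')"
    using m(1) m'(1) by (auto intro!: lie_map_cong simp: sbracket_def e[symmetric])
  ultimately show ?thesis by (simp add: R_def)
qed

section \<open>Enveloping algebras\<close>

text \<open>These closure conditions place both sides of each defining relation in the free algebra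
  on the underlying space.\<close>

locale lie_data =
  fixes g :: "('k::field, 'v) lie_superalgebra" (structure)
  assumes ladd_closed: "x \<in> space g \<Longrightarrow> y \<in> space g \<Longrightarrow> ladd g x y \<in> space g"
    and lscale_closed: "x \<in> space g \<Longrightarrow> lscale g c x \<in> space g"
    and part_subset: "a \<in> {0, 1} \<Longrightarrow> x \<in> part g a \<Longrightarrow> x \<in> space g"
    and bracket_closed: "a \<in> {0, 1} \<Longrightarrow> b \<in> {0, 1} \<Longrightarrow> x \<in> part g a \<Longrightarrow> y \<in> part g b \<Longrightarrow> bracket g x y \<in> space g"
begin

definition F :: "('k, 'v list \<Rightarrow> 'k) module" where "F = free_algebra (space g)"

definition relations :: "(('v list \<Rightarrow> 'k) \<times> ('v list \<Rightarrow> 'k)) set" where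
  "relations = {(single [ladd g x y], single [x] \<oplus>\<^bsub>F\<^esub> single [y]) | x y. x \<in> space g \<and> y \<in> space g}
    \<union> {(single [lscale g c x], c \<odot>\<^bsub>F\<^esub> single [x]) | c x. x \<in> space g}
    \<union> {(single [x] \<otimes>\<^bsub>F\<^esub> single [y],
         ((-1) ^ (a * b) \<odot>\<^bsub>F\<^esub> (single [y] \<otimes>\<^bsub>F\<^esub> single [x])) \<oplus>\<^bsub>F\<^esub> single [bracket g x y]) | a b x y.
         a \<in> {0, 1} \<and> b \<in> {0, 1} \<and> x \<in> part g a \<and> y \<in> part g b}"

abbreviation (input) Q :: "('k, ('v list \<Rightarrow> 'k) set) module" where "Q \<equiv> enveloping_algebra g"

abbreviation (input) I :: "('v list \<Rightarrow> 'k) set" where "I \<equiv> rel_ideal F relations"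

lemma Q_eq: "Q = quot_alg F I"
  by (simp add: enveloping_algebra_def F_def relations_def Let_def)

lemma unital_F: "unital_algebra F"
  unfolding F_def by (rule unital_algebra_free_algebra)

lemma gen_F: "x \<in> space g \<Longrightarrow> single [x] \<in> carrier F"
  unfolding F_def by simp

lemma relations_cases:
  assumes "(p, r) \<in> relations"
  obtains (add) x y where "x \<in> space g" "y \<in> space g" "p = single [ladd g x y]" "r = single [x] \<oplus>\<^bsub>F\<^esub> single [y]"
  | (scale) c x where "x \<in> space g" "p = single [lscale g c x]" "r = c \<odot>\<^bsub>F\<^esub> single [x]"
  | (commute) a b x y where "a \<in> {0, 1}" "b \<in> {0, 1}" "x \<in> part g a" "y \<in> part g b" "p = single [x] \<otimes>\<^bsub>F\<^esub> single [y]"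
      "r = ((-1) ^ (a * b) \<odot>\<^bsub>F\<^esub> (single [y] \<otimes>\<^bsub>F\<^esub> single [x])) \<oplus>\<^bsub>F\<^esub> single [bracket g x y]"
  using assms unfolding relations_def Un_iff mem_Collect_eq prod.inject
proof (elim disjE exE conjE)
qed (erule (3) that(1), erule (2) that(2), erule (5) that(3))

lemma relations_carrier:
  assumes "(p, r) \<in> relations" shows "p \<in> carrier F \<and> r \<in> carrier F"
proof -
  interpret F: unital_algebra F by (rule unital_F)
  from assms show ?thesis
  proof (cases rule: relations_cases)
    case (add x y)
    then show ?thesis by (simp add: gen_F ladd_closed)
  next
    case (scale c x)
    then show ?thesis by (simp add: gen_F lscale_closed)
  next
    case (commute a b x y)
    then show ?thesis using part_subset[of a x] part_subset[of b y] bracket_closed[of a b x y] by (simp add: gen_F)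
  qed
qed

lemma ideal_I: "ideal I F"
  by (rule unital_algebra.ideal_rel_ideal(1)[OF unital_F relations_carrier])

lemma unital_Q: "unital_algebra Q"
  unfolding Q_eq by (rule unital_algebra.quot_alg(5)[OF unital_F ideal_I])

definition inc :: "'v \<Rightarrow> ('v list \<Rightarrow> 'k) set" where "inc x = I +>\<^bsub>F\<^esub> single [x]"

lemma proj_hom: "(+>\<^bsub>F\<^esub>) I \<in> alg_hom F Q"
  unfolding Q_eq by (rule unital_algebra.quot_alg(2)[OF unital_F ideal_I])

lemma inc_closed: "x \<in> space g \<Longrightarrow> inc x \<in> carrier Q"
  unfolding inc_def by (rule alg_homD(2)[OF proj_hom gen_F])

lemma proj_relation: "(p, r) \<in> relations \<Longrightarrow> I +>\<^bsub>F\<^esub> p = I +>\<^bsub>F\<^esub> r"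
  using unital_algebra.quot_alg(4)[OF unital_F ideal_I] relations_carrier
    unital_algebra.ideal_rel_ideal(2)[OF unital_F relations_carrier] by simp

lemma inc_add:
  assumes "x \<in> space g" "y \<in> space g"
  shows "inc (ladd g x y) = inc x \<oplus>\<^bsub>Q\<^esub> inc y"
  unfolding inc_def alg_homD(3)[OF proj_hom gen_F[OF assms(1)] gen_F[OF assms(2)], symmetric]
  by (rule proj_relation) (use assms in \<open>auto simp: relations_def\<close>)

lemma inc_scale:
  assumes "x \<in> space g"
  shows "inc (lscale g c x) = c \<odot>\<^bsub>Q\<^esub> inc x"
  unfolding inc_def alg_homD(6)[OF proj_hom gen_F[OF assms(1)], symmetric]
  by (rule proj_relation) (use assms in \<open>auto simp: relations_def\<close>)

lemma inc_commute:
  assumes ab: "a \<in> {0, 1}" "b \<in> {0, 1}" and xy: "x \<in> part g a" "y \<in> part g b"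
  shows "inc x \<otimes>\<^bsub>Q\<^esub> inc y = (-1) ^ (a * b) \<odot>\<^bsub>Q\<^esub> (inc y \<otimes>\<^bsub>Q\<^esub> inc x) \<oplus>\<^bsub>Q\<^esub> inc (bracket g x y)"
proof -
  interpret F: unital_algebra F by (rule unital_F)
  have c: "single [x] \<in> carrier F" "single [y] \<in> carrier F" "single [bracket g x y] \<in> carrier F"
    using part_subset[OF ab(1) xy(1)] part_subset[OF ab(2) xy(2)] bracket_closed[OF ab xy] by (simp_all add: gen_F)
  have "(single [x] \<otimes>\<^bsub>F\<^esub> single [y], ((-1) ^ (a * b) \<odot>\<^bsub>F\<^esub> (single [y] \<otimes>\<^bsub>F\<^esub> single [x])) \<oplus>\<^bsub>F\<^esub> single [bracket g x y]) \<in> relations"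
    unfolding relations_def by (intro UnI2 CollectI exI conjI) (rule refl, (rule assms)+)
  from proj_relation[OF this] show ?thesis
    using c unfolding inc_def
    by (simp only: alg_homD(3,4,6)[OF proj_hom] F.m_closed F.smult_closed)
qed

text \<open>Extend \<theta> multiplicatively to words; the three hypotheses are the three families
  of relations.\<close>

lemma enveloping_lift:
  fixes B :: "('k, 'b, 'y) module_scheme"
  assumes B: "unital_algebra B" and \<theta>: "\<theta> \<in> space g \<rightarrow> carrier B"
    and add: "\<And>x y. x \<in> space g \<Longrightarrow> y \<in> space g \<Longrightarrow> \<theta> (ladd g x y) = \<theta> x \<oplus>\<^bsub>B\<^esub> \<theta> y"
    and scale: "\<And>c x. x \<in> space g \<Longrightarrow> \<theta> (lscale g c x) = c \<odot>\<^bsub>B\<^esub> \<theta> x"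
    and commute: "\<And>a b x y. a \<in> {0, 1} \<Longrightarrow> b \<in> {0, 1} \<Longrightarrow> x \<in> part g a \<Longrightarrow> y \<in> part g b \<Longrightarrow>
      \<theta> x \<otimes>\<^bsub>B\<^esub> \<theta> y = (-1) ^ (a * b) \<odot>\<^bsub>B\<^esub> (\<theta> y \<otimes>\<^bsub>B\<^esub> \<theta> x) \<oplus>\<^bsub>B\<^esub> \<theta> (bracket g x y)"
  shows "\<exists>h\<in>alg_hom Q B. \<forall>x\<in>space g. h (inc x) = \<theta> x"
proof -
  interpret F: unital_algebra F by (rule unital_F)
  interpret B: unital_algebra B by (rule B)
  let ?h = "lin_ext B (word_prod B \<theta>)"
  have h: "?h \<in> alg_hom F B" unfolding F_def by (rule B.free_ext_alg_hom[OF \<theta>])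
  have hs: "?h (single [x]) = \<theta> x" if "x \<in> space g" for x
  proof -
    have "\<theta> x \<in> carrier B" by (rule funcset_mem[OF \<theta> that])
    then show ?thesis using B.free_ext_single[OF \<theta>, of "[x]"] that by simp
  qed
  have rel: "?h p = ?h r" if "(p, r) \<in> relations" for p r
    using that
  proof (cases rule: relations_cases)
    case (add x y)
    then show ?thesis by (simp add: alg_homD(3)[OF h] gen_F hs ladd_closed assms(3))
  next
    case (scale c x)
    then show ?thesis by (simp add: alg_homD(6)[OF h] gen_F hs lscale_closed assms(4))
  next
    case (commute a b x y)
    then have s: "x \<in> space g" "y \<in> space g" "bracket g x y \<in> space g"
      using part_subset[of a x] part_subset[of b y] bracket_closed[of a b x y] by simp_all
    show ?thesis
      using s unfolding commute(5,6)
      by (simp only: alg_homD(3,4,6)[OF h] F.m_closed F.smult_closed gen_F hs assms(5)[OF commute(1-4)])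
  qed
  have "I \<subseteq> a_kernel F B ?h"
    by (rule unital_algebra.rel_ideal_minimal[OF unital_F B.ring_axioms alg_homD(1)[OF h]])
      (use relations_carrier rel in simp)
  from quot_alg_lift[OF unital_F B ideal_I h this]
  obtain k where k: "k \<in> alg_hom Q B" "\<And>x. x \<in> carrier F \<Longrightarrow> k (I +>\<^bsub>F\<^esub> x) = ?h x"
    unfolding Q_eq by (elim bexE) simp
  show ?thesis by (rule bexI[OF _ k(1)]) (simp add: inc_def k(2) gen_F hs)
qed

lemma enveloping_generated:
  assumes "z \<in> carrier Q"
  shows "z \<in> lspan Q (word_prod Q inc ` lists (space g))"
proof -
  interpret F: unital_algebra F by (rule unital_F)
  interpret Q: unital_algebra Q by (rule unital_Q)
  let ?W = "word_prod Q inc ` lists (space g)"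
  have inc: "inc \<in> space g \<rightarrow> carrier Q" by (simp add: inc_closed)
  have word: "word_prod F (\<lambda>x. single [x]) w = single w" for w
    by (induction w) (simp_all add: F_def free_algebra_simps)
  have proj: "I +>\<^bsub>F\<^esub> single w = word_prod Q inc w" if "w \<in> lists (space g)" for w
    using word_prod_hom(2)[OF F.ring_axioms alg_homD(1)[OF proj_hom] that, of "\<lambda>x. single [x]"]
    by (simp add: word inc_def[abs_def] gen_F)
  have W: "?W \<subseteq> carrier Q" using Q.word_prod_closed[OF inc] by (rule image_subsetI)
  have "I +>\<^bsub>F\<^esub> f \<in> lspan Q ?W" if "f \<in> carrier F" for f
    using that unfolding F_def[unfolded free_algebra_def]
  proof (induction rule: monoid_algebra_induct)
    case zero
    have "I +>\<^bsub>F\<^esub> \<zero>\<^bsub>F\<^esub> = \<zero>\<^bsub>Q\<^esub>" by (rule ring_hom_zero_minus(1)[OF F.ring_axioms Q.ring_axioms alg_homD(1)[OF proj_hom]])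
    then show ?case by (simp add: F_def free_algebra_simps free_algebra_def[symmetric] lspan.zero)
  next
    case (add c m f)
    have m: "m \<in> lists (space g)" using add(1) by simp
    have c: "single m \<in> carrier F" "f \<in> carrier F" using m add(2) by (simp_all add: F_def free_algebra_def[symmetric])
    have e: "(\<lambda>x. c * single m x + f x) = c \<odot>\<^bsub>F\<^esub> single m \<oplus>\<^bsub>F\<^esub> f" by (simp add: F_def free_algebra_simps)
    have "I +>\<^bsub>F\<^esub> (\<lambda>x. c * single m x + f x) = c \<odot>\<^bsub>Q\<^esub> word_prod Q inc m \<oplus>\<^bsub>Q\<^esub> (I +>\<^bsub>F\<^esub> f)"
      unfolding e using c by (simp only: alg_homD(3,6)[OF proj_hom] F.smult_closed proj[OF m])
    moreover have "\<dots> \<in> lspan Q ?W"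
      by (rule lspan.add) (use m add(5) in \<open>simp_all add: F_def free_algebra_def\<close>)
    ultimately show ?case by (simp add: F_def free_algebra_def)
  qed
  moreover have "carrier Q = (+>\<^bsub>F\<^esub>) I ` carrier F"
    unfolding Q_eq by (rule unital_algebra.quot_alg(3)[OF unital_F ideal_I])
  ultimately show ?thesis using assms by (simp add: image_iff) (elim bexE, simp)
qed

text \<open>The spanning half of a Poincare-Birkhoff-Witt theorem. Words in arbitrary Lie elements
  are first expanded into words in the family \<open>y\<close>, which are then straightened.\<close>

lemma enveloping_normal_words:
  assumes y: "straightening Q y S key sq" and span: "\<And>x. x \<in> space g \<Longrightarrow> inc x \<in> lspan Q (y ` S)"
    and z: "z \<in> carrier Q"
  shows "\<exists>f. finite {m. f m \<noteq> 0} \<and> {m. f m \<noteq> 0} \<subseteq> normal_words key sq S \<and> z = lin_ext Q (word_prod Q y) f"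
proof -
  interpret Q: straightening Q y S key sq by (rule y)
  let ?L = "word_prod Q y ` lists S"
  let ?N = "word_prod Q y ` normal_words key sq S"
  have yS: "y ` S \<subseteq> carrier Q" by (rule Q.y_closed)
  have L: "?L \<subseteq> carrier Q" using Q.word_prod_closed[OF Q.y] by (rule image_subsetI)
  have nw: "normal_words key sq S \<subseteq> lists S" by (auto simp: normal_words_def)
  have N: "?N \<subseteq> carrier Q" by (rule order_trans[OF image_mono[OF nw] L])
  have words: "word_prod Q inc w \<in> lspan Q ?L" if "w \<in> lists (space g)" for w
    using that
  proof (induction w)
    case Nil
    have "word_prod Q y [] \<in> ?L" by (rule imageI) simp
    then show ?case using Q.lspan_base[OF L] by simp
  next
    case (Cons x w)
    have p: "word_prod Q inc w \<in> carrier Q" by (rule Q.lspan_closed[OF L Cons.IH])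
    have "(\<lambda>x. x \<otimes>\<^bsub>Q\<^esub> word_prod Q inc w) ` (y ` S) \<subseteq> lspan Q ?L"
    proof (rule image_subsetI, elim imageE)
      fix q b assume q: "q = y b" "b \<in> S"
      have yb: "y b \<in> carrier Q" by (rule Q.yc[OF q(2)])
      have "(\<otimes>\<^bsub>Q\<^esub>) (y b) ` ?L \<subseteq> ?L"
      proof (rule image_subsetI, elim imageE)
        fix r v assume r: "r = word_prod Q y v" "v \<in> lists S"
        have "word_prod Q y (b # v) \<in> ?L" by (rule imageI) (use q r in simp)
        then show "y b \<otimes>\<^bsub>Q\<^esub> r \<in> ?L" by (simp add: r)
      qed
      then have "(\<otimes>\<^bsub>Q\<^esub>) (y b) ` ?L \<subseteq> lspan Q ?L"
        using Q.lspan_base[OF L] by (meson subset_iff)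
      then show "q \<otimes>\<^bsub>Q\<^esub> word_prod Q inc w \<in> lspan Q ?L"
        unfolding q(1) by (rule Q.lspan_subset[OF L _ Q.lspan_mult_left[OF L yb Cons.IH]])
    qed
    from Q.lspan_subset[OF L this Q.lspan_mult_right[OF yS p span[OF Cons.hyps(1)]]]
    show ?case by simp
  qed
  have "z \<in> lspan Q ?L"
    by (rule Q.lspan_subset[OF L _ enveloping_generated[OF z]]) (rule image_subsetI, rule words)
  then have "z \<in> lspan Q ?N"
    by (rule Q.lspan_subset[OF N, rotated]) (rule image_subsetI, rule Q.word_in_span[unfolded Q.P_def])
  moreover have "word_prod Q y \<in> normal_words key sq S \<rightarrow> carrier Q"
    using Q.word_prod_closed[OF Q.y] nw by (simp add: Pi_iff subset_iff)
  ultimately show ?thesis by (intro Q.lspan_lin_ext)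
qed

end

section \<open>The isomorphism\<close>

interpretation q: lie_data "queer_lie n" for n
proof
  fix M N assume "M \<in> space (queer_lie n)" "N \<in> space (queer_lie n)"
  then obtain m m' where m: "M = qmat n m" "N = qmat n m'" "symmetric m" "symmetric m'"
    unfolding space_queer_lie by blast
  then have "symmetric (\<lambda>u v. m u v + m' u v)" by (simp add: symmetric_def)
  then show "ladd (queer_lie n) M N \<in> space (queer_lie n)"
    unfolding space_queer_lie m queer_lie_simps qmat_arith by blast
next
  fix M c assume "M \<in> space (queer_lie n)"
  then obtain m where m: "M = qmat n m" "symmetric m" unfolding space_queer_lie by blast
  then have "symmetric (\<lambda>u v. c * m u v)" by (simp add: symmetric_def)
  then show "lscale (queer_lie n) c M \<in> space (queer_lie n)"
    unfolding space_queer_lie m queer_lie_simps qmat_arith by blast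
next
  fix a M assume "a \<in> {0, 1}" "M \<in> part (queer_lie n) a"
  then show "M \<in> space (queer_lie n)" unfolding space_queer_lie by (simp only: part_queer_lie) blast
next
  fix a b M N assume ab: "a \<in> {0, 1}" "b \<in> {0, 1}" "M \<in> part (queer_lie n) a" "N \<in> part (queer_lie n) b"
  obtain m where m: "M = qmat n m" "symmetric m" "of_parity a m"
    using ab(3) unfolding part_queer_lie[OF ab(1)] by blast
  obtain m' where m': "N = qmat n m'" "symmetric m'" "of_parity b m'"
    using ab(4) unfolding part_queer_lie[OF ab(2)] by blast
  show "bracket (queer_lie n) M N \<in> space (queer_lie n)"
    unfolding space_queer_lie m(1) m'(1) queer_lie_simps super_commutator_qmat[OF ab(1) m(3) ab(2) m'(3)]
    using symmetric_sbracket[OF m(2) m'(2)] by blast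
qed

lemma qmat_space: "symmetric m \<Longrightarrow> qmat n m \<in> space (queer_lie n)"
  unfolding space_queer_lie by blast

definition unit_class :: "nat \<Rightarrow> int \<times> int \<Rightarrow> (complex mat list \<Rightarrow> complex) set" where
  "unit_class n x = q.inc n (qmat n (unit_entry x))"

text \<open>Symmetry of the partial sums is carried through the induction, since \<open>inc\<close>
  is known to be additive on elements of the Lie superalgebra.\<close>

lemma inc_in_span:
  assumes "M \<in> space (queer_lie n)"
  shows "q.inc n M \<in> lspan (enveloping_algebra (queer_lie n)) (unit_class n ` qbasis n)"
proof -
  let ?Q = "enveloping_algebra (queer_lie n)" and ?Y = "unit_class n ` qbasis n"
  interpret Q: unital_algebra ?Q by (rule q.unital_Q)
  obtain m where m: "M = qmat n m" "symmetric m" using assms unfolding space_queer_lie by blast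
  have y: "unit_class n x \<in> carrier ?Q" for x
    unfolding unit_class_def by (rule q.inc_closed[OF qmat_space[OF symmetric_unit_entry]])
  have "symmetric (\<lambda>u v. \<Sum>x\<in>qbasis n. m (fst x) (snd x) * unit_entry x u v)
    \<and> q.inc n (qmat n (\<lambda>u v. \<Sum>x\<in>qbasis n. m (fst x) (snd x) * unit_entry x u v)) \<in> lspan ?Q ?Y"
  proof (rule combination_induct[OF finite_qbasis])
    have s: "symmetric (\<lambda>_ _. 0)" by (simp add: symmetric_def)
    have "q.inc n (0 \<cdot>\<^sub>m qmat n (\<lambda>_ _. 0)) = \<zero>\<^bsub>?Q\<^esub>"
      using q.inc_scale[OF qmat_space[OF s], of n 0] q.inc_closed[OF qmat_space[OF s], of n] by simp
    then show "symmetric (\<lambda>_ _. 0) \<and> q.inc n (qmat n (\<lambda>_ _. 0)) \<in> lspan ?Q ?Y"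
      using s by (simp add: qmat_arith lspan.zero)
  next
    fix x f assume x: "x \<in> qbasis n" and f: "symmetric f \<and> q.inc n (qmat n f) \<in> lspan ?Q ?Y"
    let ?c = "m (fst x) (snd x)"
    have s: "symmetric (\<lambda>u v. ?c * unit_entry x u v)" "symmetric f" "symmetric (\<lambda>u v. ?c * unit_entry x u v + f u v)"
      using f symmetric_unit_entry[of x] by (simp_all add: symmetric_def)
    have "q.inc n (qmat n (\<lambda>u v. ?c * unit_entry x u v + f u v)) = ?c \<odot>\<^bsub>?Q\<^esub> unit_class n x \<oplus>\<^bsub>?Q\<^esub> q.inc n (qmat n f)"
      using q.inc_add[OF qmat_space[OF s(1)] qmat_space[OF s(2)]]
        q.inc_scale[OF qmat_space[OF symmetric_unit_entry], of n ?c x]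
      by (simp add: qmat_arith unit_class_def)
    moreover have "\<dots> \<in> lspan ?Q ?Y" by (rule lspan.add) (use x f in simp_all)
    ultimately show "symmetric (\<lambda>u v. ?c * unit_entry x u v + f u v)
      \<and> q.inc n (qmat n (\<lambda>u v. ?c * unit_entry x u v + f u v)) \<in> lspan ?Q ?Y"
      using s(3) by simp
  qed
  moreover have "M = qmat n (\<lambda>u v. \<Sum>x\<in>qbasis n. m (fst x) (snd x) * unit_entry x u v)"
    unfolding m(1) by (rule qmat_cong) (rule symmetric_expansion[OF m(2)])
  ultimately show ?thesis by simp
qed

lemma unit_class_commute:
  "\<exists>z\<in>lspan (enveloping_algebra (queer_lie n)) (unit_class n ` qbasis n).
    unit_class n (a, c) \<otimes>\<^bsub>enveloping_algebra (queer_lie n)\<^esub> unit_class n (b, d)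
    = (- 1) ^ (par a c * par b d) \<odot>\<^bsub>enveloping_algebra (queer_lie n)\<^esub>
        (unit_class n (b, d) \<otimes>\<^bsub>enveloping_algebra (queer_lie n)\<^esub> unit_class n (a, c))
      \<oplus>\<^bsub>enveloping_algebra (queer_lie n)\<^esub> z"
proof -
  have p: "par u v \<in> {0, 1}" for u v by (simp add: par_def)
  have m: "qmat n (unit_entry (u, v)) \<in> part (queer_lie n) (par u v)" for u v
    unfolding part_queer_lie[OF p] using symmetric_unit_entry of_parity_unit_entry by blast
  show ?thesis
    unfolding unit_class_def
    by (rule bexI[rotated], rule inc_in_span[unfolded unit_class_def],
        rule q.bracket_closed[OF p[of a c] p[of b d] m[of a c] m[of b d]],
        rule q.inc_commute[OF p[of a c] p[of b d] m[of a c] m[of b d]])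
qed

text \<open>For an odd element the commutation relation with itself reads y y = - y y + [y, y], so
  its square is half of a linear element.\<close>

lemma straightening_unit_class:
  assumes "inj_on key (qbasis n)"
  shows "straightening (enveloping_algebra (queer_lie n)) (unit_class n) (qbasis n) key (\<lambda>x. snd x < 0)"
proof -
  let ?Q = "enveloping_algebra (queer_lie n)" and ?Y = "unit_class n ` qbasis n"
  interpret Q: unital_algebra ?Q by (rule q.unital_Q)
  have y: "unit_class n x \<in> carrier ?Q" for x
    unfolding unit_class_def by (rule q.inc_closed[OF qmat_space[OF symmetric_unit_entry]])
  have Y: "?Y \<subseteq> carrier ?Q" by (rule image_subsetI) (rule y)
  show ?thesis
  proof
    show "unit_class n \<in> qbasis n \<rightarrow> carrier ?Q" by (simp add: y)
    show "inj_on key (qbasis n)" by (rule assms)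
    show "\<exists>s. \<exists>z\<in>lspan ?Q ?Y. unit_class n b \<otimes>\<^bsub>?Q\<^esub> unit_class n c = s \<odot>\<^bsub>?Q\<^esub> (unit_class n c \<otimes>\<^bsub>?Q\<^esub> unit_class n b) \<oplus>\<^bsub>?Q\<^esub> z" for b c
      using unit_class_commute[of n "fst b" "snd b" "fst c" "snd c"] unfolding prod.collapse by (rule exI)
    fix b assume b: "b \<in> qbasis n" "snd b < 0"
    let ?y = "unit_class n b"
    have "par (fst b) (snd b) = 1" using b by (auto simp: par_def qbasis_def zero_less_mult_iff)
    then obtain z where z: "z \<in> lspan ?Q ?Y" "?y \<otimes>\<^bsub>?Q\<^esub> ?y = (- 1) \<odot>\<^bsub>?Q\<^esub> (?y \<otimes>\<^bsub>?Q\<^esub> ?y) \<oplus>\<^bsub>?Q\<^esub> z"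
      using unit_class_commute[of n "fst b" "snd b" "fst b" "snd b"] by (elim bexE) simp
    have zc: "z \<in> carrier ?Q" by (rule Q.lspan_closed[OF Y z(1)])
    have yy: "?y \<otimes>\<^bsub>?Q\<^esub> ?y \<in> carrier ?Q" using y by simp
    have "z = ?y \<otimes>\<^bsub>?Q\<^esub> ?y \<oplus>\<^bsub>?Q\<^esub> ((- 1) \<odot>\<^bsub>?Q\<^esub> (?y \<otimes>\<^bsub>?Q\<^esub> ?y) \<oplus>\<^bsub>?Q\<^esub> z)"
      using yy zc by (simp add: Q.smult_uminus_left Q.a_assoc[symmetric] Q.r_neg)
    also have "\<dots> = ?y \<otimes>\<^bsub>?Q\<^esub> ?y \<oplus>\<^bsub>?Q\<^esub> ?y \<otimes>\<^bsub>?Q\<^esub> ?y" by (simp only: z(2)[symmetric])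
    also have "\<dots> = 2 \<odot>\<^bsub>?Q\<^esub> (?y \<otimes>\<^bsub>?Q\<^esub> ?y)"
      using Q.smult_add_left[OF yy, of 1 1] yy by simp
    finally have "?y \<otimes>\<^bsub>?Q\<^esub> ?y = (1 / 2) \<odot>\<^bsub>?Q\<^esub> z" using yy by (simp add: Q.smult_smult)
    then show "?y \<otimes>\<^bsub>?Q\<^esub> ?y \<in> lspan ?Q ?Y" using Q.lspan_smult[OF Y z(1)] by simp
  qed
qed

lemma enveloping_to_limit:
  "\<exists>h\<in>alg_hom (enveloping_algebra (queer_lie n)) (classical_limit n).
    \<forall>a c. a \<in> sindices n \<longrightarrow> c \<in> sindices n \<longrightarrow> h (unit_class n (a, c)) = lie_gen n a c"
proof -
  let ?T = "classical_limit n"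
  \<comment> \<open>Reading the entries back from the matrix avoids choosing a coordinate function
    for it.\<close>
  define \<theta> where "\<theta> M = lie_map n (\<lambda>u v. M $$ (spos n u, spos n v))" for M :: "complex mat"
  have \<theta>: "\<theta> (qmat n m) = lie_map n m" for m
    unfolding \<theta>_def by (rule lie_map_cong) (rule qmat_entry)
  obtain h where h: "h \<in> alg_hom (enveloping_algebra (queer_lie n)) ?T"
    "\<And>M. M \<in> space (queer_lie n) \<Longrightarrow> h (q.inc n M) = \<theta> M"
  proof -
    have "\<exists>h\<in>alg_hom (enveloping_algebra (queer_lie n)) ?T. \<forall>M\<in>space (queer_lie n). h (q.inc n M) = \<theta> M"
    proof (rule q.enveloping_lift[OF unital_algebra_classical_limit])
      show "\<theta> \<in> space (queer_lie n) \<rightarrow> carrier ?T" by (simp add: \<theta>_def)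
    next
      fix M N assume "M \<in> space (queer_lie n)" "N \<in> space (queer_lie n)"
      then obtain m m' where m: "M = qmat n m" "N = qmat n m'" unfolding space_queer_lie by blast
      show "\<theta> (ladd (queer_lie n) M N) = \<theta> M \<oplus>\<^bsub>?T\<^esub> \<theta> N"
        unfolding m queer_lie_simps qmat_arith \<theta> by (rule lie_map_add)
    next
      fix M c assume "M \<in> space (queer_lie n)"
      then obtain m where m: "M = qmat n m" unfolding space_queer_lie by blast
      show "\<theta> (lscale (queer_lie n) c M) = c \<odot>\<^bsub>?T\<^esub> \<theta> M"
        unfolding m queer_lie_simps qmat_arith \<theta> by (rule lie_map_smult)
    next
      fix a b M N assume ab: "a \<in> {0, 1}" "b \<in> {0, 1}" "M \<in> part (queer_lie n) a" "N \<in> part (queer_lie n) b"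
      obtain m where m: "M = qmat n m" "symmetric m" "of_parity a m"
        using ab(3) unfolding part_queer_lie[OF ab(1)] by blast
      obtain m' where m': "N = qmat n m'" "symmetric m'" "of_parity b m'"
        using ab(4) unfolding part_queer_lie[OF ab(2)] by blast
      show "\<theta> M \<otimes>\<^bsub>?T\<^esub> \<theta> N = (- 1) ^ (a * b) \<odot>\<^bsub>?T\<^esub> (\<theta> N \<otimes>\<^bsub>?T\<^esub> \<theta> M) \<oplus>\<^bsub>?T\<^esub> \<theta> (bracket (queer_lie n) M N)"
        unfolding m(1) m'(1) queer_lie_simps super_commutator_qmat[OF ab(1) m(3) ab(2) m'(3)] \<theta>
        by (rule lie_map_relation[OF m(2,3) m'(2,3)])
    qed
    then show ?thesis using that by (elim bexE) simp
  qed
  show ?thesis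
    by (rule bexI[OF _ h(1)])
      (simp add: unit_class_def h(2) qmat_space symmetric_unit_entry \<theta> lie_map_unit_entry)
qed

text \<open>Composed with the action on words, \<open>h\<close> sends normal words to the operators
  \<open>deriv_word\<close>. An element killed by \<open>h\<close> is a combination of normal words,
  and independence of these operators forces its coefficients to be 0.\<close>

lemma enveloping_to_limit_kernel:
  assumes h: "h \<in> alg_hom (enveloping_algebra (queer_lie n)) (classical_limit n)"
    and gen: "\<And>a c. a \<in> sindices n \<Longrightarrow> c \<in> sindices n \<Longrightarrow> h (unit_class n (a, c)) = lie_gen n a c"
    and z: "z \<in> carrier (enveloping_algebra (queer_lie n))" "h z = \<zero>\<^bsub>classical_limit n\<^esub>"
  shows "z = \<zero>\<^bsub>enveloping_algebra (queer_lie n)\<^esub>"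
proof -
  let ?Q = "enveloping_algebra (queer_lie n)" and ?T = "classical_limit n"
  interpret Q: unital_algebra ?Q by (rule q.unital_Q)
  obtain key :: "int \<times> int \<Rightarrow> nat" where inj: "inj_on key (qbasis n)"
    and cls: "\<forall>x\<in>qbasis n. \<forall>y\<in>qbasis n. basis_class x < basis_class y \<longrightarrow> key x < key y"
    using key_exists[of n] by blast
  obtain \<Phi> where \<Phi>: "\<Phi> \<in> alg_hom ?T op_algebra"
    and \<Phi>_gen: "\<And>a c. (a, c) \<in> qbasis n \<Longrightarrow> \<Phi> (lie_gen n a c) = (\<lambda>f w. deriv_op w a c f)"
    using limit_action[of n] by blast
  obtain f where f: "finite {m. f m \<noteq> 0}" "{m. f m \<noteq> 0} \<subseteq> normal_words key (\<lambda>x. snd x < 0) (qbasis n)"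
    and zf: "z = lin_ext ?Q (word_prod ?Q (unit_class n)) f"
    using q.enveloping_normal_words[OF straightening_unit_class[OF inj] inc_in_span z(1)] by blast
  have y: "unit_class n \<in> qbasis n \<rightarrow> carrier ?Q"
    by (rule straightening.y[OF straightening_unit_class[OF inj]])
  have lists: "m \<in> lists (qbasis n)" if "f m \<noteq> 0" for m using f(2) that by (auto simp: normal_words_def)
  define k where "k x = \<Phi> (h x)" for x
  have k_hom: "k \<in> ring_hom ?Q op_algebra"
    unfolding k_def using ring_hom_trans[OF alg_homD(1)[OF h] alg_homD(1)[OF \<Phi>]] by (simp add: comp_def)
  have k_smult: "k (c \<odot>\<^bsub>?Q\<^esub> x) = c \<odot>\<^bsub>op_algebra\<^esub> k x" if "x \<in> carrier ?Q" for c x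
    unfolding k_def alg_homD(6)[OF h that] by (rule alg_homD(6)[OF \<Phi> alg_homD(2)[OF h that]])
  have k_gen: "k (unit_class n (a, c)) = (\<lambda>f w. deriv_op w a c f)" if "(a, c) \<in> qbasis n" for a c
    unfolding k_def using gen[of a c] qbasis_sindices[OF that] \<Phi>_gen[OF that] by simp
  have k_word: "k (word_prod ?Q (unit_class n) m) = deriv_word m" if "m \<in> lists (qbasis n)" for m
  proof -
    have "word_prod op_algebra (\<lambda>x. k (unit_class n x)) m = deriv_word m"
      using that
    proof (induction m)
      case Nil
      show ?case by (rule ext) simp
    next
      case (Cons x m)
      obtain a c where x: "x = (a, c)" by (cases x)
      have "word_prod op_algebra (\<lambda>x. k (unit_class n x)) m = deriv_word m" by (rule Cons.IH)
      then show ?case using Cons.hyps(1) by (intro ext) (simp add: x k_gen)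
    qed
    then show ?thesis using word_prod_hom(2)[OF Q.ring_axioms k_hom that y] by simp
  qed
  have wc: "word_prod ?Q (unit_class n) m \<in> carrier ?Q" if "f m \<noteq> 0" for m
    by (rule Q.word_prod_closed[OF y lists[OF that]])
  have "f m = 0" for m
  proof (rule deriv_word_independent[OF inj cls f])
    fix g :: "int list \<Rightarrow> complex" and w
    have "\<Phi> \<zero>\<^bsub>?T\<^esub> = \<zero>\<^bsub>op_algebra\<^esub>"
      by (rule ring_hom_zero_minus(1)[OF C.ring_axioms O.ring_axioms alg_homD(1)[OF \<Phi>]])
    then have "k z = \<zero>\<^bsub>op_algebra\<^esub>" by (simp add: k_def z(2))
    moreover have "k z = (\<Oplus>\<^bsub>op_algebra\<^esub>m\<in>{m. f m \<noteq> 0}. k (f m \<odot>\<^bsub>?Q\<^esub> word_prod ?Q (unit_class n) m))"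
      unfolding zf lin_ext_def
      by (rule ring_hom_finsum[OF Q.ring_axioms O.ring_axioms k_hom f(1)]) (simp add: wc)
    moreover have "(\<Oplus>\<^bsub>op_algebra\<^esub>m\<in>{m. f m \<noteq> 0}. k (f m \<odot>\<^bsub>?Q\<^esub> word_prod ?Q (unit_class n) m)) g w
        = (\<Sum>m\<in>{m. f m \<noteq> 0}. k (f m \<odot>\<^bsub>?Q\<^esub> word_prod ?Q (unit_class n) m) g w)"
      by (rule op_algebra_finsum[OF f(1)]) (simp add: wc ring_hom_closed[OF k_hom])
    moreover have "\<dots> = (\<Sum>m\<in>{m. f m \<noteq> 0}. f m * deriv_word m g w)"
      by (rule sum.cong[OF refl]) (simp add: k_smult wc k_word lists)
    ultimately show "(\<Sum>m\<in>{m. f m \<noteq> 0}. f m * deriv_word m g w) = 0" by simp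
  qed
  then have "f = (\<lambda>_. 0)" by (simp add: fun_eq_iff)
  then show ?thesis unfolding zf by simp
qed

text \<open>The integral form is generated by the reduced generators. Their limits are multiples of
  Lie generators, by sgn j off the diagonal and half of it on the diagonal, undoing the
  normalization in \<open>lie_gen\<close>.\<close>

lemma enveloping_to_limit_surj:
  assumes h: "h \<in> alg_hom (enveloping_algebra (queer_lie n)) (classical_limit n)"
    and gen: "\<And>a c. a \<in> sindices n \<Longrightarrow> c \<in> sindices n \<Longrightarrow> h (unit_class n (a, c)) = lie_gen n a c"
  shows "h ` carrier (enveloping_algebra (queer_lie n)) = carrier (classical_limit n)"
proof
  let ?Q = "enveloping_algebra (queer_lie n)" and ?T = "classical_limit n"
  interpret Q: unital_algebra ?Q by (rule q.unital_Q)
  show "h ` carrier ?Q \<subseteq> carrier ?T" by (rule image_subsetI) (rule alg_homD(2)[OF h])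
  have im: "h x \<in> h ` carrier ?Q" if "x \<in> carrier ?Q" for x using that by (rule imageI)
  have smult: "c \<odot>\<^bsub>?T\<^esub> t \<in> h ` carrier ?Q" if "t \<in> h ` carrier ?Q" for c t
    using that by (elim imageE) (simp add: alg_homD(6)[OF h, symmetric] im)
  have X: "Llim n i j \<in> h ` carrier ?Q" if ij: "(i, j) \<in> Lidx n" for i j
  proof -
    have s: "i \<in> sindices n" "j \<in> sindices n" "i \<le> j" using ij by (auto simp: Lidx_def sindices_def)
    have j: "sgc j * sgc j = 1" using s by (auto simp: sindices_def sgn_if)
    have "unit_class n (j, i) \<in> carrier ?Q"
      unfolding unit_class_def by (rule q.inc_closed[OF qmat_space[OF symmetric_unit_entry]])
    from im[OF this] have "lie_gen n j i \<in> h ` carrier ?Q" by (simp add: gen s)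
    then have "(if i = j then sgc j / 2 else sgc j) \<odot>\<^bsub>?T\<^esub> lie_gen n j i \<in> h ` carrier ?Q" by (rule smult)
    moreover have "(if i = j then sgc j / 2 else sgc j) \<odot>\<^bsub>?T\<^esub> lie_gen n j i = Llim n i j"
      using s(3) j by (simp add: lie_gen_def C.smult_smult)
    ultimately show ?thesis by simp
  qed
  have "spec1 n u \<in> h ` carrier ?Q" if "u \<in> carrier (UA1 n)" for u
    using that unfolding UA1_reduced
  proof (induction rule: gen_subalgebra.induct)
    case (gen x)
    then obtain i j where "x = redL n i j" "(i, j) \<in> Lidx n" by (auto simp: reduced_gens_def)
    then show ?case using X[of i j] by (simp add: Llim_def)
  next
    case one
    have "spec1 n \<one>\<^bsub>Uq n\<^esub> = h \<one>\<^bsub>?Q\<^esub>"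
      using ring_hom_one[OF spec1_hom, of n] by (simp add: UA1_simps alg_homD(5)[OF h])
    then show ?case by (simp add: im)
  next
    case (scale r x)
    have x: "x \<in> carrier (UA1 n)" using scale(2) by (simp only: UA1_reduced)
    show ?case unfolding spec1_smult[OF scale(1) x] by (rule smult[OF scale(3)])
  next
    case (add x y)
    have x: "x \<in> carrier (UA1 n)" "y \<in> carrier (UA1 n)" using add(1,2) by (simp_all only: UA1_reduced)
    obtain a b where "a \<in> carrier ?Q" "b \<in> carrier ?Q" "spec1 n x = h a" "spec1 n y = h b"
      using add(3,4) by (elim imageE) simp
    then show ?case unfolding spec1_arith(1)[OF x] by (simp add: alg_homD(3)[OF h, symmetric] im)
  next
    case (mult x y)
    have x: "x \<in> carrier (UA1 n)" "y \<in> carrier (UA1 n)" using mult(1,2) by (simp_all only: UA1_reduced)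
    obtain a b where "a \<in> carrier ?Q" "b \<in> carrier ?Q" "spec1 n x = h a" "spec1 n y = h b"
      using mult(3,4) by (elim imageE) simp
    then show ?case unfolding spec1_arith(2)[OF x] by (simp add: alg_homD(4)[OF h, symmetric] im)
  qed
  then show "carrier ?T \<subseteq> h ` carrier ?Q" unfolding spec1_surj by (rule image_subsetI)
qed

theorem theorem5p16:
  fixes n :: nat
  assumes "n \<ge> 1"
  shows "algebra_isomorphic (classical_limit n) (enveloping_algebra (queer_lie n))"
proof -
  let ?Q = "enveloping_algebra (queer_lie n)" and ?T = "classical_limit n"
  interpret Q: unital_algebra ?Q by (rule q.unital_Q)
  obtain h where h: "h \<in> alg_hom ?Q ?T"
    and gen: "\<And>a c. a \<in> sindices n \<Longrightarrow> c \<in> sindices n \<Longrightarrow> h (unit_class n (a, c)) = lie_gen n a c"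
    using enveloping_to_limit[of n] by blast
  have inj: "inj_on h (carrier ?Q)"
  proof (rule inj_onI)
    fix x y assume xy: "x \<in> carrier ?Q" "y \<in> carrier ?Q" "h x = h y"
    have "h (x \<ominus>\<^bsub>?Q\<^esub> y) = \<zero>\<^bsub>?T\<^esub>"
      unfolding ring_hom_zero_minus(3)[OF Q.ring_axioms C.ring_axioms alg_homD(1)[OF h] xy(1,2)] xy(3)
      using alg_homD(2)[OF h xy(2)] by (simp add: C.minus_eq_zero_iff)
    then have "x \<ominus>\<^bsub>?Q\<^esub> y = \<zero>\<^bsub>?Q\<^esub>"
      using enveloping_to_limit_kernel[OF h gen] xy by simp
    then show "x = y" using xy by (simp add: Q.minus_eq_zero_iff)
  qed
  have iso: "h \<in> ring_iso ?Q ?T"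
    unfolding ring_iso_def bij_betw_def using alg_homD(1)[OF h] inj enveloping_to_limit_surj[OF h gen] by simp
  \<comment> \<open>The isomorphism asked for starts at the classical limit, so the inverse of
    \<open>h\<close> is used.\<close>
  let ?k = "inv_into (carrier ?Q) h"
  have "?k \<in> ring_iso ?T ?Q" by (rule ring_iso_set_sym[OF Q.ring_axioms iso])
  moreover have "?k (c \<odot>\<^bsub>?T\<^esub> t) = c \<odot>\<^bsub>?Q\<^esub> ?k t" if "t \<in> carrier ?T" for c t
  proof -
    have "t \<in> h ` carrier ?Q" using that by (simp only: enveloping_to_limit_surj[OF h gen])
    then obtain x where x: "x \<in> carrier ?Q" "t = h x" by (rule imageE)
    show ?thesis
      unfolding x(2) alg_homD(6)[OF h x(1), symmetric] using x(1) by (simp add: inv_into_f_f[OF inj])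
  qed
  ultimately have "?k \<in> alg_iso ?T ?Q" by (simp add: alg_iso_def)
  then show ?thesis unfolding algebra_isomorphic_def by blast
qed

end
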